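(* Let $S=A+B$ with $A=QQ^*\in\mathbb{C}^{n\times n}$ Hermitian positive definite, $Q\in\mathbb{C}^{n\times n}$, and $B\in\mathbb{C}^{n\times n}$ Hermitian positive semidefinite, let $G=Q^{-1}BQ^{-*}$, let $r<\operatorname{rank}(B)$ be a positive integer, and let $\widehat S_r=Q(I+G_r)Q^*$, where $G_r$ is a rank-$r$ truncated SVD of $G$ (so that $\widehat S_r$ is a minimiser of $\mathcal{D}_{\mathrm{LD}}(\mathcal P,S)$ over all $\mathcal P=Q(I+X)Q^*$ with $X$ Hermitian positive semidefinite and $\operatorname{rank}(X)\le r$). Let $\widehat S\langle\Omega\rangle=Q(I+G\langle\Omega\rangle)Q^*$, where $G\langle\Omega\rangle$ is the randomised approximation of $G$ built from a standard Gaussian test matrix $\Omega\in\mathbb{R}^{n\times(r+p)}$, with $\operatorname{rank}(G\langle\Omega\rangle)=r+p\le\operatorname{rank}(B)$ and oversampling parameter $p\ge2$. Then $$\mathbb{E}\big[\mathcal{D}_{\mathrm{LD}}(\widehat S\langle\Omega\rangle,S)\big]-\mathcal{D}_{\mathrm{LD}}(\widehat S_r,S)\le 2\epsilon c_r,$$ where $$\epsilon=\sqrt{\Big(1+\frac{r}{p-1}\Big)\sum_{j=r+1}^n\lambda_j(G)^2},\qquad c_r=\|(I+G)^{-1}\|_F+r\,(1+\lambda_{\operatorname{rank}(B)}(G))^{-1}.$$ Furthermore, the following relative error estimate holds: $$\frac{\mathbb{E}\big[\mathcal{D}_{\mathrm{LD}}(\widehat S\langle\Omega\rangle,S)\big]-\mathcal{D}_{\mathrm{LD}}(\widehat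 S_r,S)}{\mathcal{D}_{\mathrm{LD}}(\widehat S_r,S)}\le 2c_r\sqrt{\frac{1+\frac{r}{p-1}}{n-r}}\;\frac{\lambda_{r+1}(G)}{\frac{1}{1+\lambda_{\operatorname{rank}(B)}(G)}-\log\Big(\frac{1}{1+\lambda_{\operatorname{rank}(B)}(G)}\Big)-1}.$$
   Context: $M^*$ is the conjugate transpose, $M^{-*}=(M^{-1})^*$, and $\|\cdot\|_F$ is the Frobenius norm. $\lambda_1(M)\ge\cdots\ge\lambda_n(M)$ denote the ordered eigenvalues. A rank-$r$ truncated SVD of a Hermitian positive semidefinite $M=\sum_{i}\lambda_i(M)v_iv_i^*$ ($v_i$ orthonormal eigenvectors) is $M_r=\sum_{i=1}^r\lambda_i(M)v_iv_i^*$. For Hermitian positive definite $n\times n$ matrices $X,Y$, $$\mathcal{D}_{\mathrm{LD}}(X,Y)=\operatorname{trace}(XY^{-1})-\log\det(XY^{-1})-n.$$ Randomised approximation: $\Omega\in\mathbb{R}^{n\times(r+p)}$ has independent standard Gaussian entries, $\Theta$ is a matrix whose columns form an orthonormal basis of $\operatorname{range}(G\Omega)$ (e.g. from a QR decomposition of $G\Omega$), and $G\langle\Omega\rangle=\Theta\Theta^*G\,\Theta\Theta^*$. The expectation is over $\Omega$. *)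

theory Defs
  imports
    "HOL-Probability.Probability"
    "Jordan_Normal_Form.Schur_Decomposition"
    "Jordan_Normal_Form.Gauss_Jordan_Elimination"
    "Jordan_Normal_Form.DL_Rank"
begin

unbundle no vec_syntax

definition herm_psd :: "nat \<Rightarrow> complex mat \<Rightarrow> bool" where
  "herm_psd n M \<longleftrightarrow> M \<in> carrier_mat n n \<and> mat_adjoint M = M \<and>
     (\<forall>v\<in>carrier_vec n. 0 \<le> Re ((M *\<^sub>v v) \<bullet>c v))"

definition herm_pd :: "nat \<Rightarrow> complex mat \<Rightarrow> bool" where
  "herm_pd n M \<longleftrightarrow> M \<in> carrier_mat n n \<and> mat_adjoint M = M \<and>
     (\<forall>v\<in>carrier_vec n. v \<noteq> 0\<^sub>v n \<longrightarrow> 0 < Re ((M *\<^sub>v v) \<bullet>c v))"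

text \<open>Only meaningful for invertible matrices.\<close>
definition minv :: "complex mat \<Rightarrow> complex mat" where
  "minv M = the (mat_inverse M)"

definition mtrace :: "complex mat \<Rightarrow> complex" where
  "mtrace M = (\<Sum>i<dim_row M. M $$ (i, i))"

definition frob_norm :: "complex mat \<Rightarrow> real" where
  "frob_norm M = sqrt (\<Sum>i<dim_row M. \<Sum>j<dim_col M. (cmod (M $$ (i, j)))\<^sup>2)"

text \<open>The eigenvalues of a Hermitian matrix in decreasing order, counted with multiplicity:
  the index \<open>j\<close> runs from \<open>1\<close> to the dimension. The real part loses nothing, as the
  roots of the characteristic polynomial of a Hermitian matrix are real.\<close>
definition eigval_desc :: "complex mat \<Rightarrow> nat \<Rightarrow> real" where
  "eigval_desc M j =
     rev (sorted_list_of_multiset (image_mset Re (proots (char_poly M)))) ! (j - 1)"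

text \<open>The eigenvectors \<open>v 0, \<dots>, v (n - 1)\<close> are indexed from \<open>0\<close>, the eigenvalues from \<open>1\<close>.\<close>
definition spectral_sum :: "nat \<Rightarrow> complex mat \<Rightarrow> (nat \<Rightarrow> complex Matrix.vec) \<Rightarrow> nat \<Rightarrow> complex mat" where
  "spectral_sum n M v k = Matrix.mat n n (\<lambda>(a, b).
     \<Sum>i<k. complex_of_real (eigval_desc M (i + 1)) * v i $ a * cnj (v i $ b))"

text \<open>The truncation need not be unique, hence a relation.\<close>
definition is_truncated_svd :: "nat \<Rightarrow> complex mat \<Rightarrow> nat \<Rightarrow> complex mat \<Rightarrow> bool" where
  "is_truncated_svd n M r Mr \<longleftrightarrow> (\<exists>v.
     (\<forall>i<n. v i \<in> carrier_vec n) \<and>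
     (\<forall>i<n. \<forall>j<n. v i \<bullet>c v j = (if i = j then 1 else 0)) \<and>
     M = spectral_sum n M v n \<and> Mr = spectral_sum n M v r)"

text \<open>For positive definite arguments the trace and the determinant of \<open>X Y\<^sup>-\<^sup>1\<close>
  are real and the determinant is positive.\<close>
definition logdet_div :: "nat \<Rightarrow> complex mat \<Rightarrow> complex mat \<Rightarrow> real" where
  "logdet_div n X Y =
     Re (mtrace (X * minv Y)) - ln (Re (Determinant.det (X * minv Y))) - real n"

definition std_gaussian_mat :: "'w measure \<Rightarrow> nat \<Rightarrow> nat \<Rightarrow> ('w \<Rightarrow> real mat) \<Rightarrow> bool" where
  "std_gaussian_mat P n m \<Omega> \<longleftrightarrow>
     (\<forall>\<omega>\<in>space P. \<Omega> \<omega> \<in> carrier_mat n m) \<and>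
     prob_space.indep_vars P (\<lambda>_. borel) (\<lambda>(i, j) \<omega>. \<Omega> \<omega> $$ (i, j)) ({..<n} \<times> {..<m}) \<and>
     (\<forall>i<n. \<forall>j<m. distributed P lborel (\<lambda>\<omega>. \<Omega> \<omega> $$ (i, j)) std_normal_density)"

text \<open>The number of columns of \<open>\<Theta>\<close> is left open: it is the dimension of the range of \<open>Y\<close>.\<close>
definition orthonormal_range_basis :: "nat \<Rightarrow> complex mat \<Rightarrow> complex mat \<Rightarrow> bool" where
  "orthonormal_range_basis n Y \<Theta> \<longleftrightarrow>
     dim_row \<Theta> = n \<and> mat_adjoint \<Theta> * \<Theta> = 1\<^sub>m (dim_col \<Theta>) \<and>
     vec_space.col_space n \<Theta> = vec_space.col_space n Y"

definition rand_approx :: "complex mat \<Rightarrow> complex mat \<Rightarrow> complex mat" where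
  "rand_approx G \<Theta> = \<Theta> * mat_adjoint \<Theta> * G * \<Theta> * mat_adjoint \<Theta>"

end

theory Submission
  imports Defs
    "HOL-Real_Asymp.Real_Asymp"
    "HOL-Computational_Algebra.Fundamental_Theorem_Algebra"
begin

text \<open>
  A congruence with \<open>Q\<close> reduces the divergences to those of \<open>I + X\<close> from \<open>I + G\<close>, where \<open>X = P G P\<close> is the compression of
  \<open>G\<close> to the range of \<open>G \<Omega>\<close> and \<open>P\<close> is the orthogonal projection onto it. The proof has a deterministic and a
  probabilistic half, joined by the residual \<open>\<eta> = |(I - P) G|\<close> in the Frobenius norm.

  For each outcome of rank \<open>r + p\<close>, the divergence of \<open>I + X\<close> exceeds that of the truncated decomposition by at most a multiple of \<open>\<eta>\<close>
  (\<open>divergence_excess\<close>). With \<open>W\<close> the inverse of \<open>I + G\<close>, the divergence consists of a trace that involves only the blocks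
  \<open>P W (I - P)\<close> and \<open>(I - P) G P\<close>, and of \<open>ln (1 + x) - x / (1 + x)\<close>, summed over the eigenvalues of \<open>G\<close> minus
  the same sum for \<open>X\<close>. The eigenvalues of \<open>X\<close> lie below those of \<open>G\<close>, by at most the norm of \<open>(I - P) G (I - P)\<close>. There
  are two bounds. One yields the absolute estimate. The relative estimate needs the smaller of both, because the
  optimal divergence is only known to be a multiple of \<open>rank B - r\<close>, which may be much less than \<open>n - r\<close>.

  It remains to show that the mean of \<open>\<eta>\<close> is at most \<open>2 \<epsilon>\<close>, for which the mean of \<open>\<eta>\<^sup>2\<close> is bounded by \<open>4 \<epsilon>\<^sup>2\<close>
  (\<open>sketch_bound\<close>). If \<open>G\<close> and \<open>\<Omega>\<close> were both real, the eigenvectors could be rotated to coordinate vectors and the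
  mean of \<open>\<eta>\<^sup>2\<close> would be \<open>\<epsilon>\<^sup>2\<close> at most. Here \<open>\<Omega>\<close> is real and \<open>G\<close> is complex, so that no such rotation
  exists; the factor 4 is the room that is left to avoid it. A further Gaussian column turns the residual matrix into the residual of
  a vector. Since real rotations of the columns preserve the distribution, this column may be replaced by a combination of all
  columns in a random direction, and the residual is then bounded by testing a combination that has no component along the first
  \<open>r\<close> eigenvectors. What is left are Gaussian integrals of complex forms in real variables. They are handled by three
  inequalities that replace rotation invariance: exponential moments (\<open>gauss_integral_hform_le\<close>), an isotropy up to the factor
  8/3 (\<open>gauss_proj_isotropy\<close>), and second moments against weights invariant under translations (\<open>gauss_covariance\<close>).
\<close>

section \<open>Adjoint, trace and Frobenius norm\<close>

lemma dim_mat_adjoint [simp]: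
  "dim_row (mat_adjoint A) = dim_col A" "dim_col (mat_adjoint A) = dim_row A"
  by (simp_all add: mat_adjoint_def)

lemma index_mat_adjoint [simp]:
  "i < dim_col A \<Longrightarrow> j < dim_row A \<Longrightarrow> mat_adjoint A $$ (i, j) = cnj (A $$ (j, i))"
  for A :: "complex mat"
proof -
  assume ij: "i < dim_col A" "j < dim_row A"
  then have "mat_adjoint A $$ (i, j) = conjugate (col A i) $ j"
    by (simp only: mat_adjoint_def mat_of_rows_def) simp
  also have "\<dots> = conjugate (col A i $ j)"
    by (rule vec_index_conjugate) (use ij in simp)
  finally show ?thesis using ij by simp
qed

lemma mat_adjoint_carrier [simp]:
  "mat_adjoint A \<in> carrier_mat n m \<longleftrightarrow> A \<in> carrier_mat m n"
  unfolding carrier_mat_def mem_Collect_eq dim_mat_adjoint by (rule conj_commute)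

lemma mult_carrier_square [simp]:
  "A \<in> carrier_mat n n \<Longrightarrow> B \<in> carrier_mat n n \<Longrightarrow> A * B \<in> carrier_mat n n"
  by simp

lemma minus_carrier_mat' [simp]:
  "A \<in> carrier_mat n m \<Longrightarrow> B \<in> carrier_mat n m \<Longrightarrow> A - B \<in> carrier_mat n m"
  by (simp add: minus_carrier_mat)

lemma mat_adjoint_mult:
  fixes A B :: "complex mat"
  assumes "A \<in> carrier_mat n m" "B \<in> carrier_mat m k"
  shows "mat_adjoint (A * B) = mat_adjoint B * mat_adjoint A"
  using assms by (intro eq_matI) (auto simp: scalar_prod_def mult.commute intro!: sum.cong)

lemma mat_adjoint_adjoint [simp]: "mat_adjoint (mat_adjoint A) = (A :: complex mat)"
  by (intro eq_matI) auto

lemma mat_adjoint_minus: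
  fixes A B :: "complex mat"
  assumes "A \<in> carrier_mat n m" "B \<in> carrier_mat n m"
  shows "mat_adjoint (A - B) = mat_adjoint A - mat_adjoint B"
  using assms by (intro eq_matI) auto

lemma mat_adjoint_one [simp]: "mat_adjoint (1\<^sub>m n :: complex mat) = 1\<^sub>m n"
  by (intro eq_matI) auto

lemma index_mult_mat_sum:
  "A \<in> carrier_mat n m \<Longrightarrow> B \<in> carrier_mat m k \<Longrightarrow> i < n \<Longrightarrow> j < k
   \<Longrightarrow> (A * B) $$ (i, j) = (\<Sum>l<m. A $$ (i, l) * B $$ (l, j))"
  by (auto simp: scalar_prod_def lessThan_atLeast0)

lemma mtrace_mult_sum:
  assumes "A \<in> carrier_mat n m" "B \<in> carrier_mat m n"
  shows "mtrace (A * B) = (\<Sum>i<n. \<Sum>j<m. A $$ (i, j) * B $$ (j, i))"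
proof -
  have "dim_row (A * B) = n" using assms by simp
  then show ?thesis
    unfolding mtrace_def using index_mult_mat_sum [OF assms] by simp
qed

lemma mtrace_commute:
  assumes "A \<in> carrier_mat n m" "B \<in> carrier_mat m n"
  shows "mtrace (A * B) = mtrace (B * A)"
  unfolding mtrace_mult_sum [OF assms] mtrace_mult_sum [OF assms(2,1)]
  by (subst sum.swap) (simp add: mult.commute)

lemma mtrace_add:
  "A \<in> carrier_mat n n \<Longrightarrow> B \<in> carrier_mat n n \<Longrightarrow> mtrace (A + B) = mtrace A + mtrace B"
  by (simp add: mtrace_def sum.distrib)

lemma mtrace_minus:
  "A \<in> carrier_mat n n \<Longrightarrow> B \<in> carrier_mat n n \<Longrightarrow> mtrace (A - B) = mtrace A - mtrace B"
  by (simp add: mtrace_def sum_subtractf)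

lemma frob_norm_nonneg [simp]: "0 \<le> frob_norm A"
  by (simp add: frob_norm_def sum_nonneg)

lemma frob_norm_square:
  assumes "A \<in> carrier_mat n m"
  shows "(frob_norm A)\<^sup>2 = (\<Sum>i<n. \<Sum>j<m. (cmod (A $$ (i, j)))\<^sup>2)"
  using assms by (simp add: frob_norm_def sum_nonneg)

lemma frob_norm_adjoint: "frob_norm (mat_adjoint A) = frob_norm A"
  unfolding frob_norm_def by (simp, subst sum.swap, simp)

lemma mtrace_adjoint_mult:
  assumes "A \<in> carrier_mat n m"
  shows "mtrace (mat_adjoint A * A) = of_real ((frob_norm A)\<^sup>2)"
proof -
  have sq: "cnj z * z = of_real ((cmod z)\<^sup>2)" for z
    using complex_norm_square [of z] by (simp add: mult.commute)
  have "mtrace (mat_adjoint A * A) = (\<Sum>j<m. \<Sum>i<n. cnj (A $$ (i, j)) * A $$ (i, j))"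
    using assms by (subst mtrace_mult_sum [of _ m n]) auto
  also have "\<dots> = (\<Sum>i<n. \<Sum>j<m. of_real ((cmod (A $$ (i, j)))\<^sup>2))"
    by (subst sum.swap) (simp only: sq)
  finally show ?thesis using frob_norm_square [OF assms] by simp
qed

lemma cmod_mtrace_mult_le:
  assumes "A \<in> carrier_mat n m" "B \<in> carrier_mat m n"
  shows "cmod (mtrace (A * B)) \<le> frob_norm A * frob_norm B"
proof -
  let ?S = "{..<n} \<times> {..<m}"
  let ?a = "\<lambda>p. cmod (A $$ p)" and ?b = "\<lambda>p. cmod (B $$ (snd p, fst p))"
  have "mtrace (A * B) = (\<Sum>p\<in>?S. A $$ p * B $$ (snd p, fst p))"
    using mtrace_mult_sum [OF assms] sum.cartesian_product [of "\<lambda>i j. A $$ (i, j) * B $$ (j, i)" "{..<m}" "{..<n}"]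
    by (simp add: case_prod_beta')
  then have "cmod (mtrace (A * B)) \<le> (\<Sum>p\<in>?S. ?a p * ?b p)"
    using norm_sum [of "\<lambda>p. A $$ p * B $$ (snd p, fst p)" ?S] by (simp add: norm_mult)
  also have "\<dots> \<le> sqrt ((\<Sum>p\<in>?S. (?a p)\<^sup>2) * (\<Sum>p\<in>?S. (?b p)\<^sup>2))"
    by (rule real_le_rsqrt, rule Cauchy_Schwarz_ineq_sum)
  also have "(\<Sum>p\<in>?S. (?a p)\<^sup>2) = (frob_norm A)\<^sup>2"
    using frob_norm_square [OF assms(1)] sum.cartesian_product [of "\<lambda>i j. (?a (i, j))\<^sup>2" "{..<m}" "{..<n}"]
    by (simp add: case_prod_beta')
  also have "(\<Sum>p\<in>?S. (?b p)\<^sup>2) = (frob_norm B)\<^sup>2"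
    using frob_norm_square [OF assms(2)] sum.cartesian_product [of "\<lambda>i j. (?b (i, j))\<^sup>2" "{..<m}" "{..<n}"]
    by (subst (asm) sum.swap) (simp add: case_prod_beta')
  finally show ?thesis by (simp add: real_sqrt_mult)
qed

section \<open>Unitary diagonalisation and functional calculus\<close>

definition diag_real :: "nat \<Rightarrow> (nat \<Rightarrow> real) \<Rightarrow> complex mat" where
  "diag_real n f = mat n n (\<lambda>(i, j). if i = j then of_real (f i) else 0)"

definition is_unitary :: "nat \<Rightarrow> complex mat \<Rightarrow> bool" where
  "is_unitary n U \<longleftrightarrow> U \<in> carrier_mat n n \<and> mat_adjoint U * U = 1\<^sub>m n \<and> U * mat_adjoint U = 1\<^sub>m n"

text \<open>The value of a real function of the index on the orthonormal basis of the columns of \<open>U\<close>: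
  \<open>\<Sum>i<n. f i u\<^sub>i u\<^sub>i\<^sup>*\<close>.\<close>

definition fcalc :: "nat \<Rightarrow> complex mat \<Rightarrow> (nat \<Rightarrow> real) \<Rightarrow> complex mat" where
  "fcalc n U f = U * diag_real n f * mat_adjoint U"

lemma is_unitary_carrier: "is_unitary n U \<Longrightarrow> U \<in> carrier_mat n n"
  by (simp add: is_unitary_def)

lemma is_unitaryI:
  assumes "U \<in> carrier_mat n n" "mat_adjoint U * U = 1\<^sub>m n"
  shows "is_unitary n U"
  using assms mat_mult_left_right_inverse [of "mat_adjoint U" n U] by (simp add: is_unitary_def)

lemma diag_real_carrier [simp]: "diag_real n f \<in> carrier_mat n n"
  by (simp add: diag_real_def)

lemma dim_diag_real [simp]: "dim_row (diag_real n f) = n" "dim_col (diag_real n f) = n"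
  by (simp_all add: diag_real_def)

lemma index_diag_real_mult:
  assumes A: "A \<in> carrier_mat n k" and i: "i < n" and j: "j < k"
  shows "(diag_real n f * A) $$ (i, j) = of_real (f i) * A $$ (i, j)"
proof -
  have "(diag_real n f * A) $$ (i, j) = (\<Sum>l<n. diag_real n f $$ (i, l) * A $$ (l, j))"
    by (rule index_mult_mat_sum [OF diag_real_carrier A i j])
  also have "\<dots> = (\<Sum>l<n. if l = i then of_real (f i) * A $$ (i, j) else 0)"
    using i by (intro sum.cong) (auto simp: diag_real_def)
  also have "\<dots> = of_real (f i) * A $$ (i, j)" using i by simp
  finally show ?thesis .
qed

lemma diag_real_mult: "diag_real n f * diag_real n g = diag_real n (\<lambda>i. f i * g i)"
proof (rule eq_matI)
  fix i j assume "i < dim_row (diag_real n (\<lambda>i. f i * g i))" "j < dim_col (diag_real n (\<lambda>i. f i * g i))"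
  then have ij: "i < n" "j < n" by simp_all
  show "(diag_real n f * diag_real n g) $$ (i, j) = diag_real n (\<lambda>i. f i * g i) $$ (i, j)"
    using ij by (subst index_diag_real_mult [OF diag_real_carrier ij]) (auto simp: diag_real_def)
qed simp_all

lemma diag_real_one: "diag_real n (\<lambda>_. 1) = 1\<^sub>m n"
  by (intro eq_matI) (auto simp: diag_real_def)

lemma diag_real_adjoint: "mat_adjoint (diag_real n f) = diag_real n f"
  by (intro eq_matI) (auto simp: diag_real_def)

lemma fcalc_carrier [simp]: "U \<in> carrier_mat n n \<Longrightarrow> fcalc n U f \<in> carrier_mat n n"
  by (simp add: fcalc_def)

lemma unitary_cancel:
  assumes "is_unitary n U" "A \<in> carrier_mat n n"
  shows "mat_adjoint U * (U * A) = A" "U * (mat_adjoint U * A) = A"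
  using assms assoc_mult_mat [of "mat_adjoint U" n n U n A n] assoc_mult_mat [of U n n "mat_adjoint U" n A n]
  by (auto simp: is_unitary_def)

lemma fcalc_mult:
  assumes U: "is_unitary n U"
  shows "fcalc n U f * fcalc n U g = fcalc n U (\<lambda>i. f i * g i)"
proof -
  note [simp] = is_unitary_carrier [OF U]
  have "fcalc n U f * fcalc n U g = U * (diag_real n f * (mat_adjoint U * (U * (diag_real n g * mat_adjoint U))))"
    by (simp add: fcalc_def assoc_mult_mat [of _ n n _ n _ n])
  also have "\<dots> = U * (diag_real n f * (diag_real n g * mat_adjoint U))"
    by (simp add: unitary_cancel [OF U])
  also have "\<dots> = U * (diag_real n f * diag_real n g) * mat_adjoint U"
    by (simp add: assoc_mult_mat [of _ n n _ n _ n])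
  finally show ?thesis by (simp add: diag_real_mult fcalc_def)
qed

lemma fcalc_add:
  assumes U: "U \<in> carrier_mat n n"
  shows "fcalc n U f + fcalc n U g = fcalc n U (\<lambda>i. f i + g i)"
proof -
  have "diag_real n (\<lambda>i. f i + g i) = diag_real n f + diag_real n g"
    by (intro eq_matI) (auto simp: diag_real_def)
  then show ?thesis
    using U by (simp add: fcalc_def mult_add_distrib_mat [of _ n n _ n] add_mult_distrib_mat [of _ n n _ _ n])
qed

lemma fcalc_minus:
  assumes U: "U \<in> carrier_mat n n"
  shows "fcalc n U f - fcalc n U g = fcalc n U (\<lambda>i. f i - g i)"
proof -
  have "diag_real n (\<lambda>i. f i - g i) = diag_real n f - diag_real n g"
    by (intro eq_matI) (auto simp: diag_real_def)
  then show ?thesis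
    using U by (simp add: fcalc_def mult_minus_distrib_mat [of _ n n _ n] minus_mult_distrib_mat [of _ n n _ _ n])
qed

lemma fcalc_one: "is_unitary n U \<Longrightarrow> fcalc n U (\<lambda>_. 1) = 1\<^sub>m n"
  by (auto simp: fcalc_def diag_real_one is_unitary_def)

lemma fcalc_adjoint: "U \<in> carrier_mat n n \<Longrightarrow> mat_adjoint (fcalc n U f) = fcalc n U f"
  by (simp add: fcalc_def mat_adjoint_mult [of _ n n _ n] diag_real_adjoint assoc_mult_mat [of _ n n _ n _ n])

lemma fcalc_cong: "(\<And>i. i < n \<Longrightarrow> f i = g i) \<Longrightarrow> fcalc n U f = fcalc n U g"
proof -
  assume "\<And>i. i < n \<Longrightarrow> f i = g i"
  then have "diag_real n f = diag_real n g" by (intro eq_matI) (auto simp: diag_real_def)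
  then show ?thesis by (simp add: fcalc_def)
qed

lemma mtrace_fcalc:
  assumes U: "is_unitary n U"
  shows "mtrace (fcalc n U f) = of_real (\<Sum>i<n. f i)"
proof -
  note [simp] = is_unitary_carrier [OF U]
  have "mtrace (fcalc n U f) = mtrace (mat_adjoint U * (U * diag_real n f))"
    unfolding fcalc_def by (subst mtrace_commute [of _ n n]) simp_all
  also have "\<dots> = mtrace (diag_real n f)" by (simp add: unitary_cancel [OF U])
  finally show ?thesis by (simp add: mtrace_def) (simp add: diag_real_def)
qed

lemma det_fcalc:
  assumes U: "is_unitary n U"
  shows "det (fcalc n U f) = of_real (\<Prod>i<n. f i)"
proof -
  note [simp] = is_unitary_carrier [OF U]
  have "det (mat_adjoint U) * det U = det (mat_adjoint U * U)"
    by (rule det_mult [symmetric, of _ n]) simp_all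
  then have 1: "det (mat_adjoint U) * det U = 1" using U by (simp add: is_unitary_def)
  have "det (fcalc n U f) = det U * det (diag_real n f) * det (mat_adjoint U)"
    by (simp add: fcalc_def det_mult [of _ n])
  also have "\<dots> = det (diag_real n f) * (det (mat_adjoint U) * det U)" by simp
  also have "\<dots> = det (diag_real n f)" by (simp add: 1)
  also have "\<dots> = prod_list (diag_mat (diag_real n f))"
    by (rule det_upper_triangular [of _ n]) (auto simp: diag_real_def)
  also have "diag_mat (diag_real n f) = map (\<lambda>i. complex_of_real (f i)) [0..<n]"
    by (auto simp: diag_mat_def) (simp add: diag_real_def)
  also have "prod_list \<dots> = of_real (\<Prod>i<n. f i)"
    by (simp add: prod.distinct_set_conv_list [symmetric] lessThan_atLeast0)
  finally show ?thesis .
qed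

text \<open>Test vectors are packed as columns of a square matrix \<open>Z\<close>, so that every product below is
  between square matrices of the same size.\<close>

lemma mtrace_fcalc_form:
  assumes U: "is_unitary n U" and Z: "Z \<in> carrier_mat n n"
  shows "mtrace (mat_adjoint Z * (fcalc n U f * Z))
     = of_real (\<Sum>i<n. \<Sum>k<n. f i * (cmod ((mat_adjoint U * Z) $$ (i, k)))\<^sup>2)"
proof -
  note [simp] = is_unitary_carrier [OF U] Z
  define Y where "Y = mat_adjoint U * Z"
  have [simp]: "Y \<in> carrier_mat n n" by (simp add: Y_def)
  note [simp] = carrier_matD [OF \<open>Y \<in> carrier_mat n n\<close>]
  have "mtrace (mat_adjoint Z * (fcalc n U f * Z)) = mtrace (mat_adjoint Y * (diag_real n f * Y))"
    by (simp add: Y_def fcalc_def mat_adjoint_mult [of _ n n _ n] assoc_mult_mat [of _ n n _ n _ n])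
  also have "\<dots> = (\<Sum>k<n. \<Sum>i<n. cnj (Y $$ (i, k)) * (diag_real n f * Y) $$ (i, k))"
    by (subst mtrace_mult_sum [of _ n n]) auto
  also have "\<dots> = (\<Sum>k<n. \<Sum>i<n. of_real (f i * (cmod (Y $$ (i, k)))\<^sup>2))"
  proof (intro sum.cong refl)
    fix k i assume "k \<in> {..<n}" "i \<in> {..<n}"
    then have "(diag_real n f * Y) $$ (i, k) = of_real (f i) * Y $$ (i, k)"
      by (intro index_diag_real_mult [of _ n n]) auto
    then show "cnj (Y $$ (i, k)) * (diag_real n f * Y) $$ (i, k) = of_real (f i * (cmod (Y $$ (i, k)))\<^sup>2)"
      using complex_norm_square [of "Y $$ (i, k)"] by (simp add: algebra_simps)
  qed
  finally show ?thesis by (subst sum.swap) (simp add: Y_def)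
qed

lemma frob_norm_unitary:
  assumes U: "is_unitary n U" and Z: "Z \<in> carrier_mat n n"
  shows "(frob_norm Z)\<^sup>2 = (\<Sum>i<n. \<Sum>k<n. (cmod ((mat_adjoint U * Z) $$ (i, k)))\<^sup>2)"
proof -
  have "of_real ((frob_norm Z)\<^sup>2) = mtrace (mat_adjoint Z * (fcalc n U (\<lambda>_. 1) * Z))"
    using Z unfolding fcalc_one [OF U] mtrace_adjoint_mult [OF Z, symmetric] by simp
  then show ?thesis
    unfolding mtrace_fcalc_form [OF U Z] by (simp only: of_real_eq_iff mult_1)
qed

lemma frob_norm_fcalc_mult:
  assumes U: "is_unitary n U" and Z: "Z \<in> carrier_mat n n"
  shows "(frob_norm (fcalc n U f * Z))\<^sup>2 = (\<Sum>i<n. \<Sum>k<n. (f i)\<^sup>2 * (cmod ((mat_adjoint U * Z) $$ (i, k)))\<^sup>2)"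
proof -
  note [simp] = is_unitary_carrier [OF U] Z
  have "of_real ((frob_norm (fcalc n U f * Z))\<^sup>2) = mtrace (mat_adjoint (fcalc n U f * Z) * (fcalc n U f * Z))"
    by (subst mtrace_adjoint_mult [of _ n n]) simp_all
  also have "mat_adjoint (fcalc n U f * Z) * (fcalc n U f * Z) = mat_adjoint Z * (fcalc n U f * fcalc n U f * Z)"
    by (simp add: mat_adjoint_mult [of _ n n _ n] fcalc_adjoint assoc_mult_mat [of _ n n _ n _ n])
  also have "mtrace \<dots> = of_real (\<Sum>i<n. \<Sum>k<n. (f i)\<^sup>2 * (cmod ((mat_adjoint U * Z) $$ (i, k)))\<^sup>2)"
    by (simp add: fcalc_mult [OF U] mtrace_fcalc_form [OF U] power2_eq_square)
  finally show ?thesis by (simp only: of_real_eq_iff)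
qed

lemma frob_norm_fcalc_mult_le:
  assumes U: "is_unitary n U" and Z: "Z \<in> carrier_mat n n" and f: "\<And>i. i < n \<Longrightarrow> \<bar>f i\<bar> \<le> c"
  shows "frob_norm (fcalc n U f * Z) \<le> \<bar>c\<bar> * frob_norm Z"
proof (rule power2_le_imp_le)
  have sq: "(f i)\<^sup>2 \<le> c\<^sup>2" if "i < n" for i
  proof -
    have "\<bar>f i\<bar> \<le> \<bar>c\<bar>" using f [OF that] by linarith
    then show ?thesis by (simp only: abs_le_square_iff)
  qed
  have "(\<Sum>i<n. \<Sum>k<n. (f i)\<^sup>2 * (cmod ((mat_adjoint U * Z) $$ (i, k)))\<^sup>2)
      \<le> (\<Sum>i<n. \<Sum>k<n. c\<^sup>2 * (cmod ((mat_adjoint U * Z) $$ (i, k)))\<^sup>2)"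
    by (intro sum_mono mult_right_mono sq) simp_all
  then show "(frob_norm (fcalc n U f * Z))\<^sup>2 \<le> (\<bar>c\<bar> * frob_norm Z)\<^sup>2"
    unfolding frob_norm_fcalc_mult [OF U Z] power_mult_distrib frob_norm_unitary [OF U Z]
    by (simp add: sum_distrib_left)
qed simp

lemma frob_norm_fcalc:
  assumes U: "is_unitary n U"
  shows "(frob_norm (fcalc n U f))\<^sup>2 = (\<Sum>i<n. (f i)\<^sup>2)"
proof -
  note [simp] = is_unitary_carrier [OF U]
  have "of_real ((frob_norm (fcalc n U f))\<^sup>2) = mtrace (mat_adjoint (fcalc n U f) * fcalc n U f)"
    by (subst mtrace_adjoint_mult [of _ n n]) simp_all
  also have "\<dots> = of_real (\<Sum>i<n. (f i)\<^sup>2)"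
    by (simp add: fcalc_adjoint fcalc_mult [OF U] mtrace_fcalc [OF U] power2_eq_square)
  finally show ?thesis by (simp only: of_real_eq_iff)
qed

section \<open>Orthogonal projections\<close>

definition is_proj :: "nat \<Rightarrow> complex mat \<Rightarrow> bool" where
  "is_proj n P \<longleftrightarrow> P \<in> carrier_mat n n \<and> mat_adjoint P = P \<and> P * P = P"

lemma is_proj_carrier: "is_proj n P \<Longrightarrow> P \<in> carrier_mat n n"
  by (simp add: is_proj_def)

lemma is_proj_cancel:
  assumes "is_proj n P" "A \<in> carrier_mat n k"
  shows "P * (P * A) = P * A"
  using assms assoc_mult_mat [of P n n P n A k] by (simp add: is_proj_def)

lemma is_proj_compl:
  assumes "is_proj n P"
  shows "is_proj n (1\<^sub>m n - P)"
proof -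
  have P: "P \<in> carrier_mat n n" "mat_adjoint P = P" "P * P = P" using assms by (auto simp: is_proj_def)
  have "(1\<^sub>m n - P) * P = 0\<^sub>m n n"
    using P by (simp add: minus_mult_distrib_mat [of _ n n _ _ n] minus_r_inv_mat [of _ n n])
  then have "(1\<^sub>m n - P) * (1\<^sub>m n - P) = (1\<^sub>m n - P) - 0\<^sub>m n n"
    using P by (simp add: mult_minus_distrib_mat [of _ n n _ n])
  also have "\<dots> = 1\<^sub>m n - P" using P by (intro eq_matI) auto
  finally show ?thesis using P by (simp add: is_proj_def mat_adjoint_minus [of _ n n])
qed

lemma frob_norm_proj_split:
  assumes P: "is_proj n P" and A: "A \<in> carrier_mat n k"
  shows "(frob_norm A)\<^sup>2 = (frob_norm (P * A))\<^sup>2 + (frob_norm ((1\<^sub>m n - P) * A))\<^sup>2"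
proof -
  note [simp] = is_proj_carrier [OF P] A
  have sq: "of_real ((frob_norm (R * A))\<^sup>2) = mtrace (mat_adjoint A * (R * A))" if R: "is_proj n R" for R
  proof -
    have Rc: "R \<in> carrier_mat n n" and Ra: "mat_adjoint R = R" using R by (auto simp: is_proj_def)
    have RA: "R * A \<in> carrier_mat n k" using Rc A by (rule mult_carrier_mat)
    have A': "mat_adjoint A \<in> carrier_mat k n" using A by simp
    have "mat_adjoint (R * A) * (R * A) = mat_adjoint A * R * (R * A)"
      unfolding mat_adjoint_mult [OF Rc A] Ra ..
    also have "\<dots> = mat_adjoint A * (R * (R * A))"
      by (rule assoc_mult_mat [OF A' Rc RA])
    also have "\<dots> = mat_adjoint A * (R * A)" unfolding is_proj_cancel [OF R A] ..
    finally show ?thesis unfolding mtrace_adjoint_mult [OF RA, symmetric] by (rule arg_cong)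
  qed
  have PA: "P * A \<in> carrier_mat n k" "(1\<^sub>m n - P) * A \<in> carrier_mat n k"
    by (rule mult_carrier_mat [OF _ A], simp)+
  have "(1\<^sub>m n - P) * A = A - P * A"
    using minus_mult_distrib_mat [of "1\<^sub>m n" n n P A k] left_mult_one_mat [OF A] by simp
  then have "A = P * A + (1\<^sub>m n - P) * A"
    using carrier_matD [OF PA(1)] carrier_matD [OF A] by (intro eq_matI) auto
  then have "mtrace (mat_adjoint A * A) = mtrace (mat_adjoint A * (P * A + (1\<^sub>m n - P) * A))"
    by (rule arg_cong [where f = "\<lambda>M. mtrace (mat_adjoint A * M)"])
  also have "\<dots> = mtrace (mat_adjoint A * (P * A)) + mtrace (mat_adjoint A * ((1\<^sub>m n - P) * A))"
  proof -
    have A': "mat_adjoint A \<in> carrier_mat k n" using A by simp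
    show ?thesis
      unfolding mult_add_distrib_mat [OF A' PA]
      by (rule mtrace_add; rule mult_carrier_mat [OF A'], rule PA)
  qed
  finally have "(of_real ((frob_norm A)\<^sup>2) :: complex) = of_real ((frob_norm (P * A))\<^sup>2 + (frob_norm ((1\<^sub>m n - P) * A))\<^sup>2)"
    unfolding of_real_add sq [OF P] sq [OF is_proj_compl [OF P]] mtrace_adjoint_mult [OF A, symmetric] .
  then show ?thesis by (simp only: of_real_eq_iff)
qed

lemma frob_norm_proj_mult_le:
  assumes P: "is_proj n P" and A: "A \<in> carrier_mat n k"
  shows "frob_norm (P * A) \<le> frob_norm A"
proof (rule power2_le_imp_le)
  show "(frob_norm (P * A))\<^sup>2 \<le> (frob_norm A)\<^sup>2"
    unfolding frob_norm_proj_split [OF P A] by simp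
qed simp

lemma frob_norm_mult_proj_le:
  assumes P: "is_proj n P" and A: "A \<in> carrier_mat k n"
  shows "frob_norm (A * P) \<le> frob_norm A"
proof -
  have "frob_norm (A * P) = frob_norm (mat_adjoint (A * P))" by (simp add: frob_norm_adjoint)
  also have "mat_adjoint (A * P) = P * mat_adjoint A"
    using P A by (simp add: mat_adjoint_mult [of A k n P n] is_proj_def)
  also have "frob_norm \<dots> \<le> frob_norm (mat_adjoint A)"
    using A by (intro frob_norm_proj_mult_le [OF P, of _ k]) simp_all
  finally show ?thesis by (simp add: frob_norm_adjoint)
qed

lemma frob_norm_proj:
  assumes "is_proj n P"
  shows "of_real ((frob_norm P)\<^sup>2) = mtrace P"
  using mtrace_adjoint_mult [of P n n] assms by (simp add: is_proj_def)

section \<open>The spectral theorem for Hermitian matrices\<close>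

lemma is_unitary_entries:
  assumes "U \<in> carrier_mat n n"
    and "\<And>i j. i < n \<Longrightarrow> j < n \<Longrightarrow> (\<Sum>k<n. cnj (U $$ (k, i)) * U $$ (k, j)) = (if i = j then 1 else 0)"
  shows "is_unitary n U"
proof (rule is_unitaryI [OF assms(1)], rule eq_matI)
  note d = carrier_matD [OF assms(1)]
  fix i j assume "i < dim_row (1\<^sub>m n :: complex mat)" "j < dim_col (1\<^sub>m n :: complex mat)"
  then have ij: "i < n" "j < n" by simp_all
  have "(mat_adjoint U * U) $$ (i, j) = (\<Sum>k<n. mat_adjoint U $$ (i, k) * U $$ (k, j))"
    using assms(1) ij by (intro index_mult_mat_sum [of _ n n _ n]) auto
  also have "\<dots> = (\<Sum>k<n. cnj (U $$ (k, i)) * U $$ (k, j))"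
    using d ij by (intro sum.cong) auto
  finally show "(mat_adjoint U * U) $$ (i, j) = 1\<^sub>m n $$ (i, j)"
    using assms(2) [OF ij] ij by simp
qed (use carrier_matD [OF assms(1)] in auto)

lemma is_unitary_entriesD:
  assumes U: "is_unitary n U" and ij: "i < n" "j < n"
  shows "(\<Sum>k<n. cnj (U $$ (k, i)) * U $$ (k, j)) = (if i = j then 1 else 0)"
proof -
  note d = carrier_matD [OF is_unitary_carrier [OF U]]
  have "(\<Sum>k<n. cnj (U $$ (k, i)) * U $$ (k, j)) = (\<Sum>k<n. mat_adjoint U $$ (i, k) * U $$ (k, j))"
    using d ij by (intro sum.cong) auto
  also have "\<dots> = (mat_adjoint U * U) $$ (i, j)"
    using is_unitary_carrier [OF U] ij by (intro index_mult_mat_sum [of _ n n _ n, symmetric]) auto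
  finally show ?thesis using U ij by (simp add: is_unitary_def)
qed

lemma index_fcalc:
  assumes U: "U \<in> carrier_mat n n" and ij: "i < n" "j < n"
  shows "fcalc n U f $$ (i, j) = (\<Sum>k<n. U $$ (i, k) * of_real (f k) * cnj (U $$ (j, k)))"
proof -
  note d = carrier_matD [OF U]
  have A: "mat_adjoint U \<in> carrier_mat n n" using U by simp
  have "fcalc n U f = U * (diag_real n f * mat_adjoint U)"
    unfolding fcalc_def by (rule assoc_mult_mat [OF U diag_real_carrier A])
  then have "fcalc n U f $$ (i, j) = (\<Sum>k<n. U $$ (i, k) * (diag_real n f * mat_adjoint U) $$ (k, j))"
    using index_mult_mat_sum [OF U mult_carrier_mat [OF diag_real_carrier A] ij] by simp
  also have "\<dots> = (\<Sum>k<n. U $$ (i, k) * of_real (f k) * cnj (U $$ (j, k)))"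
    using d ij by (intro sum.cong refl) (subst index_diag_real_mult [OF A], auto)
  finally show ?thesis .
qed

lemma is_unitary_mult:
  assumes U: "is_unitary n U" and V: "is_unitary n V"
  shows "is_unitary n (U * V)"
proof (rule is_unitaryI)
  note [simp] = is_unitary_carrier [OF U] is_unitary_carrier [OF V]
  show "U * V \<in> carrier_mat n n" by simp
  have "mat_adjoint (U * V) * (U * V) = mat_adjoint V * (mat_adjoint U * (U * V))"
    by (simp add: mat_adjoint_mult [of _ n n _ n] assoc_mult_mat [of _ n n _ n _ n])
  also have "\<dots> = mat_adjoint V * V" by (simp add: unitary_cancel [OF U])
  finally show "mat_adjoint (U * V) * (U * V) = 1\<^sub>m n" using V by (simp add: is_unitary_def)
qed

lemma fcalc_conjugate:
  assumes U: "is_unitary n U" and V: "is_unitary n V"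
  shows "U * fcalc n V f * mat_adjoint U = fcalc n (U * V) f"
proof -
  note [simp] = is_unitary_carrier [OF U] is_unitary_carrier [OF V]
  show ?thesis
    by (simp add: fcalc_def mat_adjoint_mult [of _ n n _ n] assoc_mult_mat [of _ n n _ n _ n])
qed

text \<open>A nonzero vector is extended to a basis and the basis is made orthonormal by the Gram-Schmidt process.\<close>

lemma unitary_completion:
  fixes v :: "complex Matrix.vec"
  assumes v: "v \<in> carrier_vec n" and v0: "v \<noteq> 0\<^sub>v n"
  obtains U c where "is_unitary n U" "c \<noteq> 0" "\<And>i. i < n \<Longrightarrow> U $$ (i, 0) = c * v $ i"
proof -
  interpret cof_vec_space n "TYPE(complex)" .
  define b where "b = basis_completion v"
  define ws where "ws = gram_schmidt n b"
  have b: "distinct b" "\<not> lin_dep (set b)" "set b \<subseteq> carrier_vec n" "length b = n"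
    unfolding b_def using basis_completion [OF v v0] by auto
  have "n \<noteq> 0" using v v0 by auto
  have hdb: "b = v # tl b" unfolding b_def basis_completion_def Let_def by simp
  have ws: "set ws \<subseteq> carrier_vec n" "corthogonal ws" "length ws = n"
    using gram_schmidt_result [OF b(3) b(1) b(2) ws_def] b(4) by auto
  have "hd ws = v" unfolding ws_def by (subst hdb) (rule gram_schmidt_hd [OF v])
  then have ws0: "ws ! 0 = v" using ws(3) \<open>n \<noteq> 0\<close> by (metis hd_conv_nth length_0_conv)
  have car: "ws ! j \<in> carrier_vec n" if "j < n" for j using ws that by auto
  define q where "q = (\<lambda>j k. \<Sum>i<n. cnj (ws ! j $ i) * ws ! k $ i)"
  have q: "q j k = ws ! k \<bullet>c ws ! j" if "j < n" "k < n" for j k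
    using car [OF that(1)] car [OF that(2)]
    by (auto simp: q_def scalar_prod_def lessThan_atLeast0 mult.commute intro!: sum.cong)
  have q0: "q j k = 0 \<longleftrightarrow> j \<noteq> k" if "j < n" "k < n" for j k
    using corthogonalD [OF ws(2), of k j] ws(3) that q [OF that] by auto
  define s where "s = (\<lambda>j. sqrt (Re (q j j)))"
  have qr: "q j j = of_real (\<Sum>i<n. (cmod (ws ! j $ i))\<^sup>2)" for j
    using complex_norm_square unfolding q_def by (simp add: mult.commute)
  have "Re (q j j) \<ge> 0" for j unfolding qr by (simp add: sum_nonneg)
  then have s: "of_real (s j) * of_real (s j) = q j j" for j
    unfolding s_def of_real_mult [symmetric] by (simp add: qr complex_eq_iff)
  define U where "U = mat n n (\<lambda>(i, j). ws ! j $ i / of_real (s j))"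
  have U: "U \<in> carrier_mat n n" by (simp add: U_def)
  have "is_unitary n U"
  proof (rule is_unitary_entries [OF U])
    fix i j assume ij: "i < n" "j < n"
    have "(\<Sum>k<n. cnj (U $$ (k, i)) * U $$ (k, j)) = q i j / (of_real (s i) * of_real (s j))"
      using ij by (simp add: U_def q_def sum_divide_distrib)
    also have "\<dots> = (if i = j then 1 else 0)"
      using q0 [OF ij] ij by (auto simp: s)
    finally show "(\<Sum>k<n. cnj (U $$ (k, i)) * U $$ (k, j)) = (if i = j then 1 else 0)" .
  qed
  moreover have "s 0 \<noteq> 0"
  proof
    assume "s 0 = 0"
    then have "q 0 0 = 0" using s [of 0] by simp
    then show False using q0 [of 0 0] \<open>n \<noteq> 0\<close> by simp
  qed
  then have "1 / complex_of_real (s 0) \<noteq> 0" by simp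
  moreover have "U $$ (i, 0) = 1 / of_real (s 0) * v $ i" if "i < n" for i
    using that by (simp add: U_def ws0)
  ultimately show ?thesis by (rule that)
qed

text \<open>By induction on the dimension: an eigenvector is completed to a unitary matrix, which splits off a block of size 1.\<close>

lemma hermitian_diagonalisation:
  assumes "M \<in> carrier_mat n n" "mat_adjoint M = (M :: complex mat)"
  shows "\<exists>U f. is_unitary n U \<and> M = fcalc n U f"
  using assms
proof (induction n arbitrary: M)
  case 0
  have "is_unitary 0 (1\<^sub>m 0)" by (simp add: is_unitary_def)
  moreover have E: "fcalc 0 (1\<^sub>m 0) (\<lambda>_. 0) \<in> carrier_mat 0 0" by simp
  have "M = fcalc 0 (1\<^sub>m 0) (\<lambda>_. 0)"
    using carrier_matD [OF 0(1)] carrier_matD [OF E] by (intro eq_matI) simp_all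
  ultimately show ?case by blast
next
  case (Suc n M)
  note M = Suc.prems
  let ?m = "Suc n"
  have "degree (char_poly M) = ?m" using degree_monic_char_poly [OF M(1)] by simp
  then have "\<not> constant (poly (char_poly M))" by (simp add: constant_degree)
  then obtain z where "poly (char_poly M) z = 0" using fundamental_theorem_of_algebra by blast
  then have "eigenvalue M z" using eigenvalue_root_char_poly [OF M(1)] by blast
  then obtain v where v: "v \<in> carrier_vec ?m" "v \<noteq> 0\<^sub>v ?m" "M *\<^sub>v v = z \<cdot>\<^sub>v v"
    using carrier_matD [OF M(1)] unfolding eigenvalue_def eigenvector_def by auto
  obtain U c where U: "is_unitary ?m U" "c \<noteq> 0" "\<And>i. i < ?m \<Longrightarrow> U $$ (i, 0) = c * v $ i"
    using unitary_completion [OF v(1,2)] by blast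
  note Uc [simp] = is_unitary_carrier [OF U(1)]
  note [simp] = M(1)
  define M' where "M' = mat_adjoint U * (M * U)"
  have M'c [simp]: "M' \<in> carrier_mat ?m ?m" by (simp add: M'_def)
  have M'a: "mat_adjoint M' = M'"
    by (simp add: M'_def mat_adjoint_mult [of _ ?m ?m _ ?m] M(2) assoc_mult_mat [of _ ?m ?m _ ?m _ ?m])
  have MU: "(M * U) $$ (i, 0) = z * U $$ (i, 0)" if i: "i < ?m" for i
  proof -
    have "(M * U) $$ (i, 0) = (\<Sum>l<?m. M $$ (i, l) * U $$ (l, 0))"
      by (rule index_mult_mat_sum [OF M(1) Uc i]) simp
    also have "\<dots> = c * (\<Sum>l<?m. M $$ (i, l) * v $ l)"
      unfolding sum_distrib_left by (rule sum.cong) (simp_all add: U(3))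
    also have "(\<Sum>l<?m. M $$ (i, l) * v $ l) = (M *\<^sub>v v) $ i"
      using carrier_matD [OF M(1)] carrier_vecD [OF v(1)] i
      by (simp add: scalar_prod_def lessThan_atLeast0)
    also have "\<dots> = z * v $ i" unfolding v(3) using carrier_vecD [OF v(1)] i by simp
    finally show ?thesis using U(3) [OF i] by simp
  qed
  have M'0: "M' $$ (i, 0) = (if i = 0 then z else 0)" if i: "i < ?m" for i
  proof -
    have "M' $$ (i, 0) = (\<Sum>l<?m. mat_adjoint U $$ (i, l) * (M * U) $$ (l, 0))"
      unfolding M'_def by (rule index_mult_mat_sum [of _ ?m ?m _ ?m]) (use i in simp_all)
    also have "\<dots> = z * (\<Sum>l<?m. cnj (U $$ (l, i)) * U $$ (l, 0))"
      unfolding sum_distrib_left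
      by (rule sum.cong) (use carrier_matD [OF Uc] i MU in simp_all)
    also have "\<dots> = (if i = 0 then z else 0)"
      using is_unitary_entriesD [OF U(1) i, of 0] by simp
    finally show ?thesis .
  qed
  have M'h: "M' $$ (i, j) = cnj (M' $$ (j, i))" if "i < ?m" "j < ?m" for i j
  proof -
    have "mat_adjoint M' $$ (i, j) = cnj (M' $$ (j, i))"
      using carrier_matD [OF M'c] that by simp
    then show ?thesis unfolding M'a .
  qed
  have zr: "z = of_real (Re z)"
  proof -
    have "z = cnj z" using M'h [of 0 0] M'0 [of 0] by simp
    then have "Im z = Im (cnj z)" by (rule arg_cong)
    then show ?thesis by (simp add: complex_eq_iff)
  qed
  have M'1: "M' $$ (0, i) = (if i = 0 then z else 0)" if "i < ?m" for i
    using M'h [of 0 i] M'0 [OF that] that zr by (auto simp: complex_eq_iff split: if_splits)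
  define N where "N = mat n n (\<lambda>(i, j). M' $$ (Suc i, Suc j))"
  have "N \<in> carrier_mat n n" by (simp add: N_def)
  moreover have "mat_adjoint N = N"
  proof (rule eq_matI)
    fix i j assume "i < dim_row N" "j < dim_col N"
    then have ij: "i < n" "j < n" by (simp_all add: N_def)
    have "mat_adjoint N $$ (i, j) = cnj (M' $$ (Suc j, Suc i))" using ij by (simp add: N_def)
    also have "\<dots> = M' $$ (Suc i, Suc j)" using ij M'h [of "Suc i" "Suc j"] by simp
    finally show "mat_adjoint N $$ (i, j) = N $$ (i, j)" using ij by (simp add: N_def)
  qed (simp_all add: N_def)
  ultimately obtain V f where V: "is_unitary n V" "N = fcalc n V f"
    using Suc.IH by blast
  define V' where "V' = mat ?m ?m (\<lambda>(i, j). if i = 0 \<or> j = 0 then (if i = j then 1 else 0) else V $$ (i - 1, j - 1))"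
  have V'c: "V' \<in> carrier_mat ?m ?m" by (simp add: V'_def)
  have V': "V' $$ (0, 0) = 1" "\<And>i. i < n \<Longrightarrow> V' $$ (Suc i, 0) = 0" "\<And>i. i < n \<Longrightarrow> V' $$ (0, Suc i) = 0"
    "\<And>i j. i < n \<Longrightarrow> j < n \<Longrightarrow> V' $$ (Suc i, Suc j) = V $$ (i, j)"
    by (simp_all add: V'_def)
  have V'u: "is_unitary ?m V'"
  proof (rule is_unitary_entries [OF V'c])
    fix i j assume ij: "i < ?m" "j < ?m"
    show "(\<Sum>k<?m. cnj (V' $$ (k, i)) * V' $$ (k, j)) = (if i = j then 1 else 0)"
      unfolding sum.lessThan_Suc_shift using ij
      by (cases i; cases j) (simp_all add: V' is_unitary_entriesD [OF V(1)])
  qed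
  define g where "g = (\<lambda>k. case k of 0 \<Rightarrow> Re z | Suc k \<Rightarrow> f k)"
  have "M' = fcalc ?m V' g"
  proof (rule eq_matI)
    fix i j assume "i < dim_row (fcalc ?m V' g)" "j < dim_col (fcalc ?m V' g)"
    then have ij: "i < ?m" "j < ?m" using carrier_matD [OF fcalc_carrier [OF V'c]] by auto
    have Nij: "M' $$ (Suc a, Suc b) = (\<Sum>k<n. V $$ (a, k) * of_real (f k) * cnj (V $$ (b, k)))" if "a < n" "b < n" for a b
    proof -
      have "M' $$ (Suc a, Suc b) = N $$ (a, b)" using that by (simp add: N_def)
      then show ?thesis by (simp only: V(2) index_fcalc [OF is_unitary_carrier [OF V(1)] that])
    qed
    show "M' $$ (i, j) = fcalc ?m V' g $$ (i, j)"
      unfolding index_fcalc [OF V'c ij] sum.lessThan_Suc_shift using ij zr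
      by (cases i; cases j) (simp_all add: V' g_def M'0 M'1 Nij)
  qed (use carrier_matD [OF M'c] carrier_matD [OF fcalc_carrier [OF V'c, of g]] in simp_all)
  moreover have "M = U * M' * mat_adjoint U"
  proof -
    have "U * M' * mat_adjoint U = U * (mat_adjoint U * (M * (U * mat_adjoint U)))"
      by (simp add: M'_def assoc_mult_mat [of _ ?m ?m _ ?m _ ?m])
    also have "U * mat_adjoint U = 1\<^sub>m ?m" using U(1) by (simp add: is_unitary_def)
    also have "M * 1\<^sub>m ?m = M" by (rule right_mult_one_mat [OF M(1)])
    also have "U * (mat_adjoint U * M) = M" by (rule unitary_cancel [OF U(1) M(1)])
    finally show ?thesis by simp
  qed
  ultimately have "M = fcalc ?m (U * V') g" using fcalc_conjugate [OF U(1) V'u] by simp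
  then show ?case using is_unitary_mult [OF U(1) V'u] by blast
qed

lemma hermitian_diagonalisation_sorted:
  assumes "M \<in> carrier_mat n n" "mat_adjoint M = (M :: complex mat)"
  obtains U f where "is_unitary n U" "M = fcalc n U f" "\<And>i j. i \<le> j \<Longrightarrow> j < n \<Longrightarrow> f j \<le> f i"
proof -
  obtain U f where U: "is_unitary n U" "M = fcalc n U f"
    using hermitian_diagonalisation [OF assms] by blast
  note Uc = is_unitary_carrier [OF U(1)]
  define xs where "xs = sort_key (\<lambda>i. - f i) [0..<n]"
  have xs: "distinct xs" "set xs = {..<n}" "length xs = n" by (auto simp: xs_def)
  define \<pi> where "\<pi> = (!) xs"
  have \<pi>: "bij_betw \<pi> {..<n} {..<n}" unfolding \<pi>_def using bij_betw_nth [OF xs(1)] xs by blast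
  have \<pi>n: "\<pi> i < n" if "i < n" for i using \<pi> that by (auto simp: bij_betw_def)
  have \<pi>i: "\<pi> i = \<pi> j \<longleftrightarrow> i = j" if "i < n" "j < n" for i j
    using bij_betw_imp_inj_on [OF \<pi>] that by (auto simp: inj_on_def)
  have "sorted (map (\<lambda>i. - f i) xs)" by (simp add: xs_def)
  then have anti: "f (\<pi> j) \<le> f (\<pi> i)" if "i \<le> j" "j < n" for i j
    using sorted_nth_mono [of "map (\<lambda>i. - f i) xs" i j] that xs(3) by (simp add: \<pi>_def)
  define V where "V = mat n n (\<lambda>(i, j). U $$ (i, \<pi> j))"
  have Vc: "V \<in> carrier_mat n n" by (simp add: V_def)
  have "is_unitary n V"
  proof (rule is_unitary_entries [OF Vc])
    fix i j assume ij: "i < n" "j < n"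
    show "(\<Sum>k<n. cnj (V $$ (k, i)) * V $$ (k, j)) = (if i = j then 1 else 0)"
      using is_unitary_entriesD [OF U(1) \<pi>n [OF ij(1)] \<pi>n [OF ij(2)]] ij by (simp add: V_def \<pi>i)
  qed
  moreover have "M = fcalc n V (\<lambda>i. f (\<pi> i))"
  proof (rule eq_matI)
    fix i j assume "i < dim_row (fcalc n V (\<lambda>i. f (\<pi> i)))" "j < dim_col (fcalc n V (\<lambda>i. f (\<pi> i)))"
    then have ij: "i < n" "j < n" using carrier_matD [OF fcalc_carrier [OF Vc]] by auto
    have "M $$ (i, j) = (\<Sum>k<n. U $$ (i, k) * of_real (f k) * cnj (U $$ (j, k)))"
      unfolding U(2) by (rule index_fcalc [OF Uc ij])
    also have "\<dots> = (\<Sum>k<n. U $$ (i, \<pi> k) * of_real (f (\<pi> k)) * cnj (U $$ (j, \<pi> k)))"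
      by (rule sum.reindex_bij_betw [OF \<pi>, symmetric])
    also have "\<dots> = fcalc n V (\<lambda>i. f (\<pi> i)) $$ (i, j)"
      unfolding index_fcalc [OF Vc ij] using ij by (simp add: V_def)
    finally show "M $$ (i, j) = fcalc n V (\<lambda>i. f (\<pi> i)) $$ (i, j)" .
  qed (use carrier_matD [OF assms(1)] carrier_matD [OF fcalc_carrier [OF Vc, of "\<lambda>i. f (\<pi> i)"]] in simp_all)
  ultimately show ?thesis using that anti by blast
qed

text \<open>The eigenvalues of a projection are 0 and 1, the latter as often as the trace says.\<close>

lemma det_one_plus_proj:
  assumes P: "is_proj n P" and k: "mtrace P = of_nat k"
  shows "det (1\<^sub>m n + of_real c \<cdot>\<^sub>m P) = of_real ((1 + c) ^ k)"
proof -
  obtain U f where U: "is_unitary n U" and Pf: "P = fcalc n U f"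
    using hermitian_diagonalisation P unfolding is_proj_def by blast
  note Uc [simp] = is_unitary_carrier [OF U]
  have "(frob_norm (fcalc n U (\<lambda>i. f i * f i - f i)))\<^sup>2 = 0"
  proof -
    have "fcalc n U (\<lambda>i. f i * f i - f i) = P * P - P"
      by (simp add: Pf fcalc_mult [OF U] fcalc_minus)
    also have "\<dots> = 0\<^sub>m n n" using P by (simp add: is_proj_def minus_r_inv_mat [of _ n n])
    finally show ?thesis by (simp add: frob_norm_def)
  qed
  then have "(\<Sum>i<n. (f i * f i - f i)\<^sup>2) = 0" unfolding frob_norm_fcalc [OF U] .
  then have "f i * f i - f i = 0" if "i < n" for i
    using that by (subst (asm) sum_nonneg_eq_0_iff) auto
  then have f01: "f i = 0 \<or> f i = 1" if "i < n" for i
    using that by (metis diff_add_cancel mult_cancel_right1 add_0 mult_eq_0_iff)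
  define K where "K = {i. i < n \<and> f i = 1}"
  have fin: "finite K" "K \<subseteq> {..<n}" by (auto simp: K_def)
  have "(\<Sum>i<n. f i) = (\<Sum>i\<in>K. f i)"
    by (rule sum.mono_neutral_right) (use f01 in \<open>auto simp: K_def\<close>)
  also have "\<dots> = real (card K)" by (simp add: K_def)
  finally have "card K = k"
    using k unfolding Pf mtrace_fcalc [OF U] by (metis of_nat_eq_iff of_real_of_nat_eq)
  have "1\<^sub>m n + of_real c \<cdot>\<^sub>m P = fcalc n U (\<lambda>i. 1 + c * f i)"
  proof -
    have "of_real c \<cdot>\<^sub>m P = fcalc n U (\<lambda>i. c * f i)"
    proof (rule eq_matI)
      fix i j assume "i < dim_row (fcalc n U (\<lambda>i. c * f i))" "j < dim_col (fcalc n U (\<lambda>i. c * f i))"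
      then have ij: "i < n" "j < n" using carrier_matD [OF fcalc_carrier [OF Uc]] by auto
      show "(of_real c \<cdot>\<^sub>m P) $$ (i, j) = fcalc n U (\<lambda>i. c * f i) $$ (i, j)"
        using ij carrier_matD [OF fcalc_carrier [OF Uc, of f]]
        by (simp add: Pf index_fcalc [OF Uc ij] sum_distrib_left mult_ac)
    qed (use carrier_matD [OF fcalc_carrier [OF Uc]] in \<open>simp_all add: Pf\<close>)
    then show ?thesis by (simp add: fcalc_one [OF U, symmetric] fcalc_add)
  qed
  then have "det (1\<^sub>m n + of_real c \<cdot>\<^sub>m P) = of_real (\<Prod>i<n. 1 + c * f i)" by (simp add: det_fcalc [OF U])
  also have "(\<Prod>i<n. 1 + c * f i) = (\<Prod>i\<in>K. 1 + c * f i)"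
    by (rule prod.mono_neutral_right) (use f01 in \<open>auto simp: K_def\<close>)
  also have "\<dots> = (1 + c) ^ k" using \<open>card K = k\<close> by (simp add: K_def)
  finally show ?thesis .
qed

section \<open>Test vectors\<close>

lemma of_real_eq_cmod: "complex_of_real r = w \<Longrightarrow> 0 \<le> r \<Longrightarrow> r = cmod w"
  by auto

lemma frob_norm_mult_le:
  assumes A: "A \<in> carrier_mat n m" and B: "B \<in> carrier_mat m k"
  shows "frob_norm (A * B) \<le> frob_norm A * frob_norm B"
proof (rule power2_le_imp_le)
  have "(cmod ((A * B) $$ (i, j)))\<^sup>2 \<le> (\<Sum>l<m. (cmod (A $$ (i, l)))\<^sup>2) * (\<Sum>l<m. (cmod (B $$ (l, j)))\<^sup>2)"
    if ij: "i < n" "j < k" for i j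
  proof -
    have "cmod ((A * B) $$ (i, j)) \<le> (\<Sum>l<m. cmod (A $$ (i, l)) * cmod (B $$ (l, j)))"
      unfolding index_mult_mat_sum [OF A B ij] norm_mult [symmetric] by (rule norm_sum)
    then have "(cmod ((A * B) $$ (i, j)))\<^sup>2 \<le> (\<Sum>l<m. cmod (A $$ (i, l)) * cmod (B $$ (l, j)))\<^sup>2"
      by (intro power_mono) simp_all
    also have "\<dots> \<le> (\<Sum>l<m. (cmod (A $$ (i, l)))\<^sup>2) * (\<Sum>l<m. (cmod (B $$ (l, j)))\<^sup>2)"
      by (rule Cauchy_Schwarz_ineq_sum)
    finally show ?thesis .
  qed
  then have "(frob_norm (A * B))\<^sup>2 \<le> (\<Sum>i<n. \<Sum>j<k. (\<Sum>l<m. (cmod (A $$ (i, l)))\<^sup>2) * (\<Sum>l<m. (cmod (B $$ (l, j)))\<^sup>2))"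
    unfolding frob_norm_square [OF mult_carrier_mat [OF A B]] by (intro sum_mono) simp_all
  also have "\<dots> = (\<Sum>i<n. \<Sum>l<m. (cmod (A $$ (i, l)))\<^sup>2) * (\<Sum>j<k. \<Sum>l<m. (cmod (B $$ (l, j)))\<^sup>2)"
    by (rule sum_product [symmetric])
  also have "\<dots> = (frob_norm A * frob_norm B)\<^sup>2"
    unfolding power_mult_distrib frob_norm_square [OF A] frob_norm_square [OF B] by (subst (2) sum.swap) (rule refl)
  finally show "(frob_norm (A * B))\<^sup>2 \<le> (frob_norm A * frob_norm B)\<^sup>2" .
qed simp

lemma fcalc_mult_support:
  assumes U: "is_unitary n U" and Z: "Z \<in> carrier_mat n n"
    and f: "\<And>i k. i < n \<Longrightarrow> k < n \<Longrightarrow> f i \<noteq> 1 \<Longrightarrow> (mat_adjoint U * Z) $$ (i, k) = 0"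
  shows "fcalc n U f * Z = Z"
proof -
  note [simp] = is_unitary_carrier [OF U] Z
  have UZ: "mat_adjoint U * Z \<in> carrier_mat n n" by simp
  have "diag_real n f * (mat_adjoint U * Z) = mat_adjoint U * Z"
  proof (rule eq_matI)
    fix i k assume "i < dim_row (mat_adjoint U * Z)" "k < dim_col (mat_adjoint U * Z)"
    then have ik: "i < n" "k < n" using carrier_matD [OF UZ] by auto
    show "(diag_real n f * (mat_adjoint U * Z)) $$ (i, k) = (mat_adjoint U * Z) $$ (i, k)"
      unfolding index_diag_real_mult [OF UZ ik] using f [OF ik] by (cases "f i = 1") simp_all
  qed (use carrier_matD [OF UZ] carrier_matD [OF Z] in simp_all)
  then have "U * (diag_real n f * (mat_adjoint U * Z)) = Z"
    by (simp only: unitary_cancel [OF U Z])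
  then show ?thesis by (simp add: fcalc_def assoc_mult_mat [of _ n n _ n _ n])
qed

text \<open>By a dimension count: there are \<open>j + 1\<close> free coefficients and \<open>j\<close> equations.\<close>

lemma test_vector:
  assumes U: "is_unitary n U" and M: "M \<in> carrier_mat n n" and j: "j < n"
  obtains Z where "Z \<in> carrier_mat n n" "frob_norm Z > 0"
    "\<And>i k. j < i \<Longrightarrow> i < n \<Longrightarrow> k < n \<Longrightarrow> (mat_adjoint U * Z) $$ (i, k) = 0"
    "\<And>i k. i < j \<Longrightarrow> k < n \<Longrightarrow> (M * Z) $$ (i, k) = 0"
proof -
  note [simp] = is_unitary_carrier [OF U] M
  define A where "A = M * U"
  have A: "A \<in> carrier_mat n n" by (simp add: A_def)
  define B where "B = mat (Suc j) (Suc j) (\<lambda>(a, b). if a < j then A $$ (a, b) else 0)"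
  have B: "B \<in> carrier_mat (Suc j) (Suc j)" by (simp add: B_def)
  have "multrow j 0 B = B" by (intro eq_matI) (auto simp: B_def)
  then have "det B = 0" using det_multrow [OF _ B, of j 0] by simp
  then obtain v where v: "v \<in> carrier_vec (Suc j)" "v \<noteq> 0\<^sub>v (Suc j)" "B *\<^sub>v v = 0\<^sub>v (Suc j)"
    using det_0_iff_vec_prod_zero_field [OF B] by blast
  define C where "C = mat n n (\<lambda>(i, k). if k = 0 \<and> i \<le> j then v $ i else 0)"
  have C: "C \<in> carrier_mat n n" by (simp add: C_def)
  define Z where "Z = U * C"
  have Z: "Z \<in> carrier_mat n n" using C by (simp add: Z_def)
  have UZ: "mat_adjoint U * Z = C" unfolding Z_def by (rule unitary_cancel [OF U C])
  have MZ: "(M * Z) $$ (i, k) = 0" if i: "i < j" and k: "k < n" for i k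
  proof -
    have "M * Z = A * C" using C by (simp add: Z_def A_def assoc_mult_mat [of _ n n _ n _ n])
    then have "(M * Z) $$ (i, k) = (\<Sum>l<n. A $$ (i, l) * C $$ (l, k))"
      using index_mult_mat_sum [OF A C, of i k] i j k by simp
    also have "\<dots> = (\<Sum>l<Suc j. A $$ (i, l) * (if k = 0 then v $ l else 0))"
      by (rule sum.mono_neutral_cong_right) (use j k in \<open>auto simp: C_def\<close>)
    also have "\<dots> = (if k = 0 then (B *\<^sub>v v) $ i else 0)"
      using i carrier_vecD [OF v(1)] by (simp add: B_def scalar_prod_def lessThan_atLeast0)
    also have "\<dots> = 0" using v(3) i by simp
    finally show ?thesis .
  qed
  have "frob_norm Z \<noteq> 0"
  proof
    assume "frob_norm Z = 0"
    then have "(\<Sum>i<n. \<Sum>k<n. (cmod (C $$ (i, k)))\<^sup>2) = 0"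
      using frob_norm_unitary [OF U Z] unfolding UZ by simp
    then have z: "C $$ (i, k) = 0" if "i < n" "k < n" for i k
      using that by (subst (asm) sum_nonneg_eq_0_iff; simp add: sum_nonneg sum_nonneg_eq_0_iff)
    have "v = 0\<^sub>v (Suc j)"
    proof (rule eq_vecI)
      fix i assume i: "i < dim_vec (0\<^sub>v (Suc j) :: complex Matrix.vec)"
      have "C $$ (i, 0) = v $ i" using i j by (simp add: C_def)
      then show "v $ i = 0\<^sub>v (Suc j) $ i" using z [of i 0] i j by simp
    qed (use v(1) in simp)
    with v(2) show False by blast
  qed
  then have "frob_norm Z > 0" using frob_norm_nonneg [of Z] by linarith
  moreover have "(mat_adjoint U * Z) $$ (i, k) = 0" if "j < i" "i < n" "k < n" for i k
    unfolding UZ using that by (simp add: C_def)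
  ultimately show ?thesis using that Z MZ by blast
qed

lemma fcalc_form_le:
  assumes U: "is_unitary n U" and Z: "Z \<in> carrier_mat n n"
    and f: "\<And>i k. i < n \<Longrightarrow> k < n \<Longrightarrow> (mat_adjoint U * Z) $$ (i, k) \<noteq> 0 \<Longrightarrow> f i \<le> c"
  shows "Re (mtrace (mat_adjoint Z * (fcalc n U f * Z))) \<le> c * (frob_norm Z)\<^sup>2"
  unfolding mtrace_fcalc_form [OF U Z] frob_norm_unitary [OF U Z] Re_complex_of_real sum_distrib_left
proof (intro sum_mono)
  fix i k assume ik: "i \<in> {..<n}" "k \<in> {..<n}"
  show "f i * (cmod ((mat_adjoint U * Z) $$ (i, k)))\<^sup>2 \<le> c * (cmod ((mat_adjoint U * Z) $$ (i, k)))\<^sup>2"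
    using f [of i k] ik by (cases "(mat_adjoint U * Z) $$ (i, k) = 0") (simp_all add: mult_right_mono)
qed

lemma fcalc_form_ge:
  assumes U: "is_unitary n U" and Z: "Z \<in> carrier_mat n n"
    and f: "\<And>i k. i < n \<Longrightarrow> k < n \<Longrightarrow> (mat_adjoint U * Z) $$ (i, k) \<noteq> 0 \<Longrightarrow> c \<le> f i"
  shows "c * (frob_norm Z)\<^sup>2 \<le> Re (mtrace (mat_adjoint Z * (fcalc n U f * Z)))"
  unfolding mtrace_fcalc_form [OF U Z] frob_norm_unitary [OF U Z] Re_complex_of_real sum_distrib_left
proof (intro sum_mono)
  fix i k assume ik: "i \<in> {..<n}" "k \<in> {..<n}"
  show "c * (cmod ((mat_adjoint U * Z) $$ (i, k)))\<^sup>2 \<le> f i * (cmod ((mat_adjoint U * Z) $$ (i, k)))\<^sup>2"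
    using f [of i k] ik by (cases "(mat_adjoint U * Z) $$ (i, k) = 0") (simp_all add: mult_right_mono)
qed

section \<open>The function \<open>ln (1 + x) - x / (1 + x)\<close>\<close>

text \<open>What an eigenvalue \<open>x\<close> of \<open>G\<close> adds to the divergence if an approximation drops it. The derivative is \<open>x / (1 + x)\<^sup>2\<close>,
  which is at most 1/4 and, from \<open>c\<close> onwards, at most \<open>1 / (1 + c)\<close>.\<close>

definition ldgap :: "real \<Rightarrow> real" where
  "ldgap x = ln (1 + x) - x / (1 + x)"

lemma ldgap_diff:
  assumes "0 \<le> y" "y \<le> x"
  obtains z where "y \<le> z" "z \<le> x" "ldgap x - ldgap y = (x - y) * (z / (1 + z)\<^sup>2)"
proof (cases "y = x")
  case True
  then show ?thesis using that [of x] by simp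
next
  case False
  have "(ldgap has_real_derivative z / (1 + z)\<^sup>2) (at z)" if "y \<le> z" for z
  proof -
    define u where "u = 1 + z"
    have z: "z = u - 1" and u: "0 < u" using that assms(1) by (simp_all add: u_def)
    show ?thesis unfolding ldgap_def [abs_def] z using u
      by (auto intro!: derivative_eq_intros simp: field_simps power2_eq_square)
  qed
  then obtain z where "y < z" "z < x" "ldgap x - ldgap y = (x - y) * (z / (1 + z)\<^sup>2)"
    using MVT2 [of y x ldgap "\<lambda>z. z / (1 + z)\<^sup>2"] False assms by auto
  then show ?thesis using that [of z] by simp
qed

lemma ldgap_mono: "0 \<le> y \<Longrightarrow> y \<le> x \<Longrightarrow> ldgap y \<le> ldgap x"
proof -
  assume y: "0 \<le> y" "y \<le> x"
  then obtain z where z: "y \<le> z" "ldgap x - ldgap y = (x - y) * (z / (1 + z)\<^sup>2)" using ldgap_diff [of y x] by auto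
  have "0 \<le> (x - y) * (z / (1 + z)\<^sup>2)" using y z(1) by (intro mult_nonneg_nonneg divide_nonneg_nonneg) auto
  then show ?thesis using z(2) by linarith
qed

lemma ldgap_nonneg: "0 \<le> x \<Longrightarrow> 0 \<le> ldgap x"
  using ldgap_mono [of 0 x] by (simp add: ldgap_def)

lemma ldgap_pos: "0 < x \<Longrightarrow> 0 < ldgap x"
proof -
  assume x: "0 < x"
  obtain z where z: "x / 2 \<le> z" "ldgap x - ldgap (x / 2) = (x - x / 2) * (z / (1 + z)\<^sup>2)"
    using ldgap_diff [of "x / 2" x] x by auto
  have "0 < (x - x / 2) * (z / (1 + z)\<^sup>2)" using x z(1) by (intro mult_pos_pos divide_pos_pos) auto
  then show ?thesis using z(2) ldgap_nonneg [of "x / 2"] x by linarith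
qed

lemma ldgap_diff_le:
  assumes "0 \<le> c" "c \<le> y" "y \<le> x"
  shows "ldgap x - ldgap y \<le> (x - y) / (1 + c)" "ldgap x - ldgap y \<le> (x - y) / 4"
proof -
  obtain z where z: "y \<le> z" "z \<le> x" "ldgap x - ldgap y = (x - y) * (z / (1 + z)\<^sup>2)"
    using ldgap_diff [of y x] assms by auto
  have z0: "0 \<le> z" using z assms by linarith
  have "z * (1 + c) \<le> (1 + z) * (1 + z)" using z assms by (intro mult_mono) auto
  then have "z / (1 + z)\<^sup>2 \<le> 1 / (1 + c)" using z0 assms
    by (intro mult_imp_div_pos_le) (auto simp: power2_eq_square intro!: mult_imp_le_div_pos)
  then show "ldgap x - ldgap y \<le> (x - y) / (1 + c)"
    using mult_left_mono [of "z / (1 + z)\<^sup>2" "1 / (1 + c)" "x - y"] assms z(3) by simp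
  have "0 \<le> (1 - z)\<^sup>2" by simp
  then have "z / (1 + z)\<^sup>2 \<le> 1 / 4" using z0
    by (intro mult_imp_div_pos_le zero_less_power) (simp_all add: power2_eq_square algebra_simps)
  then show "ldgap x - ldgap y \<le> (x - y) / 4"
    using mult_left_mono [of "z / (1 + z)\<^sup>2" "1 / 4" "x - y"] assms z(3) by simp
qed

section \<open>Compression of a positive semidefinite matrix to a subspace of its range\<close>

text \<open>Here \<open>G\<close> has the eigenvalues \<open>l\<close> and rank \<open>\<rho>\<close>, \<open>Q\<close> projects onto a subspace of its range, and the compression
  \<open>Q G Q\<close> has the eigenvalues \<open>\<mu>\<close>, of which at least \<open>m\<close> are positive.\<close>

locale compression =
  fixes n \<rho> m :: nat and U V Q :: "complex mat" and l \<mu> :: "nat \<Rightarrow> real"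
  assumes U: "is_unitary n U" and V: "is_unitary n V" and Q: "is_proj n Q"
    and l_anti: "\<And>i j. i \<le> j \<Longrightarrow> j < n \<Longrightarrow> l j \<le> l i"
    and l_pos: "\<And>i. i < \<rho> \<Longrightarrow> 0 < l i" and l_zero: "\<And>i. \<rho> \<le> i \<Longrightarrow> i < n \<Longrightarrow> l i = 0"
    and \<rho>: "0 < \<rho>" "\<rho> \<le> n"
    and QX: "Q * fcalc n U l * Q = fcalc n V \<mu>"
    and Qrange: "fcalc n U (\<lambda>i. if i < \<rho> then 1 else 0) * Q = Q"
    and \<mu>_anti: "\<And>i j. i \<le> j \<Longrightarrow> j < n \<Longrightarrow> \<mu> j \<le> \<mu> i"
    and \<mu>_pos: "\<And>i. i < m \<Longrightarrow> 0 < \<mu> i" and m: "m \<le> n"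
begin

abbreviation "G \<equiv> fcalc n U l"
abbreviation "X \<equiv> fcalc n V \<mu>"
abbreviation "PG \<equiv> fcalc n U (\<lambda>i. if i < \<rho> then 1 else 0)"
abbreviation "Gh \<equiv> fcalc n U (\<lambda>i. sqrt (l i))"
abbreviation "Q' \<equiv> 1\<^sub>m n - Q"

lemma carriers [simp]:
  "U \<in> carrier_mat n n" "V \<in> carrier_mat n n" "Q \<in> carrier_mat n n"
  using is_unitary_carrier [OF U] is_unitary_carrier [OF V] is_proj_carrier [OF Q] by auto

lemma dims [simp]: "dim_row U = n" "dim_col U = n" "dim_row V = n" "dim_col V = n" "dim_row Q = n" "dim_col Q = n"
  "dim_row (fcalc n U f) = n" "dim_col (fcalc n U f) = n" "dim_row (fcalc n V f) = n" "dim_col (fcalc n V f) = n"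
  using carrier_matD [OF carriers(1)] carrier_matD [OF carriers(2)] carrier_matD [OF carriers(3)] by (simp_all add: fcalc_def)

lemmas assoc = assoc_mult_mat [of _ n n _ n _ n]
lemmas one_mult = left_mult_one_mat [of _ n n] right_mult_one_mat [of _ n n]

lemma Q_adj: "mat_adjoint Q = Q" and QQ: "Q * Q = Q"
  using Q by (auto simp: is_proj_def)

lemma Q': "is_proj n Q'" by (rule is_proj_compl [OF Q])

lemma Q'_adj: "mat_adjoint Q' = Q'" and Q'Q': "Q' * Q' = Q'"
  using Q' by (auto simp: is_proj_def)

lemma l_nonneg: "i < n \<Longrightarrow> 0 \<le> l i"
  using l_pos [of i] l_zero [of i] by (cases "i < \<rho>") auto

lemma GhGh: "Gh * Gh = G"
  unfolding fcalc_mult [OF U] by (rule fcalc_cong) (simp add: l_nonneg)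

lemma Gh_adj: "mat_adjoint Gh = Gh" by (simp add: fcalc_adjoint)

lemma Q_X: "Q * X = X" and X_Q: "X * Q = X"
proof -
  show "Q * X = X" unfolding QX [symmetric] using is_proj_cancel [OF Q, of "G * Q" n] by (simp add: assoc)
  show "X * Q = X" unfolding QX [symmetric] by (simp add: assoc QQ)
qed

lemma Q_PG: "Q * PG = Q"
proof -
  have "mat_adjoint (PG * Q) = mat_adjoint Q" by (simp only: Qrange)
  then show ?thesis by (simp add: mat_adjoint_mult [of _ n n _ n] fcalc_adjoint Q_adj)
qed

lemma form_G:
  assumes [simp]: "Z \<in> carrier_mat n n"
  shows "mtrace (mat_adjoint Z * (G * Z)) = of_real ((frob_norm (Gh * Z))\<^sup>2)"
proof -
  have "mat_adjoint (Gh * Z) * (Gh * Z) = mat_adjoint Z * (Gh * Gh * Z)"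
    by (simp add: mat_adjoint_mult [of _ n n _ n] Gh_adj assoc)
  then show ?thesis using mtrace_adjoint_mult [of "Gh * Z" n n] by (simp add: GhGh)
qed

lemma form_X:
  assumes Z [simp]: "Z \<in> carrier_mat n n" and QZ: "Q * Z = Z"
  shows "mtrace (mat_adjoint Z * (X * Z)) = mtrace (mat_adjoint Z * (G * Z))"
proof -
  have ZQ: "mat_adjoint Z * Q = mat_adjoint Z"
  proof -
    have "mat_adjoint (Q * Z) = mat_adjoint Z" by (simp only: QZ)
    then show ?thesis by (simp add: mat_adjoint_mult [of _ n n _ n] Q_adj)
  qed
  have "mat_adjoint Z * (X * Z) = (mat_adjoint Z * Q) * (G * (Q * Z))"
    unfolding QX [symmetric] by (simp add: assoc)
  then show ?thesis by (simp only: ZQ QZ)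
qed

text \<open>A vector supported on the eigenvectors of \<open>X\<close> with positive eigenvalues lies in the range of \<open>X\<close>, hence of \<open>Q\<close>.\<close>

lemma Q_fix:
  assumes [simp]: "Z \<in> carrier_mat n n"
    and s: "\<And>i k. i < n \<Longrightarrow> k < n \<Longrightarrow> (mat_adjoint V * Z) $$ (i, k) \<noteq> 0 \<Longrightarrow> \<mu> i > 0"
  shows "Q * Z = Z"
proof -
  have "fcalc n V (\<lambda>i. if \<mu> i > 0 then 1 else 0) * Z = Z"
    by (rule fcalc_mult_support [OF V]) (use s in \<open>auto split: if_splits\<close>)
  moreover have "fcalc n V (\<lambda>i. if \<mu> i > 0 then 1 else 0) = X * fcalc n V (\<lambda>i. if \<mu> i > 0 then 1 / \<mu> i else 0)"
    unfolding fcalc_mult [OF V] by (rule fcalc_cong) simp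
  ultimately have Z: "Z = X * (fcalc n V (\<lambda>i. if \<mu> i > 0 then 1 / \<mu> i else 0) * Z)" by (simp add: assoc)
  have "Q * (X * (fcalc n V (\<lambda>i. if \<mu> i > 0 then 1 / \<mu> i else 0) * Z)) = (Q * X) * (fcalc n V (\<lambda>i. if \<mu> i > 0 then 1 / \<mu> i else 0) * Z)"
    by (simp add: assoc)
  then show ?thesis unfolding Q_X using Z by (simp only: Z [symmetric])
qed

lemma column_vector:
  assumes j: "j < n"
  obtains Z where "Z \<in> carrier_mat n n" "frob_norm Z > 0"
    "\<And>i k. i < n \<Longrightarrow> k < n \<Longrightarrow> (mat_adjoint V * Z) $$ (i, k) \<noteq> 0 \<Longrightarrow> i = j"
proof -
  define C where "C = diag_real n (\<lambda>i. if i = j then 1 else 0)"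
  have C: "C \<in> carrier_mat n n" by (simp add: C_def)
  have VC: "mat_adjoint V * (V * C) = C" by (rule unitary_cancel [OF V C])
  have "(frob_norm (V * C))\<^sup>2 = (\<Sum>i<n. \<Sum>k<n. (cmod (C $$ (i, k)))\<^sup>2)"
    using frob_norm_unitary [OF V, of "V * C"] C unfolding VC by simp
  also have "\<dots> \<ge> (cmod (C $$ (j, j)))\<^sup>2"
    using j by (intro order_trans [OF _ member_le_sum [of j]] member_le_sum) (auto intro!: sum_nonneg)
  finally have "frob_norm (V * C) \<noteq> 0" using j by (auto simp: C_def diag_real_def)
  then have "frob_norm (V * C) > 0" using frob_norm_nonneg [of "V * C"] by linarith
  moreover have "i = j" if "i < n" "k < n" "(mat_adjoint V * (V * C)) $$ (i, k) \<noteq> 0" for i k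
    using that unfolding VC by (auto simp: C_def diag_real_def split: if_splits)
  ultimately show ?thesis using that [of "V * C"] C by simp
qed

lemma \<mu>_nonneg: assumes j: "j < n" shows "0 \<le> \<mu> j"
proof -
  obtain Z where Z: "Z \<in> carrier_mat n n" "frob_norm Z > 0"
    "\<And>i k. i < n \<Longrightarrow> k < n \<Longrightarrow> (mat_adjoint V * Z) $$ (i, k) \<noteq> 0 \<Longrightarrow> i = j"
    using column_vector [OF j] by blast
  note [simp] = Z(1)
  have "mtrace (mat_adjoint Z * (X * Z)) = mtrace (mat_adjoint (Q * Z) * (G * (Q * Z)))"
    unfolding QX [symmetric] by (simp add: mat_adjoint_mult [of _ n n _ n] Q_adj assoc)
  also have "\<dots> = of_real ((frob_norm (Gh * (Q * Z)))\<^sup>2)" by (rule form_G) simp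
  finally have "0 \<le> Re (mtrace (mat_adjoint Z * (X * Z)))" by simp
  also have "\<dots> \<le> \<mu> j * (frob_norm Z)\<^sup>2" by (rule fcalc_form_le [OF V Z(1)]) (use Z(3) in auto)
  finally show ?thesis using Z(2) by (simp add: zero_le_mult_iff)
qed

text \<open>On the range of \<open>Q\<close> the forms of \<open>X\<close> and \<open>G\<close> agree, and on the range of \<open>G\<close> the form of \<open>G\<close> is bounded
  below by the least positive eigenvalue.\<close>

lemma \<mu>_ge_min: assumes j: "j < m" shows "l (\<rho> - 1) \<le> \<mu> j"
proof -
  have jn: "j < n" using j m by simp
  obtain Z where Z: "Z \<in> carrier_mat n n" "frob_norm Z > 0"
    "\<And>i k. i < n \<Longrightarrow> k < n \<Longrightarrow> (mat_adjoint V * Z) $$ (i, k) \<noteq> 0 \<Longrightarrow> i = j"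
    using column_vector [OF jn] by blast
  note [simp] = Z(1)
  have QZ: "Q * Z = Z" by (rule Q_fix [OF Z(1)]) (use Z(3) \<mu>_pos [OF j] in metis)
  have PZ: "PG * Z = Z"
  proof -
    have "PG * (Q * Z) = (PG * Q) * Z" by (simp add: assoc)
    then show ?thesis by (simp only: QZ Qrange)
  qed
  have UZ: "mat_adjoint U * Z \<in> carrier_mat n n" by simp
  have supp: "(mat_adjoint U * Z) $$ (i, k) = 0" if ik: "i < n" "k < n" and "\<rho> \<le> i" for i k
  proof -
    have "mat_adjoint U * (PG * Z) = diag_real n (\<lambda>i. if i < \<rho> then 1 else 0) * (mat_adjoint U * Z)"
      by (simp add: fcalc_def assoc unitary_cancel [OF U])
    then have "(mat_adjoint U * Z) $$ (i, k) = (diag_real n (\<lambda>i. if i < \<rho> then 1 else 0) * (mat_adjoint U * Z)) $$ (i, k)"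
      by (simp only: PZ)
    then show ?thesis unfolding index_diag_real_mult [OF UZ ik] using \<open>\<rho> \<le> i\<close> by simp
  qed
  have "l (\<rho> - 1) * (frob_norm Z)\<^sup>2 \<le> Re (mtrace (mat_adjoint Z * (G * Z)))"
  proof (rule fcalc_form_ge [OF U Z(1)])
    fix i k assume "i < n" "k < n" "(mat_adjoint U * Z) $$ (i, k) \<noteq> 0"
    then have "i < \<rho>" using supp [of i k] by force
    then show "l (\<rho> - 1) \<le> l i" using \<rho> by (intro l_anti) auto
  qed
  also have "\<dots> = Re (mtrace (mat_adjoint Z * (X * Z)))" by (simp add: form_X [OF Z(1) QZ])
  also have "\<dots> \<le> \<mu> j * (frob_norm Z)\<^sup>2" by (rule fcalc_form_le [OF V Z(1)]) (use Z(3) in auto)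
  finally show ?thesis using Z(2) by simp
qed

text \<open>Cauchy interlacing, with a vector in the span of the first \<open>j + 1\<close> eigenvectors of \<open>X\<close> that is orthogonal to the
  first \<open>j\<close> eigenvectors of \<open>G\<close>.\<close>

lemma \<mu>_le: assumes j: "j < n" shows "\<mu> j \<le> l j"
proof (cases "\<mu> j > 0")
  case True
  obtain Z where Z: "Z \<in> carrier_mat n n" "frob_norm Z > 0"
    "\<And>i k. j < i \<Longrightarrow> i < n \<Longrightarrow> k < n \<Longrightarrow> (mat_adjoint V * Z) $$ (i, k) = 0"
    "\<And>i k. i < j \<Longrightarrow> k < n \<Longrightarrow> (mat_adjoint U * Z) $$ (i, k) = 0"
    using test_vector [OF V _ j, of "mat_adjoint U"] by auto
  have \<mu>j: "\<mu> j \<le> \<mu> i" if "i < n" "k < n" "(mat_adjoint V * Z) $$ (i, k) \<noteq> 0" for i k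
    using that Z(3) [of i k] j by (intro \<mu>_anti) (auto simp: not_less [symmetric])
  have QZ: "Q * Z = Z" by (rule Q_fix [OF Z(1)]) (use \<mu>j True in fastforce)
  have "\<mu> j * (frob_norm Z)\<^sup>2 \<le> Re (mtrace (mat_adjoint Z * (X * Z)))"
    by (rule fcalc_form_ge [OF V Z(1)]) (rule \<mu>j)
  also have "\<dots> = Re (mtrace (mat_adjoint Z * (G * Z)))" by (simp add: form_X [OF Z(1) QZ])
  also have "\<dots> \<le> l j * (frob_norm Z)\<^sup>2"
  proof (rule fcalc_form_le [OF U Z(1)])
    fix i k assume "i < n" "k < n" "(mat_adjoint U * Z) $$ (i, k) \<noteq> 0"
    then show "l i \<le> l j" using Z(4) [of i k] by (intro l_anti) (auto simp: not_less [symmetric])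
  qed
  finally show ?thesis using Z(2) by simp
qed (use l_nonneg [OF j] in linarith)

text \<open>The test vector is \<open>Q G\<^sup>1\<^sup>/\<^sup>2 v\<close> with \<open>v\<close> in the span of the leading eigenvectors of \<open>G\<close>: what
  the projection loses of \<open>G\<^sup>1\<^sup>/\<^sup>2 v\<close> is controlled by \<open>Q' G Q'\<close> alone.\<close>

lemma \<mu>_ge: assumes j: "j < n" shows "l j - frob_norm (Q' * G * Q') \<le> \<mu> j"
proof -
  define t where "t = frob_norm (Q' * G * Q')"
  have M: "mat_adjoint V * (Q * Gh) \<in> carrier_mat n n" by simp
  obtain Z where Z: "Z \<in> carrier_mat n n" "frob_norm Z > 0"
    "\<And>i k. j < i \<Longrightarrow> i < n \<Longrightarrow> k < n \<Longrightarrow> (mat_adjoint U * Z) $$ (i, k) = 0"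
    "\<And>i k. i < j \<Longrightarrow> k < n \<Longrightarrow> (mat_adjoint V * (Q * Gh) * Z) $$ (i, k) = 0"
    using test_vector [OF U M j] by blast
  note [simp] = Z(1)
  define w where "w = Gh * Z"
  define y where "y = Q * w"
  define z where "z = Q' * w"
  have [simp]: "w \<in> carrier_mat n n" "y \<in> carrier_mat n n" "z \<in> carrier_mat n n"
    by (simp_all add: w_def y_def z_def)
  have "mat_adjoint V * (Q * Gh) * Z = mat_adjoint V * y" by (simp add: y_def w_def assoc)
  then have Vy: "(mat_adjoint V * y) $$ (i, k) = 0" if "i < j" "k < n" for i k
    using Z(4) that by simp
  have Qy: "Q * y = y" unfolding y_def by (rule is_proj_cancel [OF Q, of _ n]) simp
  have Q'z: "Q' * z = z" unfolding z_def by (rule is_proj_cancel [OF Q', of _ n]) simp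
  have "Re (mtrace (mat_adjoint y * (X * y))) \<le> \<mu> j * (frob_norm y)\<^sup>2"
  proof (rule fcalc_form_le [OF V])
    fix i k assume "i < n" "k < n" "(mat_adjoint V * y) $$ (i, k) \<noteq> 0"
    then show "\<mu> i \<le> \<mu> j" using Vy [of i k] by (intro \<mu>_anti) (auto simp: not_less [symmetric])
  qed simp
  then have Ghy: "(frob_norm (Gh * y))\<^sup>2 \<le> \<mu> j * (frob_norm y)\<^sup>2"
    unfolding form_X [OF \<open>y \<in> carrier_mat n n\<close> Qy] form_G [OF \<open>y \<in> carrier_mat n n\<close>] by simp
  have y2: "(frob_norm y)\<^sup>2 \<le> frob_norm Z * frob_norm (Gh * y)"
  proof -
    have "mat_adjoint y * y = mat_adjoint w * (Q * y)"
      by (simp add: y_def mat_adjoint_mult [of _ n n _ n] Q_adj assoc is_proj_cancel [OF Q])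
    also have "\<dots> = mat_adjoint Z * (Gh * y)"
      unfolding Qy by (simp add: w_def mat_adjoint_mult [of _ n n _ n] Gh_adj assoc)
    finally have "of_real ((frob_norm y)\<^sup>2) = mtrace (mat_adjoint Z * (Gh * y))"
      by (simp only: mtrace_adjoint_mult [of y n n, symmetric] \<open>y \<in> carrier_mat n n\<close>)
    then have "(frob_norm y)\<^sup>2 = cmod (mtrace (mat_adjoint Z * (Gh * y)))"
      by (rule of_real_eq_cmod) simp
    also have "\<dots> \<le> frob_norm (mat_adjoint Z) * frob_norm (Gh * y)"
      by (rule cmod_mtrace_mult_le [of _ n n]) simp_all
    finally show ?thesis by (simp add: frob_norm_adjoint)
  qed
  have yZ: "(frob_norm y)\<^sup>2 \<le> \<mu> j * (frob_norm Z)\<^sup>2"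
  proof (cases "frob_norm y = 0")
    case False
    then have py: "0 < (frob_norm y)\<^sup>2" by simp
    have "(frob_norm y)\<^sup>2 * (frob_norm y)\<^sup>2 \<le> (frob_norm Z * frob_norm (Gh * y))\<^sup>2"
      using power_mono [OF y2, of 2] by (simp add: power2_eq_square)
    also have "\<dots> \<le> (frob_norm Z)\<^sup>2 * (\<mu> j * (frob_norm y)\<^sup>2)"
      unfolding power_mult_distrib by (intro mult_left_mono Ghy) simp
    also have "\<dots> = (\<mu> j * (frob_norm Z)\<^sup>2) * (frob_norm y)\<^sup>2" by (simp add: mult_ac)
    finally show ?thesis using py by (rule mult_right_le_imp_le)
  qed (simp add: \<mu>_nonneg [OF j])
  have zZ: "(frob_norm z)\<^sup>2 \<le> t * (frob_norm Z)\<^sup>2"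
  proof (cases "frob_norm z = 0")
    case True
    then show ?thesis by (simp add: t_def)
  next
    case False
    then have pz: "0 < (frob_norm z)\<^sup>2" by simp
    have "mat_adjoint z * z = mat_adjoint z * (Q' * w)" by (simp add: z_def)
    also have "\<dots> = mat_adjoint (Q' * z) * w" by (simp add: mat_adjoint_mult [of _ n n _ n] Q'_adj assoc)
    also have "\<dots> = mat_adjoint (Gh * z) * Z"
      unfolding Q'z by (simp add: w_def mat_adjoint_mult [of _ n n _ n] Gh_adj assoc)
    finally have "of_real ((frob_norm z)\<^sup>2) = mtrace (mat_adjoint (Gh * z) * Z)"
      by (simp only: mtrace_adjoint_mult [of z n n, symmetric] \<open>z \<in> carrier_mat n n\<close>)
    then have "(frob_norm z)\<^sup>2 = cmod (mtrace (mat_adjoint (Gh * z) * Z))"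
      by (rule of_real_eq_cmod) simp
    also have "\<dots> \<le> frob_norm (mat_adjoint (Gh * z)) * frob_norm Z"
      by (rule cmod_mtrace_mult_le [of _ n n]) simp_all
    finally have z2: "(frob_norm z)\<^sup>2 \<le> frob_norm (Gh * z) * frob_norm Z" by (simp add: frob_norm_adjoint)
    have "mat_adjoint z * (G * z) = mat_adjoint (Q' * z) * (G * (Q' * z))" by (simp only: Q'z)
    also have "\<dots> = mat_adjoint z * ((Q' * G * Q') * z)"
      by (simp add: mat_adjoint_mult [of _ n n _ n] Q'_adj assoc)
    finally have "of_real ((frob_norm (Gh * z))\<^sup>2) = mtrace (mat_adjoint z * ((Q' * G * Q') * z))"
      using form_G [of z, OF \<open>z \<in> carrier_mat n n\<close>] by (simp only:)
    then have "(frob_norm (Gh * z))\<^sup>2 = cmod (mtrace (mat_adjoint z * ((Q' * G * Q') * z)))"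
      by (rule of_real_eq_cmod) simp
    also have "\<dots> \<le> frob_norm (mat_adjoint z) * frob_norm ((Q' * G * Q') * z)"
      by (rule cmod_mtrace_mult_le [of _ n n]) simp_all
    also have "\<dots> \<le> frob_norm z * (t * frob_norm z)"
      unfolding frob_norm_adjoint t_def by (intro mult_left_mono frob_norm_mult_le [of _ n n _ n]) simp_all
    finally have Ghz: "(frob_norm (Gh * z))\<^sup>2 \<le> t * (frob_norm z)\<^sup>2" by (simp add: power2_eq_square mult_ac)
    have "(frob_norm z)\<^sup>2 * (frob_norm z)\<^sup>2 \<le> (frob_norm (Gh * z) * frob_norm Z)\<^sup>2"
      using power_mono [OF z2, of 2] by (simp add: power2_eq_square)
    also have "\<dots> \<le> (t * (frob_norm z)\<^sup>2) * (frob_norm Z)\<^sup>2"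
      unfolding power_mult_distrib by (intro mult_right_mono Ghz) simp
    also have "\<dots> = (t * (frob_norm Z)\<^sup>2) * (frob_norm z)\<^sup>2" by (simp add: mult_ac)
    finally show ?thesis using pz by (rule mult_right_le_imp_le)
  qed
  have "l j * (frob_norm Z)\<^sup>2 \<le> Re (mtrace (mat_adjoint Z * (G * Z)))"
  proof (rule fcalc_form_ge [OF U Z(1)])
    fix i k assume "i < n" "k < n" "(mat_adjoint U * Z) $$ (i, k) \<noteq> 0"
    then show "l j \<le> l i" using Z(3) [of i k] j by (intro l_anti) (auto simp: not_less [symmetric])
  qed
  also have "\<dots> = (frob_norm w)\<^sup>2" by (simp add: form_G w_def)
  also have "\<dots> = (frob_norm y)\<^sup>2 + (frob_norm z)\<^sup>2"
    unfolding y_def z_def by (rule frob_norm_proj_split [OF Q, of _ n]) simp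
  also have "\<dots> \<le> (\<mu> j + t) * (frob_norm Z)\<^sup>2" using yZ zZ by (simp add: distrib_right)
  finally have "l j \<le> \<mu> j + t" using Z(2) by simp
  then show ?thesis by (simp add: t_def)
qed

end

lemma mtrace_uminus: "A \<in> carrier_mat n n \<Longrightarrow> mtrace (- A) = - mtrace A"
  by (simp add: mtrace_def sum_negf)

context compression
begin

abbreviation "W \<equiv> fcalc n U (\<lambda>i. 1 / (1 + l i))"
abbreviation "R \<equiv> fcalc n V (\<lambda>i. 1 / (1 + \<mu> i))"
abbreviation "K \<equiv> Q' * G * Q"
abbreviation "L \<equiv> Q' * G * Q'"

lemma PG_proj: "is_proj n PG"
  unfolding is_proj_def by (simp add: fcalc_adjoint fcalc_mult [OF U]) (rule fcalc_cong, simp)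

lemma PG_G: "PG * G = G"
  unfolding fcalc_mult [OF U] by (rule fcalc_cong) (simp add: l_zero)

lemma trace_PG: "mtrace PG = of_nat \<rho>"
proof -
  have "(\<Sum>i<n. if i < \<rho> then 1 else 0 :: real) = (\<Sum>i<\<rho>. 1)"
    by (rule sum.mono_neutral_cong_right) (use \<rho> in auto)
  then show ?thesis unfolding mtrace_fcalc [OF U] by simp
qed

text \<open>\<open>W - R = W (X - G) R\<close> and \<open>X R = Q X R\<close>, so only the off-diagonal blocks of \<open>G\<close> and \<open>W\<close> contribute.\<close>

lemma trace_resolvent_diff:
  "\<bar>Re (mtrace (X * W)) - Re (mtrace (X * R))\<bar> \<le> frob_norm (Q * W * Q') * frob_norm K"
proof -
  define Z where "Z = fcalc n V (\<lambda>i. \<mu> i / (1 + \<mu> i))"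
  have [simp]: "Z \<in> carrier_mat n n" "dim_row Z = n" "dim_col Z = n" by (simp_all add: Z_def)
  have RX: "R * X = Z" and XR: "X * R = Z"
    unfolding Z_def fcalc_mult [OF V] by (rule fcalc_cong, simp)+
  have QZ: "Q * Z = Z" unfolding XR [symmetric] by (simp add: assoc [symmetric] Q_X)
  have ZQ: "Z * Q = Z" unfolding RX [symmetric] by (simp add: assoc X_Q)
  have W1: "W * (1\<^sub>m n + G) = 1\<^sub>m n"
  proof -
    have "1\<^sub>m n + G = fcalc n U (\<lambda>i. 1 + l i)"
      unfolding fcalc_one [OF U, symmetric] by (rule fcalc_add) simp
    then have "W * (1\<^sub>m n + G) = fcalc n U (\<lambda>i. 1 / (1 + l i) * (1 + l i))" by (simp only: fcalc_mult [OF U])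
    also have "\<dots> = fcalc n U (\<lambda>_. 1)"
    proof (rule fcalc_cong)
      fix i assume "i < n"
      then show "1 / (1 + l i) * (1 + l i) = 1" using l_nonneg [of i] by simp
    qed
    finally show ?thesis by (simp only: fcalc_one [OF U])
  qed
  have R1: "(1\<^sub>m n + X) * R = 1\<^sub>m n"
  proof -
    have "1\<^sub>m n + X = fcalc n V (\<lambda>i. 1 + \<mu> i)"
      unfolding fcalc_one [OF V, symmetric] by (rule fcalc_add) simp
    then have "(1\<^sub>m n + X) * R = fcalc n V (\<lambda>i. (1 + \<mu> i) * (1 / (1 + \<mu> i)))" by (simp only: fcalc_mult [OF V])
    also have "\<dots> = fcalc n V (\<lambda>_. 1)"
    proof (rule fcalc_cong)
      fix i assume "i < n"
      then show "(1 + \<mu> i) * (1 / (1 + \<mu> i)) = 1" using \<mu>_nonneg [of i] by simp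
    qed
    finally show ?thesis by (simp only: fcalc_one [OF V])
  qed
  have WR: "W - R = W * ((X - G) * R)"
  proof -
    have "X - G = (1\<^sub>m n + X) - (1\<^sub>m n + G)" by (intro eq_matI) (simp_all add: algebra_simps)
    then have "W * ((X - G) * R) = W * (((1\<^sub>m n + X) - (1\<^sub>m n + G)) * R)" by (simp only:)
    also have "\<dots> = W * ((1\<^sub>m n + X) * R) - W * (1\<^sub>m n + G) * R"
      by (simp add: minus_mult_distrib_mat [of _ n n _ _ n] mult_minus_distrib_mat [of _ n n _ n] assoc)
    finally show ?thesis by (simp add: W1 R1 one_mult)
  qed
  have "mtrace (X * W) - mtrace (X * R) = mtrace (X * (W - R))"
    by (simp add: mult_minus_distrib_mat [of _ n n _ n] mtrace_minus [of _ n])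
  also have "\<dots> = mtrace ((X * (W * (X - G))) * R)" unfolding WR by (simp add: assoc)
  also have "\<dots> = mtrace (R * (X * (W * (X - G))))" by (rule mtrace_commute [of _ n n]) simp_all
  also have "R * (X * (W * (X - G))) = Z * (W * (X - G))" by (simp add: RX [symmetric] assoc)
  also have "mtrace (Z * (W * (X - G))) = mtrace (Q * (Z * (W * (X - G))))"
    by (simp add: assoc [symmetric] QZ)
  also have "\<dots> = mtrace ((Z * (W * (X - G))) * Q)" by (rule mtrace_commute [of _ n n]) simp_all
  also have "(Z * (W * (X - G))) * Q = Z * (Q * (W * ((X - G) * Q)))"
  proof -
    have "(Z * (W * (X - G))) * Q = (Z * Q) * (W * ((X - G) * Q))" unfolding ZQ by (simp add: assoc)
    then show ?thesis by (simp add: assoc)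
  qed
  also have "(X - G) * Q = - (Q' * (Q' * (G * Q)))"
  proof -
    have "(X - G) * Q = X - G * Q" by (simp add: minus_mult_distrib_mat [of _ n n _ _ n] X_Q)
    also have "\<dots> = Q * (G * Q) - G * Q" unfolding QX [symmetric] by (simp add: assoc)
    also have "\<dots> = - (G * Q - Q * (G * Q))"
      by (intro eq_matI) (simp_all del: index_mult_mat(1))
    also have "G * Q - Q * (G * Q) = Q' * (G * Q)" by (simp add: minus_mult_distrib_mat [of _ n n _ _ n] one_mult)
    also have "\<dots> = Q' * (Q' * (G * Q))" by (rule is_proj_cancel [OF Q', of _ n, symmetric]) simp
    finally show ?thesis .
  qed
  also have "Z * (Q * (W * - (Q' * (Q' * (G * Q))))) = - (Z * ((Q * W * Q') * K))"
    by (simp add: assoc)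
  also have "mtrace (- (Z * ((Q * W * Q') * K))) = - mtrace ((Z * (Q * W * Q')) * K)"
    by (simp add: mtrace_uminus [of _ n] assoc)
  finally have "cmod (mtrace (X * W) - mtrace (X * R)) = cmod (mtrace ((Z * (Q * W * Q')) * K))" by (simp only: norm_minus_cancel)
  also have "\<dots> \<le> frob_norm (Z * (Q * W * Q')) * frob_norm K"
    by (rule cmod_mtrace_mult_le [of _ n n]) simp_all
  also have "frob_norm (Z * (Q * W * Q')) \<le> \<bar>1\<bar> * frob_norm (Q * W * Q')"
    unfolding Z_def
  proof (rule frob_norm_fcalc_mult_le [OF V])
    fix i assume "i < n"
    then show "\<bar>\<mu> i / (1 + \<mu> i)\<bar> \<le> 1" using \<mu>_nonneg [of i] by simp
  qed simp
  finally have "cmod (mtrace (X * W) - mtrace (X * R)) \<le> frob_norm (Q * W * Q') * frob_norm K"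
    by (simp add: mult_right_mono)
  then show ?thesis using abs_Re_le_cmod [of "mtrace (X * W) - mtrace (X * R)"] by simp
qed

lemma trace_Q: "mtrace Q = of_real ((frob_norm Q)\<^sup>2)" by (rule frob_norm_proj [OF Q, symmetric])

lemma m_le: "real m \<le> (frob_norm Q)\<^sup>2"
proof -
  define PX where "PX = fcalc n V (\<lambda>i. if i < m then 1 else 0)"
  have PX: "is_proj n PX"
    unfolding is_proj_def PX_def by (simp add: fcalc_adjoint fcalc_mult [OF V]) (rule fcalc_cong, simp)
  note [simp] = is_proj_carrier [OF PX]
  have PXe: "PX = X * fcalc n V (\<lambda>i. if i < m then 1 / \<mu> i else 0)"
    unfolding PX_def fcalc_mult [OF V]
  proof (rule fcalc_cong)
    fix i show "(if i < m then 1 else 0) = \<mu> i * (if i < m then 1 / \<mu> i else 0)"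
      using \<mu>_pos [of i] by (cases "i < m") auto
  qed
  have "Q * PX = Q * (X * fcalc n V (\<lambda>i. if i < m then 1 / \<mu> i else 0))" by (simp only: PXe)
  also have "\<dots> = (Q * X) * fcalc n V (\<lambda>i. if i < m then 1 / \<mu> i else 0)" by (simp add: assoc)
  also have "\<dots> = PX" unfolding Q_X PXe ..
  finally have "frob_norm PX \<le> frob_norm Q" using frob_norm_mult_proj_le [OF PX, of Q n] by simp
  then have "(frob_norm PX)\<^sup>2 \<le> (frob_norm Q)\<^sup>2" by (intro power_mono) simp_all
  moreover have "(frob_norm PX)\<^sup>2 = real m"
  proof -
    have "(\<Sum>i<n. (if i < m then 1 else 0 :: real)\<^sup>2) = (\<Sum>i<m. 1)"
      by (rule sum.mono_neutral_cong_right) (use m in auto)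
    then show ?thesis unfolding PX_def frob_norm_fcalc [OF V] by simp
  qed
  ultimately show ?thesis by simp
qed

lemma PG_Q': "PG * Q' = PG - Q"
  by (simp add: mult_minus_distrib_mat [of _ n n _ n] Qrange one_mult)

lemma PG_minus_Q_proj: "is_proj n (PG - Q)"
  using is_proj_def PG_proj Q
  by (simp add: is_proj_def mat_adjoint_minus [of _ n n] minus_mult_distrib_mat [of _ n n _ _ n]
      mult_minus_distrib_mat [of _ n n _ n] Q_PG Qrange)
     (intro eq_matI; simp)

lemma norm_PG_Q': "(frob_norm (PG * Q'))\<^sup>2 = real \<rho> - (frob_norm Q)\<^sup>2"
proof -
  have "of_real ((frob_norm (PG - Q))\<^sup>2) = mtrace PG - mtrace Q"
    unfolding frob_norm_proj [OF PG_minus_Q_proj] by (simp add: mtrace_minus [of _ n])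
  also have "\<dots> = of_real (real \<rho> - (frob_norm Q)\<^sup>2)" unfolding trace_PG trace_Q by simp
  finally show ?thesis unfolding PG_Q' of_real_eq_iff .
qed

lemma norm_PG_Q'_le: "r \<le> m \<Longrightarrow> frob_norm (PG * Q') \<le> sqrt (real \<rho> - real r)"
  by (rule real_le_rsqrt) (use norm_PG_Q' m_le in simp)

lemma m_le_\<rho>: "m \<le> \<rho>"
  using norm_PG_Q' m_le zero_le_power2 [of "frob_norm (PG * Q')"] by linarith

lemma norm_QWQ'_le: "frob_norm (Q * W * Q') \<le> frob_norm (fcalc n U (\<lambda>i. if i < \<rho> then 1 / (1 + l i) else 0))"
proof -
  have "Q * W * Q' = Q * ((PG * W) * Q')"
  proof -
    have "Q * W * Q' = (Q * PG) * W * Q'" by (simp only: Q_PG)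
    then show ?thesis by (simp add: assoc)
  qed
  moreover have "PG * W = fcalc n U (\<lambda>i. if i < \<rho> then 1 / (1 + l i) else 0)"
    unfolding fcalc_mult [OF U] by (rule fcalc_cong) simp
  moreover have "frob_norm (Q * ((PG * W) * Q')) \<le> frob_norm (PG * W)"
    by (rule order_trans [OF frob_norm_proj_mult_le [OF Q, of _ n] frob_norm_mult_proj_le [OF Q', of _ n]]) simp_all
  ultimately show ?thesis by simp
qed

text \<open>On the range of \<open>G\<close> the eigenvalues of \<open>W\<close> lie between 0 and 1. The off-diagonal block does not change when 1/2 is
  subtracted from \<open>W\<close>, and then they are at most 1/2 in modulus.\<close>

lemma norm_QWQ'_le_half: "frob_norm (Q * W * Q') \<le> 1 / 2 * frob_norm (PG * Q')"
proof -
  define C where "C = fcalc n U (\<lambda>i. 1 / (1 + l i) - 1 / 2)"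
  have [simp]: "C \<in> carrier_mat n n" by (simp add: C_def)
  have H: "W = C + (1 / 2) \<cdot>\<^sub>m 1\<^sub>m n"
  proof -
    have "fcalc n U (\<lambda>i. 1 / 2) = (1 / 2) \<cdot>\<^sub>m 1\<^sub>m n"
    proof -
      have "diag_real n (\<lambda>i. 1 / 2) = (1 / 2) \<cdot>\<^sub>m 1\<^sub>m n" by (intro eq_matI) (auto simp: diag_real_def)
      then show ?thesis using U by (simp add: fcalc_def is_unitary_def mult_smult_distrib [of _ n n _ n] mult_smult_assoc_mat [of _ n n _ n] one_mult)
    qed
    then show ?thesis by (simp add: C_def fcalc_add fcalc_minus flip: \<open>fcalc n U (\<lambda>i. 1 / 2) = (1 / 2) \<cdot>\<^sub>m 1\<^sub>m n\<close>)
  qed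
  have QQ': "Q * Q' = 0\<^sub>m n n"
    by (simp add: mult_minus_distrib_mat [of _ n n _ n] QQ one_mult)
  have "Q * W * Q' = Q * (C * Q') + (1 / 2) \<cdot>\<^sub>m (Q * Q')"
    unfolding H by (simp add: assoc add_mult_distrib_mat [of _ n n _ _ n] mult_add_distrib_mat [of _ n n _ n]
      mult_smult_distrib [of _ n n _ n] mult_smult_assoc_mat [of _ n n _ n] one_mult)
  also have "\<dots> = Q * (C * Q')" unfolding QQ' by (intro eq_matI) (simp_all del: index_mult_mat(1))
  also have "\<dots> = Q * (C * (PG * Q'))"
  proof -
    have c: "PG * C = C * PG" unfolding C_def fcalc_mult [OF U] by (rule fcalc_cong) simp
    have "Q * (C * Q') = (Q * PG) * (C * Q')" by (simp only: Q_PG)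
    also have "\<dots> = Q * ((PG * C) * Q')" by (simp add: assoc)
    finally show ?thesis unfolding c by (simp add: assoc)
  qed
  finally have "frob_norm (Q * W * Q') = frob_norm (Q * (C * (PG * Q')))" by (simp only:)
  also have "\<dots> \<le> frob_norm (C * (PG * Q'))" by (rule frob_norm_proj_mult_le [OF Q, of _ n]) simp
  also have "\<dots> \<le> \<bar>1 / 2\<bar> * frob_norm (PG * Q')"
    unfolding C_def
  proof (rule frob_norm_fcalc_mult_le [OF U])
    fix i assume "i < n"
    then have "0 \<le> l i" by (rule l_nonneg)
    then have "0 < 1 / (1 + l i)" "1 / (1 + l i) \<le> 1" by simp_all
    then show "\<bar>1 / (1 + l i) - 1 / 2\<bar> \<le> 1 / 2" by linarith
  qed simp
  finally show ?thesis by simp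
qed

text \<open>The left-hand side is the trace of the block \<open>L\<close>. This block lives on the part of the range of \<open>G\<close> that \<open>Q\<close> misses, and the
  Cauchy-Schwarz inequality costs only the root of its dimension.\<close>

lemma sum_diff_le: "(\<Sum>i<n. l i - \<mu> i) \<le> frob_norm (PG * Q') * frob_norm L"
proof -
  have "of_real (\<Sum>i<n. l i - \<mu> i) = mtrace G - mtrace X"
    unfolding mtrace_fcalc [OF U] mtrace_fcalc [OF V] by (simp add: sum_subtractf)
  also have "mtrace X = mtrace (Q * (G * Q))" unfolding QX [symmetric] by (simp add: assoc)
  also have "\<dots> = mtrace ((G * Q) * Q)" by (rule mtrace_commute [of _ n n]) simp_all
  also have "\<dots> = mtrace (G * Q)" by (simp add: assoc QQ)
  also have "\<dots> = mtrace (Q * G)" by (rule mtrace_commute [of _ n n]) simp_all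
  also have "mtrace G - mtrace (Q * G) = mtrace (PG * G - Q * G)" unfolding PG_G by (simp add: mtrace_minus [of _ n])
  also have "PG * G - Q * G = (PG - Q) * G" by (simp add: minus_mult_distrib_mat [of _ n n _ _ n])
  also have "(PG - Q) * G = (Q' * (PG * Q')) * G"
  proof -
    have "Q' * (PG - Q) = (PG - Q) - Q * (PG - Q)" by (simp add: minus_mult_distrib_mat [of _ n n _ _ n] one_mult)
    also have "Q * (PG - Q) = 0\<^sub>m n n" by (simp add: mult_minus_distrib_mat [of _ n n _ n] Q_PG QQ)
    also have "(PG - Q) - 0\<^sub>m n n = PG - Q" by (intro eq_matI) simp_all
    finally show ?thesis unfolding PG_Q' by (simp only:)
  qed
  also have "\<dots> = Q' * ((PG * Q') * G)" by (simp add: assoc)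
  also have "mtrace (Q' * ((PG * Q') * G)) = mtrace (((PG * Q') * G) * Q')"
    by (rule mtrace_commute [of _ n n]) simp_all
  also have "((PG * Q') * G) * Q' = (PG * (Q' * Q')) * G * Q'" by (simp only: Q'Q')
  also have "\<dots> = (PG * Q') * L" by (simp add: assoc)
  finally have e: "of_real (\<Sum>i<n. l i - \<mu> i) = mtrace ((PG * Q') * L)" .
  have "0 \<le> (\<Sum>i<n. l i - \<mu> i)" by (intro sum_nonneg) (simp add: \<mu>_le)
  then have "(\<Sum>i<n. l i - \<mu> i) = cmod (mtrace ((PG * Q') * L))" by (rule of_real_eq_cmod [OF e])
  also have "\<dots> \<le> frob_norm (PG * Q') * frob_norm L" by (rule cmod_mtrace_mult_le [of _ n n]) simp_all
  finally show ?thesis .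
qed

lemma norm_blocks: "frob_norm K \<le> frob_norm (Q' * G)" "frob_norm L \<le> frob_norm (Q' * G)"
  by (rule frob_norm_mult_proj_le [OF Q, of _ n] frob_norm_mult_proj_le [OF Q', of _ n], simp)+

text \<open>The divergence of \<open>I + X\<close> from \<open>I + G\<close>; the factor \<open>W\<close> is the inverse of \<open>I + G\<close>.\<close>

definition divergence :: real where
  "divergence = Re (mtrace ((1\<^sub>m n + X) * W)) - ln (Re (det ((1\<^sub>m n + X) * W))) - real n"

lemma divergence_eq: "divergence = Re (mtrace (X * W)) - (\<Sum>i<n. l i / (1 + l i)) + (\<Sum>i<n. ln (1 + l i)) - (\<Sum>i<n. ln (1 + \<mu> i))"
proof -
  have pl: "0 < 1 + l i" if "i < n" for i using l_nonneg [OF that] by simp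
  have pm: "0 < 1 + \<mu> i" if "i < n" for i using \<mu>_nonneg [OF that] by simp
  have X1: "1\<^sub>m n + X = fcalc n V (\<lambda>i. 1 + \<mu> i)"
    unfolding fcalc_one [OF V, symmetric] by (rule fcalc_add) simp
  have "det ((1\<^sub>m n + X) * W) = det (1\<^sub>m n + X) * det W" by (rule det_mult [of _ n]) simp_all
  also have "\<dots> = of_real ((\<Prod>i<n. 1 + \<mu> i) * (\<Prod>i<n. 1 / (1 + l i)))"
    unfolding X1 det_fcalc [OF U] det_fcalc [OF V] by simp
  finally have "ln (Re (det ((1\<^sub>m n + X) * W))) = ln ((\<Prod>i<n. 1 + \<mu> i) * (\<Prod>i<n. 1 / (1 + l i)))"
    by (simp only: Re_complex_of_real)
  also have "\<dots> = ln (\<Prod>i<n. 1 + \<mu> i) + ln (\<Prod>i<n. 1 / (1 + l i))"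
    by (rule ln_mult_pos) (auto intro!: prod_pos divide_pos_pos pl pm)
  also have "ln (\<Prod>i<n. 1 + \<mu> i) = (\<Sum>i<n. ln (1 + \<mu> i))" by (rule ln_prod) (use pm in force)+
  also have "ln (\<Prod>i<n. 1 / (1 + l i)) = (\<Sum>i<n. ln (1 / (1 + l i)))" by (rule ln_prod) (use pl in force)+
  also have "\<dots> = (\<Sum>i<n. - ln (1 + l i))" by (rule sum.cong) (auto simp: ln_div pl)
  finally have ld: "ln (Re (det ((1\<^sub>m n + X) * W))) = (\<Sum>i<n. ln (1 + \<mu> i)) - (\<Sum>i<n. ln (1 + l i))" by (simp add: sum_negf)
  have "mtrace ((1\<^sub>m n + X) * W) = mtrace W + mtrace (X * W)"
    by (simp add: add_mult_distrib_mat [of _ n n _ _ n] mtrace_add [of _ n] one_mult)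
  then have tr: "Re (mtrace ((1\<^sub>m n + X) * W)) = (\<Sum>i<n. 1 / (1 + l i)) + Re (mtrace (X * W))"
    unfolding mtrace_fcalc [OF U] by simp
  have "real n = (\<Sum>i<n. 1 / (1 + l i) + l i / (1 + l i))"
  proof -
    have "(\<Sum>i<n. 1 / (1 + l i) + l i / (1 + l i)) = (\<Sum>i<n. 1)"
      by (rule sum.cong) (use pl in \<open>auto simp: add_divide_distrib [symmetric] less_le\<close>)
    then show ?thesis by simp
  qed
  then show ?thesis unfolding divergence_def ld tr by (simp add: sum.distrib)
qed

lemma divergence_gap: "divergence = (Re (mtrace (X * W)) - Re (mtrace (X * R))) + (\<Sum>i<n. ldgap (l i)) - (\<Sum>i<n. ldgap (\<mu> i))"
proof -
  have "Re (mtrace (X * R)) = (\<Sum>i<n. \<mu> i / (1 + \<mu> i))"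
    unfolding fcalc_mult [OF V] mtrace_fcalc [OF V] by simp
  then show ?thesis unfolding divergence_eq ldgap_def by (simp add: sum_subtractf)
qed

lemma divergence_bounded:
  "\<bar>divergence\<bar> \<le> frob_norm G * frob_norm W + (\<Sum>i<n. l i / (1 + l i)) + (\<Sum>i<n. ln (1 + l i))"
proof -
  have "frob_norm X \<le> frob_norm G" unfolding QX [symmetric]
    by (rule order_trans [OF frob_norm_mult_proj_le [OF Q, of _ n] frob_norm_proj_mult_le [OF Q, of _ n]]) simp_all
  then have "cmod (mtrace (X * W)) \<le> frob_norm G * frob_norm W"
    by (intro order_trans [OF cmod_mtrace_mult_le [of _ n n]] mult_right_mono) simp_all
  then have 1: "\<bar>Re (mtrace (X * W))\<bar> \<le> frob_norm G * frob_norm W"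
    using abs_Re_le_cmod order_trans by blast
  have 2: "0 \<le> (\<Sum>i<n. l i / (1 + l i))" by (intro sum_nonneg) (simp add: l_nonneg)
  have 3: "0 \<le> (\<Sum>i<n. ln (1 + \<mu> i))" by (intro sum_nonneg) (simp add: \<mu>_nonneg)
  have 4: "(\<Sum>i<n. ln (1 + \<mu> i)) \<le> (\<Sum>i<n. ln (1 + l i))"
  proof (rule sum_mono)
    fix i assume "i \<in> {..<n}"
    then show "ln (1 + \<mu> i) \<le> ln (1 + l i)" using \<mu>_nonneg [of i] \<mu>_le [of i] by simp
  qed
  show ?thesis unfolding divergence_eq using 1 2 3 4 by linarith
qed

text \<open>Both bounds add up the off-diagonal term, through the block \<open>K\<close>, and the loss in the first \<open>r\<close> eigenvalues, through the block
  \<open>L\<close>. The first estimates each eigenvalue separately and is the better one if \<open>G\<close> is large; the second, which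
  uses the sum of all of them, does not involve \<open>r\<close> as a factor.\<close>

lemma divergence_excess:
  assumes r: "r \<le> m"
  defines "f \<equiv> divergence - (\<Sum>i=r..<n. ldgap (l i))"
  shows "f \<le> (frob_norm (fcalc n U (\<lambda>i. if i < \<rho> then 1 / (1 + l i) else 0)) + real r / (1 + l (\<rho> - 1))) * frob_norm (Q' * G)"
    and "f \<le> 3 / 4 * sqrt (real \<rho> - real r) * frob_norm (Q' * G)"
proof -
  have rn: "r \<le> n" using r m by simp
  have c: "0 \<le> l (\<rho> - 1)" using \<rho> by (intro less_imp_le l_pos) simp
  let ?\<tau> = "Re (mtrace (X * W)) - Re (mtrace (X * R))"
  let ?\<eta> = "frob_norm (Q' * G)"
  have split: "(\<Sum>i<n. g i) = (\<Sum>i<r. g i) + (\<Sum>i=r..<n. g i)" for g :: "nat \<Rightarrow> real"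
    unfolding lessThan_atLeast0 using rn by (rule sum.atLeastLessThan_concat [OF le0, symmetric])
  have "0 \<le> (\<Sum>i=r..<n. ldgap (\<mu> i))" by (intro sum_nonneg ldgap_nonneg) (simp add: \<mu>_nonneg)
  then have f: "f \<le> ?\<tau> + (\<Sum>i<r. ldgap (l i) - ldgap (\<mu> i))"
    unfolding f_def divergence_gap split sum_subtractf by simp
  have \<mu>1: "l (\<rho> - 1) \<le> \<mu> i" "\<mu> i \<le> l i" if "i < r" for i
    using \<mu>_ge_min [of i] \<mu>_le [of i] that r m by auto
  have "(\<Sum>i<r. ldgap (l i) - ldgap (\<mu> i)) \<le> (\<Sum>i<r. ?\<eta> / (1 + l (\<rho> - 1)))"
  proof (rule sum_mono)
    fix i assume i: "i \<in> {..<r}"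
    have "ldgap (l i) - ldgap (\<mu> i) \<le> (l i - \<mu> i) / (1 + l (\<rho> - 1))"
      by (rule ldgap_diff_le(1)) (use c \<mu>1 i in auto)
    also have "\<dots> \<le> ?\<eta> / (1 + l (\<rho> - 1))"
      using \<mu>_ge [of i] i rn norm_blocks(2) c by (intro divide_right_mono) auto
    finally show "ldgap (l i) - ldgap (\<mu> i) \<le> ?\<eta> / (1 + l (\<rho> - 1))" .
  qed
  also have "\<dots> = real r / (1 + l (\<rho> - 1)) * ?\<eta>" by simp
  finally have s1: "(\<Sum>i<r. ldgap (l i) - ldgap (\<mu> i)) \<le> real r / (1 + l (\<rho> - 1)) * ?\<eta>" .
  have "?\<tau> \<le> frob_norm (fcalc n U (\<lambda>i. if i < \<rho> then 1 / (1 + l i) else 0)) * ?\<eta>"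
    using trace_resolvent_diff mult_mono [OF norm_QWQ'_le norm_blocks(1)] by simp
  then show "f \<le> (frob_norm (fcalc n U (\<lambda>i. if i < \<rho> then 1 / (1 + l i) else 0)) + real r / (1 + l (\<rho> - 1))) * ?\<eta>"
    unfolding distrib_right using f s1 by linarith
  let ?N = "sqrt (real \<rho> - real r)"
  have "frob_norm (Q * W * Q') * frob_norm K \<le> (1 / 2 * ?N) * ?\<eta>"
    using norm_QWQ'_le_half norm_PG_Q'_le [OF r] norm_blocks(1) r m_le_\<rho> by (intro mult_mono) auto
  then have t: "?\<tau> \<le> (1 / 2 * ?N) * ?\<eta>" using trace_resolvent_diff by simp
  have "(\<Sum>i<r. ldgap (l i) - ldgap (\<mu> i)) \<le> (\<Sum>i<r. (l i - \<mu> i) / 4)"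
  proof (rule sum_mono)
    fix i assume i: "i \<in> {..<r}"
    show "ldgap (l i) - ldgap (\<mu> i) \<le> (l i - \<mu> i) / 4"
      by (rule ldgap_diff_le(2) [of 0]) (use c \<mu>1 [of i] i in auto)
  qed
  also have "\<dots> \<le> (\<Sum>i<n. (l i - \<mu> i) / 4)" by (rule sum_mono2) (use rn \<mu>_le in auto)
  also have "\<dots> = (\<Sum>i<n. l i - \<mu> i) / 4" by (simp only: sum_divide_distrib)
  also have "\<dots> \<le> (?N * ?\<eta>) / 4"
    using order_trans [OF sum_diff_le mult_mono [OF norm_PG_Q'_le [OF r] norm_blocks(2)]] r m_le_\<rho> by simp
  finally show "f \<le> 3 / 4 * ?N * ?\<eta>" using f t by simp
qed

end

section \<open>Rank and factorisations\<close>

lemma col_space_factor: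
  fixes A B :: "complex mat"
  assumes A: "A \<in> carrier_mat n a" and B: "B \<in> carrier_mat n b"
    and sub: "set (cols A) \<subseteq> vec_space.col_space n B"
  obtains C where "C \<in> carrier_mat b a" "A = B * C"
proof -
  interpret vec_space "TYPE(complex)" n .
  have "\<exists>x\<in>carrier_vec b. B *\<^sub>v x = col A j" if "j < a" for j
  proof -
    have "col A j \<in> set (cols A)" using that A by (auto simp: cols_def)
    then have "col A j \<in> col_space B" using sub by blast
    then show ?thesis unfolding col_space_eq [OF B] using carrier_matD [OF B] by auto
  qed
  then obtain x where x: "x j \<in> carrier_vec b" "B *\<^sub>v x j = col A j" if "j < a" for j by metis
  define C where "C = mat b a (\<lambda>(i, j). x j $ i)"
  have C: "C \<in> carrier_mat b a" by (simp add: C_def)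
  have cC: "col C j = x j" if "j < a" for j
    using that carrier_vecD [OF x(1) [OF that]] by (intro eq_vecI) (simp_all add: C_def)
  have "A = B * C"
  proof (rule eq_matI)
    fix i j assume "i < dim_row (B * C)" "j < dim_col (B * C)"
    then have ij: "i < n" "j < a" using B C by auto
    have "A $$ (i, j) = col A j $ i" using ij A by simp
    also have "\<dots> = (B * C) $$ (i, j)"
      unfolding x(2) [OF ij(2), symmetric] using ij B C by (simp add: cC)
    finally show "A $$ (i, j) = (B * C) $$ (i, j)" .
  qed (use A B C in auto)
  then show ?thesis using that C by blast
qed

text \<open>A basis of the range chosen among the columns of \<open>F * H\<close> lies in the span of the \<open>k\<close> columns of \<open>F\<close>. Together with the
  factorisation through a maximal independent set of columns this makes the rank the least inner dimension of a factorisation.\<close>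

lemma rank_factor_le:
  fixes F H :: "complex mat"
  assumes F: "F \<in> carrier_mat n k" and H: "H \<in> carrier_mat k c"
  shows "vec_space.rank n (F * H) \<le> k"
proof -
  interpret vec_space "TYPE(complex)" n .
  have FH: "F * H \<in> carrier_mat n c" using F H by simp
  define P where "P = (\<lambda>T. T \<subseteq> set (cols (F * H)) \<and> lin_indpt T)"
  have "P {}" unfolding P_def by (auto simp: lin_dep_def)
  then obtain S where S: "finite S" "maximal S P"
    using maximal_exists_superset [of "set (cols (F * H))" P "{}"] by (auto simp: P_def)
  have r: "rank (F * H) = card S" using rank_card_indpt [OF FH] S(2) unfolding P_def by blast
  have SP: "S \<subseteq> set (cols (F * H))" "lin_indpt S" using S(2) by (auto simp: maximal_def P_def)
  have Fc: "set (cols F) \<subseteq> carrier_vec n" using cols_dim F by blast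
  have SF: "S \<subseteq> span (set (cols F))"
  proof
    fix s assume "s \<in> S"
    then obtain j where j: "j < c" "s = col (F * H) j"
      using SP(1) carrier_matD [OF FH] by (auto simp: cols_def simp del: index_mult_mat)
    have "s = F *\<^sub>v col H j" unfolding j(2) by (rule col_mult2 [OF F H j(1)])
    moreover have "col H j \<in> carrier_vec k" by (rule carrier_vecI) (use H in simp)
    ultimately have "s \<in> col_space F"
      unfolding col_space_eq [OF F] using carrier_matD [OF F] F by auto
    then show "s \<in> span (set (cols F))" unfolding col_space_def .
  qed
  then obtain C :: "complex Matrix.vec set" where "int (card C) \<le> int (card (set (cols F))) - int (card S)"
    using replacement [OF S(1) List.finite_set _ SP(2) SF, unfolded module_vec_simps, OF Fc] by blast
  then have "card S \<le> card (set (cols F))" by linarith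
  also have "\<dots> \<le> k" using card_length [of "cols F"] F by simp
  finally show ?thesis unfolding r .
qed

lemma rank_factorisation:
  fixes A :: "complex mat"
  assumes A: "A \<in> carrier_mat n c"
  obtains F H where "F \<in> carrier_mat n (vec_space.rank n A)" "H \<in> carrier_mat (vec_space.rank n A) c" "A = F * H"
proof -
  interpret vec_space "TYPE(complex)" n .
  define P where "P = (\<lambda>T. T \<subseteq> set (cols A) \<and> lin_indpt T)"
  have "P {}" unfolding P_def by (auto simp: lin_dep_def)
  then obtain S where S: "finite S" "maximal S P"
    using maximal_exists_superset [of "set (cols A)" P "{}"] by (auto simp: P_def)
  have r: "rank A = card S" using rank_card_indpt [OF A] S(2) unfolding P_def by blast
  have SP: "S \<subseteq> set (cols A)" "lin_indpt S" using S(2) by (auto simp: maximal_def P_def)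
  have Ac: "set (cols A) \<subseteq> carrier_vec n" using cols_dim A by blast
  then have Sc: "S \<subseteq> carrier_vec n" using SP(1) by blast
  have sp: "s \<in> span S" if s: "s \<in> set (cols A)" for s
  proof (rule ccontr)
    assume ns: "s \<notin> span S"
    have sc: "s \<in> carrier_vec n" using s Ac by blast
    have sS: "s \<notin> S" using ns in_own_span [of S] Sc by (auto simp: module_vec_simps)
    have "lin_indpt (S \<union> {s})"
      using lin_dep_iff_in_span [of S s] Sc SP(2) sc sS ns by (auto simp: module_vec_simps)
    then have "P (S \<union> {s})" using s SP(1) by (auto simp: P_def)
    then have "S \<union> {s} = S" using S(2) unfolding maximal_def by blast
    then show False using sS by blast
  qed
  obtain L where L: "set L = S" "distinct L" using finite_distinct_list [OF S(1)] by blast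
  define F where "F = mat_of_cols n L"
  have len: "length L = rank A" unfolding r L(1) [symmetric] using distinct_card [OF L(2)] by simp
  have F: "F \<in> carrier_mat n (rank A)" unfolding F_def len [symmetric] by simp
  have cF: "cols F = L" unfolding F_def using L(1) Sc by (intro cols_mat_of_cols) auto
  have "set (cols A) \<subseteq> col_space F" unfolding col_space_def cF L(1) using sp by blast
  then obtain C where "C \<in> carrier_mat (rank A) c" "A = F * C"
    using col_space_factor [OF A F] by blast
  then show ?thesis using that F by blast
qed

lemma underdetermined_system:
  fixes H :: "complex mat"
  assumes H: "H \<in> carrier_mat k c" and kc: "k < c"
  obtains v where "v \<in> carrier_vec c" "v \<noteq> 0\<^sub>v c" "H *\<^sub>v v = 0\<^sub>v k"
proof -
  define B where "B = mat c c (\<lambda>(i, j). if i < k then H $$ (i, j) else 0)"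
  have B: "B \<in> carrier_mat c c" by (simp add: B_def)
  have "multrow k 0 B = B" using kc by (intro eq_matI) (auto simp: B_def)
  then have "det B = 0" using det_multrow [OF _ B, of k 0] kc by simp
  then obtain v where v: "v \<in> carrier_vec c" "v \<noteq> 0\<^sub>v c" "B *\<^sub>v v = 0\<^sub>v c"
    using det_0_iff_vec_prod_zero_field [OF B] by blast
  have "H *\<^sub>v v = 0\<^sub>v k"
  proof (rule eq_vecI)
    fix i assume "i < dim_vec (0\<^sub>v k :: complex Matrix.vec)"
    then have i: "i < k" by simp
    have "(H *\<^sub>v v) $ i = (B *\<^sub>v v) $ i"
      using i kc H carrier_vecD [OF v(1)] by (simp add: B_def scalar_prod_def)
    then show "(H *\<^sub>v v) $ i = 0\<^sub>v k $ i" using v(3) i kc by simp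
  qed (use H in simp)
  then show ?thesis using that v by blast
qed

lemma fcalc_factorisation:
  assumes U: "U \<in> carrier_mat n n" and c: "c \<le> n" and f: "\<And>i. c \<le> i \<Longrightarrow> i < n \<Longrightarrow> f i = 0"
  obtains F H where "F \<in> carrier_mat n c" "H \<in> carrier_mat c n" "fcalc n U f = F * H"
proof -
  define F where "F = mat n c (\<lambda>(i, j). U $$ (i, j) * of_real (f j))"
  define H where "H = mat c n (\<lambda>(i, j). cnj (U $$ (j, i)))"
  have FH: "F \<in> carrier_mat n c" "H \<in> carrier_mat c n" by (simp_all add: F_def H_def)
  have "fcalc n U f = F * H"
  proof (rule eq_matI)
    fix i j assume "i < dim_row (F * H)" "j < dim_col (F * H)"
    then have ij: "i < n" "j < n" using FH by auto
    have "(F * H) $$ (i, j) = (\<Sum>k<c. U $$ (i, k) * of_real (f k) * cnj (U $$ (j, k)))"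
      unfolding index_mult_mat_sum [OF FH ij] using ij by (intro sum.cong) (simp_all add: F_def H_def)
    also have "\<dots> = (\<Sum>k<n. U $$ (i, k) * of_real (f k) * cnj (U $$ (j, k)))"
      by (rule sum.mono_neutral_left) (use c f in auto)
    finally show "fcalc n U f $$ (i, j) = (F * H) $$ (i, j)" unfolding index_fcalc [OF U ij] ..
  qed (use FH fcalc_carrier [OF U] in auto)
  then show ?thesis using that FH by blast
qed

text \<open>If \<open>k < c\<close>, some combination of the first \<open>c\<close> eigenvectors would be mapped to 0 by \<open>H\<close>.\<close>

lemma fcalc_factorisation_ge:
  assumes U: "is_unitary n U" and c: "c \<le> n" and f: "\<And>i. i < c \<Longrightarrow> f i \<noteq> 0"
    and F: "F \<in> carrier_mat n k" and H: "H \<in> carrier_mat k n" and e: "fcalc n U f = F * H"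
  shows "c \<le> k"
proof (rule ccontr)
  assume "\<not> c \<le> k"
  then have kc: "k < c" by simp
  note [simp] = is_unitary_carrier [OF U]
  define E where "E = mat n c (\<lambda>(i, j). if i = j then 1 else 0 :: complex)"
  have E: "E \<in> carrier_mat n c" by (simp add: E_def)
  have UE: "U * E \<in> carrier_mat n c" using E by (rule mult_carrier_mat [rotated]) simp
  have HUE: "H * (U * E) \<in> carrier_mat k c" by (rule mult_carrier_mat [OF H UE])
  obtain v where v: "v \<in> carrier_vec c" "v \<noteq> 0\<^sub>v c" "(H * (U * E)) *\<^sub>v v = 0\<^sub>v k"
    using underdetermined_system [OF HUE kc] by blast
  have DE: "diag_real n f * E \<in> carrier_mat n c" using E by (rule mult_carrier_mat [rotated]) simp
  have FHU: "mat_adjoint U * (F * (H * (U * E))) = diag_real n f * E"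
  proof -
    have "F * (H * (U * E)) = (F * H) * (U * E)" by (rule assoc_mult_mat [OF F H UE, symmetric])
    also have "\<dots> = U * (diag_real n f * (mat_adjoint U * (U * E)))"
      unfolding e [symmetric] fcalc_def using E UE DE
      by (simp add: assoc_mult_mat [of _ n n _ n _ n] assoc_mult_mat [of _ n n _ n _ c])
    also have "mat_adjoint U * (U * E) = E"
      using assoc_mult_mat [of "mat_adjoint U" n n U n E c] E U by (simp add: is_unitary_def)
    finally have "mat_adjoint U * (F * (H * (U * E))) = (mat_adjoint U * U) * (diag_real n f * E)"
      using DE by (simp add: assoc_mult_mat [of _ n n _ n _ c])
    then show ?thesis using U E by (simp add: is_unitary_def)
  qed
  define AF where "AF = mat_adjoint U * F"
  have AF: "AF \<in> carrier_mat n k" unfolding AF_def using F by (rule mult_carrier_mat [rotated]) simp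
  have "diag_real n f * E = AF * (H * (U * E))"
    unfolding FHU [symmetric] AF_def by (rule assoc_mult_mat [of "mat_adjoint U" n n F k, OF _ F HUE, symmetric]) simp
  then have "(diag_real n f * E) *\<^sub>v v = AF *\<^sub>v ((H * (U * E)) *\<^sub>v v)"
    using assoc_mult_mat_vec [OF AF HUE v(1)] by simp
  also have "\<dots> = 0\<^sub>v n" unfolding v(3) using AF by (intro eq_vecI) (auto simp: scalar_prod_def)
  finally have z: "(diag_real n f * E) *\<^sub>v v = 0\<^sub>v n" .
  have "v = 0\<^sub>v c"
  proof (rule eq_vecI)
    fix i assume "i < dim_vec (0\<^sub>v c :: complex Matrix.vec)"
    then have i: "i < c" "i < n" using c by auto
    have "((diag_real n f * E) *\<^sub>v v) $ i = (\<Sum>j<c. (diag_real n f * E) $$ (i, j) * v $ j)"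
      using i E carrier_vecD [OF v(1)] by (simp add: scalar_prod_def lessThan_atLeast0)
    also have "\<dots> = (\<Sum>j<c. if j = i then of_real (f i) * v $ i else 0)"
    proof (rule sum.cong)
      fix j assume "j \<in> {..<c}"
      then have j: "j < c" by simp
      show "(diag_real n f * E) $$ (i, j) * v $ j = (if j = i then of_real (f i) * v $ i else 0)"
        unfolding index_diag_real_mult [OF E i(2) j] using i j by (auto simp: E_def)
    qed simp
    also have "\<dots> = of_real (f i) * v $ i" using i by (simp add: sum.delta)
    finally have "of_real (f i) * v $ i = 0" using z i by simp
    then show "v $ i = 0\<^sub>v c $ i" using f [OF i(1)] i by simp
  qed (use v(1) in simp)
  then show False using v(2) by blast
qed

section \<open>Inverses and positive semidefinite matrices\<close>

lemma minv_eqI: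
  assumes M: "M \<in> carrier_mat n n" and N: "N \<in> carrier_mat n n" and MN: "M * N = 1\<^sub>m n"
  shows "minv M = N"
proof -
  have NM: "N * M = 1\<^sub>m n" by (rule mat_mult_left_right_inverse [OF M N MN])
  have "M \<in> Units (ring_mat TYPE(complex) n ())"
    unfolding Units_def using M N MN NM by (auto simp: ring_mat_simps)
  then obtain B where B: "mat_inverse M = Some B" using mat_inverse(1) [OF M, of "()"] by (cases "mat_inverse M") auto
  then have "M * B = 1\<^sub>m n" "B \<in> carrier_mat n n" using mat_inverse(2) [OF M] by auto
  then have BM: "M * B = 1\<^sub>m n" "B \<in> carrier_mat n n" by auto
  have "B = (N * M) * B" unfolding NM using BM by simp
  also have "\<dots> = N * (M * B)" by (rule assoc_mult_mat [OF N M BM(2)])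
  finally have "B = N" using BM N by simp
  then show ?thesis unfolding minv_def B by simp
qed

lemma minv_inverse:
  assumes M: "M \<in> carrier_mat n n" and d: "det M \<noteq> 0"
  shows "minv M \<in> carrier_mat n n" "M * minv M = 1\<^sub>m n" "minv M * M = 1\<^sub>m n"
proof -
  have "M \<in> Units (ring_mat TYPE(complex) n ())" by (rule det_non_zero_imp_unit [OF M d])
  then obtain B where B: "mat_inverse M = Some B" using mat_inverse(1) [OF M, of "()"] by (cases "mat_inverse M") auto
  then show "minv M \<in> carrier_mat n n" "M * minv M = 1\<^sub>m n" "minv M * M = 1\<^sub>m n"
    using mat_inverse(2) [OF M] unfolding minv_def by auto
qed

lemma adjoint_mult_diagonal:
  fixes Z W :: "complex mat"
  assumes "Z \<in> carrier_mat n k" "W \<in> carrier_mat n k" "i < k"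
  shows "(\<Sum>j<n. mat_adjoint Z $$ (i, j) * W $$ (j, i)) = col W i \<bullet>c col Z i"
  using assms by (simp add: scalar_prod_def lessThan_atLeast0 mult.commute)

lemma herm_psd_trace:
  assumes B: "herm_psd n B" and Z: "Z \<in> carrier_mat n k"
  shows "0 \<le> Re (mtrace (mat_adjoint Z * (B * Z)))"
proof -
  have Bc: "B \<in> carrier_mat n n" using B by (simp add: herm_psd_def)
  have BZ: "B * Z \<in> carrier_mat n k" using Bc Z by simp
  have "mtrace (mat_adjoint Z * (B * Z)) = (\<Sum>i<k. \<Sum>j<n. mat_adjoint Z $$ (i, j) * (B * Z) $$ (j, i))"
    by (rule mtrace_mult_sum [OF _ BZ]) (use Z in simp)
  also have "\<dots> = (\<Sum>i<k. (B *\<^sub>v col Z i) \<bullet>c col Z i)"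
    by (intro sum.cong refl) (simp add: adjoint_mult_diagonal [OF Z BZ] col_mult2 [OF Bc Z])
  finally have "Re (mtrace (mat_adjoint Z * (B * Z))) = (\<Sum>i<k. Re ((B *\<^sub>v col Z i) \<bullet>c col Z i))" by simp
  also have "\<dots> \<ge> 0"
  proof (rule sum_nonneg)
    fix i assume "i \<in> {..<k}"
    then have "col Z i \<in> carrier_vec n" by (intro carrier_vecI) (use Z in simp)
    then show "0 \<le> Re ((B *\<^sub>v col Z i) \<bullet>c col Z i)" using B by (auto simp: herm_psd_def)
  qed
  finally show ?thesis .
qed

lemma fcalc_psd_nonneg:
  assumes U: "is_unitary n U" and j: "j < n"
    and psd: "\<And>Z. Z \<in> carrier_mat n n \<Longrightarrow> 0 \<le> Re (mtrace (mat_adjoint Z * (fcalc n U f * Z)))"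
  shows "0 \<le> f j"
proof -
  note [simp] = is_unitary_carrier [OF U]
  define C where "C = diag_real n (\<lambda>i. if i = j then 1 else 0)"
  have C: "C \<in> carrier_mat n n" by (simp add: C_def)
  have UC: "U * C \<in> carrier_mat n n" using C by simp
  have "(\<Sum>i<n. \<Sum>k<n. f i * (cmod (C $$ (i, k)))\<^sup>2) = (\<Sum>i<n. \<Sum>k<n. if k = i then (if i = j then f j else 0) else 0)"
    by (intro sum.cong refl) (auto simp: C_def diag_real_def)
  also have "\<dots> = f j" using j by (simp add: sum.delta)
  finally show ?thesis
    using psd [OF UC] unfolding mtrace_fcalc_form [OF U UC] unitary_cancel(1) [OF U C] Re_complex_of_real by simp
qed

section \<open>Ordered eigenvalues\<close>

lemma eigval_desc_antimono:
  assumes M: "M \<in> carrier_mat n n" and ij: "i \<le> j" "j < n"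
  shows "eigval_desc M (j + 1) \<le> eigval_desc M (i + 1)"
proof -
  define L where "L = sorted_list_of_multiset (image_mset Re (proots (char_poly M)))"
  have "length L = size (image_mset Re (proots (char_poly M)))"
    unfolding L_def by (metis mset_sorted_list_of_multiset size_mset)
  then have len: "length L = n" using degree_monic_char_poly [OF M] by (simp add: size_proots_complex)
  have "sorted L" unfolding L_def by (rule sorted_sorted_list_of_multiset)
  then have "L ! (n - Suc j) \<le> L ! (n - Suc i)" by (rule sorted_nth_mono) (use len ij in auto)
  then show ?thesis unfolding eigval_desc_def L_def [symmetric] using len ij by (simp add: rev_nth)
qed

lemma truncated_svd_fcalc:
  assumes "is_truncated_svd n G r Gr" and r: "r \<le> n"
  obtains U where "is_unitary n U" "G = fcalc n U (\<lambda>i. eigval_desc G (i + 1))"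
    "Gr = fcalc n U (\<lambda>i. if i < r then eigval_desc G (i + 1) else 0)"
proof -
  obtain v where v: "\<And>i. i < n \<Longrightarrow> v i \<in> carrier_vec n"
    "\<And>i j. i < n \<Longrightarrow> j < n \<Longrightarrow> v i \<bullet>c v j = (if i = j then 1 else 0)"
    and G: "G = spectral_sum n G v n" and Gr: "Gr = spectral_sum n G v r"
    using assms(1) unfolding is_truncated_svd_def by blast
  define U where "U = mat n n (\<lambda>(a, i). v i $ a)"
  have Uc: "U \<in> carrier_mat n n" by (simp add: U_def)
  have U: "is_unitary n U"
  proof (rule is_unitary_entries [OF Uc])
    fix i j assume ij: "i < n" "j < n"
    have "(\<Sum>k<n. cnj (U $$ (k, i)) * U $$ (k, j)) = v j \<bullet>c v i"
      using ij v(1) [OF ij(1)] v(1) [OF ij(2)]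
      by (simp add: U_def scalar_prod_def lessThan_atLeast0 mult.commute)
    then show "(\<Sum>k<n. cnj (U $$ (k, i)) * U $$ (k, j)) = (if i = j then 1 else 0)"
      using v(2) [OF ij(2) ij(1)] by auto
  qed
  have ss: "spectral_sum n G v k = fcalc n U (\<lambda>i. if i < k then eigval_desc G (i + 1) else 0)" if k: "k \<le> n" for k
  proof (rule eq_matI)
    fix a b assume "a < dim_row (fcalc n U (\<lambda>i. if i < k then eigval_desc G (i + 1) else 0))"
      "b < dim_col (fcalc n U (\<lambda>i. if i < k then eigval_desc G (i + 1) else 0))"
    then have ab: "a < n" "b < n" using carrier_matD [OF fcalc_carrier [OF Uc]] by auto
    have "spectral_sum n G v k $$ (a, b) = (\<Sum>i<k. U $$ (a, i) * of_real (if i < k then eigval_desc G (i + 1) else 0) * cnj (U $$ (b, i)))"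
      unfolding spectral_sum_def using ab k by (simp add: U_def mult_ac)
    also have "\<dots> = (\<Sum>i<n. U $$ (a, i) * of_real (if i < k then eigval_desc G (i + 1) else 0) * cnj (U $$ (b, i)))"
      by (rule sum.mono_neutral_left) (use k in auto)
    finally show "spectral_sum n G v k $$ (a, b) = fcalc n U (\<lambda>i. if i < k then eigval_desc G (i + 1) else 0) $$ (a, b)"
      unfolding index_fcalc [OF Uc ab] .
  qed (use carrier_matD [OF fcalc_carrier [OF Uc]] in \<open>auto simp: spectral_sum_def\<close>)
  have "fcalc n U (\<lambda>i. if i < n then eigval_desc G (i + 1) else 0) = fcalc n U (\<lambda>i. eigval_desc G (i + 1))"
    by (rule fcalc_cong) simp
  then show ?thesis using that [OF U] G Gr ss [of n] ss [OF r] by simp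
qed

text \<open>With fewer positive terms than the rank, the matrix would factor through a smaller dimension.\<close>

lemma fcalc_rank_positive:
  assumes U: "is_unitary n U" and anti: "\<And>i j. i \<le> j \<Longrightarrow> j < n \<Longrightarrow> f j \<le> f i"
    and nonneg: "\<And>i. i < n \<Longrightarrow> 0 \<le> f i" and i: "i < vec_space.rank n (fcalc n U f)"
  shows "i < n" "0 < f i"
proof -
  note [simp] = is_unitary_carrier [OF U]
  interpret vec_space "TYPE(complex)" n .
  show n: "i < n" using i rank_le_nc [OF fcalc_carrier, of U f] by simp
  show "0 < f i"
  proof (rule ccontr)
    assume "\<not> 0 < f i"
    then have "f j = 0" if "i \<le> j" "j < n" for j using anti [OF that] nonneg [OF that(2)] by linarith
    then obtain F H where "F \<in> carrier_mat n i" "H \<in> carrier_mat i n" "fcalc n U f = F * H"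
      using fcalc_factorisation [of U n i f] n by auto
    then have "rank (fcalc n U f) \<le> i" using rank_factor_le by simp
    then show False using i by simp
  qed
qed

lemma rank_congruence:
  fixes C B D :: "complex mat"
  assumes "C \<in> carrier_mat n n" "B \<in> carrier_mat n n" "D \<in> carrier_mat n n"
  shows "vec_space.rank n (C * B * D) \<le> vec_space.rank n B"
proof -
  obtain F H where FH: "F \<in> carrier_mat n (vec_space.rank n B)" "H \<in> carrier_mat (vec_space.rank n B) n" "B = F * H"
    using rank_factorisation [OF assms(2)] by blast
  have "C * (F * H) * D = (C * F) * (H * D)"
    using assms FH(1,2) by (simp add: assoc_mult_mat [of _ n n _ _ _ n] assoc_mult_mat [of _ n _ _ n _ n])
  then have "C * B * D = (C * F) * (H * D)" unfolding FH(3) [symmetric] .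
  moreover have "C * F \<in> carrier_mat n (vec_space.rank n B)" "H * D \<in> carrier_mat (vec_space.rank n B) n"
    using assms FH(1,2) by simp_all
  ultimately show ?thesis using rank_factor_le by simp
qed

lemma fcalc_rank_zero:
  assumes U: "is_unitary n U" and anti: "\<And>i j. i \<le> j \<Longrightarrow> j < n \<Longrightarrow> f j \<le> f i"
    and nonneg: "\<And>i. i < n \<Longrightarrow> 0 \<le> f i" and i: "vec_space.rank n (fcalc n U f) \<le> i" "i < n"
  shows "f i = 0"
proof (rule ccontr)
  assume "f i \<noteq> 0"
  then have "f j \<noteq> 0" if "j < Suc i" for j using that anti [of j i] i nonneg [of i] by force
  moreover obtain F H where "F \<in> carrier_mat n (vec_space.rank n (fcalc n U f))"
     "H \<in> carrier_mat (vec_space.rank n (fcalc n U f)) n" "fcalc n U f = F * H"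
    using rank_factorisation [OF fcalc_carrier [OF is_unitary_carrier [OF U]]] by blast
  ultimately have "Suc i \<le> vec_space.rank n (fcalc n U f)" using fcalc_factorisation_ge [OF U, of "Suc i" f] i by auto
  then show False using i by simp
qed

section \<open>The standard Gaussian measure on a finite product of lines\<close>

definition stdn :: "real measure" where
  "stdn = density lborel std_normal_density"

definition gauss :: "'i set \<Rightarrow> ('i \<Rightarrow> real) measure" where
  "gauss I = PiM I (\<lambda>_. stdn)"

lemma sets_stdn [simp, measurable_cong]: "sets stdn = sets borel"
  by (simp add: stdn_def)

lemma space_stdn [simp]: "space stdn = UNIV"
  by (simp add: stdn_def)

lemma prob_space_stdn: "prob_space stdn"
  unfolding stdn_def by (rule prob_space_normal_density) simp

interpretation stdn: prob_space stdn
  by (rule prob_space_stdn)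

interpretation stdn_product: product_sigma_finite "\<lambda>_::'i. stdn"
  by unfold_locales

interpretation stdn_pair: pair_sigma_finite stdn stdn
  by unfold_locales

lemma prob_space_gauss: "prob_space (gauss I)"
  unfolding gauss_def by (rule prob_space_PiM) (rule prob_space_stdn)

lemma space_gauss: "space (gauss I) = extensional I"
  by (simp add: gauss_def space_PiM PiE_UNIV_domain PiE_def)

lemma nn_integral_stdn:
  assumes "f \<in> borel_measurable borel"
  shows "(\<integral>\<^sup>+x. f x \<partial>stdn) = (\<integral>\<^sup>+x. ennreal (std_normal_density x) * f x \<partial>lborel)"
  unfolding stdn_def using assms by (subst nn_integral_density) auto

lemma nn_integral_lborel_rotation:
  fixes F :: "real \<times> real \<Rightarrow> ennreal"
  assumes F [measurable]: "F \<in> borel_measurable (borel \<Otimes>\<^sub>M borel)" and cd: "c\<^sup>2 + d\<^sup>2 = 1"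
  shows "(\<integral>\<^sup>+s. \<integral>\<^sup>+t. F (c * s - d * t, d * s + c * t) \<partial>lborel \<partial>lborel) = (\<integral>\<^sup>+s. \<integral>\<^sup>+t. F (s, t) \<partial>lborel \<partial>lborel)"
proof (cases "c = 0")
  case False
  have id: "d * s + c * t = d / c * (- (d * t) + c * s) + t / c" for s t
  proof -
    have "d / c * (- (d * t) + c * s) + t / c = d * s + (1 - d\<^sup>2) / c * t"
      using False by (simp add: field_simps power2_eq_square)
    also have "(1 - d\<^sup>2) / c = c"
      using False cd by (simp add: field_simps power2_eq_square)
    finally show ?thesis by simp
  qed
  have eq: "F (c * s - d * t, d * s + c * t) = F (- (d * t) + c * s, d / c * (- (d * t) + c * s) + t / c)" for s t
    by (simp only: id [symmetric]) simp
  have "\<bar>c\<bar> * (\<integral>\<^sup>+s. \<integral>\<^sup>+t. F (c * s - d * t, d * s + c * t) \<partial>lborel \<partial>lborel)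
      = \<bar>c\<bar> * (\<integral>\<^sup>+t. \<integral>\<^sup>+s. F (c * s - d * t, d * s + c * t) \<partial>lborel \<partial>lborel)"
    by (subst lborel_pair.Fubini') simp_all
  also have "\<dots> = (\<integral>\<^sup>+t. \<bar>c\<bar> * (\<integral>\<^sup>+s. F (- (d * t) + c * s, d / c * (- (d * t) + c * s) + t / c) \<partial>lborel) \<partial>lborel)"
    by (subst nn_integral_cmult [symmetric]) (simp_all only: eq, simp_all)
  also have "\<dots> = (\<integral>\<^sup>+t. \<integral>\<^sup>+u. F (u, d / c * u + t / c) \<partial>lborel \<partial>lborel)"
    using False by (subst nn_integral_real_affine [of _ c, symmetric]) simp_all
  also have "\<dots> = (\<integral>\<^sup>+u. \<integral>\<^sup>+t. F (u, d / c * u + 1 / c * t) \<partial>lborel \<partial>lborel)"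
    by (subst lborel_pair.Fubini') simp_all
  finally have "\<bar>1 / c\<bar> * (\<bar>c\<bar> * (\<integral>\<^sup>+s. \<integral>\<^sup>+t. F (c * s - d * t, d * s + c * t) \<partial>lborel \<partial>lborel))
      = (\<integral>\<^sup>+u. \<bar>1 / c\<bar> * (\<integral>\<^sup>+t. F (u, d / c * u + 1 / c * t) \<partial>lborel) \<partial>lborel)"
    by (simp add: nn_integral_cmult)
  also have "\<dots> = (\<integral>\<^sup>+u. \<integral>\<^sup>+v. F (u, v) \<partial>lborel \<partial>lborel)"
    using False by (subst nn_integral_real_affine [of _ "1 / c", symmetric]) simp_all
  also have "\<bar>1 / c\<bar> * (\<bar>c\<bar> * (\<integral>\<^sup>+s. \<integral>\<^sup>+t. F (c * s - d * t, d * s + c * t) \<partial>lborel \<partial>lborel))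
     = (\<integral>\<^sup>+s. \<integral>\<^sup>+t. F (c * s - d * t, d * s + c * t) \<partial>lborel \<partial>lborel)"
    using False by (simp add: mult.assoc [symmetric] ennreal_mult [symmetric])
  finally show ?thesis .
next
  case True
  then have d: "\<bar>d\<bar> = 1" "d \<noteq> 0" using cd by (auto simp: abs_if power2_eq_1_iff)
  have "(\<integral>\<^sup>+s. \<integral>\<^sup>+t. F (c * s - d * t, d * s + c * t) \<partial>lborel \<partial>lborel)
     = (\<integral>\<^sup>+s. \<bar>- d\<bar> * (\<integral>\<^sup>+t. F (0 + (- d) * t, d * s) \<partial>lborel) \<partial>lborel)"
    using True d by simp
  also have "\<dots> = (\<integral>\<^sup>+s. \<integral>\<^sup>+t. F (t, d * s) \<partial>lborel \<partial>lborel)"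
    using d by (subst nn_integral_real_affine [of _ "- d", symmetric]) simp_all
  also have "\<dots> = (\<integral>\<^sup>+t. \<bar>d\<bar> * (\<integral>\<^sup>+s. F (t, 0 + d * s) \<partial>lborel) \<partial>lborel)"
    using d by (subst lborel_pair.Fubini') simp_all
  also have "\<dots> = (\<integral>\<^sup>+t. \<integral>\<^sup>+s. F (t, s) \<partial>lborel \<partial>lborel)"
    using d by (subst nn_integral_real_affine [of _ d, symmetric]) simp_all
  finally show ?thesis .
qed

lemma nn_integral_stdn_rotation:
  fixes F :: "real \<times> real \<Rightarrow> ennreal"
  assumes F [measurable]: "F \<in> borel_measurable (borel \<Otimes>\<^sub>M borel)" and cd: "c\<^sup>2 + d\<^sup>2 = 1"
  shows "(\<integral>\<^sup>+s. \<integral>\<^sup>+t. F (c * s - d * t, d * s + c * t) \<partial>stdn \<partial>stdn) = (\<integral>\<^sup>+s. \<integral>\<^sup>+t. F (s, t) \<partial>stdn \<partial>stdn)"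
proof -
  let ?\<phi> = "std_normal_density"
  define H where "H = (\<lambda>(s, t). ennreal (?\<phi> s * ?\<phi> t) * F (s, t))"
  have Hm [measurable]: "H \<in> borel_measurable (borel \<Otimes>\<^sub>M borel)"
    unfolding H_def by measurable
  have inv: "?\<phi> s * ?\<phi> t = ?\<phi> (c * s - d * t) * ?\<phi> (d * s + c * t)" for s t
  proof -
    have "(c * s - d * t)\<^sup>2 + (d * s + c * t)\<^sup>2 = (c\<^sup>2 + d\<^sup>2) * (s\<^sup>2 + t\<^sup>2)"
      by (simp add: power2_eq_square algebra_simps)
    then have "exp (- (s\<^sup>2 / 2)) * exp (- (t\<^sup>2 / 2)) = exp (- ((c * s - d * t)\<^sup>2 / 2)) * exp (- ((d * s + c * t)\<^sup>2 / 2))"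
      using cd by (simp add: exp_add [symmetric] add_divide_distrib [symmetric])
    then show ?thesis
      by (simp add: normal_density_def)
  qed
  have *: "(\<integral>\<^sup>+s. \<integral>\<^sup>+t. F (f s t, g s t) \<partial>stdn \<partial>stdn) = (\<integral>\<^sup>+s. \<integral>\<^sup>+t. ennreal (?\<phi> s * ?\<phi> t) * F (f s t, g s t) \<partial>lborel \<partial>lborel)"
    if [measurable]: "(\<lambda>(s, t). f s t) \<in> borel_measurable (borel \<Otimes>\<^sub>M borel)" "(\<lambda>(s, t). g s t) \<in> borel_measurable (borel \<Otimes>\<^sub>M borel)" for f g
    by (subst nn_integral_stdn, measurable, rule nn_integral_cong, subst nn_integral_stdn, measurable,
        subst nn_integral_cmult [symmetric], measurable)
       (simp add: ennreal_mult mult.assoc)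
  have "(\<integral>\<^sup>+s. \<integral>\<^sup>+t. F (c * s - d * t, d * s + c * t) \<partial>stdn \<partial>stdn)
     = (\<integral>\<^sup>+s. \<integral>\<^sup>+t. H (c * s - d * t, d * s + c * t) \<partial>lborel \<partial>lborel)"
    by (subst *, measurable) (simp only: H_def prod.case inv [symmetric])
  also have "\<dots> = (\<integral>\<^sup>+s. \<integral>\<^sup>+t. H (s, t) \<partial>lborel \<partial>lborel)"
    by (rule nn_integral_lborel_rotation) (use cd in auto)
  also have "\<dots> = (\<integral>\<^sup>+s. \<integral>\<^sup>+t. F (s, t) \<partial>stdn \<partial>stdn)"
    by (subst *, measurable) (simp add: H_def)
  finally show ?thesis .
qed

lemma nn_integral_stdn_uminus:
  assumes "F \<in> borel_measurable borel"
  shows "(\<integral>\<^sup>+s. F (- s) \<partial>stdn) = (\<integral>\<^sup>+s. F s \<partial>stdn)"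
proof -
  have "(\<integral>\<^sup>+s. F s \<partial>stdn) = (\<integral>\<^sup>+s. ennreal (std_normal_density s) * F s \<partial>lborel)"
    by (rule nn_integral_stdn) fact
  also have "\<dots> = \<bar>- 1::real\<bar> * (\<integral>\<^sup>+s. ennreal (std_normal_density (0 + (- 1) * s)) * F (0 + (- 1) * s) \<partial>lborel)"
    using assms by (intro nn_integral_real_affine) auto
  also have "\<dots> = (\<integral>\<^sup>+s. ennreal (std_normal_density s) * F (- s) \<partial>lborel)"
    by (simp add: normal_density_def)
  also have "\<dots> = (\<integral>\<^sup>+s. F (- s) \<partial>stdn)"
    using assms by (subst nn_integral_stdn) auto
  finally show ?thesis by simp
qed

definition preserves_gauss :: "'i set \<Rightarrow> (('i \<Rightarrow> real) \<Rightarrow> 'i \<Rightarrow> real) \<Rightarrow> bool" where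
  "preserves_gauss I T \<longleftrightarrow> T \<in> measurable (gauss I) (gauss I) \<and> distr (gauss I) (gauss I) T = gauss I"

lemma preserves_gaussI:
  assumes "T \<in> measurable (gauss I) (gauss I)"
    and "\<And>f. f \<in> borel_measurable (gauss I) \<Longrightarrow> (\<integral>\<^sup>+x. f (T x) \<partial>gauss I) = (\<integral>\<^sup>+x. (f x :: ennreal) \<partial>gauss I)"
  shows "preserves_gauss I T"
  unfolding preserves_gauss_def
proof
  show "distr (gauss I) (gauss I) T = gauss I"
  proof (rule measure_eqI)
    fix A assume "A \<in> sets (distr (gauss I) (gauss I) T)"
    then have A: "A \<in> sets (gauss I)" by simp
    have "emeasure (distr (gauss I) (gauss I) T) A = (\<integral>\<^sup>+x. indicator A x \<partial>distr (gauss I) (gauss I) T)"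
      using A by simp
    also have "\<dots> = (\<integral>\<^sup>+x. indicator A (T x) \<partial>gauss I)"
      using A by (intro nn_integral_distr assms(1)) simp
    also have "\<dots> = emeasure (gauss I) A"
      using A by (subst assms(2)) auto
    finally show "emeasure (distr (gauss I) (gauss I) T) A = emeasure (gauss I) A" .
  qed simp
qed fact

lemma preserves_gaussD:
  assumes "preserves_gauss I T" and "f \<in> borel_measurable (gauss I)"
  shows "(\<integral>\<^sup>+x. f (T x) \<partial>gauss I) = (\<integral>\<^sup>+x. f x \<partial>gauss I)"
  using assms nn_integral_distr [of T "gauss I" "gauss I" f] by (auto simp: preserves_gauss_def)

lemma preserves_gauss_comp:
  assumes "preserves_gauss I S" "preserves_gauss I T"
  shows "preserves_gauss I (\<lambda>x. S (T x))"
proof (rule preserves_gaussI)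
  note [measurable] = assms [unfolded preserves_gauss_def, THEN conjunct1]
  show "(\<lambda>x. S (T x)) \<in> measurable (gauss I) (gauss I)" by measurable
  fix f :: "_ \<Rightarrow> ennreal" assume [measurable]: "f \<in> borel_measurable (gauss I)"
  show "(\<integral>\<^sup>+x. f (S (T x)) \<partial>gauss I) = (\<integral>\<^sup>+x. f x \<partial>gauss I)"
  proof -
    have "(\<lambda>x. f (S x)) \<in> borel_measurable (gauss I)" by measurable
    from preserves_gaussD [OF assms(2) this] preserves_gaussD [OF assms(1), of f] show ?thesis by simp
  qed
qed

lemma preserves_gauss_cong:
  assumes "preserves_gauss I S" "\<And>x. x \<in> extensional I \<Longrightarrow> S x = T x"
  shows "preserves_gauss I T"
proof (rule preserves_gaussI)
  show "T \<in> measurable (gauss I) (gauss I)"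
    using assms measurable_cong [of "gauss I" S T "gauss I"] by (auto simp: preserves_gauss_def space_gauss)
  fix f :: "_ \<Rightarrow> ennreal" assume f: "f \<in> borel_measurable (gauss I)"
  have "(\<integral>\<^sup>+x. f (T x) \<partial>gauss I) = (\<integral>\<^sup>+x. f (S x) \<partial>gauss I)"
    by (rule nn_integral_cong) (simp add: assms(2) space_gauss)
  then show "(\<integral>\<^sup>+x. f (T x) \<partial>gauss I) = (\<integral>\<^sup>+x. f x \<partial>gauss I)"
    using preserves_gaussD [OF assms(1) f] by simp
qed

text \<open>A rotation in the plane of the coordinates \<open>i\<close> and \<open>j\<close>; \<open>c\<close> and \<open>d\<close> are cosine and sine.\<close>

definition givens :: "real \<Rightarrow> real \<Rightarrow> 'i \<Rightarrow> 'i \<Rightarrow> ('i \<Rightarrow> real) \<Rightarrow> 'i \<Rightarrow> real" where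
  "givens c d i j x = x(i := c * x i - d * x j, j := d * x i + c * x j)"

lemma nn_integral_gauss_insert:
  assumes "finite I" "i \<notin> I" "f \<in> borel_measurable (gauss (insert i I))"
  shows "(\<integral>\<^sup>+x. f x \<partial>gauss (insert i I)) = (\<integral>\<^sup>+x. \<integral>\<^sup>+y. f (x(i := y)) \<partial>stdn \<partial>gauss I)"
  using stdn_product.product_nn_integral_insert [of I i f] assms unfolding gauss_def by simp

lemma measurable_gauss_upd [measurable (raw)]:
  assumes "f \<in> measurable M (gauss I)" "g \<in> borel_measurable M"
  shows "(\<lambda>x. (f x)(i := g x)) \<in> measurable M (gauss (insert i I))"
proof -
  have "g \<in> measurable M stdn" using assms(2) measurable_cong_sets [of M M borel stdn] by auto
  with assms(1) show ?thesis
    unfolding gauss_def by (intro measurable_fun_upd [where J = I]) auto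
qed

lemma measurable_gauss_upd_mem:
  assumes "f \<in> measurable M (gauss I)" "g \<in> borel_measurable M" "i \<in> I"
  shows "(\<lambda>x. (f x)(i := g x)) \<in> measurable M (gauss I)"
  using measurable_gauss_upd [OF assms(1,2), of i] assms(3) by (simp add: insert_absorb)

lemma measurable_gauss_component:
  assumes "f \<in> measurable M (gauss I)" "i \<in> I"
  shows "(\<lambda>x. f x i) \<in> borel_measurable M"
proof -
  have "(\<lambda>x. f x i) \<in> measurable M stdn"
    using measurable_compose [OF assms(1) [unfolded gauss_def] measurable_component_singleton [OF assms(2)]] .
  then show ?thesis using measurable_cong_sets [of M M stdn borel] by auto
qed

lemma measurable_gauss_coordinate [measurable (raw)]:
  "i \<in> I \<Longrightarrow> (\<lambda>x. x i) \<in> borel_measurable (gauss I)"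
  by (rule measurable_gauss_component [OF measurable_ident_sets [OF refl]])

lemma preserves_gauss_givens:
  assumes I: "finite I" "i \<in> I" "j \<in> I" "i \<noteq> j" and cd: "c\<^sup>2 + d\<^sup>2 = 1"
  shows "preserves_gauss I (givens c d i j)"
proof (rule preserves_gaussI)
  note [measurable (raw)] = measurable_gauss_upd_mem
  show T: "givens c d i j \<in> measurable (gauss I) (gauss I)"
    unfolding givens_def using I by measurable
  fix f :: "_ \<Rightarrow> ennreal" assume f [measurable]: "f \<in> borel_measurable (gauss I)"
  define J where "J = I - {i, j}"
  have IJ: "I = insert j (insert i J)" and J: "finite J" "i \<notin> J" "j \<notin> insert i J"
    using I by (auto simp: J_def)
  have fm: "f \<in> borel_measurable (gauss (insert j (insert i J)))" using f unfolding IJ [symmetric] .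
  have fm2: "(\<lambda>x. f (givens c d i j x)) \<in> borel_measurable (gauss (insert j (insert i J)))"
    using measurable_compose [OF T f] unfolding IJ [symmetric] .
  have expand: "(\<integral>\<^sup>+x. h x \<partial>gauss I) = (\<integral>\<^sup>+x. \<integral>\<^sup>+s. \<integral>\<^sup>+t. h (x(i := s, j := t)) \<partial>stdn \<partial>stdn \<partial>gauss J)"
    if h: "h \<in> borel_measurable (gauss I)" for h :: "_ \<Rightarrow> ennreal"
  proof -
    note [measurable] = h [unfolded IJ]
    have "(\<integral>\<^sup>+x. h x \<partial>gauss I) = (\<integral>\<^sup>+x. \<integral>\<^sup>+t. h (x(j := t)) \<partial>stdn \<partial>gauss (insert i J))"
      unfolding IJ using J by (intro nn_integral_gauss_insert) auto
    also have "\<dots> = (\<integral>\<^sup>+x. \<integral>\<^sup>+s. \<integral>\<^sup>+t. h (x(i := s, j := t)) \<partial>stdn \<partial>stdn \<partial>gauss J)"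
      using J by (subst nn_integral_gauss_insert) auto
    finally show ?thesis .
  qed
  have "(\<integral>\<^sup>+x. f (givens c d i j x) \<partial>gauss I)
     = (\<integral>\<^sup>+x. \<integral>\<^sup>+s. \<integral>\<^sup>+t. f (x(i := c * s - d * t, j := d * s + c * t)) \<partial>stdn \<partial>stdn \<partial>gauss J)"
    using T I by (subst expand) (auto simp: givens_def fun_upd_twist)
  also have "\<dots> = (\<integral>\<^sup>+x. \<integral>\<^sup>+s. \<integral>\<^sup>+t. f (x(i := s, j := t)) \<partial>stdn \<partial>stdn \<partial>gauss J)"
  proof (rule nn_integral_cong)
    fix x assume x: "x \<in> space (gauss J)"
    have "(\<lambda>p::real \<times> real. x(i := fst p, j := snd p)) \<in> measurable (borel \<Otimes>\<^sub>M borel) (gauss (insert j (insert i J)))"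
      using x by measurable
    then have "(\<lambda>p. f (x(i := fst p, j := snd p))) \<in> borel_measurable (borel \<Otimes>\<^sub>M borel)"
      using fm by (rule measurable_compose)
    from nn_integral_stdn_rotation [OF this cd]
    show "(\<integral>\<^sup>+s. \<integral>\<^sup>+t. f (x(i := c * s - d * t, j := d * s + c * t)) \<partial>stdn \<partial>stdn)
      = (\<integral>\<^sup>+s. \<integral>\<^sup>+t. f (x(i := s, j := t)) \<partial>stdn \<partial>stdn)" by simp
  qed
  also have "\<dots> = (\<integral>\<^sup>+x. f x \<partial>gauss I)"
    by (rule expand [symmetric]) fact
  finally show "(\<integral>\<^sup>+x. f (givens c d i j x) \<partial>gauss I) = (\<integral>\<^sup>+x. f x \<partial>gauss I)" .
qed

lemma preserves_gauss_flip:
  assumes I: "finite I" "i \<in> I"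
  shows "preserves_gauss I (\<lambda>x. x(i := - x i))"
proof (rule preserves_gaussI)
  show T: "(\<lambda>x. x(i := - x i)) \<in> measurable (gauss I) (gauss I)"
    by (rule measurable_gauss_upd_mem [OF _ borel_measurable_uminus [OF measurable_gauss_component [OF _ I(2)]] I(2)])
       (rule measurable_ident_sets [OF refl])+
  fix f :: "_ \<Rightarrow> ennreal" assume f [measurable]: "f \<in> borel_measurable (gauss I)"
  define J where "J = I - {i}"
  have IJ: "I = insert i J" and J: "finite J" "i \<notin> J"
    using I by (auto simp: J_def)
  have fm: "f \<in> borel_measurable (gauss (insert i J))" using f unfolding IJ [symmetric] .
  have fm2: "(\<lambda>x. f (x(i := - x i))) \<in> borel_measurable (gauss (insert i J))"
    using measurable_compose [OF T f] unfolding IJ [symmetric] .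
  have "(\<integral>\<^sup>+x. f (x(i := - x i)) \<partial>gauss I) = (\<integral>\<^sup>+x. \<integral>\<^sup>+s. f (x(i := - s)) \<partial>stdn \<partial>gauss J)"
    using nn_integral_gauss_insert [OF J fm2] unfolding IJ [symmetric] by simp
  also have "\<dots> = (\<integral>\<^sup>+x. \<integral>\<^sup>+s. f (x(i := s)) \<partial>stdn \<partial>gauss J)"
  proof (rule nn_integral_cong)
    fix x assume x: "x \<in> space (gauss J)"
    have "(\<lambda>s. x(i := s)) \<in> measurable borel (gauss (insert i J))"
      using x by (intro measurable_gauss_upd measurable_const) auto
    then have "(\<lambda>s. f (x(i := s))) \<in> borel_measurable borel"
      using fm by (rule measurable_compose)
    from nn_integral_stdn_uminus [OF this]
    show "(\<integral>\<^sup>+s. f (x(i := - s)) \<partial>stdn) = (\<integral>\<^sup>+s. f (x(i := s)) \<partial>stdn)" .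
  qed
  also have "\<dots> = (\<integral>\<^sup>+x. f x \<partial>gauss I)"
    using nn_integral_gauss_insert [OF J fm] unfolding IJ [symmetric] by simp
  finally show "(\<integral>\<^sup>+x. f (x(i := - x i)) \<partial>gauss I) = (\<integral>\<^sup>+x. f x \<partial>gauss I)" .
qed

definition reflection :: "'i set \<Rightarrow> ('i \<Rightarrow> real) \<Rightarrow> ('i \<Rightarrow> real) \<Rightarrow> 'i \<Rightarrow> real" where
  "reflection I v x = (\<lambda>i. if i \<in> I then x i - 2 * (\<Sum>l\<in>I. v l * x l) * v i else x i)"

lemma sum_split2:
  fixes f :: "'i \<Rightarrow> real"
  assumes "finite I" "i \<in> I" "j \<in> I" "i \<noteq> j"
  shows "sum f I = f i + f j + sum f (I - {i, j})"
proof -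
  have "sum f I = f i + sum f (I - {i})" using assms by (simp add: sum.remove)
  also have "sum f (I - {i}) = f j + sum f (I - {i} - {j})" using assms by (intro sum.remove) auto
  also have "I - {i} - {j} = I - {i, j}" by auto
  finally show ?thesis by simp
qed

lemma givens_inner:
  assumes "finite I" "i \<in> I" "j \<in> I" "i \<noteq> j" and cd: "c\<^sup>2 + d\<^sup>2 = 1"
  shows "(\<Sum>l\<in>I. givens c d i j v l * givens c d i j x l) = (\<Sum>l\<in>I. v l * x l)"
proof -
  have "(c * v i - d * v j) * (c * x i - d * x j) + (d * v i + c * v j) * (d * x i + c * x j) = (c\<^sup>2 + d\<^sup>2) * (v i * x i + v j * x j)"
    by (simp add: power2_eq_square algebra_simps)
  moreover have "(\<Sum>l\<in>I - {i, j}. givens c d i j v l * givens c d i j x l) = (\<Sum>l\<in>I - {i, j}. v l * x l)"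
    by (rule sum.cong) (auto simp: givens_def)
  ultimately show ?thesis
    using assms unfolding sum_split2 [OF assms(1-4)] by (simp add: givens_def)
qed

text \<open>Every reflection is conjugate, by plane rotations, to the change of sign of one coordinate:
  each rotation clears one more coordinate of the vector.\<close>

lemma preserves_gauss_reflection:
  assumes I: "finite I" and v: "(\<Sum>l\<in>I. (v l)\<^sup>2) = 1"
  shows "preserves_gauss I (reflection I v)"
  using v
proof (induction "card {l \<in> I. v l \<noteq> 0}" arbitrary: v rule: less_induct)
  case less
  let ?S = "{l \<in> I. v l \<noteq> 0}"
  have "?S \<noteq> {}"
  proof
    assume "?S = {}"
    then have "(\<Sum>l\<in>I. (v l)\<^sup>2) = 0" by (intro sum.neutral) auto
    with less.prems show False by simp
  qed
  then obtain i where i: "i \<in> I" "v i \<noteq> 0" by auto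
  show ?case
  proof (cases "\<exists>j\<in>I. j \<noteq> i \<and> v j \<noteq> 0")
    case False
    have other: "l \<in> I - {i} \<Longrightarrow> v l = 0" for l using False by auto
    have "(\<Sum>l\<in>I. (v l)\<^sup>2) = (v i)\<^sup>2"
      using i I other by (subst sum.remove [of _ i]) auto
    then have vi: "v i * v i = 1" using less.prems by (simp add: power2_eq_square)
    have s: "(\<Sum>l\<in>I. v l * x l) = v i * x i" for x
      using i I other by (subst sum.remove [of _ i]) auto
    show ?thesis
    proof (rule preserves_gauss_cong [OF preserves_gauss_flip [OF I i(1)]])
      fix x
      show "x(i := - x i) = reflection I v x"
      proof
        fix l show "(x(i := - x i)) l = reflection I v x l"
        proof (cases "l = i")
          case True
          have "x i - 2 * (v i * x i) * v i = x i - 2 * (v i * v i) * x i" by (simp add: algebra_simps)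
          then show ?thesis using True i vi by (simp add: reflection_def s)
        qed (use other in \<open>auto simp: reflection_def\<close>)
      qed
    qed
  next
    case True
    then obtain j where j: "j \<in> I" "j \<noteq> i" "v j \<noteq> 0" by auto
    define \<rho> where "\<rho> = sqrt ((v i)\<^sup>2 + (v j)\<^sup>2)"
    have \<rho>: "\<rho> > 0" "\<rho>\<^sup>2 = (v i)\<^sup>2 + (v j)\<^sup>2"
      using i by (auto simp: \<rho>_def intro!: add_pos_nonneg)
    define c where "c = v i / \<rho>"
    define d where "d = - v j / \<rho>"
    have cd: "c\<^sup>2 + d\<^sup>2 = 1" "c\<^sup>2 + (- d)\<^sup>2 = 1"
      using \<rho> by (auto simp: c_def d_def power_divide add_divide_distrib [symmetric])
    define v' where "v' = givens c d i j v"
    have v'j: "v' j = 0" using j by (simp add: v'_def givens_def c_def d_def field_simps)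
    have "{l \<in> I. v' l \<noteq> 0} \<subset> ?S"
      using v'j i j by (auto simp: v'_def givens_def)
    then have card: "card {l \<in> I. v' l \<noteq> 0} < card ?S"
      using I by (intro psubset_card_mono) auto
    have ij: "i \<noteq> j" using j by auto
    have inner: "(\<Sum>l\<in>I. v' l * givens c d i j x l) = (\<Sum>l\<in>I. v l * x l)" for x
      unfolding v'_def using givens_inner [OF I i(1) j(1) ij cd(1)] .
    have v'1: "(\<Sum>l\<in>I. (v' l)\<^sup>2) = 1"
      using inner [of v] less.prems by (simp add: v'_def power2_eq_square)
    have undo: "givens c (- d) i j (givens c d i j x) = x" for x :: "'a \<Rightarrow> real"
    proof -
      have "c * (c * x i - d * x j) + d * (d * x i + c * x j) = (c\<^sup>2 + d\<^sup>2) * x i"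
        "c * (d * x i + c * x j) - d * (c * x i - d * x j) = (c\<^sup>2 + d\<^sup>2) * x j"
        by (simp_all add: power2_eq_square algebra_simps)
      then show ?thesis using cd ij by (auto simp: givens_def fun_eq_iff)
    qed
    have lin: "givens c (- d) i j (\<lambda>l. if l \<in> I then x l - a * y l else x l) l
       = (if l \<in> I then givens c (- d) i j x l - a * givens c (- d) i j y l else givens c (- d) i j x l)" for x y :: "'a \<Rightarrow> real" and a l
      using i(1) j(1) by (simp add: givens_def algebra_simps)
    have "preserves_gauss I (\<lambda>x. givens c (- d) i j (reflection I v' (givens c d i j x)))"
      using preserves_gauss_comp [OF preserves_gauss_givens [OF I i(1) j(1) ij cd(2)]
          preserves_gauss_comp [OF less.hyps [OF card v'1] preserves_gauss_givens [OF I i(1) j(1) ij cd(1)]]] .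
    then show ?thesis
    proof (rule preserves_gauss_cong)
      fix x
      define a where "a = 2 * (\<Sum>l\<in>I. v l * x l)"
      have R: "reflection I v' (givens c d i j x)
          = (\<lambda>l. if l \<in> I then givens c d i j x l - a * givens c d i j v l else givens c d i j x l)"
        using inner [of x] unfolding reflection_def a_def v'_def by (simp only:)
      have "givens c (- d) i j (reflection I v' (givens c d i j x)) l = reflection I v x l" for l
        by (subst R, subst lin, unfold undo, simp only: reflection_def a_def)
      then show "givens c (- d) i j (reflection I v' (givens c d i j x)) = reflection I v x" ..
    qed
  qed
qed

section \<open>Gaussian integrals\<close>

lemma borel_measurable_cnj [measurable]: "cnj \<in> borel_measurable borel"
  by (intro borel_measurable_continuous_onI continuous_intros)

lemma nn_integral_stdn_square: "(\<integral>\<^sup>+y. ennreal (y\<^sup>2) \<partial>stdn) = 1"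
proof -
  have b: "has_bochner_integral lborel (\<lambda>x. std_normal_density x * x ^ (2 * 1)) (fact (2 * 1) / (2 ^ 1 * fact 1))"
    by (rule std_normal_moment_even)
  have "(\<integral>\<^sup>+y. ennreal (y\<^sup>2) \<partial>stdn) = (\<integral>\<^sup>+y. ennreal (std_normal_density y * y ^ (2 * 1)) \<partial>lborel)"
    by (subst nn_integral_stdn) (auto simp: ennreal_mult)
  also have "\<dots> = ennreal (\<integral>y. std_normal_density y * y ^ (2 * 1) \<partial>lborel)"
    using b by (intro nn_integral_eq_integral) (auto simp: has_bochner_integral_iff)
  also have "(\<integral>y. std_normal_density y * y ^ (2 * 1) \<partial>lborel) = 1"
    using b by (auto simp: has_bochner_integral_iff)
  finally show ?thesis by simp
qed

lemma nn_integral_stdn_exp_quadratic: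
  assumes \<alpha>: "\<alpha> > 0"
  shows "(\<integral>\<^sup>+y. ennreal (exp (- (\<alpha> * y\<^sup>2 + 2 * \<beta> * y - y\<^sup>2) / 2)) \<partial>stdn) = ennreal (exp (\<beta>\<^sup>2 / (2 * \<alpha>)) / sqrt \<alpha>)"
proof -
  let ?N = "normal_density (- \<beta> / \<alpha>) (1 / sqrt \<alpha>)"
  have eq: "std_normal_density y * exp (- (\<alpha> * y\<^sup>2 + 2 * \<beta> * y - y\<^sup>2) / 2) = exp (\<beta>\<^sup>2 / (2 * \<alpha>)) / sqrt \<alpha> * ?N y" for y
  proof -
    have 1: "- (y\<^sup>2 / 2) + - (\<alpha> * y\<^sup>2 + 2 * \<beta> * y - y\<^sup>2) / 2 = \<beta>\<^sup>2 / (2 * \<alpha>) + - ((y - - \<beta> / \<alpha>)\<^sup>2 / (2 * (1 / sqrt \<alpha>)\<^sup>2))"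
      using \<alpha> by (simp add: power_divide field_simps power2_eq_square)
    have 2: "sqrt (2 * pi * (1 / sqrt \<alpha>)\<^sup>2) = sqrt (2 * pi) / sqrt \<alpha>"
      using \<alpha> by (simp add: power_divide real_sqrt_divide real_sqrt_mult)
    have "std_normal_density y * exp (- (\<alpha> * y\<^sup>2 + 2 * \<beta> * y - y\<^sup>2) / 2)
      = 1 / sqrt (2 * pi) * exp (- (y\<^sup>2 / 2) + - (\<alpha> * y\<^sup>2 + 2 * \<beta> * y - y\<^sup>2) / 2)"
      unfolding exp_add by (simp add: normal_density_def)
    also have "\<dots> = 1 / sqrt (2 * pi) * (exp (\<beta>\<^sup>2 / (2 * \<alpha>)) * exp (- ((y - - \<beta> / \<alpha>)\<^sup>2 / (2 * (1 / sqrt \<alpha>)\<^sup>2))))"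
      unfolding 1 exp_add ..
    also have "\<dots> = exp (\<beta>\<^sup>2 / (2 * \<alpha>)) / sqrt \<alpha> * ?N y"
      using \<alpha> unfolding normal_density_def 2 by simp
    finally show ?thesis .
  qed
  have "(\<integral>\<^sup>+y. ennreal (exp (- (\<alpha> * y\<^sup>2 + 2 * \<beta> * y - y\<^sup>2) / 2)) \<partial>stdn)
     = (\<integral>\<^sup>+y. ennreal (exp (\<beta>\<^sup>2 / (2 * \<alpha>)) / sqrt \<alpha>) * ennreal (?N y) \<partial>lborel)"
    by (subst nn_integral_stdn, measurable, intro nn_integral_cong)
       (use \<alpha> in \<open>subst ennreal_mult [symmetric], simp, simp, subst eq, subst ennreal_mult [symmetric], simp_all\<close>)
  also have "\<dots> = ennreal (exp (\<beta>\<^sup>2 / (2 * \<alpha>)) / sqrt \<alpha>) * (\<integral>\<^sup>+y. ennreal (?N y) \<partial>lborel)"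
    by (rule nn_integral_cmult) measurable
  also have "(\<integral>\<^sup>+y. ennreal (?N y) \<partial>lborel) = 1"
    using prob_space.emeasure_space_1 [OF prob_space_normal_density [of "1 / sqrt \<alpha>" "- \<beta> / \<alpha>"]] \<alpha>
    by (simp add: emeasure_density)
  finally show ?thesis by simp
qed

definition hform :: "nat \<Rightarrow> (nat \<Rightarrow> nat \<Rightarrow> complex) \<Rightarrow> (nat \<Rightarrow> complex) \<Rightarrow> complex" where
  "hform d a v = (\<Sum>i<d. \<Sum>j<d. cnj (v i) * a i j * v j)"

definition pos_form :: "nat \<Rightarrow> (nat \<Rightarrow> nat \<Rightarrow> complex) \<Rightarrow> bool" where
  "pos_form d a \<longleftrightarrow> (\<forall>i<d. \<forall>j<d. a j i = cnj (a i j)) \<and>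
     (\<forall>v. (\<exists>i<d. v i \<noteq> 0) \<longrightarrow> 0 < Re (hform d a v))"

lemma hform_Suc:
  "hform (Suc d) a v = hform d a v + v d * (\<Sum>i<d. cnj (v i) * a i d) + cnj (v d) * (\<Sum>j<d. a d j * v j)
     + cnj (v d) * a d d * v d"
  by (simp add: hform_def sum.distrib sum_distrib_left algebra_simps)

lemma pos_form_schur:
  assumes pd: "pos_form (Suc d) a"
  defines "s \<equiv> (\<lambda>i j. a i j - a i d * a d j / a d d)"
  shows "0 < Re (a d d)" "Im (a d d) = 0" "pos_form d s"
    and "det (mat (Suc d) (Suc d) (\<lambda>(i, j). a i j)) = a d d * det (mat d d (\<lambda>(i, j). s i j))"
proof -
  have herm: "a j i = cnj (a i j)" if "i < Suc d" "j < Suc d" for i j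
    using pd that unfolding pos_form_def by blast
  have pos: "0 < Re (hform (Suc d) a v)" if "\<exists>i<Suc d. v i \<noteq> 0" for v
    using pd that unfolding pos_form_def by blast
  have "a d d = cnj (a d d)" by (rule herm) auto
  then have "Im (a d d) = Im (cnj (a d d))" by (rule arg_cong)
  then show im: "Im (a d d) = 0" by simp
  have "0 < Re (hform (Suc d) a (\<lambda>i. if i = d then 1 else 0))"
    by (rule pos) auto
  then show re: "0 < Re (a d d)" by (simp add: hform_Suc) (simp add: hform_def)
  have nz: "a d d \<noteq> 0" using re by auto
  have cd: "cnj (a d d) = a d d" using herm [of d d] by (metis lessI)
  have herm': "s j i = cnj (s i j)" if "i < d" "j < d" for i j
  proof -
    have "a j i = cnj (a i j)" "a j d = cnj (a d j)" "a d i = cnj (a i d)"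
      using that by (auto intro!: herm)
    then show ?thesis unfolding s_def by (simp add: cd mult.commute)
  qed
  show "pos_form d s"
    unfolding pos_form_def
  proof (intro conjI allI impI)
    fix v :: "nat \<Rightarrow> complex" assume v: "\<exists>i<d. v i \<noteq> 0"
    define \<beta> where "\<beta> = (\<Sum>j<d. a d j * v j)"
    define w where "w = v(d := - \<beta> / a d d)"
    have "(\<Sum>i<d. cnj (v i) * a i d) = cnj \<beta>"
    proof -
      have "cnj (v i) * a i d = cnj (a d i * v i)" if "i < d" for i
        using herm [of d i] that by simp
      then show ?thesis unfolding \<beta>_def cnj_sum by (intro sum.cong) auto
    qed
    moreover have "hform d a w = hform d a v" "(\<Sum>i<d. cnj (w i) * a i d) = (\<Sum>i<d. cnj (v i) * a i d)"
      "(\<Sum>j<d. a d j * w j) = \<beta>"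
      by (simp_all add: w_def hform_def \<beta>_def)
    ultimately have "hform (Suc d) a w = hform d a v - cnj \<beta> * \<beta> / a d d"
      unfolding hform_Suc using nz cd by (simp add: w_def field_simps)
    moreover have "hform d s v = hform d a v - cnj \<beta> * \<beta> / a d d"
    proof -
      have "hform d s v = hform d a v - (\<Sum>i<d. \<Sum>j<d. cnj (v i) * a i d * (a d j * v j) / a d d)"
        by (simp add: hform_def s_def sum_subtractf [symmetric] algebra_simps)
      also have "(\<Sum>i<d. \<Sum>j<d. cnj (v i) * a i d * (a d j * v j) / a d d) = (\<Sum>i<d. cnj (v i) * a i d) * \<beta> / a d d"
        by (simp add: \<beta>_def sum_product sum_divide_distrib)
      finally show ?thesis using \<open>(\<Sum>i<d. cnj (v i) * a i d) = cnj \<beta>\<close> by simp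
    qed
    moreover have "0 < Re (hform (Suc d) a w)"
    proof -
      have "\<exists>i<Suc d. w i \<noteq> 0" using v by (auto simp: w_def intro: less_SucI)
      then show ?thesis by (rule pos)
    qed
    ultimately show "0 < Re (hform d s v)" by simp
  qed (rule herm')
  define S where "S = mat d d (\<lambda>(i, j). s i j)"
  define b where "b = mat d 1 (\<lambda>(i, j). a i d / a d d)"
  define c where "c = mat 1 d (\<lambda>(i, j). a d j)"
  define \<alpha> where "\<alpha> = mat 1 1 (\<lambda>(i, j). a d d)"
  have car: "S \<in> carrier_mat d d" "b \<in> carrier_mat d 1" "c \<in> carrier_mat 1 d" "\<alpha> \<in> carrier_mat 1 1"
    by (auto simp: S_def b_def c_def \<alpha>_def)
  have "mat (Suc d) (Suc d) (\<lambda>(i, j). a i j)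
      = four_block_mat (1\<^sub>m d) b (0\<^sub>m 1 d) (1\<^sub>m 1) * four_block_mat S (0\<^sub>m d 1) c \<alpha>"
  proof -
    have "four_block_mat (1\<^sub>m d) b (0\<^sub>m 1 d) (1\<^sub>m 1) * four_block_mat S (0\<^sub>m d 1) c \<alpha>
       = four_block_mat (1\<^sub>m d * S + b * c) (1\<^sub>m d * 0\<^sub>m d 1 + b * \<alpha>) (0\<^sub>m 1 d * S + 1\<^sub>m 1 * c) (0\<^sub>m 1 d * 0\<^sub>m d 1 + 1\<^sub>m 1 * \<alpha>)"
      using car by (intro mult_four_block_mat) auto
    also have "\<dots> = mat (Suc d) (Suc d) (\<lambda>(i, j). a i j)"
      using car nz
      by (intro eq_matI) (auto simp: S_def b_def c_def \<alpha>_def s_def scalar_prod_def less_Suc_eq)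
    finally show ?thesis by simp
  qed
  then have "det (mat (Suc d) (Suc d) (\<lambda>(i, j). a i j))
     = det (four_block_mat (1\<^sub>m d) b (0\<^sub>m 1 d) (1\<^sub>m 1)) * det (four_block_mat S (0\<^sub>m d 1) c \<alpha>)"
    using det_mult [OF four_block_carrier_mat [OF one_carrier_mat [of d] one_carrier_mat [of 1], of b "0\<^sub>m 1 d"]
        four_block_carrier_mat [OF car(1) car(4), of "0\<^sub>m d 1" c]] by simp
  also have "det (four_block_mat (1\<^sub>m d) b (0\<^sub>m 1 d) (1\<^sub>m 1)) = det (1\<^sub>m d :: complex mat) * det (1\<^sub>m 1 :: complex mat)"
    using car by (intro det_four_block_mat_lower_left_zero) auto
  also have "det (four_block_mat S (0\<^sub>m d 1) c \<alpha>) = det S * det \<alpha>"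
    using car by (intro det_four_block_mat_upper_right_zero) auto
  also have "det \<alpha> = a d d"
    using car by (subst det_single [of \<alpha>]) (auto simp: \<alpha>_def)
  finally show "det (mat (Suc d) (Suc d) (\<lambda>(i, j). a i j)) = a d d * det (mat d d (\<lambda>(i, j). s i j))"
    by (simp add: S_def)
qed

text \<open>A real Gaussian integral of the exponential of a complex Hermitian form. One variable is
  integrated at a time. Completing the square in the last variable subtracts from the form of the
  remaining ones the square of the real part of a linear form; the Schur complement subtracts
  the squared modulus, which is larger, hence the inequality.\<close>

lemma gauss_integral_hform_le:
  assumes "pos_form d a"
  shows "0 < Re (det (mat d d (\<lambda>(i, j). a i j))) \<and>
    (\<integral>\<^sup>+x. ennreal (exp (- (Re (hform d a (\<lambda>i. of_real (x i))) - (\<Sum>i<d. (x i)\<^sup>2)) / 2)) \<partial>gauss {..<d})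
      \<le> ennreal (1 / sqrt (Re (det (mat d d (\<lambda>(i, j). a i j)))))"
  using assms
proof (induction d arbitrary: a)
  case 0
  have "emeasure (gauss ({}::nat set)) (space (gauss {})) = 1"
    by (rule prob_space.emeasure_space_1 [OF prob_space_gauss])
  then show ?case by (simp add: hform_def)
next
  case (Suc d)
  define s where "s = (\<lambda>i j. a i j - a i d * a d j / a d d)"
  define \<alpha> where "\<alpha> = Re (a d d)"
  have pd: "pos_form (Suc d) a" using Suc.prems by simp
  note sch = pos_form_schur [OF pd, folded s_def]
  have \<alpha>: "\<alpha> > 0" "a d d = of_real \<alpha>" using sch(1,2) by (auto simp: \<alpha>_def complex_eq_iff)
  have det: "Re (det (mat (Suc d) (Suc d) (\<lambda>(i, j). a i j))) = \<alpha> * Re (det (mat d d (\<lambda>(i, j). s i j)))"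
    unfolding sch(4) \<alpha>(2) by simp
  have IH: "0 < Re (det (mat d d (\<lambda>(i, j). s i j)))"
    "(\<integral>\<^sup>+x. ennreal (exp (- (Re (hform d s (\<lambda>i. of_real (x i))) - (\<Sum>i<d. (x i)\<^sup>2)) / 2)) \<partial>gauss {..<d})
      \<le> ennreal (1 / sqrt (Re (det (mat d d (\<lambda>(i, j). s i j)))))"
    using Suc.IH [OF sch(3)] by auto
  have herm: "a j i = cnj (a i j)" if "i < Suc d" "j < Suc d" for i j
    using pd that unfolding pos_form_def by blast
  have det_pos: "0 < Re (det (mat (Suc d) (Suc d) (\<lambda>(i, j). a i j)))"
    using det IH(1) \<alpha> by simp
    let ?E = "\<lambda>d a x. exp (- (Re (hform d a (\<lambda>i. of_real (x i))) - (\<Sum>i<d. (x i)\<^sup>2)) / 2)"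
    have meas: "(\<lambda>x. ennreal (?E d a x)) \<in> borel_measurable (gauss {..<d})" for a and d
      unfolding hform_def by measurable
    have inner: "(\<integral>\<^sup>+y. ennreal (?E (Suc d) a (x(d := y))) \<partial>stdn) \<le> ennreal (1 / sqrt \<alpha>) * ennreal (?E d s x)" for x
    proof -
      define \<beta> where "\<beta> = (\<Sum>j<d. a d j * of_real (x j))"
      define b where "b = Re \<beta>"
      define q where "q = Re (hform d a (\<lambda>i. of_real (x i))) - (\<Sum>i<d. (x i)\<^sup>2)"
      have cb: "(\<Sum>i<d. of_real (x i) * a i d) = cnj \<beta>"
      proof -
        have "of_real (x i) * a i d = cnj (a d i * of_real (x i))" if "i < d" for i
          using herm [of d i] that by simp
        then show ?thesis unfolding \<beta>_def cnj_sum by (intro sum.cong) auto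
      qed
      have h: "hform (Suc d) a (\<lambda>i. of_real ((x(d := y)) i)) = hform d a (\<lambda>i. of_real (x i)) + of_real y * (cnj \<beta> + \<beta>) + of_real (\<alpha> * y\<^sup>2)" for y
      proof -
        have 1: "hform d a (\<lambda>i. of_real ((x(d := y)) i)) = hform d a (\<lambda>i. of_real (x i))"
          by (simp add: hform_def)
        have 2: "(\<Sum>i<d. cnj (of_real ((x(d := y)) i)) * a i d) = cnj \<beta>"
          using cb by simp
        have 3: "(\<Sum>j<d. a d j * of_real ((x(d := y)) j)) = \<beta>"
          by (simp add: \<beta>_def)
        show ?thesis
          unfolding hform_Suc 1 2 3 by (simp add: \<alpha>(2) algebra_simps power2_eq_square)
      qed
      have E: "?E (Suc d) a (x(d := y)) = exp (- q / 2) * exp (- (\<alpha> * y\<^sup>2 + 2 * b * y - y\<^sup>2) / 2)" for y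
        unfolding h by (simp add: exp_add [symmetric] q_def b_def) (simp add: field_simps)
      have "(\<integral>\<^sup>+y. ennreal (?E (Suc d) a (x(d := y))) \<partial>stdn)
          = ennreal (exp (- q / 2)) * (\<integral>\<^sup>+y. ennreal (exp (- (\<alpha> * y\<^sup>2 + 2 * b * y - y\<^sup>2) / 2)) \<partial>stdn)"
        unfolding E by (simp add: ennreal_mult nn_integral_cmult)
      also have "\<dots> = ennreal (exp (- q / 2)) * ennreal (exp (b\<^sup>2 / (2 * \<alpha>)) / sqrt \<alpha>)"
        unfolding nn_integral_stdn_exp_quadratic [OF \<alpha>(1)] ..
      also have "\<dots> = ennreal (1 / sqrt \<alpha>) * ennreal (exp (- (q - b\<^sup>2 / \<alpha>) / 2))"
        using \<alpha> by (simp add: ennreal_mult [symmetric] exp_add [symmetric] field_simps)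
      also have "\<dots> \<le> ennreal (1 / sqrt \<alpha>) * ennreal (?E d s x)"
      proof -
        have "hform d s (\<lambda>i. of_real (x i)) = hform d a (\<lambda>i. of_real (x i)) - cnj \<beta> * \<beta> / of_real \<alpha>"
        proof -
          have "hform d s (\<lambda>i. of_real (x i)) = hform d a (\<lambda>i. of_real (x i))
             - (\<Sum>i<d. \<Sum>j<d. of_real (x i) * a i d * (a d j * of_real (x j)) / of_real \<alpha>)"
            by (simp add: hform_def s_def sum_subtractf [symmetric] algebra_simps \<alpha>(2))
          also have "(\<Sum>i<d. \<Sum>j<d. of_real (x i) * a i d * (a d j * of_real (x j)) / of_real \<alpha>) = (\<Sum>i<d. of_real (x i) * a i d) * \<beta> / of_real \<alpha>"
            by (simp add: \<beta>_def sum_product sum_divide_distrib)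
          finally show ?thesis by (simp add: cb)
        qed
        moreover have "cnj \<beta> * \<beta> / of_real \<alpha> = of_real ((cmod \<beta>)\<^sup>2 / \<alpha>)"
          using complex_norm_square [of \<beta>] by (simp add: mult.commute)
        ultimately have "Re (hform d s (\<lambda>i. of_real (x i))) = Re (hform d a (\<lambda>i. of_real (x i))) - (cmod \<beta>)\<^sup>2 / \<alpha>"
          by (simp only: minus_complex.sel Re_complex_of_real)
        then have "Re (hform d s (\<lambda>i. of_real (x i))) - (\<Sum>i<d. (x i)\<^sup>2) = q - (cmod \<beta>)\<^sup>2 / \<alpha>"
          by (simp add: q_def)
        moreover have "b\<^sup>2 / \<alpha> \<le> (cmod \<beta>)\<^sup>2 / \<alpha>"
          using \<alpha> by (intro divide_right_mono) (auto simp: b_def cmod_power2)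
        ultimately have "- (q - b\<^sup>2 / \<alpha>) / 2 \<le> - (Re (hform d s (\<lambda>i. of_real (x i))) - (\<Sum>i<d. (x i)\<^sup>2)) / 2"
          by (intro divide_right_mono) linarith+
        then have "?E d s x \<ge> exp (- (q - b\<^sup>2 / \<alpha>) / 2)"
          by (simp only: exp_le_cancel_iff)
        then show ?thesis by (intro mult_left_mono ennreal_leI) auto
      qed
      finally show ?thesis .
    qed
    have "(\<integral>\<^sup>+x. ennreal (?E (Suc d) a x) \<partial>gauss {..<Suc d})
        = (\<integral>\<^sup>+x. \<integral>\<^sup>+y. ennreal (?E (Suc d) a (x(d := y))) \<partial>stdn \<partial>gauss {..<d})"
      unfolding lessThan_Suc using meas [of "Suc d" a, unfolded lessThan_Suc]
      by (intro nn_integral_gauss_insert) auto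
    also have "\<dots> \<le> (\<integral>\<^sup>+x. ennreal (1 / sqrt \<alpha>) * ennreal (?E d s x) \<partial>gauss {..<d})"
      by (intro nn_integral_mono inner)
    also have "\<dots> = ennreal (1 / sqrt \<alpha>) * (\<integral>\<^sup>+x. ennreal (?E d s x) \<partial>gauss {..<d})"
      using meas by (rule nn_integral_cmult)
    also have "\<dots> \<le> ennreal (1 / sqrt \<alpha>) * ennreal (1 / sqrt (Re (det (mat d d (\<lambda>(i, j). s i j)))))"
      by (intro mult_left_mono IH) auto
    also have "\<dots> = ennreal (1 / sqrt (Re (det (mat (Suc d) (Suc d) (\<lambda>(i, j). a i j)))))"
      unfolding det using \<alpha> IH(1) by (simp add: ennreal_mult [symmetric] real_sqrt_mult)
    finally show ?case using det_pos by simp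
qed

section \<open>Second moments against translation invariant weights\<close>

definition shift :: "'i set \<Rightarrow> ('i \<Rightarrow> real) \<Rightarrow> real \<Rightarrow> ('i \<Rightarrow> real) \<Rightarrow> 'i \<Rightarrow> real" where
  "shift I v a x = (\<lambda>i. if i \<in> I then x i + a * v i else x i)"

lemma preserves_gauss_id: "preserves_gauss I (\<lambda>x. x)"
  by (rule preserves_gaussI) auto

text \<open>The map \<open>T\<close> is a reflection that exchanges \<open>w\<close> with the unit vector of the coordinate \<open>k\<close>. It turns translations along
  \<open>w\<close> into changes of a single coordinate, over which one can integrate first.\<close>

lemma gauss_frame:
  assumes I: "finite I" "k \<in> I" and w: "(\<Sum>l\<in>I. (w l)\<^sup>2) = 1"
  obtains T where "preserves_gauss I T"
    "\<And>x. (\<Sum>l\<in>I. w l * T x l) = x k"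
    "\<And>x t. T (x(k := t)) = shift I w (t - x k) (T x)"
proof (cases "w k = 1")
  case True
  have "(\<Sum>l\<in>I - {k}. (w l)\<^sup>2) = 0"
    using w True sum.remove [OF I, of "\<lambda>l. (w l)\<^sup>2"] by simp
  then have z: "w l = 0" if "l \<in> I - {k}" for l
    using that I by (subst (asm) sum_nonneg_eq_0_iff) auto
  have "(\<Sum>l\<in>I. w l * x l) = x k" for x
    using True z sum.remove [OF I, of "\<lambda>l. w l * x l"] by simp
  moreover have "x(k := t) = shift I w (t - x k) x" for x t
    using True z I by (auto simp: shift_def fun_eq_iff)
  ultimately show ?thesis using that [OF preserves_gauss_id] by blast
next
  case False
  have "(w k)\<^sup>2 \<le> 1"
    unfolding w [symmetric] using I by (intro member_le_sum) auto
  then have "w k \<le> 1" by (simp add: power2_le_iff_abs_le abs_le_iff abs_square_le_1)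
  with False have wk: "w k < 1" by simp
  define \<nu> where "\<nu> = sqrt (2 - 2 * w k)"
  have \<nu>: "\<nu> > 0" "\<nu> * \<nu> = 2 - 2 * w k" using wk by (auto simp: \<nu>_def)
  define e where "e = (\<lambda>l. if l = k then 1 else 0 :: real)"
  define u where "u = (\<lambda>l. (e l - w l) / \<nu>)"
  have se: "(\<Sum>l\<in>I. e l * x l) = x k" for x :: "'a \<Rightarrow> real"
  proof -
    have "(\<Sum>l\<in>I. e l * x l) = (\<Sum>l\<in>I. if l = k then x l else 0)"
      by (rule sum.cong) (auto simp: e_def)
    then show ?thesis using I by simp
  qed
  have se': "(\<Sum>l\<in>I. x l * e l) = x k" for x :: "'a \<Rightarrow> real"
    using se [of x] by (simp add: mult.commute)
  have ux: "(\<Sum>l\<in>I. u l * x l) = (x k - (\<Sum>l\<in>I. w l * x l)) / \<nu>" for x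
    using se [of x] by (simp add: u_def sum_divide_distrib [symmetric] left_diff_distrib sum_subtractf)
  have ww: "(\<Sum>l\<in>I. w l * w l) = 1" using w by (simp add: power2_eq_square)
  have wu: "(\<Sum>l\<in>I. w l * u l) = (w k - 1) / \<nu>"
    using se' [of w] ww by (simp add: u_def sum_divide_distrib [symmetric] right_diff_distrib sum_subtractf)
  have uk: "u k = (1 - w k) / \<nu>" by (simp add: u_def e_def)
  have "(\<Sum>l\<in>I. (u l)\<^sup>2) = (\<Sum>l\<in>I. u l * u l)" by (simp add: power2_eq_square)
  also have "\<dots> = ((1 - w k) / \<nu> - (w k - 1) / \<nu>) / \<nu>"
    using ux [of u] wu uk by simp
  also have "\<dots> = (2 - 2 * w k) / (\<nu> * \<nu>)" using \<nu> by (simp add: field_simps)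
  also have "\<dots> = 1" using \<nu> wk by simp
  finally have u1: "(\<Sum>l\<in>I. (u l)\<^sup>2) = 1" .
  define T where "T = reflection I u"
  have T: "T x = (\<lambda>l. if l \<in> I then x l - 2 * ((x k - (\<Sum>l\<in>I. w l * x l)) / \<nu>) * u l else x l)" for x
    unfolding T_def reflection_def ux ..
  have two: "2 * (c / \<nu>) * ((1 - w k) / \<nu>) = c" for c
  proof -
    have "2 * (c / \<nu>) * ((1 - w k) / \<nu>) = c * ((2 - 2 * w k) / (\<nu> * \<nu>))" using \<nu>(1) by (simp add: field_simps)
    also have "(2 - 2 * w k) / (\<nu> * \<nu>) = 1" using \<nu> wk by simp
    finally show ?thesis by simp
  qed
  show ?thesis
  proof (rule that)
    show "preserves_gauss I T" unfolding T_def by (rule preserves_gauss_reflection [OF I(1) u1])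
    fix x :: "'a \<Rightarrow> real"
    define c where "c = x k - (\<Sum>l\<in>I. w l * x l)"
    have "(\<Sum>l\<in>I. w l * T x l) = (\<Sum>l\<in>I. w l * x l - 2 * (c / \<nu>) * (w l * u l))"
      by (rule sum.cong) (auto simp: T c_def algebra_simps)
    also have "\<dots> = (\<Sum>l\<in>I. w l * x l) - 2 * (c / \<nu>) * ((w k - 1) / \<nu>)"
      by (simp only: sum_subtractf sum_distrib_left [symmetric] wu)
    also have "\<dots> = (\<Sum>l\<in>I. w l * x l) + 2 * (c / \<nu>) * ((1 - w k) / \<nu>)"
      using \<nu>(1) by (simp add: field_simps)
    finally show "(\<Sum>l\<in>I. w l * T x l) = x k" unfolding two by (simp add: c_def)
    fix t
    define d where "d = t - x k"
    have wx: "(\<Sum>l\<in>I. w l * (x(k := t)) l) = (\<Sum>l\<in>I. w l * x l) + d * w k"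
    proof -
      have "(\<Sum>l\<in>I. w l * (x(k := t)) l) = (\<Sum>l\<in>I. w l * x l + d * (w l * e l))"
        by (rule sum.cong) (auto simp: e_def d_def algebra_simps)
      then show ?thesis using se' [of w] by (simp add: sum.distrib sum_distrib_left [symmetric])
    qed
    show "T (x(k := t)) = shift I w (t - x k) (T x)"
    proof
      fix l
      show "T (x(k := t)) l = shift I w (t - x k) (T x) l"
      proof (cases "l \<in> I")
        case True
        have "T (x(k := t)) l = (x(k := t)) l - 2 * ((t - ((\<Sum>l\<in>I. w l * x l) + d * w k)) / \<nu>) * u l"
          unfolding T using True wx by simp
        also have "(x(k := t)) l = x l + d * e l" by (simp add: e_def d_def)
        also have "t - ((\<Sum>l\<in>I. w l * x l) + d * w k) = c + d * (1 - w k)"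
          by (simp add: c_def d_def algebra_simps)
        also have "x l + d * e l - 2 * ((c + d * (1 - w k)) / \<nu>) * u l
            = (x l - 2 * (c / \<nu>) * u l) + d * (e l - 2 * ((1 - w k) / \<nu>) * u l)"
          using \<nu>(1) by (simp add: field_simps)
        also have "2 * ((1 - w k) / \<nu>) * u l = 2 * ((e l - w l) / \<nu>) * ((1 - w k) / \<nu>)"
          unfolding u_def by (simp only: mult_ac)
        also have "\<dots> = e l - w l" by (rule two)
        finally show ?thesis using True by (simp add: shift_def T c_def d_def)
      qed (use I in \<open>auto simp: T shift_def\<close>)
    qed
  qed
qed

lemma nn_integral_square_shift_invariant:
  fixes \<psi> :: "('i \<Rightarrow> real) \<Rightarrow> ennreal"
  assumes I: "finite I" and \<psi> [measurable]: "\<psi> \<in> borel_measurable (gauss I)"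
    and inv: "\<And>x a. x \<in> extensional I \<Longrightarrow> \<psi> (shift I v a x) = \<psi> x"
  shows "(\<integral>\<^sup>+x. ennreal ((\<Sum>l\<in>I. v l * x l)\<^sup>2) * \<psi> x \<partial>gauss I) = ennreal (\<Sum>l\<in>I. (v l)\<^sup>2) * (\<integral>\<^sup>+x. \<psi> x \<partial>gauss I)"
proof (cases "(\<Sum>l\<in>I. (v l)\<^sup>2) = 0")
  case True
  then have "v l = 0" if "l \<in> I" for l
    using that I by (subst (asm) sum_nonneg_eq_0_iff) auto
  then have "(\<Sum>l\<in>I. v l * x l) = 0" for x by (simp add: sum.neutral)
  then show ?thesis using True by simp
next
  case False
  then obtain k where k: "k \<in> I" using sum.neutral [of I "\<lambda>l. (v l)\<^sup>2"] by blast
  define \<rho> where "\<rho> = sqrt (\<Sum>l\<in>I. (v l)\<^sup>2)"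
  have \<rho>: "\<rho> > 0" "\<rho>\<^sup>2 = (\<Sum>l\<in>I. (v l)\<^sup>2)"
    using False sum_nonneg [of I "\<lambda>l. (v l)\<^sup>2"] by (auto simp: \<rho>_def order_less_le)
  define w where "w = (\<lambda>l. v l / \<rho>)"
  have w1: "(\<Sum>l\<in>I. (w l)\<^sup>2) = 1"
    using \<rho> False by (simp add: w_def power_divide sum_divide_distrib [symmetric])
  obtain T where T: "preserves_gauss I T" "\<And>x. (\<Sum>l\<in>I. w l * T x l) = x k"
    "\<And>x t. T (x(k := t)) = shift I w (t - x k) (T x)"
    using gauss_frame [OF I k w1] by blast
  have Tm [measurable]: "T \<in> measurable (gauss I) (gauss I)" using T(1) by (simp add: preserves_gauss_def)
  have Text: "T x \<in> extensional I" if "x \<in> extensional I" for x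
    using measurable_space [OF Tm, of x] that by (simp add: space_gauss)
  have vT: "(\<Sum>l\<in>I. v l * T x l) = \<rho> * x k" for x
  proof -
    have "(\<Sum>l\<in>I. v l * T x l) = \<rho> * (\<Sum>l\<in>I. w l * T x l)"
      using \<rho> by (simp add: w_def sum_distrib_left)
    then show ?thesis by (simp add: T(2))
  qed
  have \<psi>T: "\<psi> (T (x(k := t))) = \<psi> (T x)" if "x \<in> extensional I" for x t
  proof -
    have "shift I w (t - x k) (T x) = shift I v ((t - x k) / \<rho>) (T x)"
      by (auto simp: shift_def w_def fun_eq_iff)
    then show ?thesis using inv [OF Text [OF that]] by (simp add: T(3))
  qed
  define J where "J = I - {k}"
  have J: "finite J" "k \<notin> J" "I = insert k J" using I k by (auto simp: J_def)
  have split: "(\<integral>\<^sup>+x. h x \<partial>gauss I) = (\<integral>\<^sup>+x. \<integral>\<^sup>+y. h (x(k := y)) \<partial>stdn \<partial>gauss J)"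
    if "h \<in> borel_measurable (gauss I)" for h :: "_ \<Rightarrow> ennreal"
    using nn_integral_gauss_insert [OF J(1,2), of h] that unfolding J(3) [symmetric] .
  have ext: "x(k := y) \<in> extensional I" if "x \<in> extensional J" for x :: "'i \<Rightarrow> real" and y
    using that k by (auto simp: extensional_def J_def)
  define \<chi> where "\<chi> = (\<lambda>x. \<psi> (T (x(k := 0))))"
  have \<chi>: "\<psi> (T (x(k := y))) = \<chi> x" if "x \<in> space (gauss J)" for x y
    using \<psi>T [OF ext, of x 0 y] that by (simp add: \<chi>_def space_gauss)
  have meas1: "(\<lambda>x. \<psi> (T x)) \<in> borel_measurable (gauss I)" by measurable
  have meas2: "(\<lambda>x. ennreal ((\<rho> * x k)\<^sup>2) * \<psi> (T x)) \<in> borel_measurable (gauss I)" using k by measurable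
  have meas\<chi>: "\<chi> \<in> borel_measurable (gauss J)"
  proof -
    have "(\<lambda>x. x(k := 0)) \<in> measurable (gauss J) (gauss (insert k J))"
      by (intro measurable_gauss_upd measurable_ident_sets refl borel_measurable_const)
    from measurable_compose [OF this [folded J(3)] meas1] show ?thesis by (simp add: \<chi>_def)
  qed
  have "(\<integral>\<^sup>+x. ennreal ((\<Sum>l\<in>I. v l * x l)\<^sup>2) * \<psi> x \<partial>gauss I)
      = (\<integral>\<^sup>+x. ennreal ((\<rho> * x k)\<^sup>2) * \<psi> (T x) \<partial>gauss I)"
    using preserves_gaussD [OF T(1), of "\<lambda>x. ennreal ((\<Sum>l\<in>I. v l * x l)\<^sup>2) * \<psi> x"] by (simp add: vT)
  also have "\<dots> = (\<integral>\<^sup>+x. \<integral>\<^sup>+y. ennreal ((\<rho> * y)\<^sup>2) * \<psi> (T (x(k := y))) \<partial>stdn \<partial>gauss J)"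
    by (subst split [OF meas2]) simp
  also have "\<dots> = (\<integral>\<^sup>+x. ennreal (\<rho>\<^sup>2) * \<chi> x \<partial>gauss J)"
  proof (rule nn_integral_cong)
    fix x assume x: "x \<in> space (gauss J)"
    have "(\<integral>\<^sup>+y. ennreal ((\<rho> * y)\<^sup>2) * \<psi> (T (x(k := y))) \<partial>stdn) = (\<integral>\<^sup>+y. ennreal (\<rho>\<^sup>2) * \<chi> x * ennreal (y\<^sup>2) \<partial>stdn)"
      by (rule nn_integral_cong) (simp add: \<chi> [OF x] power_mult_distrib ennreal_mult mult_ac)
    also have "\<dots> = ennreal (\<rho>\<^sup>2) * \<chi> x * (\<integral>\<^sup>+y. ennreal (y\<^sup>2) \<partial>stdn)"
      by (rule nn_integral_cmult) measurable
    finally show "(\<integral>\<^sup>+y. ennreal ((\<rho> * y)\<^sup>2) * \<psi> (T (x(k := y))) \<partial>stdn) = ennreal (\<rho>\<^sup>2) * \<chi> x"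
      by (simp add: nn_integral_stdn_square)
  qed
  also have "\<dots> = ennreal (\<rho>\<^sup>2) * (\<integral>\<^sup>+x. \<chi> x \<partial>gauss J)"
    by (rule nn_integral_cmult [OF meas\<chi>])
  also have "(\<integral>\<^sup>+x. \<chi> x \<partial>gauss J) = (\<integral>\<^sup>+x. \<integral>\<^sup>+y. \<psi> (T (x(k := y))) \<partial>stdn \<partial>gauss J)"
    using stdn.emeasure_space_1 by (intro nn_integral_cong) (simp add: \<chi>)
  also have "\<dots> = (\<integral>\<^sup>+x. \<psi> x \<partial>gauss I)"
    using split [OF meas1] preserves_gaussD [OF T(1) \<psi>] by simp
  finally show ?thesis by (simp add: \<rho>)
qed

lemma gauss_square_shift_invariant:
  fixes \<phi> :: "('i \<Rightarrow> real) \<Rightarrow> real"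
  assumes I: "finite I" and \<phi> [measurable]: "\<phi> \<in> borel_measurable (gauss I)" and B: "\<And>x. \<bar>\<phi> x\<bar> \<le> B"
    and inv: "\<And>x a. x \<in> extensional I \<Longrightarrow> \<phi> (shift I v a x) = \<phi> x"
  shows "has_bochner_integral (gauss I) (\<lambda>x. (\<Sum>l\<in>I. v l * x l)\<^sup>2 * \<phi> x) ((\<Sum>l\<in>I. (v l)\<^sup>2) * (\<integral>x. \<phi> x \<partial>gauss I))"
proof -
  interpret prob_space "gauss I" by (rule prob_space_gauss)
  have pos: "has_bochner_integral (gauss I) (\<lambda>x. (\<Sum>l\<in>I. v l * x l)\<^sup>2 * \<psi> x) ((\<Sum>l\<in>I. (v l)\<^sup>2) * (\<integral>x. \<psi> x \<partial>gauss I))"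
    if \<psi> [measurable]: "\<psi> \<in> borel_measurable (gauss I)" and b: "\<And>x. 0 \<le> \<psi> x" "\<And>x. \<psi> x \<le> C"
      and inv: "\<And>x a. x \<in> extensional I \<Longrightarrow> \<psi> (shift I v a x) = \<psi> x" for \<psi> C
  proof (rule has_bochner_integral_nn_integral)
    have int: "integrable (gauss I) \<psi>"
      by (rule integrable_const_bound [where B = C]) (use b in auto)
    have "(\<integral>\<^sup>+x. ennreal ((\<Sum>l\<in>I. v l * x l)\<^sup>2 * \<psi> x) \<partial>gauss I) = (\<integral>\<^sup>+x. ennreal ((\<Sum>l\<in>I. v l * x l)\<^sup>2) * ennreal (\<psi> x) \<partial>gauss I)"
      using b by (simp add: ennreal_mult)
    also have "\<dots> = ennreal (\<Sum>l\<in>I. (v l)\<^sup>2) * (\<integral>\<^sup>+x. ennreal (\<psi> x) \<partial>gauss I)"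
      by (rule nn_integral_square_shift_invariant [OF I]) (auto simp: inv)
    also have "(\<integral>\<^sup>+x. ennreal (\<psi> x) \<partial>gauss I) = ennreal (\<integral>x. \<psi> x \<partial>gauss I)"
      using b by (intro nn_integral_eq_integral int) auto
    finally show "(\<integral>\<^sup>+x. ennreal ((\<Sum>l\<in>I. v l * x l)\<^sup>2 * \<psi> x) \<partial>gauss I) = ennreal ((\<Sum>l\<in>I. (v l)\<^sup>2) * (\<integral>x. \<psi> x \<partial>gauss I))"
      using b by (simp add: ennreal_mult sum_nonneg)
    show "0 \<le> (\<Sum>l\<in>I. (v l)\<^sup>2) * (\<integral>x. \<psi> x \<partial>gauss I)"
      using b by (intro mult_nonneg_nonneg sum_nonneg integral_nonneg_AE) auto
  qed (use b in auto)
  have B': "0 \<le> \<phi> x + B" "\<phi> x + B \<le> 2 * B" "0 \<le> B" for x using B [of x] by linarith+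
  have 1: "has_bochner_integral (gauss I) (\<lambda>x. (\<Sum>l\<in>I. v l * x l)\<^sup>2 * (\<phi> x + B)) ((\<Sum>l\<in>I. (v l)\<^sup>2) * (\<integral>x. \<phi> x + B \<partial>gauss I))"
    by (rule pos [of "\<lambda>x. \<phi> x + B" "2 * B"]) (use B' inv in auto)
  have 2: "has_bochner_integral (gauss I) (\<lambda>x. (\<Sum>l\<in>I. v l * x l)\<^sup>2 * B) ((\<Sum>l\<in>I. (v l)\<^sup>2) * (\<integral>x. B \<partial>gauss I))"
    by (rule pos [of "\<lambda>x. B" B]) (use B' in auto)
  have int: "integrable (gauss I) \<phi>"
    by (rule integrable_const_bound [where B = B]) (use B in auto)
  show ?thesis
    using has_bochner_integral_diff [OF 1 2] int by (simp add: algebra_simps prob_space)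
qed

lemma shift_add: "shift I (\<lambda>l. v l + w l) a x = shift I v a (shift I w a x)"
  by (auto simp: shift_def algebra_simps)

lemma shift_minus: "shift I (\<lambda>l. v l - w l) a x = shift I v a (shift I w (- a) x)"
  by (auto simp: shift_def algebra_simps)

lemma shift_ext: "x \<in> extensional I \<Longrightarrow> shift I v a x \<in> extensional I"
  by (auto simp: shift_def extensional_def)

lemma gauss_covariance_real:
  fixes \<phi> :: "('i \<Rightarrow> real) \<Rightarrow> real"
  assumes I: "finite I" and \<phi>: "\<phi> \<in> borel_measurable (gauss I)" and B: "\<And>x. \<bar>\<phi> x\<bar> \<le> B"
    and v: "\<And>x a. x \<in> extensional I \<Longrightarrow> \<phi> (shift I v a x) = \<phi> x"
    and w: "\<And>x a. x \<in> extensional I \<Longrightarrow> \<phi> (shift I w a x) = \<phi> x"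
  shows "has_bochner_integral (gauss I) (\<lambda>x. (\<Sum>l\<in>I. v l * x l) * (\<Sum>l\<in>I. w l * x l) * \<phi> x)
    ((\<Sum>l\<in>I. v l * w l) * (\<integral>x. \<phi> x \<partial>gauss I))"
proof -
  have 1: "has_bochner_integral (gauss I) (\<lambda>x. (\<Sum>l\<in>I. (v l + w l) * x l)\<^sup>2 * \<phi> x) ((\<Sum>l\<in>I. (v l + w l)\<^sup>2) * (\<integral>x. \<phi> x \<partial>gauss I))"
    by (rule gauss_square_shift_invariant [OF I \<phi> B]) (simp add: shift_add v w shift_ext)
  have 2: "has_bochner_integral (gauss I) (\<lambda>x. (\<Sum>l\<in>I. (v l - w l) * x l)\<^sup>2 * \<phi> x) ((\<Sum>l\<in>I. (v l - w l)\<^sup>2) * (\<integral>x. \<phi> x \<partial>gauss I))"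
    by (rule gauss_square_shift_invariant [OF I \<phi> B]) (simp add: shift_minus v w shift_ext)
  have p: "((a + b)\<^sup>2 * c - (a - b)\<^sup>2 * c) / 4 = a * b * c" for a b c :: real
    by (simp add: power2_eq_square algebra_simps)
  have s: "(\<Sum>l\<in>I. (v l + w l) * x l) = (\<Sum>l\<in>I. v l * x l) + (\<Sum>l\<in>I. w l * x l)"
    "(\<Sum>l\<in>I. (v l - w l) * x l) = (\<Sum>l\<in>I. v l * x l) - (\<Sum>l\<in>I. w l * x l)" for x
    by (simp_all add: sum.distrib sum_subtractf algebra_simps)
  have s2: "((\<Sum>l\<in>I. (v l + w l)\<^sup>2) * c - (\<Sum>l\<in>I. (v l - w l)\<^sup>2) * c) / 4 = (\<Sum>l\<in>I. v l * w l) * c" for c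
  proof -
    have "(\<Sum>l\<in>I. (v l + w l)\<^sup>2) - (\<Sum>l\<in>I. (v l - w l)\<^sup>2) = 4 * (\<Sum>l\<in>I. v l * w l)"
      unfolding sum_subtractf [symmetric] sum_distrib_left by (rule sum.cong) (auto simp: power2_eq_square algebra_simps)
    then show ?thesis by (simp add: left_diff_distrib [symmetric])
  qed
  show ?thesis
    using has_bochner_integral_divide_zero [OF has_bochner_integral_diff [OF 1 2], of 4]
    unfolding s p s2 .
qed

text \<open>A weight that is invariant under translations along the real and the imaginary parts of \<open>a\<close> and \<open>b\<close> behaves as if it were
  independent of the two linear forms, although it may depend on \<open>x\<close> in any other way.\<close>

lemma gauss_covariance:
  fixes \<phi> :: "('i \<Rightarrow> real) \<Rightarrow> complex" and a b :: "'i \<Rightarrow> complex"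
  assumes I: "finite I" and \<phi> [measurable]: "\<phi> \<in> borel_measurable (gauss I)" and B: "\<And>x. cmod (\<phi> x) \<le> B"
    and inv: "\<And>c x s. c \<in> {a, b} \<Longrightarrow> x \<in> extensional I \<Longrightarrow> \<phi> (shift I (\<lambda>l. Re (c l)) s x) = \<phi> x"
      "\<And>c x s. c \<in> {a, b} \<Longrightarrow> x \<in> extensional I \<Longrightarrow> \<phi> (shift I (\<lambda>l. Im (c l)) s x) = \<phi> x"
  shows "has_bochner_integral (gauss I)
      (\<lambda>x. (\<Sum>l\<in>I. a l * of_real (x l)) * cnj (\<Sum>l\<in>I. b l * of_real (x l)) * \<phi> x)
      ((\<Sum>l\<in>I. a l * cnj (b l)) * (\<integral>x. \<phi> x \<partial>gauss I))"
proof -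
  interpret prob_space "gauss I" by (rule prob_space_gauss)
  have int: "integrable (gauss I) \<phi>"
    by (rule integrable_const_bound [where B = B]) (use B in auto)
  have real: "has_bochner_integral (gauss I)
      (\<lambda>x. of_real (\<Sum>l\<in>I. v l * x l) * of_real (\<Sum>l\<in>I. w l * x l) * \<phi> x)
      (of_real (\<Sum>l\<in>I. v l * w l) * (\<integral>x. \<phi> x \<partial>gauss I))"
    if v: "\<And>x s. x \<in> extensional I \<Longrightarrow> \<phi> (shift I v s x) = \<phi> x"
      and w: "\<And>x s. x \<in> extensional I \<Longrightarrow> \<phi> (shift I w s x) = \<phi> x" for v w
  proof -
    have R: "has_bochner_integral (gauss I) (\<lambda>x. (\<Sum>l\<in>I. v l * x l) * (\<Sum>l\<in>I. w l * x l) * Re (\<phi> x)) ((\<Sum>l\<in>I. v l * w l) * (\<integral>x. Re (\<phi> x) \<partial>gauss I))"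
      by (rule gauss_covariance_real [OF I, where B = B]) (use order_trans [OF abs_Re_le_cmod B] in \<open>auto simp: v w\<close>)
    have M: "has_bochner_integral (gauss I) (\<lambda>x. (\<Sum>l\<in>I. v l * x l) * (\<Sum>l\<in>I. w l * x l) * Im (\<phi> x)) ((\<Sum>l\<in>I. v l * w l) * (\<integral>x. Im (\<phi> x) \<partial>gauss I))"
      by (rule gauss_covariance_real [OF I, where B = B]) (use order_trans [OF abs_Im_le_cmod B] in \<open>auto simp: v w\<close>)
    have e: "(\<lambda>x. of_real (\<Sum>l\<in>I. v l * x l) * of_real (\<Sum>l\<in>I. w l * x l) * \<phi> x)
       = (\<lambda>x. of_real ((\<Sum>l\<in>I. v l * x l) * (\<Sum>l\<in>I. w l * x l) * Re (\<phi> x)) + \<i> * of_real ((\<Sum>l\<in>I. v l * x l) * (\<Sum>l\<in>I. w l * x l) * Im (\<phi> x)))"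
      by (rule ext) (simp only: complex_eq_iff, simp)
    have "of_real (\<Sum>l\<in>I. v l * w l) * (\<integral>x. \<phi> x \<partial>gauss I)
       = of_real ((\<Sum>l\<in>I. v l * w l) * (\<integral>x. Re (\<phi> x) \<partial>gauss I)) + \<i> * of_real ((\<Sum>l\<in>I. v l * w l) * (\<integral>x. Im (\<phi> x) \<partial>gauss I))"
      using int by (simp add: complex_eq_iff)
    then show ?thesis
      using has_bochner_integral_add [OF has_bochner_integral_of_real [OF R]
          has_bochner_integral_mult_right [OF has_bochner_integral_of_real [OF M], of \<i>]] unfolding e by simp
  qed
  let ?L = "\<lambda>v x. complex_of_real (\<Sum>l\<in>I. v l * x l)"
  let ?ar = "\<lambda>l. Re (a l)" and ?ai = "\<lambda>l. Im (a l)" and ?br = "\<lambda>l. Re (b l)" and ?bi = "\<lambda>l. Im (b l)"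
  have La: "(\<Sum>l\<in>I. c l * of_real (x l)) = ?L (\<lambda>l. Re (c l)) x + \<i> * ?L (\<lambda>l. Im (c l)) x" for c x
    by (simp add: complex_eq_iff)
  have e: "(\<lambda>x. (\<Sum>l\<in>I. a l * of_real (x l)) * cnj (\<Sum>l\<in>I. b l * of_real (x l)) * \<phi> x)
     = (\<lambda>x. (?L ?ar x * ?L ?br x * \<phi> x + ?L ?ai x * ?L ?bi x * \<phi> x)
         + (\<i> * (?L ?ai x * ?L ?br x * \<phi> x) - \<i> * (?L ?ar x * ?L ?bi x * \<phi> x)))"
    unfolding La by (rule ext) (simp add: algebra_simps)
  have s: "(\<Sum>l\<in>I. a l * cnj (b l)) * c = (of_real (\<Sum>l\<in>I. ?ar l * ?br l) * c + of_real (\<Sum>l\<in>I. ?ai l * ?bi l) * c)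
         + (\<i> * (of_real (\<Sum>l\<in>I. ?ai l * ?br l) * c) - \<i> * (of_real (\<Sum>l\<in>I. ?ar l * ?bi l) * c))" for c
  proof -
    have "(\<Sum>l\<in>I. a l * cnj (b l)) = of_real (\<Sum>l\<in>I. ?ar l * ?br l) + of_real (\<Sum>l\<in>I. ?ai l * ?bi l)
         + (\<i> * of_real (\<Sum>l\<in>I. ?ai l * ?br l) - \<i> * of_real (\<Sum>l\<in>I. ?ar l * ?bi l))"
      by (simp add: complex_eq_iff sum.distrib sum_subtractf)
    then show ?thesis by (simp only:) (simp add: algebra_simps)
  qed
  show ?thesis
    unfolding e s
    by (intro has_bochner_integral_add has_bochner_integral_diff has_bochner_integral_mult_right real inv) auto
qed

section \<open>Polynomials do not vanish on sets of positive Gaussian measure\<close>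

lemma AE_stdn_not_in_finite: "finite A \<Longrightarrow> AE t in stdn. t \<notin> A"
proof -
  assume "finite A"
  then have "AE t in lborel. t \<notin> A" by (intro AE_not_in finite_imp_null_set_lborel)
  then show ?thesis unfolding stdn_def by (subst AE_density) auto
qed

lemma AE_gauss_insert:
  assumes "finite I" "i \<notin> I" and m: "{x \<in> space (gauss (insert i I)). \<not> Q x} \<in> sets (gauss (insert i I))"
    and ae: "AE x in gauss I. AE y in stdn. Q (x(i := y))"
  shows "AE x in gauss (insert i I). Q x"
proof -
  let ?N = "{x \<in> space (gauss (insert i I)). \<not> Q x}"
  have "emeasure (gauss (insert i I)) ?N = (\<integral>\<^sup>+x. indicator ?N x \<partial>gauss (insert i I))"
    using m by simp
  also have "\<dots> = (\<integral>\<^sup>+x. \<integral>\<^sup>+y. indicator ?N (x(i := y)) \<partial>stdn \<partial>gauss I)"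
    using m by (intro nn_integral_gauss_insert assms(1,2)) simp
  also have "\<dots> = (\<integral>\<^sup>+x. 0 \<partial>gauss I)"
  proof (rule nn_integral_cong_AE)
    show "AE x in gauss I. (\<integral>\<^sup>+y. indicator ?N (x(i := y)) \<partial>stdn) = 0"
      using ae
    proof (rule AE_mp, intro AE_I2 impI)
      fix x assume "AE y in stdn. Q (x(i := y))"
      then have "AE y in stdn. indicator ?N (x(i := y)) = (0::ennreal)"
        by (rule AE_mp) (auto simp: indicator_def intro!: AE_I2)
      then have "(\<integral>\<^sup>+y. indicator ?N (x(i := y)) \<partial>stdn) = (\<integral>\<^sup>+y. 0 \<partial>stdn)"
        by (rule nn_integral_cong_AE)
      then show "(\<integral>\<^sup>+y. indicator ?N (x(i := y)) \<partial>stdn) = 0" by simp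
    qed
  qed
  finally have "emeasure (gauss (insert i I)) ?N = 0" by simp
  then show ?thesis using m by (intro AE_I [of _ _ ?N]) auto
qed

text \<open>By induction on the number of coordinates: for almost all values of the others the polynomial in one coordinate is
  not 0, and then it has finitely many roots.\<close>

lemma AE_gauss_polynomial_nonzero:
  fixes f :: "('i \<Rightarrow> real) \<Rightarrow> complex"
  assumes I: "finite I" and f: "f \<in> borel_measurable (gauss I)"
    and poly: "\<And>x i. i \<in> I \<Longrightarrow> \<exists>q. \<forall>t. f (x(i := t)) = poly q (of_real t)"
    and x0: "x0 \<in> extensional I" "f x0 \<noteq> 0"
  shows "AE x in gauss I. f x \<noteq> 0"
proof -
  define mix where "mix = (\<lambda>J x i. if i \<in> J then x i else x0 i :: real)"
  have mixm: "mix J \<in> measurable (gauss J) (gauss I)" if "J \<subseteq> I" for J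
    unfolding gauss_def
  proof (rule measurable_PiM_single')
    show "mix J \<in> space (PiM J (\<lambda>_. stdn)) \<rightarrow> (\<Pi>\<^sub>E i\<in>I. space stdn)"
      using that x0(1) by (auto simp: mix_def extensional_def)
    fix i assume "i \<in> I"
    show "(\<lambda>x. mix J x i) \<in> measurable (PiM J (\<lambda>_. stdn)) stdn"
      by (cases "i \<in> J") (simp_all add: mix_def)
  qed
  have "AE x in gauss J. f (mix J x) \<noteq> 0" if "J \<subseteq> I" for J
    using finite_subset [OF that I] that
  proof (induction J rule: finite_induct)
    case empty
    have "mix {} x = x0" for x by (simp add: mix_def)
    then show ?case using x0(2) by simp
  next
    case (insert i J)
    have IH: "AE x in gauss J. f (mix J x) \<noteq> 0" using insert by auto
    have fm: "(\<lambda>x. f (mix (insert i J) x)) \<in> borel_measurable (gauss (insert i J))"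
      by (rule measurable_compose [OF mixm [OF insert.prems] f])
    show ?case
    proof (rule AE_gauss_insert [OF insert.hyps])
      show "{x \<in> space (gauss (insert i J)). \<not> f (mix (insert i J) x) \<noteq> 0} \<in> sets (gauss (insert i J))"
        using measurable_sets [OF fm, of "{0}"] by (simp add: vimage_def Int_def conj_commute)
      show "AE x in gauss J. AE y in stdn. f (mix (insert i J) (x(i := y))) \<noteq> 0"
        using IH
      proof eventually_elim
        case nz: (elim x)
        have m: "mix (insert i J) (x(i := y)) = (mix J x)(i := y)" for y
          using insert.hyps by (auto simp: mix_def)
        obtain q where q: "\<And>t. f ((mix J x)(i := t)) = poly q (of_real t)"
          using poly [of i "mix J x"] insert.prems by auto
        have "mix J x = (mix J x)(i := x0 i)" using insert.hyps by (auto simp: mix_def)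
        then have "poly q (of_real (x0 i)) \<noteq> 0" using nz q [of "x0 i"] by simp
        then have "q \<noteq> 0" by auto
        then have "finite {z. poly q z = 0}" by (rule poly_roots_finite)
        then have "finite (of_real -` {z. poly q z = 0} :: real set)"
          by (rule finite_vimageI) (simp add: inj_on_def)
        from AE_stdn_not_in_finite [OF this]
        show ?case
          by (simp add: m q)
      qed
    qed
  qed
  from this [of I] have "AE x in gauss I. f (mix I x) \<noteq> 0" by simp
  moreover have "mix I x = x" if "x \<in> space (gauss I)" for x
    using that x0(1) by (auto simp: mix_def space_gauss extensional_def fun_eq_iff)
  ultimately show ?thesis by (auto elim!: AE_mp intro!: AE_I2)
qed

section \<open>Elementary integrals\<close>

lemma nn_integral_exp_times:
  assumes S: "S > 0"
  shows "(\<integral>\<^sup>+t. ennreal (t * exp (- (t * S))) * indicator {0..} t \<partial>lborel) = ennreal (1 / S\<^sup>2)"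
proof -
  have "(\<integral>\<^sup>+t. ennreal (t * exp (- (t * S))) * indicator {0..} t \<partial>lborel)
      = 0 - (\<lambda>t. - (t / S + 1 / S\<^sup>2) * exp (- (t * S))) 0"
  proof (rule nn_integral_FTC_atLeast)
    fix t :: real
    show "((\<lambda>t. - (t / S + 1 / S\<^sup>2) * exp (- (t * S))) has_real_derivative t * exp (- (t * S))) (at t)"
      using S by (auto intro!: derivative_eq_intros simp: field_simps power2_eq_square)
    show "0 \<le> t \<Longrightarrow> 0 \<le> t * exp (- (t * S))" by simp
    show "((\<lambda>t. - (t / S + 1 / S\<^sup>2) * exp (- (t * S))) \<longlongrightarrow> 0) at_top"
      using S by real_asymp
  qed simp
  then show ?thesis by simp
qed

lemma nn_integral_exp_decay:
  assumes S: "S > 0"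
  shows "(\<integral>\<^sup>+t. ennreal (exp (- (t * S))) * indicator {0..} t \<partial>lborel) = ennreal (1 / S)"
proof -
  have "(\<integral>\<^sup>+t. ennreal (exp (- (t * S))) * indicator {0..} t \<partial>lborel)
      = 0 - (\<lambda>t. - exp (- (t * S)) / S) 0"
  proof (rule nn_integral_FTC_atLeast)
    fix t :: real
    show "((\<lambda>t. - exp (- (t * S)) / S) has_real_derivative exp (- (t * S))) (at t)"
      using S by (auto intro!: derivative_eq_intros simp: field_simps)
    show "((\<lambda>t. - exp (- (t * S)) / S) \<longlongrightarrow> 0) at_top"
      using S by real_asymp
  qed simp_all
  then show ?thesis by simp
qed

lemma has_real_derivative_affine_powr:
  "0 \<le> t \<Longrightarrow> ((\<lambda>t. (1 + 2 * t) powr a) has_real_derivative 2 * a * (1 + 2 * t) powr (a - 1)) (at t)"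
  for t a :: real
  using DERIV_fun_powr [of "\<lambda>t. 1 + 2 * t" 2 t a] by (auto intro!: derivative_eq_intros simp: mult_ac)

lemma tendsto_affine_powr: "a < 0 \<Longrightarrow> ((\<lambda>t::real. (1 + 2 * t) powr a) \<longlongrightarrow> 0) at_top"
  by (rule tendsto_neg_powr) (assumption, real_asymp)

lemma nn_integral_powr_decay:
  fixes k :: real
  assumes k: "k > 2"
  shows "(\<integral>\<^sup>+t. ennreal ((1 + 2 * t) powr (- (k / 2))) * indicator {0..} t \<partial>lborel) = ennreal (1 / (k - 2))"
proof -
  let ?F = "\<lambda>t::real. - (1 / (k - 2)) * (1 + 2 * t) powr (1 - k / 2)"
  have "(\<integral>\<^sup>+t. ennreal ((1 + 2 * t) powr (- (k / 2))) * indicator {0..} t \<partial>lborel) = 0 - ?F 0"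
  proof (rule nn_integral_FTC_atLeast)
    show "(?F \<longlongrightarrow> 0) at_top"
      using tendsto_mult_right_zero [OF tendsto_affine_powr, of "1 - k / 2" "- (1 / (k - 2))"] k by simp
  next
    fix t :: real assume t: "0 \<le> t"
    have "- (1 / (k - 2)) * (2 * (1 - k / 2)) = 1" using k by (simp add: field_simps)
    then have e: "- (1 / (k - 2)) * (2 * (1 - k / 2) * (1 + 2 * t) powr (1 - k / 2 - 1)) = (1 + 2 * t) powr (- (k / 2))"
      by (simp only: mult.assoc [symmetric]) simp
    show "(?F has_real_derivative (1 + 2 * t) powr (- (k / 2))) (at t)"
      using DERIV_cmult [OF has_real_derivative_affine_powr [OF t, of "1 - k / 2"], of "- (1 / (k - 2))"] unfolding e .
  qed simp_all
  then show ?thesis by simp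
qed

lemma nn_integral_powr_decay_times:
  fixes k :: real
  assumes k: "k > 2"
  shows "(\<integral>\<^sup>+t. ennreal (t * (1 + 2 * t) powr (- (k / 2) - 1)) * indicator {0..} t \<partial>lborel) = ennreal (1 / (k * (k - 2)))"
proof -
  let ?F = "\<lambda>t::real. 1 / (2 * k) * (1 + 2 * t) powr (- (k / 2)) - 1 / (2 * (k - 2)) * (1 + 2 * t) powr (1 - k / 2)"
  have "(\<integral>\<^sup>+t. ennreal (t * (1 + 2 * t) powr (- (k / 2) - 1)) * indicator {0..} t \<partial>lborel) = 0 - ?F 0"
  proof (rule nn_integral_FTC_atLeast)
    show "(?F \<longlongrightarrow> 0) at_top"
      using tendsto_diff [OF tendsto_mult_right_zero [OF tendsto_affine_powr, of "- (k / 2)" "1 / (2 * k)"]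
          tendsto_mult_right_zero [OF tendsto_affine_powr, of "1 - k / 2" "1 / (2 * (k - 2))"]] k by simp
  next
    fix t :: real assume t: "0 \<le> t"
    let ?p = "(1 + 2 * t) powr (- (k / 2) - 1)"
    have "(1 + 2 * t) powr (- (k / 2)) = (1 + 2 * t) powr (1 + (- (k / 2) - 1))" by simp
    also have "\<dots> = (1 + 2 * t) * ?p"
      using t by (subst powr_add) simp
    finally have p: "(1 + 2 * t) powr (- (k / 2)) = (1 + 2 * t) * ?p" .
    have "1 / (2 * k) * (2 * (- (k / 2)) * ?p) - 1 / (2 * (k - 2)) * (2 * (1 - k / 2) * (1 + 2 * t) powr (1 - k / 2 - 1))
        = - ?p / 2 + (1 + 2 * t) powr (- (k / 2)) / 2"
    proof -
      have a: "1 / (2 * k) * 2 * (- (k / 2)) = - 1 / 2" "1 / (2 * (k - 2)) * 2 * (1 - k / 2) = - 1 / 2"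
        using k by (simp_all add: field_simps)
      have b: "1 - k / 2 - 1 = - (k / 2)" by simp
      show ?thesis unfolding mult.assoc [symmetric] a b by simp
    qed
    also have "\<dots> = t * ?p" unfolding p by (simp add: algebra_simps)
    finally have e: "1 / (2 * k) * (2 * (- (k / 2)) * ?p) - 1 / (2 * (k - 2)) * (2 * (1 - k / 2) * (1 + 2 * t) powr (1 - k / 2 - 1)) = t * ?p" .
    show "(?F has_real_derivative t * ?p) (at t)"
      using DERIV_diff [OF DERIV_cmult [OF has_real_derivative_affine_powr [OF t, of "- (k / 2)"], of "1 / (2 * k)"]
          DERIV_cmult [OF has_real_derivative_affine_powr [OF t, of "1 - k / 2"], of "1 / (2 * (k - 2))"]]
      unfolding e .
    show "0 \<le> t * ?p" using t by simp
  qed simp_all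
  also have "0 - ?F 0 = 1 / (k * (k - 2))" using k by (simp add: field_simps)
  finally show ?thesis .
qed

section \<open>Gaussian vectors and complex projections\<close>

definition colm :: "nat \<Rightarrow> (nat \<Rightarrow> complex) \<Rightarrow> complex mat" where
  "colm d v = mat d 1 (\<lambda>(i, j). v i)"

lemma colm_carrier [simp]: "colm d v \<in> carrier_mat d 1" "colm d v \<in> carrier_mat d (Suc 0)"
  by (simp_all add: colm_def)

lemma dim_colm [simp]: "dim_row (colm d v) = d" "dim_col (colm d v) = 1"
  by (simp_all add: colm_def)

lemma index_colm [simp]: "i < d \<Longrightarrow> j < 1 \<Longrightarrow> colm d v $$ (i, j) = v i"
  by (simp add: colm_def)

lemma frob_norm_colm: "(frob_norm (colm d v))\<^sup>2 = (\<Sum>i<d. (cmod (v i))\<^sup>2)"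
  by (subst frob_norm_square [OF colm_carrier(1)]) simp

lemma mtrace_colm: "mtrace (mat_adjoint (colm d a) * colm d v) = (\<Sum>i<d. cnj (a i) * v i)"
  by (subst mtrace_mult_sum [of _ 1 d]) simp_all

lemma hform_mtrace:
  assumes M: "M \<in> carrier_mat d d"
  shows "hform d (\<lambda>i j. M $$ (i, j)) v = mtrace (mat_adjoint (colm d v) * (M * colm d v))"
proof -
  have "mtrace (mat_adjoint (colm d v) * (M * colm d v)) = (\<Sum>i<d. cnj (v i) * (M * colm d v) $$ (i, 0))"
    using mult_carrier_mat [OF M colm_carrier(1)] by (subst mtrace_mult_sum [of _ 1 d]) simp_all
  also have "\<dots> = (\<Sum>i<d. cnj (v i) * (\<Sum>j<d. M $$ (i, j) * v j))"
    by (intro sum.cong refl, subst index_mult_mat_sum [OF M colm_carrier(1)]) simp_all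
  finally show ?thesis by (simp add: hform_def sum_distrib_left mult.assoc)
qed

lemma hform_proj:
  assumes P: "is_proj d P"
  shows "hform d (\<lambda>i j. P $$ (i, j)) v = of_real ((frob_norm (P * colm d v))\<^sup>2)"
proof -
  have Pc: "P \<in> carrier_mat d d" and Pa: "mat_adjoint P = P" using P by (auto simp: is_proj_def)
  have PZ: "P * colm d v \<in> carrier_mat d 1" by (rule mult_carrier_mat [OF Pc colm_carrier(1)])
  have Z': "mat_adjoint (colm d v) \<in> carrier_mat 1 d" by simp
  have "mat_adjoint (P * colm d v) * (P * colm d v) = mat_adjoint (colm d v) * P * (P * colm d v)"
    unfolding mat_adjoint_mult [OF Pc colm_carrier(1)] Pa ..
  also have "\<dots> = mat_adjoint (colm d v) * (P * (P * colm d v))"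
    by (rule assoc_mult_mat [OF Z' Pc PZ])
  also have "\<dots> = mat_adjoint (colm d v) * (P * colm d v)"
    unfolding is_proj_cancel [OF P colm_carrier(1)] ..
  finally show ?thesis
    unfolding mtrace_adjoint_mult [OF PZ, symmetric] hform_mtrace [OF Pc] by (rule arg_cong [OF sym])
qed

lemma proj_inner_le:
  assumes P: "is_proj d P" and Pa: "P * colm d a = colm d a" and a: "(\<Sum>i<d. (cmod (a i))\<^sup>2) \<le> 1"
  shows "(cmod (\<Sum>i<d. cnj (a i) * v i))\<^sup>2 \<le> (frob_norm (P * colm d v))\<^sup>2"
proof -
  have Pc: "P \<in> carrier_mat d d" and Pad: "mat_adjoint P = P" using P by (auto simp: is_proj_def)
  have Z': "mat_adjoint (colm d a) \<in> carrier_mat 1 d" by simp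
  have "mat_adjoint (colm d a) = mat_adjoint (P * colm d a)" by (simp only: Pa)
  also have "\<dots> = mat_adjoint (colm d a) * P" unfolding mat_adjoint_mult [OF Pc colm_carrier(1)] Pad ..
  finally have "(\<Sum>i<d. cnj (a i) * v i) = mtrace (mat_adjoint (colm d a) * P * colm d v)"
    by (simp only: mtrace_colm [symmetric])
  also have "\<dots> = mtrace (mat_adjoint (colm d a) * (P * colm d v))"
    unfolding assoc_mult_mat [OF Z' Pc colm_carrier(1)] ..
  finally have "cmod (\<Sum>i<d. cnj (a i) * v i) \<le> frob_norm (mat_adjoint (colm d a)) * frob_norm (P * colm d v)"
    using cmod_mtrace_mult_le [OF Z' mult_carrier_mat [OF Pc colm_carrier(1), of v]] by simp
  also have "\<dots> \<le> 1 * frob_norm (P * colm d v)"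
  proof (rule mult_right_mono)
    show "frob_norm (mat_adjoint (colm d a)) \<le> 1"
      using a unfolding frob_norm_adjoint frob_norm_colm [symmetric] by (simp add: abs_square_le_1)
  qed simp
  finally show ?thesis by (intro power_mono) simp_all
qed

text \<open>The exponential moments of a complex projection of a real Gaussian vector are bounded as if the
  projection were real: this is \<open>gauss_integral_hform_le\<close> for \<open>1 + 2 t P - s a a\<^sup>*\<close>, whose
  determinant is \<open>(1 + 2 t)\<^sup>k (1 - s / (1 + 2 t))\<close>.\<close>

lemma gauss_exp_moment_le:
  assumes P: "is_proj d P" and k: "mtrace P = of_nat k"
    and a: "P * colm d a = colm d a" "(\<Sum>i<d. (cmod (a i))\<^sup>2) = 1 \<or> (\<forall>i<d. a i = 0)"
    and t: "0 \<le> t" and s: "0 \<le> s" "s < 1 + 2 * t"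
  shows "(\<integral>\<^sup>+x. ennreal (exp (- (t * (frob_norm (P * colm d (\<lambda>i. of_real (x i))))\<^sup>2)
      + s / 2 * (cmod (\<Sum>i<d. cnj (a i) * of_real (x i)))\<^sup>2)) \<partial>gauss {..<d})
    \<le> ennreal (1 / sqrt ((1 + 2 * t) ^ k * (if \<forall>i<d. a i = 0 then 1 else 1 - s / (1 + 2 * t))))"
proof -
  have Pc: "P \<in> carrier_mat d d" and Pa: "mat_adjoint P = P" using P by (auto simp: is_proj_def)
  note dP = carrier_matD [OF Pc]
  have a1: "(\<Sum>i<d. (cmod (a i))\<^sup>2) \<le> 1" using a(2) by (auto simp: sum.neutral)
  define h where "h = (\<lambda>i j. (if i = j then 1 else 0) + 2 * of_real t * P $$ (i, j) - of_real s * (a i * cnj (a j)))"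
  have one: "(\<Sum>j<d. cnj (v i) * (if i = j then 1 else 0) * v j) = of_real ((cmod (v i))\<^sup>2)" if "i < d" for v i
  proof -
    have "(\<Sum>j<d. cnj (v i) * (if i = j then 1 else 0) * v j) = (\<Sum>j<d. if j = i then cnj (v i) * v i else 0)"
      by (rule sum.cong) auto
    then show ?thesis using that complex_norm_square [of "v i"] by (simp add: mult.commute)
  qed
  have hf: "hform d h v = of_real ((\<Sum>i<d. (cmod (v i))\<^sup>2) + 2 * t * (frob_norm (P * colm d v))\<^sup>2 - s * (cmod (\<Sum>i<d. cnj (a i) * v i))\<^sup>2)" for v
  proof -
    define w where "w = (\<Sum>i<d. cnj (a i) * v i)"
    have "hform d h v = (\<Sum>i<d. \<Sum>j<d. cnj (v i) * (if i = j then 1 else 0) * v j) + 2 * of_real t * hform d (\<lambda>i j. P $$ (i, j)) v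
        - of_real s * (\<Sum>i<d. \<Sum>j<d. (cnj (v i) * a i) * (cnj (a j) * v j))"
      unfolding hform_def h_def sum_distrib_left sum.distrib [symmetric] sum_subtractf [symmetric]
      by (intro sum.cong refl) (simp add: algebra_simps)
    also have "(\<Sum>i<d. \<Sum>j<d. cnj (v i) * (if i = j then 1 else 0) * v j) = of_real (\<Sum>i<d. (cmod (v i))\<^sup>2)"
      by (simp add: one)
    also have "(\<Sum>i<d. \<Sum>j<d. (cnj (v i) * a i) * (cnj (a j) * v j)) = (\<Sum>i<d. cnj (v i) * a i) * w"
      unfolding w_def by (rule sum_product [symmetric])
    also have "(\<Sum>i<d. cnj (v i) * a i) = cnj w" by (simp add: w_def mult.commute)
    also have "cnj w * w = of_real ((cmod w)\<^sup>2)" using complex_norm_square [of w] by (simp add: mult.commute)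
    finally show ?thesis unfolding hform_proj [OF P] w_def by simp
  qed
  have pf: "pos_form d h"
    unfolding pos_form_def
  proof (intro conjI allI impI)
    fix i j assume ij: "i < d" "j < d"
    have "mat_adjoint P $$ (j, i) = cnj (P $$ (i, j))" using ij dP by simp
    then have "P $$ (j, i) = cnj (P $$ (i, j))" unfolding Pa .
    then show "h j i = cnj (h i j)" by (simp add: h_def mult.commute)
  next
    fix v :: "nat \<Rightarrow> complex" assume "\<exists>i<d. v i \<noteq> 0"
    then have N: "(\<Sum>i<d. (cmod (v i))\<^sup>2) > 0" by (auto intro!: sum_pos2)
    define p where "p = (frob_norm (P * colm d v))\<^sup>2"
    have pN: "p \<le> (\<Sum>i<d. (cmod (v i))\<^sup>2)"
      unfolding frob_norm_colm [symmetric] frob_norm_proj_split [OF P colm_carrier(1)] p_def by simp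
    have "s * (cmod (\<Sum>i<d. cnj (a i) * v i))\<^sup>2 \<le> s * p"
      unfolding p_def using proj_inner_le [OF P a(1) a1] s by (intro mult_left_mono)
    moreover have "0 < (\<Sum>i<d. (cmod (v i))\<^sup>2) + 2 * t * p - s * p"
    proof (cases "p = 0")
      case False
      then have "p > 0" by (simp add: p_def)
      then have "0 < (1 + 2 * t - s) * p" using s by simp
      also have "\<dots> \<le> (\<Sum>i<d. (cmod (v i))\<^sup>2) + 2 * t * p - s * p" using pN by (simp add: algebra_simps)
      finally show ?thesis .
    qed (use N in simp)
    ultimately show "0 < Re (hform d h v)" unfolding hf by (simp add: p_def)
  qed
  define E where "E = colm d a * mat_adjoint (colm d a)"
  have Ec: "E \<in> carrier_mat d d" unfolding E_def by (rule mult_carrier_mat [OF colm_carrier(1)]) simp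
  have Eij: "E $$ (i, j) = a i * cnj (a j)" if "i < d" "j < d" for i j
    unfolding E_def using that by (subst index_mult_mat_sum [of _ d 1 _ d]) simp_all
  have PE: "P * E = E"
    unfolding E_def using assoc_mult_mat [OF Pc colm_carrier(1) [of d a], of "mat_adjoint (colm d a)" d] a(1) by simp
  define s' where "s' = s / (1 + 2 * t)"
  have s': "s' * (1 + 2 * t) = s" using t by (simp add: s'_def)
  have fac: "mat d d (\<lambda>(i, j). h i j) = (1\<^sub>m d + of_real (2 * t) \<cdot>\<^sub>m P) * (1\<^sub>m d + of_real (- s') \<cdot>\<^sub>m E)"
  proof -
    have "(1\<^sub>m d + of_real (2 * t) \<cdot>\<^sub>m P) * (1\<^sub>m d + of_real (- s') \<cdot>\<^sub>m E)
       = (1\<^sub>m d + of_real (2 * t) \<cdot>\<^sub>m P) + of_real (- s') \<cdot>\<^sub>m ((1\<^sub>m d + of_real (2 * t) \<cdot>\<^sub>m P) * E)"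
      using Pc Ec by (subst mult_add_distrib_mat [of _ d d _ d]) (simp_all add: mult_smult_distrib [of _ d d _ d])
    also have "(1\<^sub>m d + of_real (2 * t) \<cdot>\<^sub>m P) * E = E + of_real (2 * t) \<cdot>\<^sub>m E"
      using Pc Ec by (subst add_mult_distrib_mat [of _ d d _ _ d]) (simp_all add: PE mult_smult_assoc_mat [of _ d d _ d])
    also have "(1\<^sub>m d + of_real (2 * t) \<cdot>\<^sub>m P) + of_real (- s') \<cdot>\<^sub>m (E + of_real (2 * t) \<cdot>\<^sub>m E) = mat d d (\<lambda>(i, j). h i j)"
    proof (rule eq_matI)
      fix i j assume "i < dim_row (mat d d (\<lambda>(i, j). h i j))" "j < dim_col (mat d d (\<lambda>(i, j). h i j))"
      then have ij: "i < d" "j < d" by simp_all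
      have "complex_of_real s * (a i * cnj (a j)) = of_real s' * (a i * cnj (a j)) + of_real s' * (of_real t * (a i * (cnj (a j) * 2)))"
        unfolding s' [symmetric] by (simp add: algebra_simps)
      then show "((1\<^sub>m d + of_real (2 * t) \<cdot>\<^sub>m P) + of_real (- s') \<cdot>\<^sub>m (E + of_real (2 * t) \<cdot>\<^sub>m E)) $$ (i, j) = mat d d (\<lambda>(i, j). h i j) $$ (i, j)"
        using ij dP carrier_matD [OF Ec] by (simp add: h_def Eij algebra_simps)
    qed (use dP carrier_matD [OF Ec] in simp_all)
    finally show ?thesis by simp
  qed
  have det: "det (mat d d (\<lambda>(i, j). h i j)) = of_real ((1 + 2 * t) ^ k * (if \<forall>i<d. a i = 0 then 1 else 1 - s'))"
  proof -
    have "det (1\<^sub>m d + of_real (- s') \<cdot>\<^sub>m E) = of_real (if \<forall>i<d. a i = 0 then 1 else 1 - s')"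
    proof (cases "\<forall>i<d. a i = 0")
      case True
      then have "1\<^sub>m d + of_real (- s') \<cdot>\<^sub>m E = 1\<^sub>m d"
        using carrier_matD [OF Ec] by (intro eq_matI) (simp_all add: Eij)
      then show ?thesis using True by simp
    next
      case False
      then have n1: "(\<Sum>i<d. (cmod (a i))\<^sup>2) = 1" using a(2) by blast
      have "is_proj d E"
        unfolding is_proj_def
      proof (intro conjI Ec eq_matI)
        fix i j assume "i < dim_row E" "j < dim_col E"
        then have ij: "i < d" "j < d" using carrier_matD [OF Ec] by simp_all
        show "mat_adjoint E $$ (i, j) = E $$ (i, j)"
          using ij carrier_matD [OF Ec] by (simp add: Eij mult.commute)
        have "(E * E) $$ (i, j) = (\<Sum>l<d. a i * cnj (a l) * (a l * cnj (a j)))"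
          using ij by (subst index_mult_mat_sum [OF Ec Ec]) (simp_all add: Eij)
        also have "\<dots> = a i * cnj (a j) * of_real (\<Sum>l<d. (cmod (a l))\<^sup>2)"
          unfolding of_real_sum sum_distrib_left complex_norm_square by (rule sum.cong) (simp_all add: mult_ac)
        finally show "(E * E) $$ (i, j) = E $$ (i, j)" using n1 ij by (simp add: Eij)
      qed (use carrier_matD [OF Ec] in simp_all)
      moreover have "mtrace E = of_nat 1"
      proof -
        have "mtrace E = (\<Sum>i<d. of_real ((cmod (a i))\<^sup>2))"
          using carrier_matD [OF Ec] unfolding mtrace_def complex_norm_square by (simp add: Eij)
        also have "\<dots> = of_real (\<Sum>i<d. (cmod (a i))\<^sup>2)" by simp
        finally show ?thesis using n1 by simp
      qed
      ultimately show ?thesis unfolding if_not_P [OF False] using det_one_plus_proj [of d E 1 "- s'"] by simp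
    qed
    then show ?thesis
      unfolding fac using Pc Ec det_one_plus_proj [OF P k, of "2 * t"] by (subst det_mult [of _ d]) simp_all
  qed
  have eq: "- (Re (hform d h (\<lambda>i. of_real (x i))) - (\<Sum>i<d. (x i)\<^sup>2)) / 2
    = - (t * (frob_norm (P * colm d (\<lambda>i. of_real (x i))))\<^sup>2) + s / 2 * (cmod (\<Sum>i<d. cnj (a i) * of_real (x i)))\<^sup>2" for x :: "nat \<Rightarrow> real"
    unfolding hf by (simp add: field_simps)
  show ?thesis
    using gauss_integral_hform_le [OF pf] unfolding eq det s'_def by simp
qed

lemma sqrt_power_powr: "x > 0 \<Longrightarrow> sqrt (x ^ k) = x powr (real k / 2)"
  by (simp add: powr_half_sqrt [symmetric] powr_realpow [symmetric] powr_powr)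

lemma borel_measurable_proj_norm [measurable]:
  assumes P: "is_proj d P"
  shows "(\<lambda>x. (frob_norm (P * colm d (\<lambda>i. of_real (x i))))\<^sup>2) \<in> borel_measurable (gauss {..<d})"
proof -
  have "(\<lambda>x. Re (hform d (\<lambda>i j. P $$ (i, j)) (\<lambda>i. of_real (x i)))) \<in> borel_measurable (gauss {..<d})"
    unfolding hform_def by measurable
  then show ?thesis unfolding hform_proj [OF P] by simp
qed

lemma gauss_proj_exp_le:
  assumes P: "is_proj d P" and k: "mtrace P = of_nat k" and t: "0 \<le> t"
  shows "(\<integral>\<^sup>+x. ennreal (exp (- (t * (frob_norm (P * colm d (\<lambda>i. of_real (x i))))\<^sup>2))) \<partial>gauss {..<d})
    \<le> ennreal ((1 + 2 * t) powr (- (real k / 2)))"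
proof -
  have z: "P * colm d (\<lambda>_. 0) = colm d (\<lambda>_. 0)"
    using is_proj_carrier [OF P] carrier_matD [OF is_proj_carrier [OF P]]
    by (intro eq_matI) (simp_all add: scalar_prod_def)
  have "(\<integral>\<^sup>+x. ennreal (exp (- (t * (frob_norm (P * colm d (\<lambda>i. of_real (x i))))\<^sup>2)
      + 0 / 2 * (cmod (\<Sum>i<d. cnj 0 * of_real (x i)))\<^sup>2)) \<partial>gauss {..<d})
    \<le> ennreal (1 / sqrt ((1 + 2 * t) ^ k * (if \<forall>i<d. (0::complex) = 0 then 1 else 1 - 0 / (1 + 2 * t))))"
    by (rule gauss_exp_moment_le [OF P k z _ t]) (use t in simp_all)
  moreover have "1 / sqrt ((1 + 2 * t) ^ k * (if \<forall>i<d. (0::complex) = 0 then 1 else 1 - 0 / (1 + 2 * t)))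
      = (1 + 2 * t) powr (- (real k / 2))"
    using t by (simp add: sqrt_power_powr powr_minus_divide)
  ultimately show ?thesis by (simp only: div_0 mult_zero_left add_0_right)
qed

text \<open>The probability of a zero is at most \<open>E exp (- t |P x|\<^sup>2)\<close>, which tends to 0 as \<open>t\<close> grows.\<close>

lemma AE_proj_nonzero:
  assumes P: "is_proj d P" and k: "mtrace P = of_nat k" "0 < k"
  shows "AE x in gauss {..<d}. frob_norm (P * colm d (\<lambda>i. of_real (x i))) \<noteq> 0"
proof -
  note [measurable] = borel_measurable_proj_norm [OF P]
  let ?S = "\<lambda>x. (frob_norm (P * colm d (\<lambda>i. complex_of_real (x i))))\<^sup>2"
  let ?N = "{x \<in> space (gauss {..<d}). ?S x = 0}"
  have N: "?N \<in> sets (gauss {..<d})" by measurable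
  have le: "emeasure (gauss {..<d}) ?N \<le> ennreal ((1 + 2 * t) powr (- (real k / 2)))" if t: "0 \<le> t" for t
  proof -
    have "emeasure (gauss {..<d}) ?N = (\<integral>\<^sup>+x. indicator ?N x \<partial>gauss {..<d})"
      by (rule nn_integral_indicator [OF N, symmetric])
    also have "\<dots> \<le> (\<integral>\<^sup>+x. ennreal (exp (- (t * ?S x))) \<partial>gauss {..<d})"
      by (rule nn_integral_mono) (auto simp: indicator_def)
    also have "\<dots> \<le> ennreal ((1 + 2 * t) powr (- (real k / 2)))" by (rule gauss_proj_exp_le [OF P k(1) t])
    finally show ?thesis .
  qed
  have "((\<lambda>t::real. ennreal ((1 + 2 * t) powr (- (real k / 2)))) \<longlongrightarrow> ennreal 0) at_top"
    using k by (intro tendsto_ennrealI tendsto_affine_powr) simp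
  moreover have "\<forall>\<^sub>F t in at_top. emeasure (gauss {..<d}) ?N \<le> ennreal ((1 + 2 * t) powr (- (real k / 2)))"
    using eventually_ge_at_top [of "0::real"] by eventually_elim (rule le)
  ultimately have "emeasure (gauss {..<d}) ?N \<le> ennreal 0"
    by (rule tendsto_lowerbound) simp
  then have z: "emeasure (gauss {..<d}) ?N = 0" by simp
  show ?thesis by (rule AE_I [OF _ z N]) auto
qed

lemma gauss_exp_norm: "0 \<le> t \<Longrightarrow>
  (\<integral>\<^sup>+x. ennreal (exp (- (t * (\<Sum>i<d. (x i)\<^sup>2)))) \<partial>gauss {..<d}) = ennreal ((1 + 2 * t) powr (- (real d / 2)))"
proof (induction d)
  case 0
  have "emeasure (gauss ({}::nat set)) (space (gauss {})) = 1"
    by (rule prob_space.emeasure_space_1 [OF prob_space_gauss])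
  then show ?case using 0 by simp
next
  case (Suc d)
  have one: "(\<integral>\<^sup>+y. ennreal (exp (- (t * y\<^sup>2))) \<partial>stdn) = ennreal ((1 + 2 * t) powr (- (1 / 2)))"
  proof -
    have e: "- ((1 + 2 * t) * y\<^sup>2 + 2 * 0 * y - y\<^sup>2) / 2 = - (t * y\<^sup>2)" for y :: real by (simp add: algebra_simps)
    have "(\<integral>\<^sup>+y. ennreal (exp (- ((1 + 2 * t) * y\<^sup>2 + 2 * 0 * y - y\<^sup>2) / 2)) \<partial>stdn)
        = ennreal (exp (0\<^sup>2 / (2 * (1 + 2 * t))) / sqrt (1 + 2 * t))"
      by (rule nn_integral_stdn_exp_quadratic) (use Suc.prems in simp)
    then show ?thesis unfolding e using Suc.prems by (simp add: powr_minus_divide powr_half_sqrt)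
  qed
  have "(\<integral>\<^sup>+x. ennreal (exp (- (t * (\<Sum>i<Suc d. (x i)\<^sup>2)))) \<partial>gauss {..<Suc d})
     = (\<integral>\<^sup>+x. \<integral>\<^sup>+y. ennreal (exp (- (t * (\<Sum>i<Suc d. ((x(d := y)) i)\<^sup>2)))) \<partial>stdn \<partial>gauss {..<d})"
    unfolding lessThan_Suc by (rule nn_integral_gauss_insert) simp_all
  also have "\<dots> = (\<integral>\<^sup>+x. ennreal (exp (- (t * (\<Sum>i<d. (x i)\<^sup>2)))) * ennreal ((1 + 2 * t) powr (- (1 / 2))) \<partial>gauss {..<d})"
  proof (rule nn_integral_cong)
    fix x :: "nat \<Rightarrow> real"
    have "ennreal (exp (- (t * (\<Sum>i<Suc d. ((x(d := y)) i)\<^sup>2)))) = ennreal (exp (- (t * (\<Sum>i<d. (x i)\<^sup>2)))) * ennreal (exp (- (t * y\<^sup>2)))" for y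
    proof -
      have "- (t * (\<Sum>i<Suc d. ((x(d := y)) i)\<^sup>2)) = - (t * (\<Sum>i<d. (x i)\<^sup>2)) + - (t * y\<^sup>2)"
        by (simp add: distrib_left)
      then show ?thesis by (simp only: exp_add ennreal_mult [OF exp_ge_zero exp_ge_zero])
    qed
    then show "(\<integral>\<^sup>+y. ennreal (exp (- (t * (\<Sum>i<Suc d. ((x(d := y)) i)\<^sup>2)))) \<partial>stdn)
      = ennreal (exp (- (t * (\<Sum>i<d. (x i)\<^sup>2)))) * ennreal ((1 + 2 * t) powr (- (1 / 2)))"
      by (simp add: nn_integral_cmult one)
  qed
  also have "\<dots> = ennreal ((1 + 2 * t) powr (- (real d / 2))) * ennreal ((1 + 2 * t) powr (- (1 / 2)))"
    using Suc.IH [OF Suc.prems] by (subst nn_integral_multc) simp_all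
  also have "\<dots> = ennreal ((1 + 2 * t) powr (- (real (Suc d) / 2)))"
  proof -
    have "- (real d / 2) + - (1 / 2) = - (real (Suc d) / 2)" by (simp add: field_simps)
    then show ?thesis
      unfolding ennreal_mult [OF powr_ge_zero powr_ge_zero, symmetric] powr_add [symmetric] by (simp only:)
  qed
  finally show ?case .
qed

text \<open>From \<open>1 / s = \<integral> exp (- t s) dt\<close> over \<open>t \<ge> 0\<close> by exchanging the integrals.\<close>

lemma gauss_inverse_norm_square:
  assumes d: "2 < d"
  shows "(\<integral>\<^sup>+x. ennreal (1 / (\<Sum>i<d. (x i)\<^sup>2)) \<partial>gauss {..<d}) = ennreal (1 / (real d - 2))"
proof -
  interpret G: prob_space "gauss {..<d}" by (rule prob_space_gauss)
  interpret pair_sigma_finite "gauss {..<d}" lborel by unfold_locales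
  have P: "is_proj d (1\<^sub>m d)" "mtrace (1\<^sub>m d) = of_nat d" by (simp_all add: is_proj_def mtrace_def)
  have "AE x in gauss {..<d}. frob_norm (1\<^sub>m d * colm d (\<lambda>i. of_real (x i))) \<noteq> 0"
    using AE_proj_nonzero [OF P] d by simp
  then have nz: "AE x in gauss {..<d}. 0 < (\<Sum>i<d. (x i)\<^sup>2)"
  proof eventually_elim
    case (elim x)
    have "(frob_norm (colm d (\<lambda>i. complex_of_real (x i))))\<^sup>2 \<noteq> 0" using elim left_mult_one_mat [OF colm_carrier(1)] by simp
    then have "(\<Sum>i<d. (x i)\<^sup>2) \<noteq> 0" unfolding frob_norm_colm by simp
    then show ?case using sum_nonneg [of "{..<d}" "\<lambda>i. (x i)\<^sup>2"] by (simp add: order_less_le)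
  qed
  have 1: "(\<integral>\<^sup>+x. ennreal (1 / (\<Sum>i<d. (x i)\<^sup>2)) \<partial>gauss {..<d})
    = (\<integral>\<^sup>+x. (\<integral>\<^sup>+t. ennreal (exp (- (t * (\<Sum>i<d. (x i)\<^sup>2)))) * indicator {0..} t \<partial>lborel) \<partial>gauss {..<d})"
  proof (rule nn_integral_cong_AE)
    show "AE x in gauss {..<d}. ennreal (1 / (\<Sum>i<d. (x i)\<^sup>2))
        = (\<integral>\<^sup>+t. ennreal (exp (- (t * (\<Sum>i<d. (x i)\<^sup>2)))) * indicator {0..} t \<partial>lborel)"
      using nz by eventually_elim (rule nn_integral_exp_decay [symmetric])
  qed
  have 2: "\<dots> = (\<integral>\<^sup>+t. (\<integral>\<^sup>+x. ennreal (exp (- (t * (\<Sum>i<d. (x i)\<^sup>2)))) * indicator {0..} t \<partial>gauss {..<d}) \<partial>lborel)"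
  proof -
    define S where "S = (\<lambda>x::nat \<Rightarrow> real. \<Sum>i<d. (x i)\<^sup>2)"
    have [measurable]: "S \<in> borel_measurable (gauss {..<d})"
      unfolding S_def by (intro borel_measurable_sum borel_measurable_power measurable_gauss_coordinate)
    have "case_prod (\<lambda>x t. ennreal (exp (- (t * S x))) * indicator {0..} t) \<in> borel_measurable (gauss {..<d} \<Otimes>\<^sub>M lborel)"
      by measurable
    from Fubini' [OF this, symmetric] show ?thesis unfolding S_def .
  qed
  have 3: "\<dots> = (\<integral>\<^sup>+t. ennreal ((1 + 2 * t) powr (- (real d / 2))) * indicator {0..} t \<partial>lborel)"
    by (rule nn_integral_cong) (simp add: nn_integral_multc gauss_exp_norm indicator_def)
  have 4: "\<dots> = ennreal (1 / (real d - 2))"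
    by (rule nn_integral_powr_decay) (use d in simp)
  show ?thesis unfolding 1 2 3 4 ..
qed

text \<open>Isotropy up to a constant. For a real projection the constant would be 1, by symmetry;
  the elementary bound \<open>y \<le> exp (s y / 2) / s\<close> with \<open>s = 3/4 (1 + 2 t)\<close> gives 8/3.\<close>

lemma gauss_proj_isotropy:
  assumes P: "is_proj d P" and k: "mtrace P = of_nat k" "2 < k"
    and a: "P * colm d a = colm d a" "(\<Sum>i<d. (cmod (a i))\<^sup>2) = 1"
  shows "(\<integral>\<^sup>+x. ennreal ((cmod (\<Sum>i<d. cnj (a i) * of_real (x i)))\<^sup>2 / ((frob_norm (P * colm d (\<lambda>i. of_real (x i))))\<^sup>2)\<^sup>2) \<partial>gauss {..<d})
    \<le> ennreal (8 / 3 / (real k * (real k - 2)))"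
proof -
  interpret G: prob_space "gauss {..<d}" by (rule prob_space_gauss)
  interpret pair_sigma_finite "gauss {..<d}" lborel by unfold_locales
  define S where "S = (\<lambda>x. (frob_norm (P * colm d (\<lambda>i. complex_of_real (x i))))\<^sup>2)"
  define y where "y = (\<lambda>x::nat \<Rightarrow> real. (cmod (\<Sum>i<d. cnj (a i) * of_real (x i)))\<^sup>2)"
  have y0: "0 \<le> y x" and S0: "0 \<le> S x" for x by (simp_all add: y_def S_def)
  have [measurable]: "S \<in> borel_measurable (gauss {..<d})"
    unfolding S_def by (rule borel_measurable_proj_norm [OF P])
  have [measurable]: "y \<in> borel_measurable (gauss {..<d})"
    unfolding y_def by measurable
  have nz: "\<not> (\<forall>i<d. a i = 0)" using a(2) by (auto intro: ccontr)
  have inner: "(\<integral>\<^sup>+x. ennreal (y x * exp (- (t * S x))) \<partial>gauss {..<d}) \<le> ennreal (8 / 3 * (1 + 2 * t) powr (- (real k / 2) - 1))"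
    if t: "0 \<le> t" for t
  proof -
    define s where "s = 3 / 4 * (1 + 2 * t)"
    have s: "0 < s" "s < 1 + 2 * t" using t by (auto simp: s_def)
    have s3: "s / (1 + 2 * t) = 3 / 4"
      unfolding s_def by (rule nonzero_mult_div_cancel_right) (use t in simp)
    have y_le: "z \<le> 1 / s * exp (s / 2 * z)" if "0 \<le> z" for z
    proof -
      have "2 * (s / 2 * z) \<le> exp 1 * exp (s / 2 * z - 1)"
        using exp_ge_add_one_self [of 1] exp_ge_add_one_self [of "s / 2 * z - 1"] that s
        by (intro mult_mono) simp_all
      also have "\<dots> = exp (s / 2 * z)" by (simp add: exp_add [symmetric])
      finally show ?thesis using s by (simp add: field_simps)
    qed
    have "(\<integral>\<^sup>+x. ennreal (y x * exp (- (t * S x))) \<partial>gauss {..<d})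
      \<le> (\<integral>\<^sup>+x. ennreal (1 / s) * ennreal (exp (- (t * S x) + s / 2 * y x)) \<partial>gauss {..<d})"
    proof (rule nn_integral_mono)
      fix x
      have "y x * exp (- (t * S x)) \<le> 1 / s * exp (s / 2 * y x) * exp (- (t * S x))"
        by (intro mult_right_mono y_le y0) simp_all
      also have "\<dots> = 1 / s * exp (- (t * S x) + s / 2 * y x)" by (simp only: exp_add mult_ac)
      finally show "ennreal (y x * exp (- (t * S x))) \<le> ennreal (1 / s) * ennreal (exp (- (t * S x) + s / 2 * y x))"
        using s y0 by (simp add: ennreal_mult [symmetric])
    qed
    also have "\<dots> = ennreal (1 / s) * (\<integral>\<^sup>+x. ennreal (exp (- (t * S x) + s / 2 * y x)) \<partial>gauss {..<d})"
      by (rule nn_integral_cmult) measurable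
    also have "\<dots> \<le> ennreal (1 / s) * ennreal (1 / sqrt ((1 + 2 * t) ^ k * (1 - s / (1 + 2 * t))))"
      using gauss_exp_moment_le [OF P k(1) a(1) disjI1 [OF a(2)] t less_imp_le [OF s(1)] s(2)] nz
      unfolding S_def y_def by (intro mult_left_mono) (simp_all only: if_False, simp)
    also have "\<dots> = ennreal (8 / 3 * (1 + 2 * t) powr (- (real k / 2) - 1))"
    proof -
      have e1: "sqrt ((1 + 2 * t) ^ k * (1 - s / (1 + 2 * t))) = (1 + 2 * t) powr (real k / 2) / 2"
        unfolding s3 using t by (simp add: real_sqrt_mult sqrt_power_powr real_sqrt_divide)
      have "- (real k / 2) - 1 = - (1 + real k / 2)" by simp
      then have e2: "(1 + 2 * t) powr (- (real k / 2) - 1) = 1 / ((1 + 2 * t) * (1 + 2 * t) powr (real k / 2))"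
        using t by (simp only: powr_minus_divide powr_add) simp
      have e3: "1 / (3 / 4 * b) * (1 / (u / 2)) = 8 / 3 * (1 / (b * u))" for b u :: real
        by (cases "b = 0"; cases "u = 0") (simp_all add: field_simps)
      have "ennreal (1 / s) * ennreal (1 / ((1 + 2 * t) powr (real k / 2) / 2))
          = ennreal (1 / s * (1 / ((1 + 2 * t) powr (real k / 2) / 2)))"
        using s(1) by (intro ennreal_mult [symmetric]) simp_all
      then show ?thesis unfolding e1 e2 unfolding s_def e3 .
    qed
    finally show ?thesis .
  qed
  have "(\<integral>\<^sup>+x. ennreal (y x / (S x)\<^sup>2) \<partial>gauss {..<d})
     \<le> (\<integral>\<^sup>+x. (\<integral>\<^sup>+t. ennreal (t * (y x * exp (- (t * S x)))) * indicator {0..} t \<partial>lborel) \<partial>gauss {..<d})"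
  proof (rule nn_integral_mono)
    fix x
    show "ennreal (y x / (S x)\<^sup>2) \<le> (\<integral>\<^sup>+t. ennreal (t * (y x * exp (- (t * S x)))) * indicator {0..} t \<partial>lborel)"
    proof (cases "S x = 0")
      case False
      have "(\<integral>\<^sup>+t. ennreal (t * (y x * exp (- (t * S x)))) * indicator {0..} t \<partial>lborel)
          = (\<integral>\<^sup>+t. ennreal (y x) * (ennreal (t * exp (- (t * S x))) * indicator {0..} t) \<partial>lborel)"
        using y0 by (intro nn_integral_cong) (auto simp: ennreal_mult [symmetric] indicator_def mult_ac)
      also have "\<dots> = ennreal (y x) * ennreal (1 / (S x)\<^sup>2)"
        using False S0 [of x] by (subst nn_integral_cmult) (simp_all add: nn_integral_exp_times order_less_le)
      finally show ?thesis using y0 by (simp add: ennreal_mult [symmetric])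
    qed simp
  qed
  also have "\<dots> = (\<integral>\<^sup>+t. (\<integral>\<^sup>+x. ennreal (t * (y x * exp (- (t * S x)))) * indicator {0..} t \<partial>gauss {..<d}) \<partial>lborel)"
  proof -
    have "case_prod (\<lambda>x t. ennreal (t * (y x * exp (- (t * S x)))) * indicator {0..} t) \<in> borel_measurable (gauss {..<d} \<Otimes>\<^sub>M lborel)"
      by measurable
    from Fubini' [OF this, symmetric] show ?thesis .
  qed
  also have "\<dots> \<le> (\<integral>\<^sup>+t. ennreal (8 / 3) * (ennreal (t * (1 + 2 * t) powr (- (real k / 2) - 1)) * indicator {0..} t) \<partial>lborel)"
  proof (rule nn_integral_mono)
    fix t :: real
    show "(\<integral>\<^sup>+x. ennreal (t * (y x * exp (- (t * S x)))) * indicator {0..} t \<partial>gauss {..<d})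
      \<le> ennreal (8 / 3) * (ennreal (t * (1 + 2 * t) powr (- (real k / 2) - 1)) * indicator {0..} t)"
    proof (cases "0 \<le> t")
      case True
      have "(\<integral>\<^sup>+x. ennreal (t * (y x * exp (- (t * S x)))) * indicator {0..} t \<partial>gauss {..<d})
         = ennreal t * (\<integral>\<^sup>+x. ennreal (y x * exp (- (t * S x))) \<partial>gauss {..<d})"
        using True y0 by (subst nn_integral_cmult [symmetric]) (simp_all add: ennreal_mult)
      also have "\<dots> \<le> ennreal t * ennreal (8 / 3 * (1 + 2 * t) powr (- (real k / 2) - 1))"
        by (intro mult_left_mono inner True) simp
      finally show ?thesis using True by (simp add: ennreal_mult [symmetric] mult_ac)
    qed simp
  qed
  also have "\<dots> = ennreal (8 / 3) * ennreal (1 / (real k * (real k - 2)))"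
    using k(2) by (subst nn_integral_cmult) (simp_all add: nn_integral_powr_decay_times)
  finally show ?thesis using k(2) unfolding y_def S_def by (simp add: ennreal_mult [symmetric])
qed

section \<open>The orthogonal projection onto the range of a matrix\<close>

text \<open>The last condition keeps the range of \<open>P\<close> inside the range of \<open>Y\<close>; this form needs no notion of dimension.\<close>

definition is_range_proj :: "nat \<Rightarrow> nat \<Rightarrow> complex mat \<Rightarrow> complex mat \<Rightarrow> bool" where
  "is_range_proj d a Y P \<longleftrightarrow> is_proj d P \<and> P * Y = Y \<and> (\<exists>C\<in>carrier_mat a d. P = Y * C)"

lemma is_range_proj_proj: "is_range_proj d a Y P \<Longrightarrow> is_proj d P"
  by (simp add: is_range_proj_def)

lemma is_range_proj_absorb:
  assumes Y: "Y \<in> carrier_mat d a" and P: "is_range_proj d a Y P" and R: "is_proj d R" and RY: "R * Y = Y"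
  shows "R * P = P" "P * R = P"
proof -
  obtain C where C: "C \<in> carrier_mat a d" "P = Y * C" and Pp: "is_proj d P" using P by (auto simp: is_range_proj_def)
  note c [simp] = is_proj_carrier [OF R] is_proj_carrier [OF Pp]
  show RP: "R * P = P"
    unfolding C(2) by (subst assoc_mult_mat [of R d d Y a C d, symmetric]) (use Y C RY in auto)
  have "mat_adjoint (R * P) = mat_adjoint P" by (simp only: RP)
  then show "P * R = P" using R Pp by (simp add: mat_adjoint_mult [of _ d d _ d] is_proj_def)
qed

lemma is_range_proj_unique:
  assumes Y: "Y \<in> carrier_mat d a" and P: "is_range_proj d a Y P" and R: "is_range_proj d a Y R"
  shows "P = R"
proof -
  have "R * P = P" using is_range_proj_absorb(1) [OF Y P, of R] R by (simp add: is_range_proj_def)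
  moreover have "R * P = R" using is_range_proj_absorb(2) [OF Y R, of P] P by (simp add: is_range_proj_def)
  ultimately show ?thesis by simp
qed

text \<open>With \<open>P = Y C\<close> the left inverse forces \<open>C Y = I\<close>, and \<open>Y C\<close> and \<open>C Y\<close> have the same trace.\<close>

lemma trace_range_proj:
  assumes Y: "Y \<in> carrier_mat d a" and P: "is_range_proj d a Y P"
    and L: "L \<in> carrier_mat a d" "L * Y = 1\<^sub>m a"
  shows "mtrace P = of_nat a"
proof -
  obtain C where C: "C \<in> carrier_mat a d" "P = Y * C" and PY: "P * Y = Y" using P by (auto simp: is_range_proj_def)
  have CY: "C * Y \<in> carrier_mat a a" using C(1) Y by (rule mult_carrier_mat)
  have "C * Y = (L * Y) * (C * Y)" unfolding L(2) by (simp only: left_mult_one_mat [OF CY])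
  also have "\<dots> = L * (Y * (C * Y))" by (rule assoc_mult_mat [OF L(1) Y CY])
  also have "Y * (C * Y) = Y * C * Y" by (rule assoc_mult_mat [OF Y C(1) Y, symmetric])
  also have "\<dots> = Y" using PY unfolding C(2) .
  finally have "C * Y = 1\<^sub>m a" unfolding L(2) .
  then show ?thesis unfolding C(2) mtrace_commute [OF Y C(1)] by (simp add: mtrace_def)
qed

lemma frob_norm_zero: "A \<in> carrier_mat n m \<Longrightarrow> frob_norm A = 0 \<Longrightarrow> A = 0\<^sub>m n m"
proof -
  assume A: "A \<in> carrier_mat n m" and z: "frob_norm A = 0"
  have "(\<Sum>i<n. \<Sum>j<m. (cmod (A $$ (i, j)))\<^sup>2) = 0" using frob_norm_square [OF A] z by simp
  then have "A $$ (i, j) = 0" if "i < n" "j < m" for i j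
    using that by (subst (asm) sum_nonneg_eq_0_iff; simp add: sum_nonneg sum_nonneg_eq_0_iff)
  then show "A = 0\<^sub>m n m" using A by (intro eq_matI) auto
qed

text \<open>With \<open>Y\<^sup>* Y = V diag(f) V\<^sup>*\<close> the matrices \<open>Y V diag(1/(f + \<delta>)) V\<^sup>* Y\<^sup>*\<close> are rational functions of
  the entries of \<open>Y\<close>; the projection is their limit as \<open>\<delta>\<close> tends to 0, whatever the rank of \<open>Y\<close>.\<close>

lemma gram_diagonalisation:
  assumes Y: "Y \<in> carrier_mat d a"
  obtains V f where "is_unitary a V" "mat_adjoint Y * Y = fcalc a V f"
    "\<And>i. i < a \<Longrightarrow> 0 \<le> f i" "\<And>i j. i < a \<Longrightarrow> f i = 0 \<Longrightarrow> j < d \<Longrightarrow> (Y * V) $$ (j, i) = 0"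
proof -
  have M: "mat_adjoint Y * Y \<in> carrier_mat a a" by (rule mult_carrier_mat [OF _ Y]) (use Y in simp)
  have "mat_adjoint (mat_adjoint Y * Y) = mat_adjoint Y * Y"
    using Y by (simp add: mat_adjoint_mult [of _ a d _ a])
  then obtain V f where V: "is_unitary a V" and f: "mat_adjoint Y * Y = fcalc a V f"
    using hermitian_diagonalisation [OF M] by blast
  note Vc [simp] = is_unitary_carrier [OF V]
  have YV: "Y * V \<in> carrier_mat d a" by (rule mult_carrier_mat [OF Y Vc])
  have D: "mat_adjoint (Y * V) * (Y * V) = diag_real a f"
  proof -
    have "mat_adjoint (Y * V) * (Y * V) = mat_adjoint V * (mat_adjoint Y * Y) * V"
      using Y YV M by (simp add: mat_adjoint_mult [of _ d a _ a] assoc_mult_mat [of _ a a _ d _ a]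
         assoc_mult_mat [of _ a d _ a _ a] assoc_mult_mat [of _ a a _ a _ a])
    also have "\<dots> = diag_real a f * (mat_adjoint V * V)"
      unfolding f fcalc_def by (simp add: assoc_mult_mat [of _ a a _ a _ a] unitary_cancel [OF V])
    finally show ?thesis using V by (simp add: is_unitary_def right_mult_one_mat [of _ a a])
  qed
  have fi: "of_real (f i) = (\<Sum>j<d. of_real ((cmod ((Y * V) $$ (j, i)))\<^sup>2) :: complex)" if i: "i < a" for i
  proof -
    have "of_real (f i) = (mat_adjoint (Y * V) * (Y * V)) $$ (i, i)" unfolding D using i by (simp add: diag_real_def)
    also have "\<dots> = (\<Sum>j<d. mat_adjoint (Y * V) $$ (i, j) * (Y * V) $$ (j, i))"
      by (rule index_mult_mat_sum [OF _ YV i i]) (use YV in simp)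
    also have "\<dots> = (\<Sum>j<d. cnj ((Y * V) $$ (j, i)) * (Y * V) $$ (j, i))"
      by (intro sum.cong refl arg_cong2 [of _ _ _ _ "(*)"] index_mat_adjoint) (use carrier_matD [OF YV] i in auto)
    also have "\<dots> = (\<Sum>j<d. of_real ((cmod ((Y * V) $$ (j, i)))\<^sup>2))"
      by (intro sum.cong refl) (simp only: complex_norm_square mult.commute)
    finally show ?thesis .
  qed
  then have fr: "f i = (\<Sum>j<d. (cmod ((Y * V) $$ (j, i)))\<^sup>2)" if "i < a" for i
    using that unfolding of_real_sum [symmetric] of_real_eq_iff by blast
  show ?thesis
  proof (rule that [OF V f])
    show "0 \<le> f i" if "i < a" for i unfolding fr [OF that] by (rule sum_nonneg) simp
    show "(Y * V) $$ (j, i) = 0" if "i < a" "f i = 0" "j < d" for i j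
    proof -
      have "(\<Sum>j<d. (cmod ((Y * V) $$ (j, i)))\<^sup>2) = 0" using fr that by simp
      then have "\<forall>j\<in>{..<d}. (cmod ((Y * V) $$ (j, i)))\<^sup>2 = 0" by (subst (asm) sum_nonneg_eq_0_iff) simp_all
      then show ?thesis using that(3) by simp
    qed
  qed
qed

definition gram_resolvent :: "nat \<Rightarrow> complex mat \<Rightarrow> real \<Rightarrow> complex mat" where
  "gram_resolvent a Y t = mat_adjoint Y * Y + mat a a (\<lambda>(i, j). if i = j then of_real t else 0)"

lemma index_sandwich:
  assumes Y: "Y \<in> carrier_mat d a" and V: "V \<in> carrier_mat a a" and ij: "i < d" "j < d"
  shows "(Y * fcalc a V h * mat_adjoint Y) $$ (i, j)
    = (\<Sum>k<a. (Y * V) $$ (i, k) * of_real (h k) * cnj ((Y * V) $$ (j, k)))"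
proof -
  have YV: "Y * V \<in> carrier_mat d a" by (rule mult_carrier_mat [OF Y V])
  have DA: "diag_real a h * mat_adjoint (Y * V) \<in> carrier_mat a d"
    by (rule mult_carrier_mat [of _ a a]) (use YV in simp_all)
  have "Y * fcalc a V h * mat_adjoint Y = (Y * V) * (diag_real a h * mat_adjoint (Y * V))"
  proof -
    have aY: "mat_adjoint Y \<in> carrier_mat a d" and aV: "mat_adjoint V \<in> carrier_mat a a" using Y V by simp_all
    have aVY: "mat_adjoint (Y * V) = mat_adjoint V * mat_adjoint Y" by (rule mat_adjoint_mult [OF Y V])
    have "fcalc a V h * mat_adjoint Y = V * (diag_real a h * mat_adjoint (Y * V))"
      unfolding fcalc_def aVY using V aV aY mult_carrier_mat [OF aV aY]
      by (simp add: assoc_mult_mat [of _ a a _ a _ d])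
    then have "Y * fcalc a V h * mat_adjoint Y = Y * (V * (diag_real a h * mat_adjoint (Y * V)))"
      using assoc_mult_mat [OF Y fcalc_carrier [OF V] aY] by simp
    also have "\<dots> = (Y * V) * (diag_real a h * mat_adjoint (Y * V))"
      by (rule assoc_mult_mat [OF Y V DA, symmetric])
    finally show ?thesis .
  qed
  then have "(Y * fcalc a V h * mat_adjoint Y) $$ (i, j) = (\<Sum>k<a. (Y * V) $$ (i, k) * (diag_real a h * mat_adjoint (Y * V)) $$ (k, j))"
    using index_mult_mat_sum [OF YV DA ij] by simp
  also have "\<dots> = (\<Sum>k<a. (Y * V) $$ (i, k) * (of_real (h k) * mat_adjoint (Y * V) $$ (k, j)))"
    by (intro sum.cong refl arg_cong2 [of _ _ _ _ "(*)"] index_diag_real_mult [of _ a d]) (use YV ij in simp_all)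
  also have "\<dots> = (\<Sum>k<a. (Y * V) $$ (i, k) * of_real (h k) * cnj ((Y * V) $$ (j, k)))"
  proof (intro sum.cong refl)
    fix k assume "k \<in> {..<a}"
    then have "mat_adjoint (Y * V) $$ (k, j) = cnj ((Y * V) $$ (j, k))"
      by (intro index_mat_adjoint) (use carrier_matD [OF YV] ij in auto)
    then show "(Y * V) $$ (i, k) * (of_real (h k) * mat_adjoint (Y * V) $$ (k, j)) = (Y * V) $$ (i, k) * of_real (h k) * cnj ((Y * V) $$ (j, k))"
      by (simp only: mult.assoc)
  qed
  finally show ?thesis .
qed

lemma range_proj_limit:
  assumes Y: "Y \<in> carrier_mat d a"
  obtains P where "is_range_proj d a Y P"
    "\<And>i j. i < d \<Longrightarrow> j < d \<Longrightarrow>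
      (\<lambda>k. inverse (det (gram_resolvent a Y (1 / Suc k))) * (Y * adj_mat (gram_resolvent a Y (1 / Suc k)) * mat_adjoint Y) $$ (i, j))
        \<longlonglongrightarrow> P $$ (i, j)"
proof -
  obtain V f where V: "is_unitary a V" and f: "mat_adjoint Y * Y = fcalc a V f"
    and f0: "\<And>i. i < a \<Longrightarrow> 0 \<le> f i" and Y0: "\<And>i j. i < a \<Longrightarrow> f i = 0 \<Longrightarrow> j < d \<Longrightarrow> (Y * V) $$ (j, i) = 0"
    using gram_diagonalisation [OF Y] by blast
  note Vc [simp] = is_unitary_carrier [OF V]
  define N where "N = fcalc a V (\<lambda>i. if f i = 0 then 0 else 1 / f i)"
  have N [simp]: "N \<in> carrier_mat a a" by (simp add: N_def)
  define P where "P = Y * N * mat_adjoint Y"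
  have aY: "mat_adjoint Y \<in> carrier_mat a d" using Y by simp
  have NY: "N * mat_adjoint Y \<in> carrier_mat a d" by (rule mult_carrier_mat [OF N aY])
  have YN: "Y * N \<in> carrier_mat d a" by (rule mult_carrier_mat [OF Y N])
  have P: "P \<in> carrier_mat d d" unfolding P_def by (rule mult_carrier_mat [OF YN aY])
  have Pe: "P = Y * (N * mat_adjoint Y)" unfolding P_def by (rule assoc_mult_mat [OF Y N aY])
  have PY: "P * Y = Y"
  proof -
    define E where "E = N * (mat_adjoint Y * Y) - 1\<^sub>m a"
    have Ef: "E = fcalc a V (\<lambda>i. if f i = 0 then -1 else 0)"
    proof -
      have "E = fcalc a V (\<lambda>i. (if f i = 0 then 0 else 1 / f i) * f i - 1)"
        unfolding E_def f N_def fcalc_mult [OF V] fcalc_one [OF V, symmetric] by (rule fcalc_minus) simp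
      then show ?thesis by (simp only:) (rule fcalc_cong, simp)
    qed
    have E [simp]: "E \<in> carrier_mat a a" by (simp add: Ef)
    have YE: "Y * E \<in> carrier_mat d a" by (rule mult_carrier_mat [OF Y E])
    have "mat_adjoint (Y * E) * (Y * E) = mat_adjoint E * ((mat_adjoint Y * Y) * E)"
      using Y YE by (simp add: mat_adjoint_mult [of _ d a _ a] assoc_mult_mat [of _ a a _ d _ a] assoc_mult_mat [of _ a d _ a _ a])
    also have "(mat_adjoint Y * Y) * E = fcalc a V (\<lambda>i. 0)"
      unfolding f Ef fcalc_mult [OF V] by (rule fcalc_cong) simp
    also have "mat_adjoint E * fcalc a V (\<lambda>i. 0) = fcalc a V (\<lambda>i. 0)"
      unfolding Ef fcalc_adjoint [OF Vc] fcalc_mult [OF V] by (rule fcalc_cong) simp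
    finally have "of_real ((frob_norm (Y * E))\<^sup>2) = mtrace (fcalc a V (\<lambda>i. 0))"
      by (simp only: mtrace_adjoint_mult [OF YE, symmetric])
    then have "of_real ((frob_norm (Y * E))\<^sup>2) = (0::complex)" unfolding mtrace_fcalc [OF V] by simp
    then have YE0: "Y * E = 0\<^sub>m d a" by (intro frob_norm_zero [OF YE]) simp
    have M: "mat_adjoint Y * Y \<in> carrier_mat a a" by (rule mult_carrier_mat [OF aY Y])
    have "P * Y = Y * (N * (mat_adjoint Y * Y))"
      unfolding Pe assoc_mult_mat [OF Y NY Y] assoc_mult_mat [OF N aY Y] ..
    also have "N * (mat_adjoint Y * Y) = E + 1\<^sub>m a" unfolding E_def using carrier_matD [OF mult_carrier_mat [OF N M]] by (intro eq_matI) (auto simp del: index_mult_mat)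
    also have "Y * (E + 1\<^sub>m a) = Y * E + Y" using Y by (simp add: mult_add_distrib_mat [of _ d a _ a])
    finally show ?thesis unfolding YE0 using Y by simp
  qed
  have aN: "mat_adjoint N = N" by (simp add: N_def fcalc_adjoint)
  have adj: "mat_adjoint P = P"
  proof -
    have "mat_adjoint P = mat_adjoint (mat_adjoint Y) * mat_adjoint (Y * N)"
      unfolding P_def by (rule mat_adjoint_mult [OF YN aY])
    also have "mat_adjoint (Y * N) = mat_adjoint N * mat_adjoint Y" by (rule mat_adjoint_mult [OF Y N])
    finally show ?thesis unfolding aN mat_adjoint_adjoint by (simp only: Pe [symmetric])
  qed
  have PP: "P * P = P"
  proof -
    have "P * P = P * (Y * (N * mat_adjoint Y))" by (simp only: Pe [symmetric])
    also have "\<dots> = P * Y * (N * mat_adjoint Y)" by (rule assoc_mult_mat [OF P Y NY, symmetric])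
    finally show ?thesis unfolding PY by (simp only: Pe [symmetric])
  qed
  have rp: "is_range_proj d a Y P" unfolding is_range_proj_def is_proj_def using P adj PP PY NY Pe by blast
  show ?thesis
  proof (rule that [OF rp])
    fix i j assume ij: "i < d" "j < d"
    have res: "inverse (det (gram_resolvent a Y t)) * (Y * adj_mat (gram_resolvent a Y t) * mat_adjoint Y) $$ (i, j)
      = (\<Sum>k<a. (Y * V) $$ (i, k) * of_real (1 / (f k + t)) * cnj ((Y * V) $$ (j, k)))" if t: "t > 0" for t
    proof -
      define A where "A = gram_resolvent a Y t"
      have "mat a a (\<lambda>(i, j). if i = j then of_real t else 0) = t \<cdot>\<^sub>m (1\<^sub>m a :: complex mat)"
        by (intro eq_matI) auto
      moreover have "fcalc a V (\<lambda>_. t) = of_real t \<cdot>\<^sub>m (1\<^sub>m a :: complex mat)"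
      proof -
        have "diag_real a (\<lambda>_. t) = of_real t \<cdot>\<^sub>m 1\<^sub>m a" by (intro eq_matI) (auto simp: diag_real_def)
        then have "fcalc a V (\<lambda>_. t) = of_real t \<cdot>\<^sub>m (V * mat_adjoint V)"
          unfolding fcalc_def by (simp add: mult_smult_distrib [of _ a a _ a] mult_smult_assoc_mat [of _ a a _ a] right_mult_one_mat [of _ a a])
        then show ?thesis using V by (simp add: is_unitary_def)
      qed
      ultimately have A: "A = fcalc a V (\<lambda>i. f i + t)"
        unfolding A_def gram_resolvent_def f by (simp add: fcalc_add [symmetric])
      then have Ac: "A \<in> carrier_mat a a" by simp
      have ft: "f k + t > 0" if "k < a" for k using f0 [OF that] t by simp
      have "0 < (\<Prod>k<a. f k + t)" using ft by (intro prod_pos) auto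
      then have dA: "det A \<noteq> 0" unfolding A det_fcalc [OF V] of_real_eq_0_iff by linarith
      have inv: "A * fcalc a V (\<lambda>k. 1 / (f k + t)) = 1\<^sub>m a"
      proof -
        have "A * fcalc a V (\<lambda>k. 1 / (f k + t)) = fcalc a V (\<lambda>_. 1)"
          unfolding A fcalc_mult [OF V]
        proof (rule fcalc_cong)
          fix k assume "k < a"
          then show "(f k + t) * (1 / (f k + t)) = 1" using ft [of k] by simp
        qed
        then show ?thesis by (simp only: fcalc_one [OF V])
      qed
      have "adj_mat A = adj_mat A * (A * fcalc a V (\<lambda>k. 1 / (f k + t)))"
        unfolding inv using adj_mat(1) [OF Ac] by simp
      also have "\<dots> = (adj_mat A * A) * fcalc a V (\<lambda>k. 1 / (f k + t))"
        by (rule assoc_mult_mat [OF adj_mat(1) [OF Ac] Ac fcalc_carrier [OF Vc], symmetric])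
      also have "\<dots> = det A \<cdot>\<^sub>m fcalc a V (\<lambda>k. 1 / (f k + t))"
        unfolding adj_mat(3) [OF Ac] by (simp add: mult_smult_assoc_mat [of _ a a _ a] left_mult_one_mat [of _ a a])
      finally have "Y * adj_mat A * mat_adjoint Y = det A \<cdot>\<^sub>m (Y * fcalc a V (\<lambda>k. 1 / (f k + t)) * mat_adjoint Y)"
        using Y aY mult_carrier_mat [OF Y fcalc_carrier [OF Vc]]
        by (simp add: mult_smult_distrib [of _ d a _ a] mult_smult_assoc_mat [of _ d a _ d])
      then have "(Y * adj_mat A * mat_adjoint Y) $$ (i, j) = det A * (Y * fcalc a V (\<lambda>k. 1 / (f k + t)) * mat_adjoint Y) $$ (i, j)"
        using ij Y by (simp del: index_mult_mat(1))
      then show ?thesis unfolding A_def [symmetric] index_sandwich [OF Y Vc ij] using dA by simp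
    qed
    have "(\<lambda>k. inverse (det (gram_resolvent a Y (1 / Suc k))) * (Y * adj_mat (gram_resolvent a Y (1 / Suc k)) * mat_adjoint Y) $$ (i, j))
      = (\<lambda>n. \<Sum>k<a. (Y * V) $$ (i, k) * of_real (1 / (f k + 1 / Suc n)) * cnj ((Y * V) $$ (j, k)))"
      by (rule ext, rule res) simp
    moreover have "(\<lambda>n. \<Sum>k<a. (Y * V) $$ (i, k) * of_real (1 / (f k + 1 / Suc n)) * cnj ((Y * V) $$ (j, k)))
      \<longlonglongrightarrow> (\<Sum>k<a. (Y * V) $$ (i, k) * of_real (if f k = 0 then 0 else 1 / f k) * cnj ((Y * V) $$ (j, k)))"
    proof (rule tendsto_sum)
      fix k assume "k \<in> {..<a}"
      then have k: "k < a" by simp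
      show "(\<lambda>n. (Y * V) $$ (i, k) * of_real (1 / (f k + 1 / Suc n)) * cnj ((Y * V) $$ (j, k)))
        \<longlonglongrightarrow> (Y * V) $$ (i, k) * of_real (if f k = 0 then 0 else 1 / f k) * cnj ((Y * V) $$ (j, k))"
      proof (cases "f k = 0")
        case True
        then have "(Y * V) $$ (i, k) = 0" by (rule Y0 [OF k _ ij(1)])
        then show ?thesis by simp
      next
        case False
        have "(\<lambda>n. f k + 1 / real (Suc n)) \<longlonglongrightarrow> f k + 0"
          by (intro tendsto_intros LIMSEQ_Suc lim_1_over_n)
        then have "(\<lambda>n. 1 / (f k + 1 / real (Suc n))) \<longlonglongrightarrow> 1 / f k"
          using False by (intro tendsto_divide tendsto_const) simp_all
        then show ?thesis using False by (intro tendsto_intros) simp_all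
      qed
    qed
    moreover have "P $$ (i, j) = (\<Sum>k<a. (Y * V) $$ (i, k) * of_real (if f k = 0 then 0 else 1 / f k) * cnj ((Y * V) $$ (j, k)))"
      unfolding P_def N_def by (rule index_sandwich [OF Y Vc ij])
    ultimately show "(\<lambda>k. inverse (det (gram_resolvent a Y (1 / Suc k))) * (Y * adj_mat (gram_resolvent a Y (1 / Suc k)) * mat_adjoint Y) $$ (i, j)) \<longlonglongrightarrow> P $$ (i, j)"
      by simp
  qed
qed

definition range_proj :: "nat \<Rightarrow> nat \<Rightarrow> complex mat \<Rightarrow> complex mat" where
  "range_proj d a Y = (SOME P. is_range_proj d a Y P)"

lemma is_range_proj: "Y \<in> carrier_mat d a \<Longrightarrow> is_range_proj d a Y (range_proj d a Y)"
  unfolding range_proj_def by (rule someI_ex) (meson range_proj_limit)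

section \<open>Measurability\<close>

text \<open>Matrices of a fixed size form no type here, so measurability is required entry by entry.\<close>

definition measurable_mat :: "'x measure \<Rightarrow> nat \<Rightarrow> nat \<Rightarrow> ('x \<Rightarrow> complex mat) \<Rightarrow> bool" where
  "measurable_mat M n m Y \<longleftrightarrow> (\<forall>x\<in>space M. Y x \<in> carrier_mat n m) \<and>
     (\<forall>i<n. \<forall>j<m. (\<lambda>x. Y x $$ (i, j)) \<in> borel_measurable M)"

lemma measurable_matD:
  assumes "measurable_mat M n m Y"
  shows "x \<in> space M \<Longrightarrow> Y x \<in> carrier_mat n m" "i < n \<Longrightarrow> j < m \<Longrightarrow> (\<lambda>x. Y x $$ (i, j)) \<in> borel_measurable M"
  using assms by (auto simp: measurable_mat_def)

lemma measurable_matI: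
  assumes "\<And>x. x \<in> space M \<Longrightarrow> Y x \<in> carrier_mat n m"
    and "\<And>i j. i < n \<Longrightarrow> j < m \<Longrightarrow> (\<lambda>x. Y x $$ (i, j)) \<in> borel_measurable M"
  shows "measurable_mat M n m Y"
  using assms by (auto simp: measurable_mat_def)

lemma measurable_mat_const: "A \<in> carrier_mat n m \<Longrightarrow> measurable_mat M n m (\<lambda>_. A)"
  by (simp add: measurable_mat_def)

lemma measurable_mat_mult:
  assumes A: "measurable_mat M n k A" and B: "measurable_mat M k m B"
  shows "measurable_mat M n m (\<lambda>x. A x * B x)"
proof (rule measurable_matI)
  fix i j assume ij: "i < n" "j < m"
  have "(\<lambda>x. \<Sum>l<k. A x $$ (i, l) * B x $$ (l, j)) \<in> borel_measurable M"
    by (intro borel_measurable_sum borel_measurable_times measurable_matD(2) [OF A] measurable_matD(2) [OF B]) (use ij in auto)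
  then show "(\<lambda>x. (A x * B x) $$ (i, j)) \<in> borel_measurable M"
    by (subst measurable_cong [OF index_mult_mat_sum [OF measurable_matD(1) [OF A] measurable_matD(1) [OF B] ij]])
qed (use measurable_matD(1) [OF A] measurable_matD(1) [OF B] in \<open>blast intro: mult_carrier_mat\<close>)

lemma measurable_mat_add:
  assumes A: "measurable_mat M n m A" and B: "measurable_mat M n m B"
  shows "measurable_mat M n m (\<lambda>x. A x + B x)" "measurable_mat M n m (\<lambda>x. A x - B x)"
proof -
  have c: "A x \<in> carrier_mat n m" "B x \<in> carrier_mat n m" if "x \<in> space M" for x
    using that measurable_matD(1) [OF A] measurable_matD(1) [OF B] by auto
  show "measurable_mat M n m (\<lambda>x. A x + B x)"
  proof (rule measurable_matI)
    fix i j assume ij: "i < n" "j < m"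
    have "(\<lambda>x. A x $$ (i, j) + B x $$ (i, j)) \<in> borel_measurable M"
      by (intro borel_measurable_add measurable_matD(2) [OF A ij] measurable_matD(2) [OF B ij])
    then show "(\<lambda>x. (A x + B x) $$ (i, j)) \<in> borel_measurable M"
      by (subst measurable_cong [where g = "\<lambda>x. A x $$ (i, j) + B x $$ (i, j)"]) (use carrier_matD [OF c(1)] carrier_matD [OF c(2)] ij in auto)
  qed (use c in simp)
  show "measurable_mat M n m (\<lambda>x. A x - B x)"
  proof (rule measurable_matI)
    fix i j assume ij: "i < n" "j < m"
    have "(\<lambda>x. A x $$ (i, j) - B x $$ (i, j)) \<in> borel_measurable M"
      by (intro borel_measurable_diff measurable_matD(2) [OF A ij] measurable_matD(2) [OF B ij])
    then show "(\<lambda>x. (A x - B x) $$ (i, j)) \<in> borel_measurable M"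
      by (subst measurable_cong [where g = "\<lambda>x. A x $$ (i, j) - B x $$ (i, j)"]) (use carrier_matD [OF c(1)] carrier_matD [OF c(2)] ij in auto)
  qed (use c in simp)
qed

lemma measurable_mat_adjoint:
  assumes A: "measurable_mat M n m A"
  shows "measurable_mat M m n (\<lambda>x. mat_adjoint (A x))"
proof (rule measurable_matI)
  fix i j assume ij: "i < m" "j < n"
  have "(\<lambda>x. cnj (A x $$ (j, i))) \<in> borel_measurable M"
    by (rule measurable_compose [OF measurable_matD(2) [OF A ij(2,1)] borel_measurable_cnj])
  then show "(\<lambda>x. mat_adjoint (A x) $$ (i, j)) \<in> borel_measurable M"
    by (subst measurable_cong [where g = "\<lambda>x. cnj (A x $$ (j, i))"])
       (use carrier_matD [OF measurable_matD(1) [OF A]] ij in auto)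
qed (use measurable_matD(1) [OF A] in simp)

lemma measurable_mat_trace:
  assumes A: "measurable_mat M n n A"
  shows "(\<lambda>x. mtrace (A x)) \<in> borel_measurable M"
proof -
  have "(\<lambda>x. \<Sum>i<n. A x $$ (i, i)) \<in> borel_measurable M"
    by (intro borel_measurable_sum measurable_matD(2) [OF A]) auto
  then show ?thesis
    by (subst measurable_cong [where g = "\<lambda>x. \<Sum>i<n. A x $$ (i, i)"])
       (use carrier_matD [OF measurable_matD(1) [OF A]] in \<open>auto simp: mtrace_def\<close>)
qed

lemma measurable_mat_frob_norm:
  assumes A: "measurable_mat M n m A"
  shows "(\<lambda>x. frob_norm (A x)) \<in> borel_measurable M"
proof -
  have "(\<lambda>x. sqrt (\<Sum>i<n. \<Sum>j<m. (cmod (A x $$ (i, j)))\<^sup>2)) \<in> borel_measurable M"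
  proof -
    have "(\<lambda>x. \<Sum>i<n. \<Sum>j<m. (cmod (A x $$ (i, j)))\<^sup>2) \<in> borel_measurable M"
      by (intro borel_measurable_sum borel_measurable_power measurable_compose [OF _ borel_measurable_norm] measurable_matD(2) [OF A]) auto
    then show ?thesis by measurable
  qed
  then show ?thesis
    by (subst measurable_cong [where g = "\<lambda>x. sqrt (\<Sum>i<n. \<Sum>j<m. (cmod (A x $$ (i, j)))\<^sup>2)"])
       (use carrier_matD [OF measurable_matD(1) [OF A]] in \<open>auto simp: frob_norm_def\<close>)
qed

lemma measurable_mat_det:
  assumes A: "measurable_mat M n n A"
  shows "(\<lambda>x. det (A x)) \<in> borel_measurable M"
proof -
  have pi: "p i < n" if "p permutes {0..<n}" "i < n" for p i
    using permutes_in_image [OF that(1), of i] that(2) by simp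
  have "(\<lambda>x. \<Sum>p | p permutes {0..<n}. signof p * (\<Prod>i = 0..<n. A x $$ (i, p i))) \<in> borel_measurable M"
    by (intro borel_measurable_sum borel_measurable_times borel_measurable_const borel_measurable_prod measurable_matD(2) [OF A])
       (auto intro: pi)
  then show ?thesis
    by (subst measurable_cong [where g = "\<lambda>x. \<Sum>p | p permutes {0..<n}. signof p * (\<Prod>i = 0..<n. A x $$ (i, p i))"])
       (auto intro!: det_def' measurable_matD(1) [OF A])
qed

lemma measurable_mat_adj_mat:
  assumes A: "measurable_mat M n n A"
  shows "measurable_mat M n n (\<lambda>x. adj_mat (A x))"
proof (rule measurable_matI)
  fix i j assume ij: "i < n" "j < n"
  have "measurable_mat M (n - 1) (n - 1) (\<lambda>x. mat_delete (A x) j i)"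
  proof (rule measurable_matI)
    fix a b assume ab: "a < n - 1" "b < n - 1"
    show "(\<lambda>x. mat_delete (A x) j i $$ (a, b)) \<in> borel_measurable M"
      by (subst measurable_cong [where g = "\<lambda>x. A x $$ (if a < j then a else Suc a, if b < i then b else Suc b)"])
         (use ab carrier_matD [OF measurable_matD(1) [OF A]] in \<open>auto simp: mat_delete_def intro!: measurable_matD(2) [OF A]\<close>)
  qed (rule carrier_matI; use carrier_matD [OF measurable_matD(1) [OF A]] in \<open>simp add: mat_delete_def\<close>)
  from measurable_mat_det [OF this] have "(\<lambda>x. cofactor (A x) j i) \<in> borel_measurable M"
    unfolding cofactor_def by (intro borel_measurable_times borel_measurable_const)
  then show "(\<lambda>x. adj_mat (A x) $$ (i, j)) \<in> borel_measurable M"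
    by (subst measurable_cong [where g = "\<lambda>x. cofactor (A x) j i"])
       (use ij carrier_matD [OF measurable_matD(1) [OF A]] in \<open>auto simp: adj_mat_def\<close>)
qed (use measurable_matD(1) [OF A] adj_mat(1) in blast)

text \<open>The projection is a pointwise limit of rational functions of the entries, also where the rank of \<open>Y\<close> drops.\<close>

lemma measurable_mat_range_proj:
  assumes Y: "measurable_mat M d a Y"
    and P: "\<And>x. x \<in> space M \<Longrightarrow> is_range_proj d a (Y x) (P x)"
  shows "measurable_mat M d d P"
proof (rule measurable_matI)
  fix i j assume ij: "i < d" "j < d"
  define A where "A = (\<lambda>k x. gram_resolvent a (Y x) (1 / real (Suc k)))"
  have A: "measurable_mat M a a (A k)" for k
    unfolding A_def gram_resolvent_def
    by (intro measurable_mat_add(1) measurable_mat_mult [of M a d] measurable_mat_adjoint Y measurable_mat_const) simp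
  define g where "g = (\<lambda>k x. inverse (det (A k x)) * (Y x * adj_mat (A k x) * mat_adjoint (Y x)) $$ (i, j))"
  have "measurable_mat M d d (\<lambda>x. Y x * adj_mat (A k x) * mat_adjoint (Y x))" for k
    by (intro measurable_mat_mult [of M d a] measurable_mat_adjoint Y measurable_mat_adj_mat A)
  then have g: "g k \<in> borel_measurable M" for k
    unfolding g_def using measurable_mat_det [OF A, of k] ij
    by (intro borel_measurable_times measurable_matD(2) [of M d d]) simp_all
  have lim: "(\<lambda>k. g k x) \<longlonglongrightarrow> P x $$ (i, j)" if x: "x \<in> space M" for x
  proof -
    have Yx: "Y x \<in> carrier_mat d a" by (rule measurable_matD(1) [OF Y x])
    obtain P' where P': "is_range_proj d a (Y x) P'" and l: "\<And>i j. i < d \<Longrightarrow> j < d \<Longrightarrow>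
      (\<lambda>k. inverse (det (gram_resolvent a (Y x) (1 / Suc k))) * (Y x * adj_mat (gram_resolvent a (Y x) (1 / Suc k)) * mat_adjoint (Y x)) $$ (i, j))
        \<longlonglongrightarrow> P' $$ (i, j)"
      using range_proj_limit [OF Yx] by blast
    show ?thesis unfolding is_range_proj_unique [OF Yx P [OF x] P'] g_def A_def by (rule l [OF ij])
  qed
  show "(\<lambda>x. P x $$ (i, j)) \<in> borel_measurable M" by (rule borel_measurable_LIMSEQ_metric [OF g lim])
qed (rule is_proj_carrier [OF is_range_proj_proj [OF P]])

section \<open>Quadratic forms in Gaussian vectors\<close>

text \<open>The expectation of \<open>z\<^sup>* H z\<close> is that of the trace of \<open>H\<close> if the linear forms \<open>z\<close> are orthonormal and \<open>H\<close> does not see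
  translations along their coefficients.\<close>

lemma gauss_quadratic_form:
  fixes H :: "('i \<Rightarrow> real) \<Rightarrow> complex mat" and a :: "nat \<Rightarrow> 'i \<Rightarrow> complex"
  assumes I: "finite I" and H: "measurable_mat (gauss I) d d H"
    and B: "\<And>x i j. i < d \<Longrightarrow> j < d \<Longrightarrow> cmod (H x $$ (i, j)) \<le> B"
    and orth: "\<And>p q. p < d \<Longrightarrow> q < d \<Longrightarrow> (\<Sum>l\<in>I. a p l * cnj (a q l)) = (if p = q then 1 else 0)"
    and inv: "\<And>p x s. p < d \<Longrightarrow> x \<in> extensional I \<Longrightarrow> H (shift I (\<lambda>l. Re (a p l)) s x) = H x"
      "\<And>p x s. p < d \<Longrightarrow> x \<in> extensional I \<Longrightarrow> H (shift I (\<lambda>l. Im (a p l)) s x) = H x"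
    and f: "\<And>x. x \<in> space (gauss I) \<Longrightarrow>
      mtrace (mat_adjoint (colm d (\<lambda>p. \<Sum>l\<in>I. a p l * of_real (x l))) * (H x * colm d (\<lambda>p. \<Sum>l\<in>I. a p l * of_real (x l)))) = of_real (f x)"
      "\<And>x. x \<in> space (gauss I) \<Longrightarrow> 0 \<le> f x"
    and t: "\<And>x. x \<in> space (gauss I) \<Longrightarrow> mtrace (H x) = of_real (t x)" "\<And>x. x \<in> space (gauss I) \<Longrightarrow> 0 \<le> t x"
  shows "(\<integral>\<^sup>+x. ennreal (f x) \<partial>gauss I) = (\<integral>\<^sup>+x. ennreal (t x) \<partial>gauss I)"
proof -
  interpret prob_space "gauss I" by (rule prob_space_gauss)
  define z where "z = (\<lambda>x p. \<Sum>l\<in>I. a p l * complex_of_real (x l))"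
  have e: "has_bochner_integral (gauss I) (\<lambda>x. z x q * cnj (z x p) * H x $$ (p, q))
      ((\<Sum>l\<in>I. a q l * cnj (a p l)) * (\<integral>x. H x $$ (p, q) \<partial>gauss I))" if pq: "p < d" "q < d" for p q
    unfolding z_def
  proof (rule gauss_covariance [OF I measurable_matD(2) [OF H pq] B [OF pq]])
    fix c and x :: "'i \<Rightarrow> real" and s assume "c \<in> {a q, a p}" "x \<in> extensional I"
    then show "H (shift I (\<lambda>l. Re (c l)) s x) $$ (p, q) = H x $$ (p, q)"
      "H (shift I (\<lambda>l. Im (c l)) s x) $$ (p, q) = H x $$ (p, q)" using inv pq by auto
  qed
  have "has_bochner_integral (gauss I) (\<lambda>x. \<Sum>p<d. \<Sum>q<d. z x q * cnj (z x p) * H x $$ (p, q))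
      (\<Sum>p<d. \<Sum>q<d. (\<Sum>l\<in>I. a q l * cnj (a p l)) * (\<integral>x. H x $$ (p, q) \<partial>gauss I))"
    by (intro has_bochner_integral_sum e) auto
  moreover have "(\<Sum>p<d. \<Sum>q<d. (\<Sum>l\<in>I. a q l * cnj (a p l)) * (\<integral>x. H x $$ (p, q) \<partial>gauss I))
      = (\<Sum>p<d. \<Sum>q<d. if q = p then \<integral>x. H x $$ (p, p) \<partial>gauss I else 0)"
    by (intro sum.cong refl) (simp add: orth)
  moreover have "\<dots> = (\<Sum>p<d. \<integral>x. H x $$ (p, p) \<partial>gauss I)" by (simp add: sum.delta)
  ultimately have hb: "has_bochner_integral (gauss I) (\<lambda>x. \<Sum>p<d. \<Sum>q<d. z x q * cnj (z x p) * H x $$ (p, q))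
      (\<Sum>p<d. \<integral>x. H x $$ (p, p) \<partial>gauss I)" by simp
  have ff: "(\<Sum>p<d. \<Sum>q<d. z x q * cnj (z x p) * H x $$ (p, q)) = of_real (f x)" if x: "x \<in> space (gauss I)" for x
    unfolding f(1) [OF x, symmetric] z_def [symmetric] hform_mtrace [OF measurable_matD(1) [OF H x], symmetric] hform_def
    by (simp add: mult_ac z_def)
  have "has_bochner_integral (gauss I) (\<lambda>x. of_real (f x) :: complex) (\<Sum>p<d. \<integral>x. H x $$ (p, p) \<partial>gauss I)"
    using hb by (subst has_bochner_integral_cong [OF refl _ refl]) (auto simp: ff [symmetric])
  from has_bochner_integral_bounded_linear [OF bounded_linear_Re this]
  have fb: "has_bochner_integral (gauss I) f (Re (\<Sum>p<d. \<integral>x. H x $$ (p, p) \<partial>gauss I))" by simp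
  have "integrable (gauss I) (\<lambda>x. H x $$ (p, p))" if "p < d" for p
    by (rule integrable_const_bound [where B = B]) (use that B measurable_matD(2) [OF H] in auto)
  then have "has_bochner_integral (gauss I) (\<lambda>x. \<Sum>p<d. H x $$ (p, p)) (\<Sum>p<d. \<integral>x. H x $$ (p, p) \<partial>gauss I)"
    by (intro has_bochner_integral_sum has_bochner_integral_integrable) auto
  moreover have "(\<Sum>p<d. H x $$ (p, p)) = of_real (t x)" if x: "x \<in> space (gauss I)" for x
    using t(1) [OF x] carrier_matD [OF measurable_matD(1) [OF H x]] by (simp add: mtrace_def)
  ultimately have "has_bochner_integral (gauss I) (\<lambda>x. of_real (t x) :: complex) (\<Sum>p<d. \<integral>x. H x $$ (p, p) \<partial>gauss I)"
    by (subst has_bochner_integral_cong [OF refl _ refl]) auto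
  from has_bochner_integral_bounded_linear [OF bounded_linear_Re this]
  have tb: "has_bochner_integral (gauss I) t (Re (\<Sum>p<d. \<integral>x. H x $$ (p, p) \<partial>gauss I))" by simp
  have "(\<integral>\<^sup>+x. ennreal (f x) \<partial>gauss I) = ennreal (\<integral>x. f x \<partial>gauss I)"
    by (rule nn_integral_eq_integral) (use fb f(2) in \<open>auto simp: has_bochner_integral_iff\<close>)
  moreover have "(\<integral>\<^sup>+x. ennreal (t x) \<partial>gauss I) = ennreal (\<integral>x. t x \<partial>gauss I)"
    by (rule nn_integral_eq_integral) (use tb t(2) in \<open>auto simp: has_bochner_integral_iff\<close>)
  ultimately show ?thesis using fb tb by (simp add: has_bochner_integral_iff)
qed

lemma borel_measurable_complex_of_real:
  "f \<in> borel_measurable M \<Longrightarrow> (\<lambda>x. complex_of_real (f x)) \<in> borel_measurable M"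
  by measurable

lemma measurable_mat_compose:
  "measurable_mat N n m A \<Longrightarrow> f \<in> measurable M N \<Longrightarrow> measurable_mat M n m (\<lambda>x. A (f x))"
  by (auto simp: measurable_mat_def measurable_space intro: measurable_compose [of f M N])

lemma cmod_entry_le_frob_norm:
  assumes "A \<in> carrier_mat n m" "i < n" "j < m"
  shows "cmod (A $$ (i, j)) \<le> frob_norm A"
proof (rule power2_le_imp_le)
  show "(cmod (A $$ (i, j)))\<^sup>2 \<le> (frob_norm A)\<^sup>2"
    unfolding frob_norm_square [OF assms(1)]
  proof -
    have "(cmod (A $$ (i, j)))\<^sup>2 \<le> (\<Sum>j<m. (cmod (A $$ (i, j)))\<^sup>2)"
      using assms by (intro member_le_sum) auto
    also have "\<dots> \<le> (\<Sum>i<n. \<Sum>j<m. (cmod (A $$ (i, j)))\<^sup>2)"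
      by (rule member_le_sum [of i "{..<n}" "\<lambda>i. \<Sum>j<m. (cmod (A $$ (i, j)))\<^sup>2"]) (use assms in \<open>auto intro!: sum_nonneg\<close>)
    finally show "(cmod (A $$ (i, j)))\<^sup>2 \<le> (\<Sum>i<n. \<Sum>j<m. (cmod (A $$ (i, j)))\<^sup>2)" .
  qed
qed simp

lemma det_polynomial_family:
  fixes M :: "'x \<Rightarrow> complex mat"
  assumes M: "\<And>t. M t \<in> carrier_mat d d"
    and entry: "\<And>i j. i < d \<Longrightarrow> j < d \<Longrightarrow> \<exists>q. \<forall>t. M t $$ (i, j) = poly q (e t)"
  shows "\<exists>q. \<forall>t. det (M t) = poly q (e t)"
proof -
  obtain p where p: "\<And>i j t. i < d \<Longrightarrow> j < d \<Longrightarrow> M t $$ (i, j) = poly (p i j) (e t)"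
    using entry by metis
  define R where "R = mat d d (\<lambda>(i, j). p i j)"
  have "det (M t) = poly (det R) (e t)" for t
  proof -
    have h: "comm_ring_hom (\<lambda>q. poly q (e t))" by unfold_locales
    have "M t = map_mat (\<lambda>q. poly q (e t)) R"
      using carrier_matD [OF M [of t]] by (intro eq_matI) (simp_all add: R_def p)
    then show ?thesis using comm_ring_hom.hom_det [OF h, of R] by simp
  qed
  then show ?thesis by blast
qed

text \<open>The probabilistic part concerns a fixed matrix \<open>G\<close> with eigenvectors \<open>U\<close> and eigenvalues \<open>l\<close>. The test matrix with \<open>m = r + p\<close>
  columns gets one more independent column; a point \<open>x\<close> of the coordinate space holds its entries \<open>x (i, c)\<close>.\<close>

locale sketch =
  fixes n r m :: nat and U :: "complex mat" and l :: "nat \<Rightarrow> real"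
  assumes U: "is_unitary n U" and r: "0 < r" "r \<le> n" "r + 2 \<le> m"
begin

abbreviation "I \<equiv> {..<n} \<times> {..<Suc m}"
abbreviation "G \<equiv> fcalc n U l"

text \<open>The adjoint of the test matrix, enlarged by one more column; its entries are real.\<close>
definition T :: "(nat \<times> nat \<Rightarrow> real) \<Rightarrow> complex mat" where
  "T x = mat (Suc m) n (\<lambda>(c, i). of_real (x (i, c)))"

definition U1 :: "complex mat" where "U1 = mat n r (\<lambda>(i, j). U $$ (i, j))"

lemma carriers [simp]:
  "U \<in> carrier_mat n n" "T x \<in> carrier_mat (Suc m) n" "mat_adjoint (T x) \<in> carrier_mat n (Suc m)" "U1 \<in> carrier_mat n r"
  "T x * U1 \<in> carrier_mat (Suc m) r" "mat_adjoint U1 \<in> carrier_mat r n"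
  using is_unitary_carrier [OF U] by (auto simp: T_def U1_def intro: mult_carrier_mat)

lemma measurable_T: "measurable_mat (gauss I) (Suc m) n T"
proof (rule measurable_matI)
  fix c i assume ci: "c < Suc m" "i < n"
  then have "(\<lambda>x::nat \<times> nat \<Rightarrow> real. x (i, c)) \<in> borel_measurable (gauss I)" by (intro measurable_gauss_coordinate) auto
  then have "(\<lambda>x. complex_of_real (x (i, c))) \<in> borel_measurable (gauss I)" by (rule borel_measurable_complex_of_real)
  then show "(\<lambda>x. T x $$ (c, i)) \<in> borel_measurable (gauss I)" using ci by (simp add: T_def)
qed simp

text \<open>Almost surely the rows of the test matrix in the coordinates of the first \<open>r\<close> eigenvectors
  are independent. As the test matrix is real and the eigenvectors are complex, a point where the
  leading minor does not vanish is found on the line through \<open>Re U\<close> in direction \<open>Im U\<close>: at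
  the complex parameter \<open>\<i>\<close> the minor is 1.\<close>

lemma AE_left_inverse: "AE x in gauss I. \<exists>L\<in>carrier_mat r (Suc m). L * (T x * U1) = 1\<^sub>m r"
proof -
  define M where "M = (\<lambda>x::nat \<times> nat \<Rightarrow> complex. mat r r (\<lambda>(c, j). \<Sum>i<n. x (i, c) * U $$ (i, j)))"
  have M: "M x \<in> carrier_mat r r" for x by (simp add: M_def)
  define f where "f = (\<lambda>x::nat \<times> nat \<Rightarrow> real. det (M (\<lambda>q. of_real (x q))))"
  have poly: "\<exists>q. \<forall>t. f (x(k := t)) = poly q (of_real t)" for x k
    unfolding f_def
  proof (rule det_polynomial_family [OF M])
    fix c j assume cj: "c < r" "j < r"
    have "M (\<lambda>q. of_real ((x(k := t)) q)) $$ (c, j)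
      = poly (\<Sum>i<n. (if (i, c) = k then [:0, U $$ (i, j):] else [:of_real (x (i, c)) * U $$ (i, j):])) (of_real t)" for t
      using cj by (simp add: M_def poly_sum) (rule sum.cong, auto)
    then show "\<exists>q. \<forall>t. M (\<lambda>q. of_real ((x(k := t)) q)) $$ (c, j) = poly q (of_real t)" by blast
  qed
  define xs where "xs = (\<lambda>s (i, c). of_real (Re (U $$ (i, c))) - s * of_real (Im (U $$ (i, c))) :: complex)"
  have "\<exists>q. \<forall>s. det (M (xs s)) = poly q s"
  proof (rule det_polynomial_family [OF M, where e = "\<lambda>s. s"])
    fix c j assume cj: "c < r" "j < r"
    have "M (xs s) $$ (c, j) = poly (\<Sum>i<n. [:of_real (Re (U $$ (i, c))) * U $$ (i, j), - of_real (Im (U $$ (i, c))) * U $$ (i, j):]) s" for s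
      using cj by (simp add: M_def poly_sum xs_def) (rule sum.cong, auto simp: algebra_simps)
    then show "\<exists>q. \<forall>s. M (xs s) $$ (c, j) = poly q s" by blast
  qed
  then obtain q where q: "\<And>s. det (M (xs s)) = poly q s" by blast
  have "M (xs \<i>) = 1\<^sub>m r"
  proof (rule eq_matI)
    fix i j assume "i < dim_row (1\<^sub>m r :: complex mat)" "j < dim_col (1\<^sub>m r :: complex mat)"
    then have ij: "i < r" "j < r" "i < n" "j < n" using r by auto
    have "M (xs \<i>) $$ (i, j) = (\<Sum>k<n. cnj (U $$ (k, i)) * U $$ (k, j))"
      unfolding M_def xs_def using ij by (simp add: complex_eq_iff)
    then show "M (xs \<i>) $$ (i, j) = 1\<^sub>m r $$ (i, j)"
      unfolding is_unitary_entriesD [OF U ij(3,4)] using ij by simp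
  qed (simp_all add: M_def)
  then have "poly q \<i> \<noteq> 0" unfolding q [symmetric] by simp
  then have "q \<noteq> 0" by auto
  then have "finite {z. poly q z = 0}" by (rule poly_roots_finite)
  moreover have "infinite (range complex_of_real)" by (simp add: finite_image_iff inj_on_def infinite_UNIV_char_0)
  ultimately obtain s :: real where s: "poly q (of_real s) \<noteq> 0"
    by (metis (mono_tags, lifting) finite_subset image_subsetI mem_Collect_eq)
  define x0 where "x0 = restrict (\<lambda>(i, c). Re (U $$ (i, c)) - s * Im (U $$ (i, c))) I"
  have "M (\<lambda>q. of_real (x0 q)) = M (xs (of_real s))"
    unfolding M_def x0_def xs_def using r by (intro eq_matI) (auto intro!: sum.cong)
  then have f0: "f x0 \<noteq> 0" unfolding f_def using s q by simp
  have Mm: "measurable_mat (gauss I) r r (\<lambda>x. M (\<lambda>q. of_real (x q)))"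
  proof (rule measurable_matI)
    fix c j assume cj: "c < r" "j < r"
    have "(\<lambda>x. \<Sum>i<n. complex_of_real (x (i, c)) * U $$ (i, j)) \<in> borel_measurable (gauss I)"
    proof (intro borel_measurable_sum borel_measurable_times borel_measurable_const borel_measurable_complex_of_real)
      fix i assume "i \<in> {..<n}"
      then show "(\<lambda>x::nat \<times> nat \<Rightarrow> real. x (i, c)) \<in> borel_measurable (gauss I)"
        using cj r by (intro measurable_gauss_coordinate) auto
    qed
    then show "(\<lambda>x. M (\<lambda>q. of_real (x q)) $$ (c, j)) \<in> borel_measurable (gauss I)" using cj by (simp add: M_def)
  qed (rule M)
  have "AE x in gauss I. f x \<noteq> 0"
  proof (rule AE_gauss_polynomial_nonzero [OF _ _ poly _ f0])
    show "f \<in> borel_measurable (gauss I)" unfolding f_def by (rule measurable_mat_det [OF Mm])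
    show "x0 \<in> extensional I" unfolding x0_def by (rule restrict_extensional)
  qed simp
  then show ?thesis
  proof eventually_elim
    case (elim x)
    let ?M = "M (\<lambda>q. of_real (x q))"
    define N where "N = inverse (det ?M) \<cdot>\<^sub>m adj_mat ?M"
    have N: "N \<in> carrier_mat r r" unfolding N_def using adj_mat(1) [OF M] by simp
    have "N * ?M = inverse (det ?M) \<cdot>\<^sub>m (adj_mat ?M * ?M)"
      unfolding N_def by (rule mult_smult_assoc_mat [OF adj_mat(1) [OF M] M])
    also have "\<dots> = 1\<^sub>m r" unfolding adj_mat(3) [OF M] using elim by (intro eq_matI) (simp_all add: f_def)
    finally have NM: "N * ?M = 1\<^sub>m r" .
    define L where "L = mat r (Suc m) (\<lambda>(a, c). if c < r then N $$ (a, c) else 0)"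
    have L: "L \<in> carrier_mat r (Suc m)" by (simp add: L_def)
    have "L * (T x * U1) = N * ?M"
    proof (rule eq_matI)
      fix a j assume "a < dim_row (N * ?M)" "j < dim_col (N * ?M)"
      then have aj: "a < r" "j < r" using N M [of "\<lambda>q. of_real (x q)"] by auto
      have TU: "(T x * U1) $$ (c, j) = (\<Sum>i<n. of_real (x (i, c)) * U $$ (i, j))" if "c < Suc m" for c
        using that aj by (subst index_mult_mat_sum [of _ "Suc m" n _ r]) (simp_all add: T_def U1_def)
      have "(L * (T x * U1)) $$ (a, j) = (\<Sum>c<Suc m. L $$ (a, c) * (T x * U1) $$ (c, j))"
        by (rule index_mult_mat_sum [OF L _ aj]) simp
      also have "\<dots> = (\<Sum>c<Suc m. (if c < r then N $$ (a, c) else 0) * (\<Sum>i<n. of_real (x (i, c)) * U $$ (i, j)))"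
      proof (intro sum.cong refl)
        fix c assume "c \<in> {..<Suc m}"
        then show "L $$ (a, c) * (T x * U1) $$ (c, j) = (if c < r then N $$ (a, c) else 0) * (\<Sum>i<n. of_real (x (i, c)) * U $$ (i, j))"
          using TU [of c] aj by (simp add: L_def del: index_mult_mat)
      qed
      also have "\<dots> = (\<Sum>c<r. N $$ (a, c) * ?M $$ (c, j))"
        using r aj by (intro sum.mono_neutral_cong_right) (auto simp: M_def)
      also have "\<dots> = (N * ?M) $$ (a, j)" by (rule index_mult_mat_sum [OF N M aj, symmetric])
      finally show "(L * (T x * U1)) $$ (a, j) = (N * ?M) $$ (a, j)" .
    qed (use N M [of "\<lambda>q. of_real (x q)"] L carrier_matD [OF carriers(5) [of x]] in auto)
    then show ?case using L NM by auto
  qed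
qed

text \<open>A vector in the range of \<open>P0 x\<close> combines the \<open>m + 1\<close> columns of the test matrix to a
  vector without components along the leading eigenvectors.\<close>
definition P0 :: "(nat \<times> nat \<Rightarrow> real) \<Rightarrow> complex mat" where
  "P0 x = 1\<^sub>m (Suc m) - range_proj (Suc m) r (T x * U1)"

lemma proj_P0: "is_proj (Suc m) (P0 x)"
  unfolding P0_def by (rule is_proj_compl) (use is_range_proj [of "T x * U1" "Suc m" r] in \<open>simp add: is_range_proj_def\<close>)

lemma P0_carrier [simp]: "P0 x \<in> carrier_mat (Suc m) (Suc m)"
  by (rule is_proj_carrier [OF proj_P0])

lemma P0_kill: "P0 x * (T x * U1) = 0\<^sub>m (Suc m) r"
proof -
  let ?R = "range_proj (Suc m) r (T x * U1)"
  have R: "is_range_proj (Suc m) r (T x * U1) ?R" by (rule is_range_proj) simp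
  then have c: "?R \<in> carrier_mat (Suc m) (Suc m)" and RY: "?R * (T x * U1) = T x * U1"
    using is_proj_carrier by (auto simp: is_range_proj_def)
  have "P0 x * (T x * U1) = 1\<^sub>m (Suc m) * (T x * U1) - ?R * (T x * U1)"
    unfolding P0_def by (rule minus_mult_distrib_mat [OF one_carrier_mat c carriers(5)])
  then show ?thesis unfolding RY left_mult_one_mat [OF carriers(5)]
    using carrier_matD [OF carriers(5) [of x]] by (intro eq_matI) (simp_all del: index_mult_mat(1))
qed

lemma measurable_P0: "measurable_mat (gauss I) (Suc m) (Suc m) P0"
  unfolding P0_def
  by (intro measurable_mat_add(2) measurable_mat_const measurable_mat_range_proj [of _ _ r "\<lambda>x. T x * U1"] is_range_proj
      measurable_mat_mult [of _ _ n] measurable_T) simp_all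

lemma AE_trace_P0: "AE x in gauss I. mtrace (P0 x) = of_nat (Suc m - r)"
  using AE_left_inverse
proof eventually_elim
  case (elim x)
  have R: "is_range_proj (Suc m) r (T x * U1) (range_proj (Suc m) r (T x * U1))" by (rule is_range_proj) simp
  have "mtrace (range_proj (Suc m) r (T x * U1)) = of_nat r"
    using trace_range_proj [OF carriers(5) R] elim by blast
  moreover have "range_proj (Suc m) r (T x * U1) \<in> carrier_mat (Suc m) (Suc m)"
    using R is_proj_carrier by (auto simp: is_range_proj_def)
  ultimately show ?case unfolding P0_def using r by (simp add: mtrace_minus [of _ "Suc m"] of_nat_diff mtrace_def [of "1\<^sub>m (Suc m)"])
qed

end

context sketch
begin

lemma T_adjoint_entry: "i < n \<Longrightarrow> c < Suc m \<Longrightarrow> mat_adjoint (T x) $$ (i, c) = of_real (x (i, c))"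
  by (simp add: T_def)

subsection \<open>The residual in the extra column\<close>

definition Y :: "(nat \<times> nat \<Rightarrow> real) \<Rightarrow> complex mat" where
  "Y x = G * mat n m (\<lambda>(i, c). of_real (x (i, c)))"

definition A :: "(nat \<times> nat \<Rightarrow> real) \<Rightarrow> complex mat" where
  "A x = (1\<^sub>m n - range_proj n m (Y x)) * G"

lemma G_carrier [simp]: "G \<in> carrier_mat n n" by simp

lemma Y_carrier [simp]: "Y x \<in> carrier_mat n m"
  unfolding Y_def by (rule mult_carrier_mat [OF G_carrier]) simp

lemma Y_proj: "is_range_proj n m (Y x) (range_proj n m (Y x))" by (rule is_range_proj) simp

lemma residual_proj: "is_proj n (1\<^sub>m n - range_proj n m (Y x))"
  by (rule is_proj_compl [OF is_range_proj_proj [OF Y_proj]])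

lemma residual_carrier [simp]: "1\<^sub>m n - range_proj n m (Y x) \<in> carrier_mat n n"
  by (rule is_proj_carrier [OF residual_proj])

lemma A_carrier [simp]: "A x \<in> carrier_mat n n" by (simp add: A_def)

lemma measurable_Y:
  assumes K: "{..<n} \<times> {..<m} \<subseteq> K"
  shows "measurable_mat (gauss K) n m Y"
  unfolding Y_def
proof (intro measurable_mat_mult [of _ _ n] measurable_mat_const G_carrier measurable_matI)
  fix i c assume ic: "i < n" "c < m"
  then have "(\<lambda>x::nat \<times> nat \<Rightarrow> real. x (i, c)) \<in> borel_measurable (gauss K)"
    using K by (intro measurable_gauss_coordinate) auto
  then have "(\<lambda>x. complex_of_real (x (i, c))) \<in> borel_measurable (gauss K)" by (rule borel_measurable_complex_of_real)
  then show "(\<lambda>x. mat n m (\<lambda>(i, c). complex_of_real (x (i, c))) $$ (i, c)) \<in> borel_measurable (gauss K)" using ic by simp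
qed simp

lemma measurable_A_on:
  assumes K: "{..<n} \<times> {..<m} \<subseteq> K"
  shows "measurable_mat (gauss K) n n A"
  unfolding A_def
  by (intro measurable_mat_mult [of _ _ n] measurable_mat_add(2) measurable_mat_const
      measurable_mat_range_proj [of _ _ m Y] measurable_Y [OF K] Y_proj) simp_all

lemma measurable_A: "measurable_mat (gauss I) n n A" by (rule measurable_A_on) auto

text \<open>The last column is independent of the projection, so its residual has the mean of the squared Frobenius norm of the residual.\<close>

definition \<delta> :: "(nat \<times> nat \<Rightarrow> real) \<Rightarrow> real" where
  "\<delta> x = (frob_norm (A x * colm n (\<lambda>i. of_real (x (i, m)))))\<^sup>2"

lemma frob_norm_A_le: "frob_norm (A x) \<le> frob_norm G"
  unfolding A_def by (rule frob_norm_proj_mult_le [OF residual_proj G_carrier])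

lemma nn_integral_\<delta>: "(\<integral>\<^sup>+x. ennreal (\<delta> x) \<partial>gauss I) = (\<integral>\<^sup>+x. ennreal ((frob_norm (A x))\<^sup>2) \<partial>gauss I)"
proof -
  define a :: "nat \<Rightarrow> nat \<times> nat \<Rightarrow> complex" where "a = (\<lambda>p q. if q = (p, m) then 1 else 0)"
  define H where "H = (\<lambda>x. mat_adjoint (A x) * A x)"
  have Hc: "H x \<in> carrier_mat n n" for x by (simp add: H_def)
  have z: "(\<Sum>q\<in>I. a p q * complex_of_real (x q)) = of_real (x (p, m))" if "p < n" for p x
  proof -
    have "(\<Sum>q\<in>I. a p q * complex_of_real (x q)) = (\<Sum>q\<in>I. if q = (p, m) then of_real (x q) else 0)"
      by (rule sum.cong) (auto simp: a_def)
    then show ?thesis using that by (simp add: sum.delta)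
  qed
  have col: "colm n (\<lambda>p. \<Sum>q\<in>I. a p q * complex_of_real (x q)) = colm n (\<lambda>p. of_real (x (p, m)))" for x
    by (rule eq_matI) (simp_all add: z)
  have shift: "A (shift I v s x) = A x" if "\<And>i c. c < m \<Longrightarrow> v (i, c) = 0" for v s x
  proof -
    have "mat n m (\<lambda>(i, c). complex_of_real (shift I v s x (i, c))) = mat n m (\<lambda>(i, c). complex_of_real (x (i, c)))"
      by (rule eq_matI) (simp_all add: shift_def that)
    then show ?thesis unfolding A_def Y_def by (simp only:)
  qed
  show ?thesis
  proof (rule gauss_quadratic_form [where a = a and H = H and d = n and B = "(frob_norm G)\<^sup>2"])
    show "measurable_mat (gauss I) n n H"
      unfolding H_def by (intro measurable_mat_mult [of _ _ n] measurable_mat_adjoint measurable_A)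
    fix x :: "nat \<times> nat \<Rightarrow> real"
    show "cmod (H x $$ (i, j)) \<le> (frob_norm G)\<^sup>2" if "i < n" "j < n" for i j
    proof -
      have "cmod (H x $$ (i, j)) \<le> frob_norm (H x)" by (rule cmod_entry_le_frob_norm [OF Hc that])
      also have "\<dots> \<le> frob_norm (mat_adjoint (A x)) * frob_norm (A x)"
        unfolding H_def by (rule frob_norm_mult_le [of _ n n _ n]) simp_all
      also have "\<dots> \<le> frob_norm G * frob_norm G"
        unfolding frob_norm_adjoint by (intro mult_mono frob_norm_A_le) simp_all
      finally show ?thesis by (simp add: power2_eq_square)
    qed
    show "(\<Sum>q\<in>I. a p q * cnj (a p' q)) = (if p = p' then 1 else 0)" if "p < n" "p' < n" for p p'
    proof -
      have "(\<Sum>q\<in>I. a p q * cnj (a p' q)) = (\<Sum>q\<in>I. if q = (p, m) then (if p = p' then 1 else 0) else 0)"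
        by (rule sum.cong) (auto simp: a_def)
      then show ?thesis using that by (simp add: sum.delta)
    qed
    show "H (shift I (\<lambda>q. Re (a p q)) s x) = H x" "H (shift I (\<lambda>q. Im (a p q)) s x) = H x" for p s
      unfolding H_def by (simp_all add: shift a_def)
    show "mtrace (mat_adjoint (colm n (\<lambda>p. \<Sum>q\<in>I. a p q * complex_of_real (x q))) * (H x * colm n (\<lambda>p. \<Sum>q\<in>I. a p q * complex_of_real (x q)))) = of_real (\<delta> x)"
    proof -
      let ?v = "colm n (\<lambda>i. complex_of_real (x (i, m)))"
      have Av: "A x * ?v \<in> carrier_mat n 1" by (rule mult_carrier_mat [OF A_carrier]) simp
      have "mat_adjoint ?v * (H x * ?v) = mat_adjoint (A x * ?v) * (A x * ?v)"
        unfolding H_def using Av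
        by (simp add: mat_adjoint_mult [of _ n n _ 1] assoc_mult_mat [of _ n n _ n _ 1] assoc_mult_mat [of _ 1 n _ n _ 1])
      then show ?thesis unfolding col \<delta>_def mtrace_adjoint_mult [OF Av, symmetric] by simp
    qed
    show "mtrace (H x) = of_real ((frob_norm (A x))\<^sup>2)" unfolding H_def by (rule mtrace_adjoint_mult [OF A_carrier])
  qed (simp_all add: \<delta>_def)
qed

subsection \<open>Rotating the columns\<close>

definition row_reflection :: "nat \<Rightarrow> (nat \<Rightarrow> real) \<Rightarrow> (nat \<times> nat \<Rightarrow> real) \<Rightarrow> nat \<times> nat \<Rightarrow> real" where
  "row_reflection k v x = (\<lambda>(i, c). if i < k \<and> c < Suc m then x (i, c) - 2 * (\<Sum>b<Suc m. v b * x (i, b)) * v c else x (i, c))"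

lemma preserves_gauss_row_reflection:
  assumes v: "(\<Sum>c<Suc m. (v c)\<^sup>2) = 1" and k: "k \<le> n"
  shows "preserves_gauss I (row_reflection k v)"
  using k
proof (induction k)
  case 0
  have "row_reflection 0 v = (\<lambda>x. x)" by (simp add: row_reflection_def fun_eq_iff)
  then show ?case by (simp add: preserves_gauss_id)
next
  case (Suc k)
  define w where "w = (\<lambda>(i, c). if i = k then v c else 0)"
  have s: "(\<Sum>q\<in>I. w q * g q) = (\<Sum>c<Suc m. v c * g (k, c))" for g :: "nat \<times> nat \<Rightarrow> real"
  proof -
    have "(\<Sum>q\<in>I. w q * g q) = (\<Sum>i<n. \<Sum>c<Suc m. w (i, c) * g (i, c))" unfolding sum.cartesian_product by (rule sum.cong) auto
    also have "\<dots> = (\<Sum>i<n. if i = k then \<Sum>c<Suc m. v c * g (k, c) else 0)"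
      by (rule sum.cong) (auto simp: w_def)
    also have "\<dots> = (\<Sum>c<Suc m. v c * g (k, c))" using Suc.prems by (simp add: sum.delta)
    finally show ?thesis .
  qed
  have "(\<Sum>q\<in>I. (w q)\<^sup>2) = (\<Sum>q\<in>I. w q * w q)" by (simp only: power2_eq_square)
  also have "\<dots> = (\<Sum>c<Suc m. v c * w (k, c))" by (rule s)
  also have "\<dots> = (\<Sum>c<Suc m. (v c)\<^sup>2)" by (simp only: w_def prod.case if_True power2_eq_square refl)
  finally have "(\<Sum>q\<in>I. (w q)\<^sup>2) = 1" unfolding v .
  then have "preserves_gauss I (reflection I w)" by (intro preserves_gauss_reflection) simp_all
  then have "preserves_gauss I (\<lambda>x. reflection I w (row_reflection k v x))"
    by (rule preserves_gauss_comp [OF _ Suc.IH [OF Suc_leD [OF Suc.prems]]])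
  moreover have "(\<lambda>x. reflection I w (row_reflection k v x)) = row_reflection (Suc k) v"
  proof (intro ext, goal_cases)
    case (1 x q)
    obtain i c where q: "q = (i, c)" by (cases q)
    show ?case unfolding reflection_def s q using Suc.prems
      by (auto simp: row_reflection_def w_def less_Suc_eq simp del: sum.lessThan_Suc)
  qed
  ultimately show ?case by simp
qed

definition householder :: "(nat \<Rightarrow> real) \<Rightarrow> nat \<Rightarrow> nat \<Rightarrow> real" where
  "householder v a b = (if a = b then 1 else 0) - 2 * v a * v b"

text \<open>After a rotation of the columns that puts the combination with coefficients \<open>h\<close> last, the residual of the last column
  bounds what is left of \<open>u\<close>: the part of \<open>u\<close> orthogonal to \<open>h\<close> combines the first \<open>m\<close> new columns, so
  its image is annihilated, and the rest is the component of \<open>u\<close> along \<open>h\<close> times the residual.\<close>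

lemma rotated_residual_le:
  assumes H: "\<And>i c. i < n \<Longrightarrow> c < Suc m \<Longrightarrow> x' (i, c) = (\<Sum>b<Suc m. H b c * x (i, b))"
    and HH: "\<And>a b. a < Suc m \<Longrightarrow> b < Suc m \<Longrightarrow> (\<Sum>c<Suc m. H a c * H b c) = (if a = b then 1 else 0)"
    and h: "\<And>b. b < Suc m \<Longrightarrow> H b m = h b"
  shows "(cmod (\<Sum>b<Suc m. of_real (h b) * u b))\<^sup>2 * \<delta> x' \<le> (frob_norm (G * (mat_adjoint (T x) * colm (Suc m) u)))\<^sup>2"
proof -
  define w where "w = (\<lambda>c. \<Sum>b<Suc m. of_real (H b c) * u b)"
  have x: "complex_of_real (x (i, b)) = (\<Sum>c<Suc m. of_real (H b c) * of_real (x' (i, c)))" if "i < n" "b < Suc m" for i b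
  proof -
    have "(\<Sum>c<Suc m. H b c * x' (i, c)) = (\<Sum>c<Suc m. \<Sum>a<Suc m. H b c * H a c * x (i, a))"
      by (intro sum.cong refl) (simp add: H [OF that(1)] sum_distrib_left mult.assoc del: sum.lessThan_Suc)
    also have "\<dots> = (\<Sum>a<Suc m. (\<Sum>c<Suc m. H b c * H a c) * x (i, a))"
      unfolding sum_distrib_right by (rule sum.swap)
    also have "\<dots> = (\<Sum>a<Suc m. if a = b then x (i, b) else 0)"
      by (intro sum.cong refl) (auto simp: HH that simp del: sum.lessThan_Suc)
    also have "\<dots> = x (i, b)" using that by (simp add: sum.delta del: sum.lessThan_Suc)
    finally show ?thesis unfolding of_real_mult [symmetric] of_real_sum [symmetric] by simp
  qed
  have Ou: "mat_adjoint (T x) * colm (Suc m) u = mat n m (\<lambda>(i, c). of_real (x' (i, c))) * colm m w + w m \<cdot>\<^sub>m colm n (\<lambda>i. of_real (x' (i, m)))"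
  proof (rule eq_matI)
    fix i j assume "i < dim_row (mat n m (\<lambda>(i, c). complex_of_real (x' (i, c))) * colm m w + w m \<cdot>\<^sub>m colm n (\<lambda>i. of_real (x' (i, m))))"
      "j < dim_col (mat n m (\<lambda>(i, c). complex_of_real (x' (i, c))) * colm m w + w m \<cdot>\<^sub>m colm n (\<lambda>i. of_real (x' (i, m))))"
    then have ij: "i < n" "j < 1" "j = 0" by simp_all
    have "(mat_adjoint (T x) * colm (Suc m) u) $$ (i, j) = (\<Sum>b<Suc m. mat_adjoint (T x) $$ (i, b) * colm (Suc m) u $$ (b, j))"
      by (rule index_mult_mat_sum [OF _ _ ij(1,2)]) simp_all
    also have "\<dots> = (\<Sum>b<Suc m. of_real (x (i, b)) * u b)"
      by (intro sum.cong refl) (use ij in \<open>simp add: T_adjoint_entry\<close>)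
    also have "\<dots> = (\<Sum>b<Suc m. \<Sum>c<Suc m. of_real (x' (i, c)) * (of_real (H b c) * u b))"
      by (intro sum.cong refl) (simp add: x [OF ij(1)] sum_distrib_right sum_distrib_left mult_ac del: sum.lessThan_Suc)
    also have "\<dots> = (\<Sum>c<Suc m. of_real (x' (i, c)) * w c)"
      unfolding w_def sum_distrib_left by (rule sum.swap)
    also have "\<dots> = (\<Sum>c<m. of_real (x' (i, c)) * w c) + of_real (x' (i, m)) * w m" by simp
    also have "(\<Sum>c<m. of_real (x' (i, c)) * w c) = (mat n m (\<lambda>(i, c). of_real (x' (i, c))) * colm m w) $$ (i, j)"
      using ij by (subst index_mult_mat_sum [of _ n m _ 1]) simp_all
    finally show "(mat_adjoint (T x) * colm (Suc m) u) $$ (i, j)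
      = (mat n m (\<lambda>(i, c). of_real (x' (i, c))) * colm m w + w m \<cdot>\<^sub>m colm n (\<lambda>i. of_real (x' (i, m)))) $$ (i, j)"
      using ij by (simp del: index_mult_mat(1))
  qed (use carrier_matD [OF carriers(3) [of x]] in auto)
  let ?R = "1\<^sub>m n - range_proj n m (Y x')"
  let ?e = "colm n (\<lambda>i. complex_of_real (x' (i, m)))"
  have Yw: "Y x' * colm m w \<in> carrier_mat n 1" by (rule mult_carrier_mat [OF Y_carrier]) simp
  have Ge: "G * ?e \<in> carrier_mat n 1" by (rule mult_carrier_mat [OF G_carrier]) simp
  have "G * (mat_adjoint (T x) * colm (Suc m) u) = Y x' * colm m w + w m \<cdot>\<^sub>m (G * ?e)"
  proof -
    let ?X = "mat n m (\<lambda>(i, c). complex_of_real (x' (i, c)))"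
    have Xw: "?X * colm m w \<in> carrier_mat n 1" by (rule mult_carrier_mat [OF _ colm_carrier(1)]) simp
    have "G * (?X * colm m w + w m \<cdot>\<^sub>m ?e) = G * (?X * colm m w) + G * (w m \<cdot>\<^sub>m ?e)"
      by (rule mult_add_distrib_mat [OF G_carrier Xw]) simp
    also have "G * (?X * colm m w) = Y x' * colm m w"
      unfolding Y_def by (rule assoc_mult_mat [OF G_carrier _ colm_carrier(1), symmetric]) simp
    also have "G * (w m \<cdot>\<^sub>m ?e) = w m \<cdot>\<^sub>m (G * ?e)" by (rule mult_smult_distrib [OF G_carrier colm_carrier(1)])
    finally show ?thesis unfolding Ou .
  qed
  then have "?R * (G * (mat_adjoint (T x) * colm (Suc m) u)) = ?R * (Y x' * colm m w) + w m \<cdot>\<^sub>m (?R * (G * ?e))"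
    using Yw Ge by (simp only:) (subst mult_add_distrib_mat [of _ n n _ 1], simp_all add: mult_smult_distrib [of _ n n _ 1])
  also have "?R * (Y x' * colm m w) = 0\<^sub>m n 1"
  proof -
    have Rc: "range_proj n m (Y x') \<in> carrier_mat n n" by (rule is_proj_carrier [OF is_range_proj_proj [OF Y_proj]])
    have "range_proj n m (Y x') * (Y x' * colm m w) = (range_proj n m (Y x') * Y x') * colm m w"
      by (rule assoc_mult_mat [OF Rc Y_carrier colm_carrier(1), symmetric])
    also have "range_proj n m (Y x') * Y x' = Y x'" using Y_proj [of x'] by (simp add: is_range_proj_def)
    finally have "range_proj n m (Y x') * (Y x' * colm m w) = Y x' * colm m w" .
    moreover have "?R * (Y x' * colm m w) = 1\<^sub>m n * (Y x' * colm m w) - range_proj n m (Y x') * (Y x' * colm m w)"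
      by (rule minus_mult_distrib_mat [OF one_carrier_mat Rc Yw])
    ultimately show ?thesis unfolding left_mult_one_mat [OF Yw] using carrier_matD [OF Yw] by (intro eq_matI) (simp_all del: index_mult_mat(1))
  qed
  also have "?R * (G * ?e) = A x' * ?e" unfolding A_def by (rule assoc_mult_mat [OF residual_carrier G_carrier colm_carrier(1), symmetric])
  finally have e: "?R * (G * (mat_adjoint (T x) * colm (Suc m) u)) = 0\<^sub>m n 1 + w m \<cdot>\<^sub>m (A x' * ?e)" .
  have Ae: "A x' * ?e \<in> carrier_mat n 1" by (rule mult_carrier_mat [OF A_carrier]) simp
  have GO: "G * (mat_adjoint (T x) * colm (Suc m) u) \<in> carrier_mat n 1"
    by (rule mult_carrier_mat [OF G_carrier], rule mult_carrier_mat [OF carriers(3)]) simp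
  have "frob_norm (?R * (G * (mat_adjoint (T x) * colm (Suc m) u))) = cmod (w m) * frob_norm (A x' * ?e)"
  proof -
    have "0\<^sub>m n 1 + w m \<cdot>\<^sub>m (A x' * ?e) = w m \<cdot>\<^sub>m (A x' * ?e)" using Ae by (intro left_add_zero_mat) simp
    moreover have "frob_norm (w m \<cdot>\<^sub>m (A x' * ?e)) = cmod (w m) * frob_norm (A x' * ?e)"
      unfolding frob_norm_def by (simp add: norm_mult power_mult_distrib sum_distrib_left [symmetric] real_sqrt_mult del: index_mult_mat(1))
    ultimately show ?thesis unfolding e by simp
  qed
  then have "(cmod (w m))\<^sup>2 * \<delta> x' = (frob_norm (?R * (G * (mat_adjoint (T x) * colm (Suc m) u))))\<^sup>2"
    by (simp add: \<delta>_def power_mult_distrib)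
  also have "\<dots> \<le> (frob_norm (G * (mat_adjoint (T x) * colm (Suc m) u)))\<^sup>2"
    by (intro power_mono frob_norm_proj_mult_le [OF residual_proj GO]) simp
  finally show ?thesis unfolding w_def using h by simp
qed

text \<open>A rotation of the columns acts on each row separately. It is the reflection that exchanges \<open>h\<close> with the last unit vector.\<close>

lemma rotation_exists:
  assumes h: "(\<Sum>c<Suc m. (h c)\<^sup>2) = 1"
  obtains R H where "preserves_gauss I R"
    "\<And>x i c. i < n \<Longrightarrow> c < Suc m \<Longrightarrow> R x (i, c) = (\<Sum>b<Suc m. H b c * x (i, b))"
    "\<And>a b. a < Suc m \<Longrightarrow> b < Suc m \<Longrightarrow> (\<Sum>c<Suc m. H a c * H b c) = (if a = b then 1 else 0 :: real)"
    "\<And>b. b < Suc m \<Longrightarrow> H b m = h b"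
proof (cases "\<forall>b<Suc m. h b = (if b = m then 1 else 0)")
  case True
  show ?thesis
  proof (rule that [of "\<lambda>x. x" "\<lambda>a b. if a = b then 1 else 0"])
    show "x (i, c) = (\<Sum>b<Suc m. (if b = c then 1 else 0) * x (i, b))" if "c < Suc m" for x :: "nat \<times> nat \<Rightarrow> real" and i c
    proof -
      have "(\<Sum>b<Suc m. (if b = c then 1 else 0) * x (i, b)) = (\<Sum>b<Suc m. if b = c then x (i, c) else 0)"
        by (rule sum.cong) auto
      then show ?thesis using that by (simp add: sum.delta del: sum.lessThan_Suc)
    qed
    show "(\<Sum>c<Suc m. (if a = c then 1 else 0) * (if b = c then 1 else 0)) = (if a = b then 1 else 0 :: real)" if "a < Suc m" for a b
    proof -
      have "(\<Sum>c<Suc m. (if a = c then 1 else 0) * (if b = c then 1 else 0)) = (\<Sum>c<Suc m. if c = a then (if a = b then 1 else 0) else 0 :: real)"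
        by (rule sum.cong) auto
      then show ?thesis using that by (simp add: sum.delta del: sum.lessThan_Suc)
    qed
  qed (use True preserves_gauss_id in auto)
next
  case False
  define e where "e = (\<lambda>b. if b = m then 1 else 0 :: real)"
  define N where "N = (\<Sum>c<Suc m. (e c - h c)\<^sup>2)"
  have se: "(\<Sum>c<Suc m. e c * g c) = g m" for g
    by (simp add: e_def)
  have Nh: "N = 2 * (1 - h m)"
  proof -
    have "N = (\<Sum>c<Suc m. e c * e c) - 2 * (\<Sum>c<Suc m. e c * h c) + (\<Sum>c<Suc m. (h c)\<^sup>2)"
      unfolding N_def sum_distrib_left sum_subtractf [symmetric] sum.distrib [symmetric]
      by (rule sum.cong) (simp_all add: power2_eq_square algebra_simps)
    then show ?thesis unfolding h se by (simp add: e_def)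
  qed
  have N0: "N > 0"
  proof -
    obtain b where "b < Suc m" "h b \<noteq> e b" using False by (auto simp: e_def)
    then have "0 < (\<Sum>c<Suc m. (e c - h c)\<^sup>2)" by (intro sum_pos2 [of _ b]) auto
    then show ?thesis by (simp only: N_def)
  qed
  define v where "v = (\<lambda>c. (e c - h c) / sqrt N)"
  have vv: "v a * v b = (e a - h a) * (e b - h b) / N" for a b using N0 by (simp add: v_def)
  have v1: "(\<Sum>c<Suc m. (v c)\<^sup>2) = 1"
  proof -
    have "(\<Sum>c<Suc m. (v c)\<^sup>2) = (\<Sum>c<Suc m. (e c - h c)\<^sup>2 / N)"
      by (rule sum.cong) (simp_all add: power2_eq_square vv)
    also have "\<dots> = N / N" unfolding N_def by (simp only: sum_divide_distrib)
    finally show ?thesis using N0 by simp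
  qed
  define H where "H = householder v"
  show ?thesis
  proof (rule that [of "row_reflection n v" H])
    show "preserves_gauss I (row_reflection n v)" by (rule preserves_gauss_row_reflection [OF v1]) simp
    show "row_reflection n v x (i, c) = (\<Sum>b<Suc m. H b c * x (i, b))" if "i < n" "c < Suc m" for x i c
    proof -
      have "(\<Sum>b<Suc m. H b c * x (i, b)) = (\<Sum>b<Suc m. (if b = c then x (i, c) else 0) - 2 * (v b * x (i, b)) * v c)"
        by (rule sum.cong) (auto simp: H_def householder_def algebra_simps)
      also have "\<dots> = x (i, c) - 2 * (\<Sum>b<Suc m. v b * x (i, b)) * v c"
        unfolding sum_subtractf sum_distrib_left sum_distrib_right using that by (simp add: sum.delta del: sum.lessThan_Suc)
      finally show ?thesis unfolding row_reflection_def using that by simp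
    qed
    show "(\<Sum>c<Suc m. H a c * H b c) = (if a = b then 1 else 0)" if "a < Suc m" "b < Suc m" for a b
    proof -
      have "(\<Sum>c<Suc m. H a c * H b c) = (\<Sum>c<Suc m. (if c = a then (if a = b then 1 else 0) - 2 * v b * v a else 0)
          - (if c = b then 2 * v a * v b else 0) + 4 * v a * v b * (v c)\<^sup>2)"
        by (rule sum.cong) (auto simp: H_def householder_def algebra_simps power2_eq_square)
      also have "\<dots> = ((if a = b then 1 else 0) - 2 * v b * v a) - 2 * v a * v b + 4 * v a * v b * (\<Sum>c<Suc m. (v c)\<^sup>2)"
        unfolding sum.distrib sum_subtractf sum_distrib_left [symmetric] using that by (simp add: sum.delta del: sum.lessThan_Suc)
      finally show ?thesis unfolding v1 by simp
    qed
    show "H b m = h b" if "b < Suc m" for b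
    proof -
      have "2 * (v b * v m) = (e b - h b) * (2 * (1 - h m)) / N" unfolding vv by (simp add: e_def)
      also have "\<dots> = e b - h b" unfolding Nh [symmetric] using N0 by simp
      finally show ?thesis by (simp add: H_def householder_def e_def mult.assoc)
    qed
  qed
qed

end

context sketch
begin

subsection \<open>The projected rows in the trailing directions\<close>

definition a :: "nat \<Rightarrow> (nat \<times> nat \<Rightarrow> real) \<Rightarrow> complex mat" where
  "a j x = P0 x * (T x * colm n (\<lambda>i. U $$ (i, j)))"

lemma Tu_carrier [simp]: "T x * colm n v \<in> carrier_mat (Suc m) 1" "T x * colm n v \<in> carrier_mat (Suc m) (Suc 0)"
  using mult_carrier_mat [OF carriers(2) colm_carrier(1)] by simp_all

lemma a_carrier [simp]: "a j x \<in> carrier_mat (Suc m) 1"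
  unfolding a_def by (rule mult_carrier_mat [OF P0_carrier Tu_carrier(1)])

lemma measurable_a: "measurable_mat (gauss I) (Suc m) 1 (a j)"
  unfolding a_def
  by (intro measurable_mat_mult [of _ _ "Suc m"] measurable_P0 measurable_mat_mult [of _ _ n] measurable_T measurable_mat_const colm_carrier)

text \<open>\<open>P0\<close> depends on the directions \<open>Re u\<close> and \<open>Im u\<close> of the test matrix, because \<open>u\<close> is orthogonal to the
  leading eigenvectors only in the complex sense. A larger projection, onto the complement of the leading rows that are
  orthogonal to both directions, does not, and its rank is larger by one only. For a weight that does not depend on these directions the second moments
  are those of an independent vector, which gives the trace of the projection.\<close>

lemma nn_integral_a_le:
  assumes j: "r \<le> j" "j < n"
  shows "(\<integral>\<^sup>+x. ennreal ((frob_norm (a j x))\<^sup>2) \<partial>gauss I) \<le> ennreal (real (Suc m - r) + 1)"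
proof -
  define u where "u = (\<lambda>i. U $$ (i, j))"
  define v where "v = vec r (\<lambda>k. \<Sum>i<n. cnj (U $$ (i, k)) * of_real (Re (u i)))"
  have v: "v \<in> carrier_vec r" by (simp add: v_def)
  have uo: "(\<Sum>i<n. cnj (U $$ (i, k)) * u i) = 0" if "k < r" for k
    unfolding u_def using is_unitary_entriesD [OF U, of k j] that j r by auto
  obtain C where C: "is_unitary r C" and Cv: "\<And>k. 0 < k \<Longrightarrow> k < r \<Longrightarrow> (\<Sum>i<r. cnj (C $$ (i, k)) * v $ i) = 0"
  proof (cases "v = 0\<^sub>v r")
    case True
    show ?thesis
    proof (rule that [of "1\<^sub>m r"])
      show "is_unitary r (1\<^sub>m r)" by (simp add: is_unitary_def)
    qed (use True in simp)
  next
    case False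
    obtain C c where C: "is_unitary r C" "c \<noteq> 0" "\<And>i. i < r \<Longrightarrow> C $$ (i, 0) = c * v $ i"
      using unitary_completion [OF v False] by blast
    show ?thesis
    proof (rule that [OF C(1)])
      fix k assume k: "0 < k" "k < r"
      have "c * (\<Sum>i<r. cnj (C $$ (i, k)) * v $ i) = (\<Sum>i<r. cnj (C $$ (i, k)) * C $$ (i, 0))"
        unfolding sum_distrib_left by (rule sum.cong) (simp_all add: C(3) mult_ac)
      also have "\<dots> = 0" using is_unitary_entriesD [OF C(1), of k 0] k by simp
      finally show "(\<Sum>i<r. cnj (C $$ (i, k)) * v $ i) = 0" using C(2) by simp
    qed
  qed
  define C1 where "C1 = mat r (r - 1) (\<lambda>(i, k). C $$ (i, Suc k))"
  have C1 [simp]: "C1 \<in> carrier_mat r (r - 1)" by (simp add: C1_def)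
  have C1o: "mat_adjoint C1 * C1 = 1\<^sub>m (r - 1)"
  proof (rule eq_matI)
    fix p q assume "p < dim_row (1\<^sub>m (r - 1) :: complex mat)" "q < dim_col (1\<^sub>m (r - 1) :: complex mat)"
    then have pq: "p < r - 1" "q < r - 1" "Suc p < r" "Suc q < r" by auto
    have "(mat_adjoint C1 * C1) $$ (p, q) = (\<Sum>k<r. cnj (C $$ (k, Suc p)) * C $$ (k, Suc q))"
      using pq by (subst index_mult_mat_sum [of _ "r - 1" r _ "r - 1"]) (simp_all add: C1_def)
    then show "(mat_adjoint C1 * C1) $$ (p, q) = 1\<^sub>m (r - 1) $$ (p, q)"
      unfolding is_unitary_entriesD [OF C pq(3,4)] using pq by simp
  qed (simp_all add: C1_def)
  define V where "V = U1 * C1"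
  have V [simp]: "V \<in> carrier_mat n (r - 1)" unfolding V_def by (rule mult_carrier_mat [OF carriers(4) C1])
  have Vi: "V $$ (i, k) = (\<Sum>b<r. U $$ (i, b) * C $$ (b, Suc k))" if "i < n" "k < r - 1" for i k
    unfolding V_def using that by (subst index_mult_mat_sum [OF carriers(4) C1]) (simp_all add: U1_def C1_def)
  have VR: "(\<Sum>i<n. V $$ (i, k) * of_real (Re (u i))) = 0" if k: "k < r - 1" for k
  proof -
    have "cnj (\<Sum>i<n. V $$ (i, k) * of_real (Re (u i))) = (\<Sum>i<n. \<Sum>b<r. cnj (C $$ (b, Suc k)) * (cnj (U $$ (i, b)) * of_real (Re (u i))))"
      unfolding cnj_sum
    proof (rule sum.cong [OF refl])
      fix i assume "i \<in> {..<n}"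
      then show "cnj (V $$ (i, k) * of_real (Re (u i))) = (\<Sum>b<r. cnj (C $$ (b, Suc k)) * (cnj (U $$ (i, b)) * of_real (Re (u i))))"
        using Vi [of i k] k by (simp add: sum_distrib_right sum_distrib_left mult_ac)
    qed
    also have "\<dots> = (\<Sum>b<r. \<Sum>i<n. cnj (C $$ (b, Suc k)) * (cnj (U $$ (i, b)) * of_real (Re (u i))))" by (rule sum.swap)
    also have "\<dots> = (\<Sum>b<r. cnj (C $$ (b, Suc k)) * v $ b)"
      by (rule sum.cong) (simp_all add: v_def sum_distrib_left)
    also have "\<dots> = 0" by (rule Cv) (use k in auto)
    finally show ?thesis by (simp only: complex_cnj_zero_iff)
  qed
  have VI: "(\<Sum>i<n. V $$ (i, k) * of_real (Im (u i))) = 0" if k: "k < r - 1" for k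
  proof -
    have "(\<Sum>i<n. V $$ (i, k) * cnj (u i)) = (\<Sum>i<n. \<Sum>b<r. C $$ (b, Suc k) * (U $$ (i, b) * cnj (u i)))"
    proof (rule sum.cong [OF refl])
      fix i assume "i \<in> {..<n}"
      then show "V $$ (i, k) * cnj (u i) = (\<Sum>b<r. C $$ (b, Suc k) * (U $$ (i, b) * cnj (u i)))"
        using Vi [of i k] k by (simp add: sum_distrib_right sum_distrib_left mult_ac)
    qed
    also have "\<dots> = (\<Sum>b<r. C $$ (b, Suc k) * (\<Sum>i<n. U $$ (i, b) * cnj (u i)))"
      unfolding sum.swap [of _ "{..<n}"] sum_distrib_left ..
    also have "\<dots> = 0"
    proof (rule sum.neutral, rule ballI)
      fix b assume "b \<in> {..<r}"
      then have "cnj (\<Sum>i<n. cnj (U $$ (i, b)) * u i) = 0" using uo by simp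
      then show "C $$ (b, Suc k) * (\<Sum>i<n. U $$ (i, b) * cnj (u i)) = 0" by simp
    qed
    finally have 0: "(\<Sum>i<n. V $$ (i, k) * cnj (u i)) = 0" .
    have "(\<Sum>i<n. V $$ (i, k) * cnj (u i)) = (\<Sum>i<n. V $$ (i, k) * of_real (Re (u i)) - \<i> * (V $$ (i, k) * of_real (Im (u i))))"
      by (rule sum.cong) (simp_all add: complex_eq_iff)
    also have "\<dots> = - \<i> * (\<Sum>i<n. V $$ (i, k) * of_real (Im (u i)))"
      unfolding sum_subtractf VR [OF k] sum_distrib_left [symmetric] by simp
    finally show ?thesis using 0 by simp
  qed
  have TV [simp]: "T x * V \<in> carrier_mat (Suc m) (r - 1)" for x by (rule mult_carrier_mat [OF carriers(2) V])
  define R1 where "R1 = (\<lambda>x. range_proj (Suc m) (r - 1) (T x * V))"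
  have R1: "is_range_proj (Suc m) (r - 1) (T x * V) (R1 x)" for x unfolding R1_def by (rule is_range_proj [OF TV])
  define H where "H = (\<lambda>x. 1\<^sub>m (Suc m) - R1 x)"
  have Hp: "is_proj (Suc m) (H x)" for x unfolding H_def by (rule is_proj_compl [OF is_range_proj_proj [OF R1]])
  have R1c [simp]: "R1 x \<in> carrier_mat (Suc m) (Suc m)" for x by (rule is_proj_carrier [OF is_range_proj_proj [OF R1]])
  have Hc [simp]: "H x \<in> carrier_mat (Suc m) (Suc m)" for x by (rule is_proj_carrier [OF Hp])
  have PH: "P0 x * H x = P0 x" for x
  proof -
    let ?R = "range_proj (Suc m) r (T x * U1)"
    have R: "is_range_proj (Suc m) r (T x * U1) ?R" by (rule is_range_proj) simp
    have Rc [simp]: "?R \<in> carrier_mat (Suc m) (Suc m)" by (rule is_proj_carrier [OF is_range_proj_proj [OF R]])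
    have TVe: "T x * V = (T x * U1) * C1" unfolding V_def by (rule assoc_mult_mat [OF carriers(2) carriers(4) C1, symmetric])
    have "?R * (T x * V) = (?R * (T x * U1)) * C1" unfolding TVe by (rule assoc_mult_mat [OF Rc carriers(5) C1, symmetric])
    also have "\<dots> = T x * V" using R unfolding TVe by (simp add: is_range_proj_def)
    finally have "?R * R1 x = R1 x" by (rule is_range_proj_absorb(1) [OF TV R1 is_range_proj_proj [OF R]])
    then have PR: "P0 x * R1 x = R1 x - R1 x"
      unfolding P0_def by (simp add: minus_mult_distrib_mat [of _ "Suc m" "Suc m" _ _ "Suc m"] left_mult_one_mat [of _ "Suc m" "Suc m"])
    have "P0 x * H x = P0 x * 1\<^sub>m (Suc m) - P0 x * R1 x"
      unfolding H_def by (rule mult_minus_distrib_mat [OF P0_carrier one_carrier_mat R1c])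
    also have "\<dots> = P0 x" unfolding PR right_mult_one_mat [OF P0_carrier]
      using carrier_matD [OF P0_carrier [of x]] carrier_matD [OF R1c [of x]] by (intro eq_matI) simp_all
    finally show ?thesis .
  qed
  define e :: "nat \<Rightarrow> nat \<times> nat \<Rightarrow> complex" where "e = (\<lambda>p (i, c). if c = p then u i else 0)"
  have eT: "colm (Suc m) (\<lambda>p. \<Sum>q\<in>I. e p q * of_real (x q)) = T x * colm n u" for x
  proof (rule eq_matI)
    fix p k assume "p < dim_row (T x * colm n u)" "k < dim_col (T x * colm n u)"
    then have pk: "p < Suc m" "k < 1" using carrier_matD [OF Tu_carrier(1) [of x u]] by auto
    have "(\<Sum>q\<in>I. e p q * of_real (x q)) = (\<Sum>i<n. \<Sum>c<Suc m. e p (i, c) * of_real (x (i, c)))"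
      unfolding sum.cartesian_product by (rule sum.cong) auto
    also have "\<dots> = (\<Sum>i<n. \<Sum>c<Suc m. if c = p then u i * of_real (x (i, p)) else 0)"
      by (intro sum.cong refl) (auto simp: e_def)
    also have "\<dots> = (\<Sum>i<n. u i * of_real (x (i, p)))" using pk by (simp add: sum.delta del: sum.lessThan_Suc)
    also have "\<dots> = (\<Sum>i<n. T x $$ (p, i) * colm n u $$ (i, k))" using pk by (intro sum.cong refl) (simp add: T_def)
    also have "\<dots> = (T x * colm n u) $$ (p, k)" by (rule index_mult_mat_sum [OF carriers(2) colm_carrier(1) pk, symmetric])
    finally show "colm (Suc m) (\<lambda>p. \<Sum>q\<in>I. e p q * of_real (x q)) $$ (p, k) = (T x * colm n u) $$ (p, k)" using pk by simp
  qed (use carrier_matD [OF Tu_carrier(1) [of x u]] in simp_all)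
  have Tshift: "H (shift I g s x) = H x"
    if g: "\<And>i c. g (i, c) = (if c = p then g' i else 0)" and g': "\<And>k. k < r - 1 \<Longrightarrow> (\<Sum>i<n. V $$ (i, k) * of_real (g' i)) = 0"
    for g g' p s x
  proof -
    have "T (shift I g s x) * V = T x * V"
    proof (rule eq_matI)
      fix c k assume "c < dim_row (T x * V)" "k < dim_col (T x * V)"
      then have ck: "c < Suc m" "k < r - 1" using carrier_matD [OF TV [of x]] by auto
      have "(T (shift I g s x) * V) $$ (c, k) = (\<Sum>i<n. T (shift I g s x) $$ (c, i) * V $$ (i, k))"
        by (rule index_mult_mat_sum [OF carriers(2) V ck])
      also have "\<dots> = (\<Sum>i<n. T x $$ (c, i) * V $$ (i, k) + of_real (if c = p then s else 0) * (V $$ (i, k) * of_real (g' i)))"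
        by (rule sum.cong) (use ck in \<open>auto simp: T_def shift_def g algebra_simps\<close>)
      also have "\<dots> = (\<Sum>i<n. T x $$ (c, i) * V $$ (i, k))"
        unfolding sum.distrib sum_distrib_left [symmetric] g' [OF ck(2)] by simp
      also have "\<dots> = (T x * V) $$ (c, k)" by (rule index_mult_mat_sum [OF carriers(2) V ck, symmetric])
      finally show "(T (shift I g s x) * V) $$ (c, k) = (T x * V) $$ (c, k)" .
    qed (use carrier_matD [OF TV [of x]] carrier_matD [OF TV [of "shift I g s x"]] in simp_all)
    then show ?thesis unfolding H_def R1_def by (simp only:)
  qed
  have Hm: "measurable_mat (gauss I) (Suc m) (Suc m) H"
    unfolding H_def
    by (intro measurable_mat_add(2) measurable_mat_const measurable_mat_range_proj [of _ _ "r - 1" "\<lambda>x. T x * V", OF _ R1]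
        measurable_mat_mult [of _ _ n] measurable_T V one_carrier_mat)
  have HT: "H x * (T x * colm n u) \<in> carrier_mat (Suc m) 1" for x by (rule mult_carrier_mat [OF Hc Tu_carrier(1)])
  have eq: "(\<integral>\<^sup>+x. ennreal ((frob_norm (H x * (T x * colm n u)))\<^sup>2) \<partial>gauss I) = (\<integral>\<^sup>+x. ennreal ((frob_norm (H x))\<^sup>2) \<partial>gauss I)"
  proof (rule gauss_quadratic_form [where a = e and H = H and d = "Suc m" and B = "sqrt (real (Suc m))"])
    show "measurable_mat (gauss I) (Suc m) (Suc m) H" by (rule Hm)
    fix x :: "nat \<times> nat \<Rightarrow> real"
    show "cmod (H x $$ (i, j)) \<le> sqrt (real (Suc m))" if "i < Suc m" "j < Suc m" for i j
    proof -
      have "cmod (H x $$ (i, j)) \<le> frob_norm (H x)" by (rule cmod_entry_le_frob_norm [OF Hc that])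
      also have "frob_norm (H x) = frob_norm (H x * 1\<^sub>m (Suc m))" by (simp only: right_mult_one_mat [OF Hc])
      also have "\<dots> \<le> frob_norm (1\<^sub>m (Suc m))" by (rule frob_norm_proj_mult_le [OF Hp one_carrier_mat])
      also have "\<dots> = sqrt (real (Suc m))"
      proof (rule real_sqrt_unique [symmetric])
        have "(frob_norm (1\<^sub>m (Suc m)))\<^sup>2 = (\<Sum>i<Suc m. \<Sum>j<Suc m. if j = i then 1 else 0)"
          unfolding frob_norm_square [OF one_carrier_mat] by (intro sum.cong refl) auto
        also have "\<dots> = (\<Sum>i<Suc m. 1)" by (intro sum.cong refl) (simp add: sum.delta del: sum.lessThan_Suc)
        finally show "(frob_norm (1\<^sub>m (Suc m)))\<^sup>2 = real (Suc m)" by simp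
      qed simp
      finally show ?thesis .
    qed
    show "(\<Sum>q\<in>I. e p q * cnj (e p' q)) = (if p = p' then 1 else 0)" if "p < Suc m" "p' < Suc m" for p p'
    proof -
      have "(\<Sum>q\<in>I. e p q * cnj (e p' q)) = (\<Sum>i<n. \<Sum>c<Suc m. e p (i, c) * cnj (e p' (i, c)))"
        unfolding sum.cartesian_product by (rule sum.cong) auto
      also have "\<dots> = (\<Sum>i<n. \<Sum>c<Suc m. if c = p then (if p = p' then cnj (U $$ (i, j)) * U $$ (i, j) else 0) else 0)"
        by (intro sum.cong refl) (auto simp: e_def u_def)
      also have "\<dots> = (\<Sum>i<n. if p = p' then cnj (U $$ (i, j)) * U $$ (i, j) else 0)"
        using that by (simp add: sum.delta del: sum.lessThan_Suc)
      also have "\<dots> = (if p = p' then 1 else 0)" using is_unitary_entriesD [OF U j(2) j(2)] by simp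
      finally show ?thesis .
    qed
    show "H (shift I (\<lambda>q. Re (e p q)) s x) = H x" for p s
      by (rule Tshift [where g' = "\<lambda>i. Re (u i)" and p = p]) (auto simp: e_def VR)
    show "H (shift I (\<lambda>q. Im (e p q)) s x) = H x" for p s
      by (rule Tshift [where g' = "\<lambda>i. Im (u i)" and p = p]) (auto simp: e_def VI)
    show "mtrace (mat_adjoint (colm (Suc m) (\<lambda>p. \<Sum>q\<in>I. e p q * complex_of_real (x q))) * (H x * colm (Suc m) (\<lambda>p. \<Sum>q\<in>I. e p q * complex_of_real (x q))))
      = of_real ((frob_norm (H x * (T x * colm n u)))\<^sup>2)"
    proof -
      let ?y = "T x * colm n u"
      have ya: "mat_adjoint ?y \<in> carrier_mat 1 (Suc m)" by simp
      have "mat_adjoint (H x * ?y) = mat_adjoint ?y * H x"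
        using Hp [of x] by (simp add: mat_adjoint_mult [OF Hc Tu_carrier(1)] is_proj_def)
      then have "mat_adjoint (H x * ?y) * (H x * ?y) = mat_adjoint ?y * (H x * (H x * ?y))"
        using assoc_mult_mat [OF ya Hc HT [of x]] by simp
      also have "H x * (H x * ?y) = H x * ?y" by (rule is_proj_cancel [OF Hp Tu_carrier(1)])
      finally show ?thesis unfolding eT mtrace_adjoint_mult [OF HT, symmetric] by simp
    qed
    show "mtrace (H x) = of_real ((frob_norm (H x))\<^sup>2)" by (rule frob_norm_proj [OF Hp, symmetric])
  qed simp_all
  have tr: "AE x in gauss I. (frob_norm (H x))\<^sup>2 = real (Suc m - r) + 1"
    using AE_left_inverse
  proof eventually_elim
    case (elim x)
    then obtain L where L: "L \<in> carrier_mat r (Suc m)" "L * (T x * U1) = 1\<^sub>m r" by blast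
    have aC: "mat_adjoint C1 \<in> carrier_mat (r - 1) r" unfolding mat_adjoint_carrier by (rule C1)
    have L1: "mat_adjoint C1 * L \<in> carrier_mat (r - 1) (Suc m)" by (rule mult_carrier_mat [OF aC L(1)])
    have "(mat_adjoint C1 * L) * (T x * V) = mat_adjoint C1 * (L * (T x * V))" by (rule assoc_mult_mat [OF aC L(1) TV])
    also have "L * (T x * V) = L * ((T x * U1) * C1)"
      unfolding V_def assoc_mult_mat [OF carriers(2) carriers(4) C1] ..
    also have "L * ((T x * U1) * C1) = (L * (T x * U1)) * C1" by (rule assoc_mult_mat [OF L(1) carriers(5) C1, symmetric])
    also have "\<dots> = C1" unfolding L(2) by (rule left_mult_one_mat [OF C1])
    finally have "(mat_adjoint C1 * L) * (T x * V) = 1\<^sub>m (r - 1)" unfolding C1o .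
    then have "mtrace (R1 x) = of_nat (r - 1)" by (rule trace_range_proj [OF TV R1 L1])
    then have "of_real ((frob_norm (H x))\<^sup>2) = (of_nat (Suc m) - of_nat (r - 1) :: complex)"
      unfolding frob_norm_proj [OF Hp] unfolding H_def
      by (simp add: mtrace_minus [of _ "Suc m"] mtrace_def [of "1\<^sub>m (Suc m)"])
    also have "\<dots> = of_real (real (Suc m - r) + 1)" using r by (simp add: of_nat_diff)
    finally show ?case unfolding of_real_eq_iff .
  qed
  interpret prob_space "gauss I" by (rule prob_space_gauss)
  have "(\<integral>\<^sup>+x. ennreal ((frob_norm (a j x))\<^sup>2) \<partial>gauss I) \<le> (\<integral>\<^sup>+x. ennreal ((frob_norm (H x * (T x * colm n u)))\<^sup>2) \<partial>gauss I)"
  proof (intro nn_integral_mono ennreal_leI power_mono)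
    fix x
    have "a j x = (P0 x * H x) * (T x * colm n u)" unfolding PH a_def u_def ..
    also have "\<dots> = P0 x * (H x * (T x * colm n u))" by (rule assoc_mult_mat [OF P0_carrier Hc Tu_carrier(1)])
    finally show "frob_norm (a j x) \<le> frob_norm (H x * (T x * colm n u))"
      using frob_norm_proj_mult_le [OF proj_P0 HT] by simp
  qed simp
  also have "\<dots> = (\<integral>\<^sup>+x. ennreal (real (Suc m - r) + 1) \<partial>gauss I)"
    unfolding eq by (rule nn_integral_cong_AE) (use tr in eventually_elim, simp)
  also have "\<dots> = ennreal (real (Suc m - r) + 1)" by (simp add: emeasure_space_1)
  finally show ?thesis .
qed

end

lemma frob_norm_fcalc_column:
  assumes U: "is_unitary n U" and Z: "Z \<in> carrier_mat n 1"
  shows "(frob_norm (fcalc n U f * Z))\<^sup>2 = (\<Sum>i<n. (f i)\<^sup>2 * (cmod ((mat_adjoint U * Z) $$ (i, 0)))\<^sup>2)"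
proof -
  note Uc [simp] = is_unitary_carrier [OF U]
  have aU: "mat_adjoint U \<in> carrier_mat n n" by simp
  have UZ: "mat_adjoint U * Z \<in> carrier_mat n 1" by (rule mult_carrier_mat [OF aU Z])
  define W where "W = diag_real n f * (mat_adjoint U * Z)"
  have W: "W \<in> carrier_mat n 1" unfolding W_def by (rule mult_carrier_mat [OF diag_real_carrier UZ])
  have UW: "U * W \<in> carrier_mat n 1" by (rule mult_carrier_mat [OF Uc W])
  have e: "fcalc n U f * Z = U * W"
    unfolding fcalc_def W_def
    using assoc_mult_mat [OF mult_carrier_mat [OF Uc diag_real_carrier] aU Z, of f] assoc_mult_mat [OF Uc diag_real_carrier UZ, of f] by simp
  have aW: "mat_adjoint W \<in> carrier_mat 1 n" unfolding mat_adjoint_carrier by (rule W)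
  have "mat_adjoint (U * W) * (U * W) = mat_adjoint W * (mat_adjoint U * (U * W))"
    unfolding mat_adjoint_mult [OF Uc W] by (rule assoc_mult_mat [OF aW aU UW])
  also have "mat_adjoint U * (U * W) = W"
    using assoc_mult_mat [OF aU Uc W] U W by (simp add: is_unitary_def)
  finally have "of_real ((frob_norm (U * W))\<^sup>2) = (of_real ((frob_norm W)\<^sup>2) :: complex)"
    by (simp only: mtrace_adjoint_mult [OF UW, symmetric] mtrace_adjoint_mult [OF W, symmetric])
  then have "(frob_norm (fcalc n U f * Z))\<^sup>2 = (frob_norm W)\<^sup>2" unfolding e of_real_eq_iff .
  also have "\<dots> = (\<Sum>i<n. (cmod (W $$ (i, 0)))\<^sup>2)" unfolding frob_norm_square [OF W] by simp
  also have "\<dots> = (\<Sum>i<n. (f i)\<^sup>2 * (cmod ((mat_adjoint U * Z) $$ (i, 0)))\<^sup>2)"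
  proof (rule sum.cong [OF refl])
    fix i assume "i \<in> {..<n}"
    then have "W $$ (i, 0) = of_real (f i) * (mat_adjoint U * Z) $$ (i, 0)"
      unfolding W_def by (intro index_diag_real_mult [OF UZ]) simp_all
    then show "(cmod (W $$ (i, 0)))\<^sup>2 = (f i)\<^sup>2 * (cmod ((mat_adjoint U * Z) $$ (i, 0)))\<^sup>2"
      by (simp only: norm_mult norm_of_real power_mult_distrib power2_abs)
  qed
  finally show ?thesis .
qed

text \<open>The integrand is homogeneous of degree 2 in \<open>a\<close>.\<close>

lemma gauss_proj_isotropy_scaled:
  assumes P: "is_proj d P" and k: "mtrace P = of_nat k" "2 < k" and a: "P * colm d a = colm d a"
  shows "(\<integral>\<^sup>+x. ennreal ((cmod (\<Sum>i<d. cnj (a i) * of_real (x i)))\<^sup>2 / ((frob_norm (P * colm d (\<lambda>i. of_real (x i))))\<^sup>2)\<^sup>2) \<partial>gauss {..<d})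
    \<le> ennreal (8 / 3 / (real k * (real k - 2)) * (\<Sum>i<d. (cmod (a i))\<^sup>2))"
proof (cases "(\<Sum>i<d. (cmod (a i))\<^sup>2) = 0")
  case True
  then have "\<forall>i\<in>{..<d}. (cmod (a i))\<^sup>2 = 0" by (subst (asm) sum_nonneg_eq_0_iff) simp_all
  then have "(\<Sum>i<d. cnj (a i) * of_real (x i)) = 0" for x by (intro sum.neutral) simp
  then show ?thesis by simp
next
  case False
  define s where "s = (\<Sum>i<d. (cmod (a i))\<^sup>2)"
  have s: "0 < s" using False sum_nonneg [of "{..<d}" "\<lambda>i. (cmod (a i))\<^sup>2"] by (simp add: s_def order_less_le)
  define b where "b = (\<lambda>i. of_real (1 / sqrt s) * a i)"
  have colb: "colm d b = of_real (1 / sqrt s) \<cdot>\<^sub>m colm d a" by (intro eq_matI) (simp_all add: b_def)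
  have Pb: "P * colm d b = colm d b"
    unfolding colb mult_smult_distrib [OF is_proj_carrier [OF P] colm_carrier(1)] a ..
  have b1: "(\<Sum>i<d. (cmod (b i))\<^sup>2) = 1"
  proof -
    have "(\<Sum>i<d. (cmod (b i))\<^sup>2) = (\<Sum>i<d. 1 / s * (cmod (a i))\<^sup>2)"
      by (rule sum.cong [OF refl]) (use s in \<open>simp add: b_def norm_mult power_mult_distrib power_divide norm_divide\<close>)
    also have "\<dots> = 1 / s * s" unfolding s_def sum_distrib_left ..
    finally show ?thesis using s by simp
  qed
  have ab: "(cmod (\<Sum>i<d. cnj (a i) * of_real (x i)))\<^sup>2 = s * (cmod (\<Sum>i<d. cnj (b i) * of_real (x i)))\<^sup>2" for x
  proof -
    have "(\<Sum>i<d. cnj (b i) * of_real (x i)) = of_real (1 / sqrt s) * (\<Sum>i<d. cnj (a i) * of_real (x i))"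
      unfolding sum_distrib_left by (rule sum.cong [OF refl]) (simp add: b_def mult.assoc)
    then have "cmod (\<Sum>i<d. cnj (b i) * of_real (x i)) = 1 / sqrt s * cmod (\<Sum>i<d. cnj (a i) * of_real (x i))"
      using s by (simp add: norm_mult norm_divide)
    then show ?thesis using s by (simp add: power_mult_distrib power_divide)
  qed
  have k0: "0 < real k * (real k - 2)" using k(2) by simp
  have "(\<integral>\<^sup>+x. ennreal ((cmod (\<Sum>i<d. cnj (a i) * of_real (x i)))\<^sup>2 / ((frob_norm (P * colm d (\<lambda>i. of_real (x i))))\<^sup>2)\<^sup>2) \<partial>gauss {..<d})
    = (\<integral>\<^sup>+x. ennreal s * ennreal ((cmod (\<Sum>i<d. cnj (b i) * of_real (x i)))\<^sup>2 / ((frob_norm (P * colm d (\<lambda>i. of_real (x i))))\<^sup>2)\<^sup>2) \<partial>gauss {..<d})"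
    unfolding ab using s by (intro nn_integral_cong) (simp add: ennreal_mult [symmetric] del: power_divide)
  also have "\<dots> = ennreal s * (\<integral>\<^sup>+x. ennreal ((cmod (\<Sum>i<d. cnj (b i) * of_real (x i)))\<^sup>2 / ((frob_norm (P * colm d (\<lambda>i. of_real (x i))))\<^sup>2)\<^sup>2) \<partial>gauss {..<d})"
  proof (rule nn_integral_cmult)
    note [measurable] = borel_measurable_proj_norm [OF P]
    have [measurable]: "(\<lambda>x. (cmod (\<Sum>i<d. cnj (b i) * of_real (x i)))\<^sup>2) \<in> borel_measurable (gauss {..<d})" by measurable
    show "(\<lambda>x. ennreal ((cmod (\<Sum>i<d. cnj (b i) * of_real (x i)))\<^sup>2 / ((frob_norm (P * colm d (\<lambda>i. of_real (x i))))\<^sup>2)\<^sup>2)) \<in> borel_measurable (gauss {..<d})"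
      by measurable
  qed
  also have "\<dots> \<le> ennreal s * ennreal (8 / 3 / (real k * (real k - 2)))"
    by (intro mult_left_mono gauss_proj_isotropy [OF P k Pb b1]) simp
  also have "\<dots> = ennreal (8 / 3 / (real k * (real k - 2)) * s)"
    using s k0 by (simp add: ennreal_mult [symmetric] mult.commute)
  finally show ?thesis unfolding s_def .
qed

context sketch
begin

abbreviation "J \<equiv> {..<Suc m}"
abbreviation "rv g \<equiv> colm (Suc m) (\<lambda>i. complex_of_real (g i))"

definition S :: "(nat \<times> nat \<Rightarrow> real) \<Rightarrow> (nat \<Rightarrow> real) \<Rightarrow> real" where
  "S x g = (frob_norm (P0 x * rv g))\<^sup>2"
definition N :: "(nat \<times> nat \<Rightarrow> real) \<Rightarrow> (nat \<Rightarrow> real) \<Rightarrow> real" where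
  "N x g = (frob_norm (G * (mat_adjoint (T x) * (P0 x * rv g))))\<^sup>2"

text \<open>The infinite value at the exceptional points, which have measure 0, makes the pointwise estimate hold everywhere.\<close>

definition F :: "(nat \<times> nat \<Rightarrow> real) \<Rightarrow> (nat \<Rightarrow> real) \<Rightarrow> ennreal" where
  "F x g = (if S x g = 0 then \<infinity> else ennreal (N x g / (S x g)\<^sup>2))"

lemma P0g_carrier [simp]: "P0 x * rv g \<in> carrier_mat (Suc m) 1"
  by (rule mult_carrier_mat [OF P0_carrier colm_carrier(1)])

lemma P0_adj: "mat_adjoint (P0 x) = P0 x" using proj_P0 [of x] by (simp add: is_proj_def)

lemma S_form: "(\<Sum>b<Suc m. of_real (g b) * (P0 x * rv g) $$ (b, 0)) = of_real (S x g)"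
proof -
  define u where "u = (\<lambda>b. (P0 x * rv g) $$ (b, 0))"
  have cu: "colm (Suc m) u = P0 x * rv g"
    using carrier_matD [OF P0g_carrier [of x g]] by (intro eq_matI) (simp_all add: u_def del: index_mult_mat(1))
  have "of_real (S x g) = mtrace (mat_adjoint (rv g) * (P0 x * rv g))"
    unfolding S_def hform_proj [OF proj_P0, symmetric] hform_mtrace [OF P0_carrier] ..
  also have "\<dots> = (\<Sum>b<Suc m. cnj (of_real (g b)) * u b)" unfolding cu [symmetric] by (rule mtrace_colm)
  finally show ?thesis by (simp add: u_def del: index_mult_mat(1) sum.lessThan_Suc)
qed

lemma measurable_\<delta>: "\<delta> \<in> borel_measurable (gauss I)"
proof -
  have "measurable_mat (gauss I) n 1 (\<lambda>x. colm n (\<lambda>i. complex_of_real (x (i, m))))"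
  proof (rule measurable_matI)
    fix i j :: nat assume ij: "i < n" "j < 1"
    then have "(\<lambda>x::nat \<times> nat \<Rightarrow> real. x (i, m)) \<in> borel_measurable (gauss I)" by (intro measurable_gauss_coordinate) auto
    from borel_measurable_complex_of_real [OF this]
    show "(\<lambda>x. colm n (\<lambda>i. complex_of_real (x (i, m))) $$ (i, j)) \<in> borel_measurable (gauss I)" using ij by simp
  qed simp
  from measurable_mat_frob_norm [OF measurable_mat_mult [OF measurable_A this]]
  show ?thesis unfolding \<delta>_def [abs_def] by (rule borel_measurable_power)
qed

text \<open>The columns are rotated to the direction \<open>g / |g|\<close>, and the combination with coefficients \<open>P0 x g\<close> is tested. Its component
  along \<open>g / |g|\<close> is \<open>|P0 x g|\<^sup>2 / |g|\<close>.\<close>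

lemma inverse_norm_times_residual_le:
  "ennreal (1 / (\<Sum>b<Suc m. (g b)\<^sup>2)) * (\<integral>\<^sup>+x. ennreal (\<delta> x) \<partial>gauss I) \<le> (\<integral>\<^sup>+x. F x g \<partial>gauss I)"
proof (cases "(\<Sum>b<Suc m. (g b)\<^sup>2) = 0")
  case True
  then show ?thesis by (simp only: True) simp
next
  case False
  define s where "s = (\<Sum>b<Suc m. (g b)\<^sup>2)"
  have s: "0 < s" using False sum_nonneg [of "{..<Suc m}" "\<lambda>b. (g b)\<^sup>2"] by (simp add: s_def order_less_le del: sum.lessThan_Suc)
  define h where "h = (\<lambda>b. g b / sqrt s)"
  have h1: "(\<Sum>b<Suc m. (h b)\<^sup>2) = 1"
  proof -
    have "(\<Sum>b<Suc m. (h b)\<^sup>2) = (\<Sum>b<Suc m. (g b)\<^sup>2 / s)" using s by (intro sum.cong refl) (simp add: h_def power_divide)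
    also have "\<dots> = s / s" unfolding s_def sum_divide_distrib ..
    finally show ?thesis using s by simp
  qed
  obtain R H where R: "preserves_gauss I R"
    and RH: "\<And>x i c. i < n \<Longrightarrow> c < Suc m \<Longrightarrow> R x (i, c) = (\<Sum>b<Suc m. H b c * x (i, b))"
    and HH: "\<And>a b. a < Suc m \<Longrightarrow> b < Suc m \<Longrightarrow> (\<Sum>c<Suc m. H a c * H b c) = (if a = b then 1 else 0 :: real)"
    and Hh: "\<And>b. b < Suc m \<Longrightarrow> H b m = h b"
    using rotation_exists [OF h1] by blast
  have dm: "(\<lambda>x. ennreal (1 / s) * ennreal (\<delta> x)) \<in> borel_measurable (gauss I)"
    using measurable_\<delta> by measurable
  have "ennreal (1 / s) * (\<integral>\<^sup>+x. ennreal (\<delta> x) \<partial>gauss I) = (\<integral>\<^sup>+x. ennreal (1 / s) * ennreal (\<delta> x) \<partial>gauss I)"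
    by (rule nn_integral_cmult [symmetric]) (use measurable_\<delta> in measurable)
  also have "\<dots> = (\<integral>\<^sup>+x. ennreal (1 / s) * ennreal (\<delta> (R x)) \<partial>gauss I)"
    by (rule preserves_gaussD [OF R dm, symmetric])
  also have "\<dots> \<le> (\<integral>\<^sup>+x. F x g \<partial>gauss I)"
  proof (rule nn_integral_mono)
    fix x :: "nat \<times> nat \<Rightarrow> real"
    show "ennreal (1 / s) * ennreal (\<delta> (R x)) \<le> F x g"
    proof (cases "S x g = 0")
      case False
      define u where "u = (\<lambda>b. (P0 x * rv g) $$ (b, 0))"
      have cu: "colm (Suc m) u = P0 x * rv g"
        using carrier_matD [OF P0g_carrier [of x g]] by (intro eq_matI) (simp_all add: u_def del: index_mult_mat(1))
      have "(\<Sum>b<Suc m. of_real (h b) * u b) = of_real (1 / sqrt s) * (\<Sum>b<Suc m. of_real (g b) * u b)"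
        unfolding sum_distrib_left by (intro sum.cong refl) (simp add: h_def)
      also have "\<dots> = of_real (1 / sqrt s * S x g)" unfolding u_def S_form by simp
      finally have hu: "cmod (\<Sum>b<Suc m. of_real (h b) * u b) = \<bar>1 / sqrt s * S x g\<bar>" by (simp only: norm_of_real)
      have "(cmod (\<Sum>b<Suc m. of_real (h b) * u b))\<^sup>2 * \<delta> (R x) \<le> N x g"
        unfolding N_def cu [symmetric] by (rule rotated_residual_le [OF RH HH Hh])
      then have "(S x g)\<^sup>2 / s * \<delta> (R x) \<le> N x g"
        unfolding hu using s by (simp add: power_mult_distrib power_divide)
      then have "1 / s * \<delta> (R x) \<le> N x g / (S x g)\<^sup>2"
        using False s by (simp add: field_simps)
      then have "ennreal (1 / s * \<delta> (R x)) \<le> F x g" unfolding F_def using False by (simp add: ennreal_leI)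
      moreover have "ennreal (1 / s) * ennreal (\<delta> (R x)) = ennreal (1 / s * \<delta> (R x))"
        by (rule ennreal_mult [symmetric]) (use s in \<open>simp_all add: \<delta>_def\<close>)
      ultimately show ?thesis by (simp only:)
    qed (simp add: F_def)
  qed
  finally show ?thesis unfolding s_def .
qed

lemma measurable_F: "case_prod F \<in> borel_measurable (gauss I \<Otimes>\<^sub>M gauss J)"
proof -
  have g: "measurable_mat (gauss J) (Suc m) 1 (\<lambda>g. rv g)"
  proof (rule measurable_matI)
    fix i j :: nat assume ij: "i < Suc m" "j < 1"
    then have "(\<lambda>x::nat \<Rightarrow> real. x i) \<in> borel_measurable (gauss J)" by (intro measurable_gauss_coordinate) auto
    from borel_measurable_complex_of_real [OF this]
    show "(\<lambda>g. rv g $$ (i, j)) \<in> borel_measurable (gauss J)" using ij by simp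
  qed simp
  have Pg: "measurable_mat (gauss I \<Otimes>\<^sub>M gauss J) (Suc m) 1 (\<lambda>w. P0 (fst w) * rv (snd w))"
    by (intro measurable_mat_mult [OF measurable_mat_compose [OF measurable_P0 measurable_fst] measurable_mat_compose [OF g measurable_snd]])
  have S: "(\<lambda>w. S (fst w) (snd w)) \<in> borel_measurable (gauss I \<Otimes>\<^sub>M gauss J)"
    unfolding S_def by (intro borel_measurable_power measurable_mat_frob_norm [OF Pg])
  have "measurable_mat (gauss I \<Otimes>\<^sub>M gauss J) n 1 (\<lambda>w. G * (mat_adjoint (T (fst w)) * (P0 (fst w) * rv (snd w))))"
    by (intro measurable_mat_mult [OF measurable_mat_const [OF G_carrier]]
       measurable_mat_mult [OF measurable_mat_adjoint [OF measurable_mat_compose [OF measurable_T measurable_fst]] Pg])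
  then have N: "(\<lambda>w. N (fst w) (snd w)) \<in> borel_measurable (gauss I \<Otimes>\<^sub>M gauss J)"
    unfolding N_def by (intro borel_measurable_power measurable_mat_frob_norm)
  define s where "s = (\<lambda>w. S (fst w) (snd w))"
  define nn where "nn = (\<lambda>w. N (fst w) (snd w))"
  note [measurable] = S [folded s_def] N [folded nn_def]
  have "(\<lambda>w. if s w = 0 then \<infinity> else ennreal (nn w / (s w)\<^sup>2)) \<in> borel_measurable (gauss I \<Otimes>\<^sub>M gauss J)"
    by measurable
  then show ?thesis unfolding case_prod_beta' F_def s_def nn_def .
qed

lemma a_leading: "j < r \<Longrightarrow> a j x = 0\<^sub>m (Suc m) 1"
proof (rule eq_matI)
  fix p q assume j: "j < r" and "p < dim_row (0\<^sub>m (Suc m) 1 :: complex mat)" "q < dim_col (0\<^sub>m (Suc m) 1 :: complex mat)"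
  then have pq: "p < Suc m" "q < 1" by auto
  have "a j x $$ (p, q) = (\<Sum>c<Suc m. P0 x $$ (p, c) * (T x * colm n (\<lambda>i. U $$ (i, j))) $$ (c, q))"
    unfolding a_def by (rule index_mult_mat_sum [OF P0_carrier Tu_carrier(1) pq])
  also have "\<dots> = (\<Sum>c<Suc m. P0 x $$ (p, c) * (T x * U1) $$ (c, j))"
  proof (rule sum.cong [OF refl])
    fix c assume "c \<in> {..<Suc m}"
    then have c: "c < Suc m" by simp
    have "(T x * colm n (\<lambda>i. U $$ (i, j))) $$ (c, q) = (T x * U1) $$ (c, j)"
      unfolding index_mult_mat_sum [OF carriers(2) colm_carrier(1) c pq(2)] index_mult_mat_sum [OF carriers(2,4) c j]
      by (intro sum.cong refl) (use pq j in \<open>simp add: U1_def\<close>)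
    then show "P0 x $$ (p, c) * (T x * colm n (\<lambda>i. U $$ (i, j))) $$ (c, q) = P0 x $$ (p, c) * (T x * U1) $$ (c, j)" by (simp only:)
  qed
  also have "\<dots> = (P0 x * (T x * U1)) $$ (p, j)" by (rule index_mult_mat_sum [OF P0_carrier carriers(5) pq(1) j, symmetric])
  also have "\<dots> = 0" unfolding P0_kill using pq j by simp
  finally show "a j x $$ (p, q) = 0\<^sub>m (Suc m) 1 $$ (p, q)" using pq by simp
qed (use carrier_matD [OF a_carrier [of j x]] in simp_all)

text \<open>The vectors tested have no component along the leading eigenvectors, so only the trailing eigenvalues remain.\<close>

lemma N_sum: "N x g = (\<Sum>j=r..<n. (l j)\<^sup>2 * (cmod (\<Sum>c<Suc m. cnj (a j x $$ (c, 0)) * of_real (g c)))\<^sup>2)"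
proof -
  let ?Z = "mat_adjoint (T x) * (P0 x * rv g)"
  have Z: "?Z \<in> carrier_mat n 1" by (rule mult_carrier_mat [OF carriers(3) P0g_carrier])
  have aU: "mat_adjoint U \<in> carrier_mat n n" by simp
  have e: "(mat_adjoint U * ?Z) $$ (j, 0) = (\<Sum>c<Suc m. cnj (a j x $$ (c, 0)) * of_real (g c))" if j: "j < n" for j
  proof -
    let ?u = "colm n (\<lambda>i. U $$ (i, j))"
    have ua: "mat_adjoint ?u \<in> carrier_mat 1 n" by simp
    have Tua: "mat_adjoint (T x * ?u) \<in> carrier_mat 1 (Suc m)" unfolding mat_adjoint_carrier by (rule Tu_carrier(1))
    have "(mat_adjoint U * ?Z) $$ (j, 0) = (\<Sum>i<n. mat_adjoint U $$ (j, i) * ?Z $$ (i, 0))"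
      by (rule index_mult_mat_sum [OF aU Z j]) simp
    also have "\<dots> = (\<Sum>i<n. mat_adjoint ?u $$ (0, i) * ?Z $$ (i, 0))"
      by (rule sum.cong [OF refl]) (use j carrier_matD [OF carriers(1)] in \<open>simp del: index_mult_mat(1)\<close>)
    also have "\<dots> = mtrace (mat_adjoint ?u * ?Z)"
      unfolding mtrace_mult_sum [OF ua Z] by simp
    also have "mat_adjoint ?u * ?Z = mat_adjoint (T x * ?u) * (P0 x * rv g)"
      unfolding mat_adjoint_mult [OF carriers(2) colm_carrier(1)] by (rule assoc_mult_mat [OF ua carriers(3) P0g_carrier, symmetric])
    also have "\<dots> = (mat_adjoint (T x * ?u) * P0 x) * rv g" by (rule assoc_mult_mat [OF Tua P0_carrier colm_carrier(1), symmetric])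
    also have "mat_adjoint (T x * ?u) * P0 x = mat_adjoint (a j x)"
      unfolding a_def mat_adjoint_mult [OF P0_carrier Tu_carrier(1)] P0_adj ..
    also have "mtrace (mat_adjoint (a j x) * rv g) = (\<Sum>c<Suc m. cnj (a j x $$ (c, 0)) * of_real (g c))"
    proof -
      have "colm (Suc m) (\<lambda>c. a j x $$ (c, 0)) = a j x" using carrier_matD [OF a_carrier [of j x]] by (intro eq_matI) simp_all
      then show ?thesis using mtrace_colm [of "Suc m" "\<lambda>c. a j x $$ (c, 0)" "\<lambda>c. of_real (g c)"] by (simp only:)
    qed
    finally show ?thesis .
  qed
  have "N x g = (\<Sum>j<n. (l j)\<^sup>2 * (cmod ((mat_adjoint U * ?Z) $$ (j, 0)))\<^sup>2)"
    unfolding N_def by (rule frob_norm_fcalc_column [OF U Z])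
  also have "\<dots> = (\<Sum>j<n. (l j)\<^sup>2 * (cmod (\<Sum>c<Suc m. cnj (a j x $$ (c, 0)) * of_real (g c)))\<^sup>2)"
    by (intro sum.cong refl) (simp only: e lessThan_iff)
  also have "\<dots> = (\<Sum>j=r..<n. (l j)\<^sup>2 * (cmod (\<Sum>c<Suc m. cnj (a j x $$ (c, 0)) * of_real (g c)))\<^sup>2)"
  proof (rule sum.mono_neutral_right)
    show "\<forall>j\<in>{..<n} - {r..<n}. (l j)\<^sup>2 * (cmod (\<Sum>c<Suc m. cnj (a j x $$ (c, 0)) * of_real (g c)))\<^sup>2 = 0"
    proof
      fix j assume "j \<in> {..<n} - {r..<n}"
      then have "j < r" by auto
      then have "(\<Sum>c<Suc m. cnj (a j x $$ (c, 0)) * of_real (g c)) = (\<Sum>c<Suc m. 0)"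
        unfolding a_leading [OF \<open>j < r\<close>] by (intro sum.cong refl) simp
      then show "(l j)\<^sup>2 * (cmod (\<Sum>c<Suc m. cnj (a j x $$ (c, 0)) * of_real (g c)))\<^sup>2 = 0" by (simp del: sum.lessThan_Suc)
    qed
  qed auto
  finally show ?thesis .
qed

lemma inner_integral_le:
  assumes tr: "mtrace (P0 x) = of_nat (Suc m - r)"
  defines "c \<equiv> 8 / 3 / (real (Suc m - r) * (real (Suc m - r) - 2))"
  shows "(\<integral>\<^sup>+g. F x g \<partial>gauss J) \<le> (\<Sum>j=r..<n. ennreal ((l j)\<^sup>2 * c) * ennreal ((frob_norm (a j x))\<^sup>2))"
proof -
  have k: "2 < Suc m - r" using r by simp
  define y where "y = (\<lambda>j g. (cmod (\<Sum>c<Suc m. cnj (a j x $$ (c, 0)) * of_real (g c)))\<^sup>2)"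
  have [measurable]: "y j \<in> borel_measurable (gauss J)" for j unfolding y_def by measurable
  have [measurable]: "S x \<in> borel_measurable (gauss J)"
    unfolding S_def by (rule borel_measurable_proj_norm [OF proj_P0])
  have y0: "0 \<le> y j g" for j g by (simp add: y_def)
  have c0: "0 \<le> c" unfolding c_def using k by simp
  have "AE g in gauss J. frob_norm (P0 x * rv g) \<noteq> 0" by (rule AE_proj_nonzero [OF proj_P0 tr]) (use k in simp)
  then have "(\<integral>\<^sup>+g. F x g \<partial>gauss J) = (\<integral>\<^sup>+g. (\<Sum>j=r..<n. ennreal ((l j)\<^sup>2) * ennreal (y j g / (S x g)\<^sup>2)) \<partial>gauss J)"
  proof (intro nn_integral_cong_AE, eventually_elim)
    case (elim g)
    then have "S x g \<noteq> 0" by (simp add: S_def)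
    then have "F x g = ennreal (\<Sum>j=r..<n. (l j)\<^sup>2 * (y j g / (S x g)\<^sup>2))"
      unfolding F_def N_sum by (simp add: sum_divide_distrib y_def del: sum.lessThan_Suc)
    also have "\<dots> = (\<Sum>j=r..<n. ennreal ((l j)\<^sup>2 * (y j g / (S x g)\<^sup>2)))" by (rule sum_ennreal [symmetric]) (simp add: y0)
    also have "\<dots> = (\<Sum>j=r..<n. ennreal ((l j)\<^sup>2) * ennreal (y j g / (S x g)\<^sup>2))"
      by (intro sum.cong refl ennreal_mult) (simp_all add: y0)
    finally show ?case .
  qed
  also have "\<dots> = (\<Sum>j=r..<n. ennreal ((l j)\<^sup>2) * (\<integral>\<^sup>+g. ennreal (y j g / (S x g)\<^sup>2) \<partial>gauss J))"
    by (subst nn_integral_sum) (simp_all add: nn_integral_cmult)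
  also have "\<dots> \<le> (\<Sum>j=r..<n. ennreal ((l j)\<^sup>2 * c) * ennreal ((frob_norm (a j x))\<^sup>2))"
  proof (rule sum_mono)
    fix j assume "j \<in> {r..<n}"
    have col: "colm (Suc m) (\<lambda>c. a j x $$ (c, 0)) = a j x" using carrier_matD [OF a_carrier [of j x]] by (intro eq_matI) simp_all
    have Pa: "P0 x * colm (Suc m) (\<lambda>c. a j x $$ (c, 0)) = colm (Suc m) (\<lambda>c. a j x $$ (c, 0))"
      unfolding col unfolding a_def by (rule is_proj_cancel [OF proj_P0 Tu_carrier(1)])
    have fa: "(\<Sum>i<Suc m. (cmod (a j x $$ (i, 0)))\<^sup>2) = (frob_norm (a j x))\<^sup>2"
      using frob_norm_colm [of "Suc m" "\<lambda>c. a j x $$ (c, 0)"] unfolding col by simp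
    have "(\<integral>\<^sup>+g. ennreal (y j g / (S x g)\<^sup>2) \<partial>gauss J) \<le> ennreal (c * (frob_norm (a j x))\<^sup>2)"
      unfolding y_def S_def c_def fa [symmetric] by (rule gauss_proj_isotropy_scaled [OF proj_P0 tr k Pa])
    then have "ennreal ((l j)\<^sup>2) * (\<integral>\<^sup>+g. ennreal (y j g / (S x g)\<^sup>2) \<partial>gauss J) \<le> ennreal ((l j)\<^sup>2) * ennreal (c * (frob_norm (a j x))\<^sup>2)"
      by (rule mult_left_mono) simp
    also have "\<dots> = ennreal ((l j)\<^sup>2 * c) * ennreal ((frob_norm (a j x))\<^sup>2)"
      using c0 by (simp add: ennreal_mult mult.assoc)
    finally show "ennreal ((l j)\<^sup>2) * (\<integral>\<^sup>+g. ennreal (y j g / (S x g)\<^sup>2) \<partial>gauss J) \<le> ennreal ((l j)\<^sup>2 * c) * ennreal ((frob_norm (a j x))\<^sup>2)" .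
  qed
  finally show ?thesis .
qed

text \<open>The direction \<open>g\<close> is averaged over a Gaussian vector independent of the test matrix. With \<open>q = p\<close> the constants are
  \<open>1 / (m - 1)\<close> for the mean of \<open>1 / |g|\<^sup>2\<close>, \<open>8 / 3 / ((q + 1) (q - 1))\<close> for the isotropy and \<open>q + 2\<close> for the projected rows, and
  \<open>8 / 3 (q + 2) \<le> 4 (q + 1)\<close>.\<close>

theorem sketch_bound:
  "(\<integral>\<^sup>+x. ennreal ((frob_norm (A x))\<^sup>2) \<partial>gauss I)
    \<le> ennreal (4 * (1 + real r / (real m - real r - 1)) * (\<Sum>j=r..<n. (l j)\<^sup>2))"
proof -
  interpret GI: prob_space "gauss I" by (rule prob_space_gauss)
  interpret GJ: prob_space "gauss J" by (rule prob_space_gauss)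
  interpret pair_sigma_finite "gauss I" "gauss J" by unfold_locales
  define c where "c = 8 / 3 / (real (Suc m - r) * (real (Suc m - r) - 2))"
  define E where "E = (\<integral>\<^sup>+x. ennreal (\<delta> x) \<partial>gauss I)"
  define q where "q = real m - real r"
  have q: "2 \<le> q" "real (Suc m - r) = q + 1" using r by (auto simp: q_def of_nat_diff)
  have c: "c = 8 / 3 / ((q + 1) * (q - 1))" unfolding c_def q(2) by simp
  have c0: "0 \<le> c" unfolding c using q(1) by simp
  have m1: "0 < real m - 1" using r by simp
  have "ennreal (1 / (real m - 1)) * E = (\<integral>\<^sup>+g. ennreal (1 / (\<Sum>b<Suc m. (g b)\<^sup>2)) \<partial>gauss J) * E"
    using gauss_inverse_norm_square [of "Suc m"] r by (simp del: sum.lessThan_Suc)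
  also have "\<dots> = (\<integral>\<^sup>+g. ennreal (1 / (\<Sum>b<Suc m. (g b)\<^sup>2)) * E \<partial>gauss J)"
  proof (rule nn_integral_multc [symmetric])
    have "(\<lambda>g. \<Sum>b<Suc m. (g b)\<^sup>2) \<in> borel_measurable (gauss J)"
      by (intro borel_measurable_sum borel_measurable_power measurable_gauss_coordinate)
    then show "(\<lambda>g. ennreal (1 / (\<Sum>b<Suc m. (g b)\<^sup>2))) \<in> borel_measurable (gauss J)"
      by (intro measurable_compose [OF _ measurable_ennreal] borel_measurable_divide borel_measurable_const)
  qed
  also have "\<dots> \<le> (\<integral>\<^sup>+g. (\<integral>\<^sup>+x. F x g \<partial>gauss I) \<partial>gauss J)"
    unfolding E_def by (rule nn_integral_mono) (rule inverse_norm_times_residual_le)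
  also have "\<dots> = (\<integral>\<^sup>+x. (\<integral>\<^sup>+g. F x g \<partial>gauss J) \<partial>gauss I)" by (rule Fubini' [OF measurable_F])
  also have "\<dots> \<le> (\<integral>\<^sup>+x. (\<Sum>j=r..<n. ennreal ((l j)\<^sup>2 * c) * ennreal ((frob_norm (a j x))\<^sup>2)) \<partial>gauss I)"
    by (rule nn_integral_mono_AE) (use AE_trace_P0 in eventually_elim, unfold c_def, rule inner_integral_le)
  also have "\<dots> = (\<Sum>j=r..<n. ennreal ((l j)\<^sup>2 * c) * (\<integral>\<^sup>+x. ennreal ((frob_norm (a j x))\<^sup>2) \<partial>gauss I))"
  proof -
    have [measurable]: "(\<lambda>x. (frob_norm (a j x))\<^sup>2) \<in> borel_measurable (gauss I)" for j
      by (intro borel_measurable_power measurable_mat_frob_norm [OF measurable_a])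
    show ?thesis by (subst nn_integral_sum) (simp_all add: nn_integral_cmult)
  qed
  also have "\<dots> \<le> (\<Sum>j=r..<n. ennreal ((l j)\<^sup>2 * c) * ennreal (q + 2))"
  proof (rule sum_mono)
    fix j assume "j \<in> {r..<n}"
    then have "(\<integral>\<^sup>+x. ennreal ((frob_norm (a j x))\<^sup>2) \<partial>gauss I) \<le> ennreal (q + 2)"
      using nn_integral_a_le [of j] unfolding q(2) by (simp add: add.assoc)
    then show "ennreal ((l j)\<^sup>2 * c) * (\<integral>\<^sup>+x. ennreal ((frob_norm (a j x))\<^sup>2) \<partial>gauss I) \<le> ennreal ((l j)\<^sup>2 * c) * ennreal (q + 2)"
      by (rule mult_left_mono) simp
  qed
  also have "\<dots> = ennreal (\<Sum>j=r..<n. (l j)\<^sup>2 * c * (q + 2))"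
    using c0 q(1) by (subst sum_ennreal [symmetric]) (simp_all add: ennreal_mult)
  also have "(\<Sum>j=r..<n. (l j)\<^sup>2 * c * (q + 2)) = c * (q + 2) * (\<Sum>j=r..<n. (l j)\<^sup>2)"
    by (simp add: sum_distrib_left mult_ac)
  finally have b: "ennreal (1 / (real m - 1)) * E \<le> ennreal (c * (q + 2) * (\<Sum>j=r..<n. (l j)\<^sup>2))" .
  have s0: "0 \<le> (\<Sum>j=r..<n. (l j)\<^sup>2)" by (rule sum_nonneg) simp
  have "E = ennreal ((real m - 1) * (1 / (real m - 1))) * E" using m1 by simp
  also have "\<dots> = ennreal (real m - 1) * (ennreal (1 / (real m - 1)) * E)"
    using m1 by (subst ennreal_mult) (simp_all add: mult.assoc)
  also have "\<dots> \<le> ennreal (real m - 1) * ennreal (c * (q + 2) * (\<Sum>j=r..<n. (l j)\<^sup>2))" by (rule mult_left_mono [OF b]) simp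
  also have "\<dots> = ennreal ((real m - 1) * (c * (q + 2)) * (\<Sum>j=r..<n. (l j)\<^sup>2))"
    using m1 c0 q(1) s0 by (simp add: ennreal_mult [symmetric] mult_ac)
  also have "\<dots> \<le> ennreal (4 * (1 + real r / (real m - real r - 1)) * (\<Sum>j=r..<n. (l j)\<^sup>2))"
  proof (intro ennreal_leI mult_right_mono s0)
    have "c * (q + 2) \<le> 4 / (q - 1)"
    proof -
      have "c * (q + 2) = (8 / 3 * (q + 2) / (q + 1)) / (q - 1)" unfolding c using q(1) by (simp add: field_simps)
      also have "\<dots> \<le> 4 / (q - 1)" using q(1) by (intro divide_right_mono) (simp_all add: field_simps)
      finally show ?thesis .
    qed
    then have "(real m - 1) * (c * (q + 2)) \<le> (real m - 1) * (4 / (q - 1))" using m1 by (intro mult_left_mono) simp_all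
    also have "\<dots> = 4 * (1 + real r / (real m - real r - 1))"
    proof -
      have "real m - 1 = (q - 1) + real r" by (simp add: q_def)
      then have "(real m - 1) * (4 / (q - 1)) = 4 * (((q - 1) + real r) / (q - 1))" by simp
      also have "((q - 1) + real r) / (q - 1) = 1 + real r / (q - 1)" using q(1) by (simp only: add_divide_distrib) simp
      finally show ?thesis unfolding q_def .
    qed
    finally show "(real m - 1) * (c * (q + 2)) \<le> 4 * (1 + real r / (real m - real r - 1))" .
  qed
  finally show ?thesis unfolding E_def nn_integral_\<delta> .
qed

end

section \<open>Reduction to the identity\<close>

lemma pd_factor_det_nonzero:
  assumes Q: "Q \<in> carrier_mat n n" and pd: "herm_pd n (Q * mat_adjoint Q)"
  shows "det Q \<noteq> 0"
proof
  assume d: "det Q = 0"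
  have A: "Q * mat_adjoint Q \<in> carrier_mat n n" using Q by simp
  have "det (Q * mat_adjoint Q) = det Q * det (mat_adjoint Q)" by (rule det_mult [OF Q]) (use Q in simp)
  then have "det (Q * mat_adjoint Q) = 0" using d by simp
  then obtain v where v: "v \<in> carrier_vec n" "v \<noteq> 0\<^sub>v n" "(Q * mat_adjoint Q) *\<^sub>v v = 0\<^sub>v n"
    using det_0_iff_vec_prod_zero_field [OF A] by blast
  have "0 < Re (((Q * mat_adjoint Q) *\<^sub>v v) \<bullet>c v)" using pd v unfolding herm_pd_def by blast
  then show False unfolding v(3) using v(1) by (simp add: scalar_prod_def)
qed

text \<open>The divergence does not change under a congruence of both arguments: the product of one argument with the inverse
  of the other changes by a similarity.\<close>

lemma logdet_div_congruence:
  assumes Q: "Q \<in> carrier_mat n n" "det Q \<noteq> 0" and M: "M \<in> carrier_mat n n"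
    and N: "N \<in> carrier_mat n n" and W: "W \<in> carrier_mat n n" and NW: "N * W = 1\<^sub>m n"
  shows "logdet_div n (Q * M * mat_adjoint Q) (Q * N * mat_adjoint Q)
    = Re (mtrace (M * W)) - ln (Re (det (M * W))) - real n"
proof -
  define q where "q = minv Q"
  have q: "q \<in> carrier_mat n n" "Q * q = 1\<^sub>m n" "q * Q = 1\<^sub>m n" unfolding q_def by (rule minv_inverse [OF Q])+
  have qa: "mat_adjoint q \<in> carrier_mat n n" and Qa: "mat_adjoint Q \<in> carrier_mat n n" using q(1) Q(1) by simp_all
  have Qqa: "mat_adjoint Q * mat_adjoint q = 1\<^sub>m n"
    unfolding mat_adjoint_mult [OF q(1) Q(1), symmetric] q(3) by simp
  note assoc = assoc_mult_mat [of _ n n _ n _ n]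
  note [simp] = q(1) qa Qa Q(1) M N W
  have cancel: "mat_adjoint Q * (mat_adjoint q * Z) = Z" if "Z \<in> carrier_mat n n" for Z
    using assoc_mult_mat [OF Qa qa that] that unfolding Qqa by (simp add: left_mult_one_mat [of _ n n])
  have NWZ: "N * (W * Z) = Z" if "Z \<in> carrier_mat n n" for Z
    using assoc_mult_mat [OF N W that] that unfolding NW by (simp add: left_mult_one_mat [of _ n n])
  have "(Q * N * mat_adjoint Q) * (mat_adjoint q * W * q) = 1\<^sub>m n"
    by (simp add: assoc cancel NWZ q(2))
  then have mi: "minv (Q * N * mat_adjoint Q) = mat_adjoint q * W * q" by (intro minv_eqI [of _ n]) simp_all
  have e: "(Q * M * mat_adjoint Q) * (mat_adjoint q * W * q) = Q * ((M * W) * q)"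
    by (simp add: assoc cancel)
  have "mtrace (Q * ((M * W) * q)) = mtrace (((M * W) * q) * Q)" by (rule mtrace_commute [of _ n n]) simp_all
  also have "((M * W) * q) * Q = M * W" by (simp add: assoc q(3) right_mult_one_mat [of _ n n])
  finally have tr: "mtrace (Q * ((M * W) * q)) = mtrace (M * W)" .
  have dq: "det Q * det q = 1" using det_mult [OF Q(1) q(1)] unfolding q(2) by simp
  have "det (Q * ((M * W) * q)) = det Q * (det (M * W) * det q)"
    by (simp add: det_mult [of _ n])
  also have "\<dots> = (det Q * det q) * det (M * W)" by (simp only: mult_ac)
  finally have d: "det (Q * ((M * W) * q)) = det (M * W)" unfolding dq by simp
  show ?thesis unfolding logdet_div_def mi e tr d ..
qed

lemma orthonormal_range_basis_is_range_proj:
  assumes \<Theta>: "orthonormal_range_basis n Y \<Theta>" and Y: "Y \<in> carrier_mat n m"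
  shows "is_range_proj n m Y (\<Theta> * mat_adjoint \<Theta>)" "\<Theta> \<in> carrier_mat n (dim_col \<Theta>)"
proof -
  interpret vec_space "TYPE(complex)" n .
  define k where "k = dim_col \<Theta>"
  have T: "\<Theta> \<in> carrier_mat n k" and o: "mat_adjoint \<Theta> * \<Theta> = 1\<^sub>m k" and cs: "col_space \<Theta> = col_space Y"
    using \<Theta> by (auto simp: orthonormal_range_basis_def k_def)
  have aT: "mat_adjoint \<Theta> \<in> carrier_mat k n" using T by simp
  have own: "set (cols M) \<subseteq> col_space M" if "M \<in> carrier_mat n c" for M c
    unfolding col_space_def using in_own_span [of "set (cols M)"] cols_dim [of M] carrier_matD [OF that] by (simp add: module_vec_simps)
  obtain C1 where C1: "C1 \<in> carrier_mat m k" "\<Theta> = Y * C1" using col_space_factor [OF T Y] own [OF T] cs by blast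
  obtain C2 where C2: "C2 \<in> carrier_mat k m" "Y = \<Theta> * C2" using col_space_factor [OF Y T] own [OF Y] cs by blast
  have P: "\<Theta> * mat_adjoint \<Theta> \<in> carrier_mat n n" by (rule mult_carrier_mat [OF T aT])
  have Pc: "\<Theta> * mat_adjoint \<Theta> * (\<Theta> * Z) = \<Theta> * Z" if Z: "Z \<in> carrier_mat k c" for Z c
  proof -
    have "\<Theta> * mat_adjoint \<Theta> * (\<Theta> * Z) = \<Theta> * (mat_adjoint \<Theta> * (\<Theta> * Z))"
      by (rule assoc_mult_mat [OF T aT mult_carrier_mat [OF T Z]])
    also have "mat_adjoint \<Theta> * (\<Theta> * Z) = (mat_adjoint \<Theta> * \<Theta>) * Z" by (rule assoc_mult_mat [OF aT T Z, symmetric])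
    finally show ?thesis unfolding o left_mult_one_mat [OF Z] .
  qed
  have p1: "is_proj n (\<Theta> * mat_adjoint \<Theta>)"
    unfolding is_proj_def
  proof (intro conjI P Pc [OF aT])
    show "mat_adjoint (\<Theta> * mat_adjoint \<Theta>) = \<Theta> * mat_adjoint \<Theta>"
      unfolding mat_adjoint_mult [OF T aT] mat_adjoint_adjoint ..
  qed
  have p2: "\<Theta> * mat_adjoint \<Theta> * Y = Y" using Pc [OF C2(1)] unfolding C2(2) [symmetric] .
  have p3: "\<Theta> * mat_adjoint \<Theta> = Y * (C1 * mat_adjoint \<Theta>)"
    using assoc_mult_mat [OF Y C1(1) aT] unfolding C1(2) [symmetric] .
  show "is_range_proj n m Y (\<Theta> * mat_adjoint \<Theta>)"
    unfolding is_range_proj_def by (intro conjI p1 p2 bexI [where x = "C1 * mat_adjoint \<Theta>"] p3 mult_carrier_mat [OF C1(1) aT])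
  show "\<Theta> \<in> carrier_mat n (dim_col \<Theta>)" unfolding k_def [symmetric] by (rule T)
qed

lemma rand_approx_eq:
  assumes G: "G \<in> carrier_mat n n" and T: "\<Theta> \<in> carrier_mat n k"
  shows "rand_approx G \<Theta> = \<Theta> * mat_adjoint \<Theta> * G * (\<Theta> * mat_adjoint \<Theta>)"
proof -
  have aT: "mat_adjoint \<Theta> \<in> carrier_mat k n" using T by simp
  have c: "\<Theta> * mat_adjoint \<Theta> * G \<in> carrier_mat n n" by (rule mult_carrier_mat [OF mult_carrier_mat [OF T aT] G])
  show ?thesis unfolding rand_approx_def by (rule assoc_mult_mat [OF c T aT])
qed

text \<open>The truncation and the inverse of \<open>I + G\<close> have the same eigenvectors, so the divergence is a sum over the
  eigenvalues; a retained eigenvalue contributes 0 and a dropped eigenvalue \<open>x\<close> contributes \<open>ldgap x\<close>.\<close>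

lemma divergence_truncation:
  assumes U: "is_unitary n U" and l: "\<And>i. i < n \<Longrightarrow> 0 \<le> l i" and r: "r \<le> n"
  defines "D \<equiv> (1\<^sub>m n + fcalc n U (\<lambda>i. if i < r then l i else 0)) * fcalc n U (\<lambda>i. 1 / (1 + l i))"
  shows "Re (mtrace D) - ln (Re (det D)) - real n = (\<Sum>i=r..<n. ldgap (l i))"
proof -
  define d where "d = (\<lambda>i. (1 + (if i < r then l i else 0)) * (1 / (1 + l i)))"
  have "1\<^sub>m n + fcalc n U (\<lambda>i. if i < r then l i else 0) = fcalc n U (\<lambda>i. 1 + (if i < r then l i else 0))"
    unfolding fcalc_one [OF U, symmetric] by (rule fcalc_add [OF is_unitary_carrier [OF U]])
  then have D: "D = fcalc n U d" unfolding D_def d_def by (simp only: fcalc_mult [OF U])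
  have dpos: "0 < d i" if "i < n" for i using l [OF that] by (simp add: d_def)
  have "ln (Re (det D)) = (\<Sum>i<n. ln (d i))"
    unfolding D det_fcalc [OF U] Re_complex_of_real by (rule ln_prod) (use dpos in force)+
  moreover have "Re (mtrace D) = (\<Sum>i<n. d i)" unfolding D mtrace_fcalc [OF U] by simp
  ultimately have "Re (mtrace D) - ln (Re (det D)) - real n = (\<Sum>i<n. d i - ln (d i) - 1)"
    by (simp add: sum_subtractf)
  also have "\<dots> = (\<Sum>i=r..<n. ldgap (l i))"
  proof (rule sum.mono_neutral_cong_right)
    show "\<forall>i\<in>{..<n} - {r..<n}. d i - ln (d i) - 1 = 0"
    proof
      fix i assume "i \<in> {..<n} - {r..<n}"
      then have "i < r" "0 \<le> l i" using l by auto
      then have "d i = 1" by (simp add: d_def)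
      then show "d i - ln (d i) - 1 = 0" by simp
    qed
    show "d i - ln (d i) - 1 = ldgap (l i)" if "i \<in> {r..<n}" for i
    proof -
      have p: "0 < 1 + l i" using l [of i] that by simp
      have di: "d i = 1 / (1 + l i)" using that by (simp add: d_def)
      have "1 / (1 + l i) - 1 = - (l i / (1 + l i))" using p by (simp add: field_simps)
      then show ?thesis unfolding di ldgap_def using p by (simp add: ln_div)
    qed
  qed auto
  finally show ?thesis .
qed

section \<open>Transfer to the coordinate space\<close>

lemma distr_gaussian_mat:
  assumes P: "prob_space P" and \<Omega>: "std_gaussian_mat P n m \<Omega>" and nm: "0 < n" "0 < m"
  defines "Z \<equiv> (\<lambda>\<omega>. \<lambda>q\<in>{..<n} \<times> {..<m}. (case q of (i, j) \<Rightarrow> \<Omega> \<omega> $$ (i, j)))"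
  shows "Z \<in> measurable P (gauss ({..<n} \<times> {..<m}))" "distr P (gauss ({..<n} \<times> {..<m})) Z = gauss ({..<n} \<times> {..<m})"
proof -
  interpret prob_space P by (rule P)
  let ?I = "{..<n} \<times> {..<m}"
  define X where "X = (\<lambda>(i, j) \<omega>. \<Omega> \<omega> $$ (i, j))"
  have ind: "indep_vars (\<lambda>_. borel) X ?I" and dst: "\<And>i j. i < n \<Longrightarrow> j < m \<Longrightarrow> distributed P lborel (\<lambda>\<omega>. \<Omega> \<omega> $$ (i, j)) std_normal_density"
    using \<Omega> by (auto simp: std_gaussian_mat_def X_def)
  have rv: "X q \<in> borel_measurable P" if "q \<in> ?I" for q
    using distributed_measurable [OF dst] that by (auto simp: X_def)
  have dX: "distr P borel (X q) = stdn" if q: "q \<in> ?I" for q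
  proof -
    have d: "distributed P lborel (X q) std_normal_density" using q dst by (auto simp: X_def)
    have "distr P borel (X q) = distr P lborel (X q)" by (rule distr_cong) simp_all
    then show ?thesis unfolding stdn_def using distributed_distr_eq_density [OF d] by simp
  qed
  have Z: "Z = (\<lambda>\<omega>. \<lambda>q\<in>?I. X q \<omega>)" unfolding Z_def X_def by (auto simp: fun_eq_iff restrict_def)
  have sb: "sets (PiM ?I (\<lambda>_. borel :: real measure)) = sets (gauss ?I)"
    unfolding gauss_def by (intro sets_PiM_cong) simp_all
  have "Z \<in> measurable P (PiM ?I (\<lambda>_. borel))" unfolding Z by (intro measurable_restrict rv)
  then show "Z \<in> measurable P (gauss ?I)" by (simp add: measurable_cong_sets [OF refl sb])
  have "distr P (PiM ?I (\<lambda>_. borel)) (\<lambda>\<omega>. \<lambda>q\<in>?I. X q \<omega>) = (\<Pi>\<^sub>M q\<in>?I. distr P borel (X q))"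
    using indep_vars_iff_distr_eq_PiM' [of ?I X "\<lambda>_. borel"] rv ind nm by auto
  also have "\<dots> = gauss ?I" unfolding gauss_def by (intro PiM_cong) (simp_all add: dX)
  finally have "distr P (PiM ?I (\<lambda>_. borel)) Z = gauss ?I" unfolding Z .
  moreover have "distr P (gauss ?I) Z = distr P (PiM ?I (\<lambda>_. borel)) Z" by (rule distr_cong) (simp_all add: sb)
  ultimately show "distr P (gauss ?I) Z = gauss ?I" by simp
qed

lemma nn_integral_gauss_restrict:
  assumes "finite J" "finite K" "J \<inter> K = {}" and f: "f \<in> borel_measurable (gauss J)"
  shows "(\<integral>\<^sup>+x. f (restrict x J) \<partial>gauss (J \<union> K)) = (\<integral>\<^sup>+x. f x \<partial>gauss J)"
  using assms(2,3)
proof (induction K)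
  case empty
  show ?case unfolding Un_empty_right
  proof (rule nn_integral_cong)
    fix x assume "x \<in> space (gauss J)"
    then have "restrict x J = x" unfolding space_gauss by (rule extensional_restrict)
    then show "f (restrict x J) = f x" by (simp only:)
  qed
next
  case (insert k K)
  interpret stdn: prob_space stdn by (rule prob_space_stdn)
  have m: "(\<lambda>x. f (restrict x J)) \<in> borel_measurable (gauss (insert k (J \<union> K)))"
  proof (rule measurable_compose [OF _ f])
    show "(\<lambda>x. restrict x J) \<in> measurable (gauss (insert k (J \<union> K))) (gauss J)"
      unfolding gauss_def by (rule measurable_restrict_subset) auto
  qed
  have "(\<integral>\<^sup>+x. f (restrict x J) \<partial>gauss (insert k (J \<union> K)))
      = (\<integral>\<^sup>+x. \<integral>\<^sup>+y. f (restrict (x(k := y)) J) \<partial>stdn \<partial>gauss (J \<union> K))"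
    by (rule nn_integral_gauss_insert [OF _ _ m]) (use insert.hyps insert.prems assms(1) in auto)
  also have "\<dots> = (\<integral>\<^sup>+x. f (restrict x J) \<partial>gauss (J \<union> K))"
  proof (rule nn_integral_cong)
    fix x :: "'a \<Rightarrow> real"
    have e: "restrict (x(k := y)) J = restrict x J" for y using insert.prems by (auto simp: restrict_def fun_eq_iff)
    show "(\<integral>\<^sup>+y. f (restrict (x(k := y)) J) \<partial>stdn) = f (restrict x J)"
      unfolding e using stdn.emeasure_space_1 by simp
  qed
  also have "\<dots> = (\<integral>\<^sup>+x. f x \<partial>gauss J)" by (rule insert.IH) (use insert.prems in auto)
  finally show ?case unfolding Un_insert_right .
qed

section \<open>The final estimates\<close>

text \<open>The smaller of the two bounds is \<open>2 e h sqrt N\<close> with \<open>h = min 1 ((a + w) / sqrt N)\<close>. The factor \<open>sqrt (N + q)\<close> in the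
  denominator of the claim is won from \<open>h\<^sup>2 (N + q) \<le> (a + w)\<^sup>2 + q\<close>.\<close>

lemma relative_bound:
  fixes a b c q N h E0 lr g D x :: real
  assumes a: "0 \<le> a" and w: "0 \<le> w" and q: "0 \<le> q" and N: "1 \<le> N" and E0: "0 \<le> E0" and lr: "0 \<le> lr" and g: "0 < g"
    and D: "N * g \<le> D" and e: "0 \<le> e" "e \<le> E0 * (sqrt N * lr)"
    and x: "x \<le> 2 * e * (a + w)" "x \<le> 2 * e * sqrt N"
  shows "x / D \<le> 2 * (sqrt (a\<^sup>2 + q) + w) * (E0 / sqrt (N + q)) * (lr / g)"
proof -
  define h where "h = min ((a + w) / sqrt N) 1"
  have sN: "0 < sqrt N" using N by simp
  have h0: "0 \<le> h" "h \<le> 1" unfolding h_def using a w sN by auto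
  have hN: "(h * sqrt N)\<^sup>2 \<le> (a + w)\<^sup>2"
  proof (rule power_mono)
    have "h * sqrt N \<le> (a + w) / sqrt N * sqrt N" unfolding h_def using sN by (intro mult_right_mono) auto
    then show "h * sqrt N \<le> a + w" using sN by simp
  qed (use h0 sN in simp)
  have xh: "x \<le> 2 * e * (h * sqrt N)"
  proof (cases "(a + w) / sqrt N \<le> 1")
    case True
    then have "h * sqrt N = a + w" using sN by (simp add: h_def)
    then show ?thesis using x(1) by simp
  next
    case False
    then have "h = 1" by (simp add: h_def)
    then show ?thesis using x(2) by simp
  qed
  have "x \<le> 2 * (E0 * (sqrt N * lr)) * (h * sqrt N)"
    using xh mult_right_mono [OF e(2), of "h * sqrt N"] h0 sN by simp
  also have "\<dots> = N * (2 * E0 * lr * h)" using N by (simp add: algebra_simps real_sqrt_mult_self flip: power2_eq_square)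
  finally have x1: "x \<le> N * (2 * E0 * lr * h)" .
  have Ng: "0 < N * g" using N g by simp
  have y0: "0 \<le> N * (2 * E0 * lr * h)" using N E0 lr h0 by simp
  have "x / D \<le> N * (2 * E0 * lr * h) / D" using x1 D Ng by (intro divide_right_mono) auto
  also have "\<dots> \<le> N * (2 * E0 * lr * h) / (N * g)" using D Ng y0 by (intro divide_left_mono) auto
  also have "\<dots> = 2 * h * E0 * (lr / g)" using N by simp
  finally have 1: "x / D \<le> 2 * h * E0 * (lr / g)" .
  have hc: "h \<le> (sqrt (a\<^sup>2 + q) + w) / sqrt (N + q)"
  proof (rule mult_imp_le_div_pos)
    show "0 < sqrt (N + q)" using N q by simp
    show "h * sqrt (N + q) \<le> sqrt (a\<^sup>2 + q) + w"
    proof (rule power2_le_imp_le)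
      have "(h * sqrt (N + q))\<^sup>2 = (h * sqrt N)\<^sup>2 + h\<^sup>2 * q" using N q by (simp add: power_mult_distrib distrib_left)
      also have "\<dots> \<le> (a + w)\<^sup>2 + 1 * q" using hN h0 q by (intro add_mono mult_right_mono) (simp_all add: power_le_one)
      also have "\<dots> = (a\<^sup>2 + q) + 2 * (a * w) + w\<^sup>2" by (simp add: power2_sum)
      also have "\<dots> \<le> (a\<^sup>2 + q) + 2 * (sqrt (a\<^sup>2 + q) * w) + w\<^sup>2"
      proof -
        have "a \<le> sqrt (a\<^sup>2 + q)" using a q by (intro real_le_rsqrt) simp
        then show ?thesis using w by (simp add: mult_right_mono)
      qed
      also have "\<dots> = (sqrt (a\<^sup>2 + q) + w)\<^sup>2" using q by (simp add: power2_sum)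
      finally show "(h * sqrt (N + q))\<^sup>2 \<le> (sqrt (a\<^sup>2 + q) + w)\<^sup>2" .
    qed (use w q in simp)
  qed
  have "2 * h * E0 * (lr / g) \<le> 2 * ((sqrt (a\<^sup>2 + q) + w) / sqrt (N + q)) * E0 * (lr / g)"
    using hc E0 lr g by (intro mult_right_mono mult_left_mono) auto
  then show ?thesis using 1 by (simp add: mult_ac)
qed

theorem theorem5:
  fixes n r p :: nat
    and A B S Q G Gr Sr :: "complex mat"
    and P :: "'w measure"
    and \<Omega> :: "'w \<Rightarrow> real mat"
    and \<Theta> G\<Omega> S\<Omega> :: "'w \<Rightarrow> complex mat"
    and \<epsilon> c\<^sub>r :: real
  assumes "Q \<in> carrier_mat n n"
    and "A = Q * mat_adjoint Q"
    and "herm_pd n A"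
    and "herm_psd n B"
    and "S = A + B"
    and "G = minv Q * B * mat_adjoint (minv Q)"
    and "0 < r"
    and "r < vec_space.rank n B"
    and "is_truncated_svd n G r Gr"
    and "Sr = Q * (1\<^sub>m n + Gr) * mat_adjoint Q"
    and "2 \<le> p"
    and "prob_space P"
    and "std_gaussian_mat P n (r + p) \<Omega>"
    and "\<And>\<omega>. \<omega> \<in> space P \<Longrightarrow>
           orthonormal_range_basis n (G * map_mat complex_of_real (\<Omega> \<omega>)) (\<Theta> \<omega>)"
    and "\<And>\<omega>. G\<Omega> \<omega> = rand_approx G (\<Theta> \<omega>)"
    and "\<And>\<omega>. S\<Omega> \<omega> = Q * (1\<^sub>m n + G\<Omega> \<omega>) * mat_adjoint Q"
    and "AE \<omega> in P. vec_space.rank n (G\<Omega> \<omega>) = r + p"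
    and "r + p \<le> vec_space.rank n B"
    and "\<epsilon> = sqrt ((1 + real r / (real p - 1)) * (\<Sum>j = r + 1..n. (eigval_desc G j)\<^sup>2))"
    and "c\<^sub>r = frob_norm (minv (1\<^sub>m n + G))
             + real r * inverse (1 + eigval_desc G (vec_space.rank n B))"
  shows "integrable P (\<lambda>\<omega>. logdet_div n (S\<Omega> \<omega>) S)
    \<and> (\<integral>\<omega>. logdet_div n (S\<Omega> \<omega>) S \<partial>P) - logdet_div n Sr S \<le> 2 * \<epsilon> * c\<^sub>r
    \<and> ((\<integral>\<omega>. logdet_div n (S\<Omega> \<omega>) S \<partial>P) - logdet_div n Sr S) / logdet_div n Sr S
        \<le> 2 * c\<^sub>r * sqrt ((1 + real r / (real p - 1)) / (real n - real r))
          * (eigval_desc G (r + 1)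
             / (1 / (1 + eigval_desc G (vec_space.rank n B))
                - ln (1 / (1 + eigval_desc G (vec_space.rank n B))) - 1))"
proof -
  interpret prob_space P by fact
  define \<rho> where "\<rho> = vec_space.rank n B"
  define m where "m = r + p"
  define q where "q = minv Q"
  define l where "l = (\<lambda>i. eigval_desc G (i + 1))"
  have Q: "Q \<in> carrier_mat n n" by fact
  have B: "herm_psd n B" "B \<in> carrier_mat n n" using \<open>herm_psd n B\<close> by (auto simp: herm_psd_def)
  have rp: "0 < r" "2 \<le> p" by fact+
  have r\<rho>: "r < \<rho>" and m\<rho>: "m \<le> \<rho>" using assms(8,18) by (simp_all add: \<rho>_def m_def)
  have \<rho>n: "\<rho> \<le> n" unfolding \<rho>_def by (rule vec_space.rank_le_nc [OF B(2)])
  have n: "0 < n" and rn: "r \<le> n" and mn: "m \<le> n" using r\<rho> m\<rho> \<rho>n by auto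
  have detQ: "det Q \<noteq> 0" using pd_factor_det_nonzero [OF Q] assms(2,3) by simp
  have q: "q \<in> carrier_mat n n" "Q * q = 1\<^sub>m n" "q * Q = 1\<^sub>m n" unfolding q_def by (rule minv_inverse [OF Q detQ])+
  have qa: "mat_adjoint q \<in> carrier_mat n n" and Qa: "mat_adjoint Q \<in> carrier_mat n n" using q(1) Q by simp_all
  have qQa: "mat_adjoint q * mat_adjoint Q = 1\<^sub>m n"
    unfolding mat_adjoint_mult [OF Q q(1), symmetric] q(2) by simp
  note assoc = assoc_mult_mat [of _ n n _ n _ n]
  have G_q: "G = q * B * mat_adjoint q" using assms(6) by (simp add: q_def)
  have Gc: "G \<in> carrier_mat n n" unfolding G_q using q(1) qa B(2) by simp
  have cancel: "Q * (q * Z) = Z" if "Z \<in> carrier_mat n n" for Z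
    using assoc_mult_mat [OF Q q(1) that] that unfolding q(2) by (simp add: left_mult_one_mat [of _ n n])
  have B_G: "B = Q * G * mat_adjoint Q"
    unfolding G_q using Q q(1) qa Qa B(2) by (simp add: assoc cancel qQa right_mult_one_mat [of _ n n])
  have S_eq: "S = Q * (1\<^sub>m n + G) * mat_adjoint Q"
  proof -
    have "Q * (1\<^sub>m n + G) * mat_adjoint Q = Q * mat_adjoint Q + Q * G * mat_adjoint Q"
      using Q Qa Gc by (simp add: mult_add_distrib_mat [of _ n n _ n] add_mult_distrib_mat [of _ n n _ _ n] right_mult_one_mat [of _ n n])
    then show ?thesis using assms(2,5) B_G by simp
  qed

  \<comment> \<open>\<open>G\<close> and \<open>B\<close> have the same rank, so exactly the first \<open>\<rho>\<close> eigenvalues of \<open>G\<close> are positive.\<close>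
  obtain U where U: "is_unitary n U" and GU: "G = fcalc n U l" and GrU: "Gr = fcalc n U (\<lambda>i. if i < r then l i else 0)"
    using truncated_svd_fcalc [OF assms(9) rn] unfolding l_def by blast
  note Uc = is_unitary_carrier [OF U]
  have l_anti: "l j \<le> l i" if "i \<le> j" "j < n" for i j unfolding l_def by (rule eigval_desc_antimono [OF Gc that])
  have G_psd: "0 \<le> Re (mtrace (mat_adjoint Z * (G * Z)))" if Z: "Z \<in> carrier_mat n n" for Z
  proof -
    have qZ: "mat_adjoint q * Z \<in> carrier_mat n n" using qa Z by simp
    have "mat_adjoint Z * (G * Z) = mat_adjoint (mat_adjoint q * Z) * (B * (mat_adjoint q * Z))"
      unfolding G_q mat_adjoint_mult [OF qa Z] using q(1) qa B(2) Z by (simp add: assoc)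
    then show ?thesis using herm_psd_trace [OF B(1) qZ] by simp
  qed
  have l_nonneg: "0 \<le> l i" if "i < n" for i by (rule fcalc_psd_nonneg [OF U that]) (use G_psd GU in simp)
  have rankG: "vec_space.rank n (fcalc n U l) = \<rho>"
    unfolding GU [symmetric]
  proof (rule antisym)
    show "vec_space.rank n G \<le> \<rho>" unfolding G_q \<rho>_def by (rule rank_congruence [OF q(1) B(2) qa])
    show "\<rho> \<le> vec_space.rank n G" unfolding \<rho>_def by (subst B_G, rule rank_congruence [OF Q Gc Qa])
  qed
  have l_pos: "0 < l i" if "i < \<rho>" for i
    by (rule fcalc_rank_positive(2) [where f = l, OF U l_anti l_nonneg]) (use that rankG in simp_all)
  have l_zero: "l i = 0" if "\<rho> \<le> i" "i < n" for i
    by (rule fcalc_rank_zero [where f = l, OF U l_anti l_nonneg]) (use that rankG in simp_all)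
  define W where "W = fcalc n U (\<lambda>i. 1 / (1 + l i))"
  have Wc: "W \<in> carrier_mat n n" unfolding W_def by (rule fcalc_carrier [OF Uc])
  have GW: "(1\<^sub>m n + G) * W = 1\<^sub>m n"
  proof -
    have "1\<^sub>m n + G = fcalc n U (\<lambda>i. 1 + l i)" unfolding GU fcalc_one [OF U, symmetric] by (rule fcalc_add [OF Uc])
    then have "(1\<^sub>m n + G) * W = fcalc n U (\<lambda>i. (1 + l i) * (1 / (1 + l i)))" unfolding W_def by (simp only: fcalc_mult [OF U])
    also have "\<dots> = fcalc n U (\<lambda>_. 1)"
    proof (rule fcalc_cong)
      fix i assume "i < n"
      then show "(1 + l i) * (1 / (1 + l i)) = 1" using l_nonneg [of i] by simp
    qed
    finally show ?thesis by (simp only: fcalc_one [OF U])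
  qed
  have IG: "1\<^sub>m n + G \<in> carrier_mat n n" using Gc by simp
  have W_minv: "minv (1\<^sub>m n + G) = W" by (rule minv_eqI [OF IG Wc GW])
  have LD: "logdet_div n (Q * M * mat_adjoint Q) S = Re (mtrace (M * W)) - ln (Re (det (M * W))) - real n"
    if "M \<in> carrier_mat n n" for M
    unfolding S_eq by (rule logdet_div_congruence [OF Q detQ that IG Wc GW])
  define Dr where "Dr = (\<Sum>i=r..<n. ldgap (l i))"
  have Dr: "logdet_div n Sr S = Dr"
  proof -
    have "1\<^sub>m n + Gr \<in> carrier_mat n n" unfolding GrU using Uc by simp
    then show ?thesis
      unfolding assms(10) Dr_def using LD divergence_truncation [OF U l_nonneg rn] unfolding GrU W_def by simp
  qed

  \<comment> \<open>Whatever basis \<open>\<Theta>\<close> is chosen, \<open>\<Theta> \<Theta>\<^sup>*\<close> is the projection onto the range of \<open>G \<Omega>\<close>, and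
    \<open>G\<Omega>\<close> is the compression of \<open>G\<close> to it.\<close>
  define Y where "Y = (\<lambda>\<omega>. G * map_mat complex_of_real (\<Omega> \<omega>))"
  define Pi where "Pi = (\<lambda>\<omega>. \<Theta> \<omega> * mat_adjoint (\<Theta> \<omega>))"
  define D where "D = (\<lambda>\<omega>. logdet_div n (S\<Omega> \<omega>) S)"
  define \<eta> where "\<eta> = (\<lambda>\<omega>. frob_norm ((1\<^sub>m n - Pi \<omega>) * G))"
  have \<Omega>c: "\<Omega> \<omega> \<in> carrier_mat n m" if "\<omega> \<in> space P" for \<omega>
    using assms(13) that by (auto simp: std_gaussian_mat_def m_def)
  have Yc: "Y \<omega> \<in> carrier_mat n m" if "\<omega> \<in> space P" for \<omega>
    unfolding Y_def by (rule mult_carrier_mat [OF Gc]) (use \<Omega>c [OF that] in simp)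
  have ob: "orthonormal_range_basis n (Y \<omega>) (\<Theta> \<omega>)" if "\<omega> \<in> space P" for \<omega>
    unfolding Y_def by (rule assms(14) [OF that])
  have Pi: "is_range_proj n m (Y \<omega>) (Pi \<omega>)" if "\<omega> \<in> space P" for \<omega>
    unfolding Pi_def by (rule orthonormal_range_basis_is_range_proj(1) [OF ob [OF that] Yc [OF that]])
  have Tc: "\<Theta> \<omega> \<in> carrier_mat n (dim_col (\<Theta> \<omega>))" if "\<omega> \<in> space P" for \<omega>
    by (rule orthonormal_range_basis_is_range_proj(2) [OF ob [OF that] Yc [OF that]])
  have Pip: "is_proj n (Pi \<omega>)" if "\<omega> \<in> space P" for \<omega> by (rule is_range_proj_proj [OF Pi [OF that]])
  have Pic: "Pi \<omega> \<in> carrier_mat n n" if "\<omega> \<in> space P" for \<omega> by (rule is_proj_carrier [OF Pip [OF that]])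
  define X where "X = (\<lambda>\<omega>. Pi \<omega> * G * Pi \<omega>)"
  have Xc: "X \<omega> \<in> carrier_mat n n" if "\<omega> \<in> space P" for \<omega> unfolding X_def using Pic [OF that] Gc by simp
  have GX: "G\<Omega> \<omega> = X \<omega>" if "\<omega> \<in> space P" for \<omega>
    unfolding assms(15) X_def Pi_def by (rule rand_approx_eq [OF Gc Tc [OF that]])
  have D_eq: "D \<omega> = Re (mtrace ((1\<^sub>m n + X \<omega>) * W)) - ln (Re (det ((1\<^sub>m n + X \<omega>) * W))) - real n" if "\<omega> \<in> space P" for \<omega>
    unfolding D_def assms(16) GX [OF that] by (rule LD) (use Xc [OF that] in simp)
  define a where "a = frob_norm (fcalc n U (\<lambda>i. if i < \<rho> then 1 / (1 + l i) else 0))"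
  define w where "w = real r / (1 + l (\<rho> - 1))"
  define K where "K = frob_norm G * frob_norm W + (\<Sum>i<n. l i / (1 + l i)) + (\<Sum>i<n. ln (1 + l i))"
  have bounds: "\<bar>D \<omega>\<bar> \<le> K" "D \<omega> - Dr \<le> (a + w) * \<eta> \<omega>" "D \<omega> - Dr \<le> 3 / 4 * sqrt (real \<rho> - real r) * \<eta> \<omega>"
    if \<omega>: "\<omega> \<in> space P" and rk: "vec_space.rank n (G\<Omega> \<omega>) = m" for \<omega>
  proof -
    have Pa: "mat_adjoint (Pi \<omega>) = Pi \<omega>" using Pip [OF \<omega>] by (simp add: is_proj_def)
    have Ga: "mat_adjoint G = G" unfolding GU by (rule fcalc_adjoint [OF Uc])
    note c = Pic [OF \<omega>] Xc [OF \<omega>] Gc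
    have "mat_adjoint (X \<omega>) = X \<omega>"
      unfolding X_def using c by (simp add: mat_adjoint_mult [of _ n n _ n] Pa Ga assoc)
    then obtain V \<mu> where V: "is_unitary n V" and XV: "X \<omega> = fcalc n V \<mu>" and \<mu>_anti: "\<And>i j. i \<le> j \<Longrightarrow> j < n \<Longrightarrow> \<mu> j \<le> \<mu> i"
      using hermitian_diagonalisation_sorted [OF Xc [OF \<omega>]] by blast
    have \<mu>_nonneg: "0 \<le> \<mu> i" if "i < n" for i
    proof (rule fcalc_psd_nonneg [OF V that])
      fix Z :: "complex mat" assume Z: "Z \<in> carrier_mat n n"
      have PZ: "Pi \<omega> * Z \<in> carrier_mat n n" using c Z by simp
      have "mat_adjoint Z * (X \<omega> * Z) = mat_adjoint (Pi \<omega> * Z) * (G * (Pi \<omega> * Z))"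
        unfolding X_def mat_adjoint_mult [OF c(1) Z] Pa using c Z by (simp add: assoc)
      then show "0 \<le> Re (mtrace (mat_adjoint Z * (fcalc n V \<mu> * Z)))" using G_psd [OF PZ] unfolding XV by simp
    qed
    have rkV: "vec_space.rank n (fcalc n V \<mu>) = m" using rk GX [OF \<omega>] XV by simp
    have \<mu>_pos: "0 < \<mu> i" if "i < m" for i
      by (rule fcalc_rank_positive(2) [where f = \<mu>, OF V \<mu>_anti \<mu>_nonneg]) (use that rkV in simp_all)
    have range: "fcalc n U (\<lambda>i. if i < \<rho> then 1 else 0) * Pi \<omega> = Pi \<omega>"
    proof -
      let ?PG = "fcalc n U (\<lambda>i. if i < \<rho> then 1 else 0)"
      have PGc: "?PG \<in> carrier_mat n n" by (rule fcalc_carrier [OF Uc])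
      obtain C where C: "C \<in> carrier_mat m n" "Pi \<omega> = Y \<omega> * C" using Pi [OF \<omega>] by (auto simp: is_range_proj_def)
      have M: "map_mat complex_of_real (\<Omega> \<omega>) \<in> carrier_mat n m" using \<Omega>c [OF \<omega>] by simp
      have PGG: "?PG * G = G" unfolding GU fcalc_mult [OF U] by (rule fcalc_cong) (simp add: l_zero)
      have "?PG * Y \<omega> = Y \<omega>" using assoc_mult_mat [OF PGc Gc M] unfolding PGG Y_def by simp
      then show ?thesis unfolding C(2) using assoc_mult_mat [OF PGc Yc [OF \<omega>] C(1)] by simp
    qed
    interpret C: compression n \<rho> m U V "Pi \<omega>" l \<mu>
    proof (unfold_locales, goal_cases)
      case 9 show ?case unfolding GU [symmetric] XV [symmetric] X_def ..
    qed (use U V Pip [OF \<omega>] l_anti l_pos l_zero r\<rho> \<rho>n range \<mu>_anti \<mu>_pos mn in auto)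
    have "D \<omega> = C.divergence" unfolding C.divergence_def D_eq [OF \<omega>] XV W_def ..
    then show "\<bar>D \<omega>\<bar> \<le> K" "D \<omega> - Dr \<le> (a + w) * \<eta> \<omega>" "D \<omega> - Dr \<le> 3 / 4 * sqrt (real \<rho> - real r) * \<eta> \<omega>"
      using C.divergence_bounded C.divergence_excess [of r]
      unfolding K_def a_def w_def \<eta>_def Dr_def GU [symmetric] W_def [symmetric] by (simp_all add: m_def)
  qed
  have AE_rank: "AE \<omega> in P. vec_space.rank n (G\<Omega> \<omega>) = m" using assms(17) by (simp add: m_def)

  \<comment> \<open>\<open>\<Theta>\<close> itself need not be measurable, but the projection is determined by \<open>\<Omega>\<close> and is measurable.\<close>
  have \<Omega>m: "(\<lambda>\<omega>. \<Omega> \<omega> $$ (i, j)) \<in> borel_measurable P" if "i < n" "j < m" for i j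
  proof -
    have "distributed P lborel (\<lambda>\<omega>. \<Omega> \<omega> $$ (i, j)) std_normal_density"
      using assms(13) that by (simp add: std_gaussian_mat_def m_def)
    from distributed_measurable [OF this] show ?thesis by simp
  qed
  have Ym: "measurable_mat P n m Y"
    unfolding Y_def
  proof (intro measurable_mat_mult [OF measurable_mat_const [OF Gc]] measurable_matI)
    fix i j assume ij: "i < n" "j < m"
    have "(\<lambda>\<omega>. complex_of_real (\<Omega> \<omega> $$ (i, j))) \<in> borel_measurable P"
      by (rule borel_measurable_complex_of_real [OF \<Omega>m [OF ij]])
    then show "(\<lambda>\<omega>. map_mat complex_of_real (\<Omega> \<omega>) $$ (i, j)) \<in> borel_measurable P"
      by (subst measurable_cong [where g = "\<lambda>\<omega>. complex_of_real (\<Omega> \<omega> $$ (i, j))"])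
         (use ij carrier_matD [OF \<Omega>c] in auto)
  qed (use \<Omega>c in simp)
  have Pim: "measurable_mat P n n Pi" by (rule measurable_mat_range_proj [OF Ym Pi])
  have \<eta>m: "\<eta> \<in> borel_measurable P"
    unfolding \<eta>_def
    by (intro measurable_mat_frob_norm [of P n n] measurable_mat_mult [of P n n] measurable_mat_add(2) measurable_mat_const Pim Gc one_carrier_mat)
  have XWm: "measurable_mat P n n (\<lambda>\<omega>. (1\<^sub>m n + X \<omega>) * W)"
    unfolding X_def
    by (intro measurable_mat_mult [of P n n] measurable_mat_add(1) measurable_mat_const Pim Gc Wc one_carrier_mat)
  have Dm: "D \<in> borel_measurable P"
  proof -
    define t where "t = (\<lambda>\<omega>. mtrace ((1\<^sub>m n + X \<omega>) * W))"
    define d where "d = (\<lambda>\<omega>. det ((1\<^sub>m n + X \<omega>) * W))"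
    have [measurable]: "t \<in> borel_measurable P" "d \<in> borel_measurable P"
      unfolding t_def d_def by (rule measurable_mat_trace [OF XWm], rule measurable_mat_det [OF XWm])
    have "(\<lambda>\<omega>. Re (t \<omega>) - ln (Re (d \<omega>)) - real n) \<in> borel_measurable P" by measurable
    then show ?thesis by (subst measurable_cong [where g = "\<lambda>\<omega>. Re (t \<omega>) - ln (Re (d \<omega>)) - real n"]) (simp_all add: D_eq t_def d_def)
  qed
  have Di: "integrable P D"
    by (rule integrable_const_bound [where B = K]) (use AE_rank AE_space Dm bounds(1) in \<open>auto elim!: eventually_elim2\<close>)

  \<comment> \<open>The bound on the mean square of the residual is carried over to the coordinate space of \<open>\<Omega>\<close>.\<close>
  define \<epsilon>2 where "\<epsilon>2 = (1 + real r / (real p - 1)) * (\<Sum>i=r..<n. (l i)\<^sup>2)"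
  have fac: "0 \<le> 1 + real r / (real p - 1)" using rp by simp
  have \<epsilon>20: "0 \<le> \<epsilon>2" unfolding \<epsilon>2_def by (intro mult_nonneg_nonneg fac sum_nonneg) simp
  have \<epsilon>: "\<epsilon> = sqrt \<epsilon>2"
  proof -
    have "(\<Sum>j = r + 1..n. (eigval_desc G j)\<^sup>2) = (\<Sum>i=r..<n. (l i)\<^sup>2)"
      unfolding l_def by (rule sum.reindex_bij_witness [of _ Suc "\<lambda>j. j - 1"]) auto
    then show ?thesis unfolding assms(19) \<epsilon>2_def by simp
  qed
  interpret sk: sketch n r m U l by unfold_locales (use U rp rn in \<open>auto simp: m_def\<close>)
  have \<eta>G: "\<eta> \<omega> \<le> frob_norm G" if "\<omega> \<in> space P" for \<omega>
    unfolding \<eta>_def by (rule frob_norm_proj_mult_le [OF is_proj_compl [OF Pip [OF that]] Gc])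
  have \<eta>0: "0 \<le> \<eta> \<omega>" for \<omega> by (simp add: \<eta>_def)
  have \<eta>i: "integrable P \<eta>" by (rule integrable_const_bound [where B = "frob_norm G"]) (use \<eta>m \<eta>G \<eta>0 in auto)
  have \<eta>2i: "integrable P (\<lambda>\<omega>. (\<eta> \<omega>)\<^sup>2)"
    by (rule integrable_const_bound [where B = "(frob_norm G)\<^sup>2"]) (use \<eta>m \<eta>G \<eta>0 in \<open>auto intro!: power_mono\<close>)
  have E\<eta>2: "expectation (\<lambda>\<omega>. (\<eta> \<omega>)\<^sup>2) \<le> 4 * \<epsilon>2"
  proof -
    let ?I = "{..<n} \<times> {..<m}"
    define Z where "Z = (\<lambda>\<omega>. \<lambda>q\<in>?I. (case q of (i, j) \<Rightarrow> \<Omega> \<omega> $$ (i, j)))"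
    have Z: "Z \<in> measurable P (gauss ?I)" "distr P (gauss ?I) Z = gauss ?I"
      unfolding Z_def using distr_gaussian_mat [OF assms(12), of n m \<Omega>] assms(13) n rp by (simp_all add: m_def)
    define f where "f = (\<lambda>x. ennreal ((frob_norm (sk.A x))\<^sup>2))"
    have Am: "(\<lambda>x. frob_norm (sk.A x)) \<in> borel_measurable (gauss ?I)"
      by (rule measurable_mat_frob_norm [OF sk.measurable_A_on]) simp
    then have fm: "f \<in> borel_measurable (gauss ?I)" unfolding f_def by measurable
    have \<eta>f: "ennreal ((\<eta> \<omega>)\<^sup>2) = f (Z \<omega>)" if \<omega>: "\<omega> \<in> space P" for \<omega>
    proof -
      have "mat n m (\<lambda>(i, c). complex_of_real (Z \<omega> (i, c))) = map_mat complex_of_real (\<Omega> \<omega>)"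
        using carrier_matD [OF \<Omega>c [OF \<omega>]] by (intro eq_matI) (auto simp: Z_def)
      then have "sk.Y (Z \<omega>) = Y \<omega>" unfolding sk.Y_def Y_def GU by simp
      then have "range_proj n m (sk.Y (Z \<omega>)) = Pi \<omega>"
        using is_range_proj_unique [OF Yc [OF \<omega>] _ Pi [OF \<omega>]] is_range_proj [OF Yc [OF \<omega>]] by simp
      then show ?thesis unfolding \<eta>_def f_def sk.A_def GU by simp
    qed
    have "ennreal (expectation (\<lambda>\<omega>. (\<eta> \<omega>)\<^sup>2)) = (\<integral>\<^sup>+\<omega>. ennreal ((\<eta> \<omega>)\<^sup>2) \<partial>P)"
      by (rule nn_integral_eq_integral [OF \<eta>2i, symmetric]) simp
    also have "\<dots> = (\<integral>\<^sup>+\<omega>. f (Z \<omega>) \<partial>P)" by (rule nn_integral_cong [OF \<eta>f])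
    also have "\<dots> = (\<integral>\<^sup>+x. f x \<partial>distr P (gauss ?I) Z)" by (rule nn_integral_distr [OF Z(1), symmetric]) (use fm in simp)
    also have "\<dots> = (\<integral>\<^sup>+x. f x \<partial>gauss ?I)" unfolding Z(2) ..
    also have "\<dots> = (\<integral>\<^sup>+x. f (restrict x ?I) \<partial>gauss (?I \<union> {..<n} \<times> {m}))"
      by (rule nn_integral_gauss_restrict [OF _ _ _ fm, symmetric]) auto
    also have "?I \<union> {..<n} \<times> {m} = {..<n} \<times> {..<Suc m}" by (auto simp: less_Suc_eq)
    also have "(\<integral>\<^sup>+x. f (restrict x ?I) \<partial>gauss ({..<n} \<times> {..<Suc m})) = (\<integral>\<^sup>+x. f x \<partial>gauss ({..<n} \<times> {..<Suc m}))"
    proof (rule nn_integral_cong)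
      fix x :: "nat \<times> nat \<Rightarrow> real"
      have "mat n m (\<lambda>(i, c). complex_of_real (restrict x ?I (i, c))) = mat n m (\<lambda>(i, c). complex_of_real (x (i, c)))"
        by (intro eq_matI) auto
      then have "sk.Y (restrict x ?I) = sk.Y x" unfolding sk.Y_def by (simp only:)
      then show "f (restrict x ?I) = f x" unfolding f_def sk.A_def by (simp only:)
    qed
    also have "\<dots> \<le> ennreal (4 * (1 + real r / (real m - real r - 1)) * (\<Sum>j=r..<n. (l j)\<^sup>2))"
      unfolding f_def by (rule sk.sketch_bound)
    also have "4 * (1 + real r / (real m - real r - 1)) * (\<Sum>j=r..<n. (l j)\<^sup>2) = 4 * \<epsilon>2"
      unfolding \<epsilon>2_def m_def by simp
    finally show ?thesis using \<epsilon>20 by (subst (asm) ennreal_le_iff) auto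
  qed
  have E\<eta>: "expectation \<eta> \<le> 2 * \<epsilon>"
  proof -
    have "(expectation \<eta>)\<^sup>2 \<le> expectation (\<lambda>\<omega>. (\<eta> \<omega>)\<^sup>2)"
      using variance_eq [OF \<eta>i \<eta>2i] variance_positive [of \<eta>] by linarith
    also have "\<dots> \<le> (2 * \<epsilon>)\<^sup>2" using E\<eta>2 \<epsilon>20 unfolding \<epsilon> by (simp add: power_mult_distrib)
    finally show ?thesis by (rule power2_le_imp_le) (simp add: \<epsilon> \<epsilon>20)
  qed
  have mean: "expectation D - Dr \<le> 2 * \<epsilon> * c" if c: "0 \<le> c" and b: "\<And>\<omega>. \<omega> \<in> space P \<Longrightarrow> vec_space.rank n (G\<Omega> \<omega>) = m \<Longrightarrow> D \<omega> - Dr \<le> c * \<eta> \<omega>" for c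
  proof -
    have "expectation D - Dr = expectation (\<lambda>\<omega>. D \<omega> - Dr)" using Di by (simp add: prob_space)
    also have "\<dots> \<le> expectation (\<lambda>\<omega>. c * \<eta> \<omega>)"
      by (rule integral_mono_AE) (use Di \<eta>i AE_rank AE_space b in \<open>auto elim!: eventually_elim2\<close>)
    also have "\<dots> = c * expectation \<eta>" by simp
    also have "\<dots> \<le> c * (2 * \<epsilon>)" by (rule mult_left_mono [OF E\<eta> c])
    finally show ?thesis by (simp add: mult_ac)
  qed

  \<comment> \<open>The kernel of \<open>G\<close> adds \<open>n - \<rho>\<close> to the square of the norm of \<open>W\<close>; \<open>a\<close> is the norm of the rest.\<close>
  have l\<rho>: "0 < l (\<rho> - 1)" by (rule l_pos) (use r\<rho> in simp)
  have a0: "0 \<le> a" and w0: "0 \<le> w" using l\<rho> by (simp_all add: a_def w_def)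
  have W2: "(frob_norm W)\<^sup>2 = a\<^sup>2 + (real n - real \<rho>)"
  proof -
    have "(frob_norm W)\<^sup>2 = (\<Sum>i<n. (if i < \<rho> then 1 / (1 + l i) else 0)\<^sup>2 + (if i < \<rho> then 0 else 1))"
      unfolding W_def frob_norm_fcalc [OF U] by (rule sum.cong [OF refl]) (simp add: l_zero)
    also have "\<dots> = a\<^sup>2 + (\<Sum>i<n. if i < \<rho> then 0 else 1)"
      unfolding a_def frob_norm_fcalc [OF U] by (rule sum.distrib)
    also have "(\<Sum>i<n. if i < \<rho> then 0 else 1 :: real) = (\<Sum>i=\<rho>..<n. 1)"
      by (rule sum.mono_neutral_cong_right) auto
    finally show ?thesis using \<rho>n by (simp add: of_nat_diff)
  qed
  have W_a: "frob_norm W = sqrt (a\<^sup>2 + (real n - real \<rho>))"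
    unfolding W2 [symmetric] by simp
  have el: "eigval_desc G \<rho> = l (\<rho> - 1)" using r\<rho> by (simp add: l_def)
  have cr: "c\<^sub>r = sqrt (a\<^sup>2 + (real n - real \<rho>)) + w"
    unfolding assms(20) W_minv W_a \<rho>_def [symmetric] el w_def by (simp add: divide_inverse)
  have aW: "a \<le> sqrt (a\<^sup>2 + (real n - real \<rho>))" by (rule real_le_rsqrt) (use \<rho>n in simp)
  have m1: "expectation D - Dr \<le> 2 * \<epsilon> * (a + w)" by (rule mean [OF _ bounds(2)]) (use a0 w0 in auto)
  have m2: "expectation D - Dr \<le> 2 * \<epsilon> * sqrt (real \<rho> - real r)"
  proof -
    have "expectation D - Dr \<le> 2 * \<epsilon> * (3 / 4 * sqrt (real \<rho> - real r))" by (rule mean [OF _ bounds(3)]) (use r\<rho> in auto)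
    also have "\<dots> \<le> 2 * \<epsilon> * sqrt (real \<rho> - real r)" using \<epsilon>20 r\<rho> by (intro mult_left_mono) (simp_all add: \<epsilon>)
    finally show ?thesis .
  qed
  have claim1: "expectation D - Dr \<le> 2 * \<epsilon> * c\<^sub>r"
  proof (rule order_trans [OF m1])
    show "2 * \<epsilon> * (a + w) \<le> 2 * \<epsilon> * c\<^sub>r" unfolding cr using aW \<epsilon>20 by (intro mult_left_mono) (simp_all add: \<epsilon>)
  qed
  have g: "1 / (1 + l (\<rho> - 1)) - ln (1 / (1 + l (\<rho> - 1))) - 1 = ldgap (l (\<rho> - 1))"
  proof -
    have p: "0 < 1 + l (\<rho> - 1)" using l\<rho> by simp
    have "1 / (1 + l (\<rho> - 1)) - 1 = - (l (\<rho> - 1) / (1 + l (\<rho> - 1)))" using p by (simp add: field_simps)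
    then show ?thesis unfolding ldgap_def using p by (simp add: ln_div)
  qed
  have DrN: "(real \<rho> - real r) * ldgap (l (\<rho> - 1)) \<le> Dr"
  proof -
    have "(real \<rho> - real r) * ldgap (l (\<rho> - 1)) = (\<Sum>i=r..<\<rho>. ldgap (l (\<rho> - 1)))" using r\<rho> by (simp add: of_nat_diff)
    also have "\<dots> \<le> (\<Sum>i=r..<\<rho>. ldgap (l i))"
    proof (rule sum_mono)
      fix i assume "i \<in> {r..<\<rho>}"
      then show "ldgap (l (\<rho> - 1)) \<le> ldgap (l i)" using l\<rho> \<rho>n by (intro ldgap_mono l_anti) auto
    qed
    also have "\<dots> \<le> Dr" unfolding Dr_def by (rule sum_mono2) (use \<rho>n l_nonneg ldgap_nonneg in auto)
    finally show ?thesis .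
  qed
  have \<epsilon>le: "\<epsilon> \<le> sqrt (1 + real r / (real p - 1)) * (sqrt (real \<rho> - real r) * l r)"
  proof -
    have "(\<Sum>i=r..<n. (l i)\<^sup>2) = (\<Sum>i=r..<\<rho>. (l i)\<^sup>2)"
      by (rule sum.mono_neutral_right) (use \<rho>n l_zero in auto)
    also have "\<dots> \<le> (\<Sum>i=r..<\<rho>. (l r)\<^sup>2)"
      by (intro sum_mono power_mono l_anti l_nonneg) (use \<rho>n in auto)
    also have "\<dots> = (real \<rho> - real r) * (l r)\<^sup>2" using r\<rho> by (simp add: of_nat_diff)
    finally have "\<epsilon> \<le> sqrt ((1 + real r / (real p - 1)) * ((real \<rho> - real r) * (l r)\<^sup>2))"
      unfolding \<epsilon> \<epsilon>2_def by (intro real_sqrt_le_mono mult_left_mono fac)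
    also have "\<dots> = sqrt (1 + real r / (real p - 1)) * (sqrt (real \<rho> - real r) * l r)"
      using l_nonneg [of r] r\<rho> \<rho>n by (simp add: real_sqrt_mult)
    finally show ?thesis .
  qed
  have claim2: "(expectation D - Dr) / Dr
      \<le> 2 * (sqrt (a\<^sup>2 + (real n - real \<rho>)) + w) * (sqrt (1 + real r / (real p - 1)) / sqrt ((real \<rho> - real r) + (real n - real \<rho>))) * (l r / ldgap (l (\<rho> - 1)))"
    by (rule relative_bound [OF a0 w0 _ _ _ _ _ DrN _ \<epsilon>le m1 m2])
       (use \<rho>n r\<rho> fac l_nonneg [of r] ldgap_pos [OF l\<rho>] \<epsilon>20 in \<open>auto simp: \<epsilon>\<close>)
  have "(real \<rho> - real r) + (real n - real \<rho>) = real n - real r" by simp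
  then have claim2': "(expectation D - Dr) / Dr \<le> 2 * c\<^sub>r * sqrt ((1 + real r / (real p - 1)) / (real n - real r)) * (l r / ldgap (l (\<rho> - 1)))"
    using claim2 unfolding cr real_sqrt_divide by simp
  have lr: "eigval_desc G (r + 1) = l r" by (simp add: l_def)
  show ?thesis
    unfolding Dr \<rho>_def [symmetric] el lr g using Di claim1 claim2' unfolding D_def by blast
qed

end
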